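(* Suppose that for some $\delta > 0$, $\varepsilon > 0$, and $c \in [0, 1)$ we can solve one of the following problems with $O(m^{(1+\delta)(1-c)-\varepsilon})$ preprocessing work, $O(m^{\delta(1-c) - \varepsilon})$ update work, and $O(m^{2\delta(1-c) - \varepsilon})$ query work: (i) fully dynamic $O(m^c)$-approximate average-linkage \#HAC, with the work bounds being amortized; (ii) incremental (on dense graphs) or decremental $O(m^c)$-approximate average-linkage \#HAC, with the work bounds being worst-case. Then the triangle detection hardness conjecture is false for this value of $\delta$.
   Context: Graph HAC on an undirected graph ($m$ edges) with edge weights $w$: initially every vertex is its own cluster; two clusters are adjacent if some edge crosses between them; HAC repeatedly merges the two adjacent clusters of highest similarity. Average linkage: $\mathcal{W}(X,Y)=\sum_{\{x,y\}\in E,\,x\in X,\,y\in Y} w(x,y)/(|X||Y|)$. $\lambda$-approximate HAC: at a step where the maximum similarity is $\mathcal{W}_{\max}$, any adjacent clusters with similarity at least $\mathcal{W}_{\max}/\lambda$ may be merged. Dynamic \#HAC: edge insertions and deletions (incremental: only insertions; decremental: only deletions), and a query, given a threshold $\theta$, asks for the number of clusters when agglomeration is run until all cluster similarities are strictly below $\theta$. Triangle detection hardness conjecture (for $\delta$): any word-RAM algorithm detecting whether an $m$-edge graph contains a triangle requires $\Omega(m^{1+\delta-o(1)})$ expected work. *)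

theory Defs
  imports
    "HOL-Probability.Probability"
    "HOL-Probability.SPMF"
    "HOL-Library.Landau_Symbols"
begin

section \<open>A randomized word RAM\<close>

text \<open>
  Programs are structured commands over finitely many word arrays, each addressed by words and
  named statically in the program text; a register is a cell with a constant address. Up to
  constant factors this is the usual machine with a single memory.  All words are natural numbers
  below a bound \<open>B\<close> (that is, \<open>2\<close> to the word length), and every elementary operation has unit
  cost. An operation whose result does not fit into a word aborts the run.  As the constant in the
  word length is part of the algorithm, wrap-around arithmetic would be equally powerful.
  A run is a sub-probability distribution; the missing mass is the probability of
  divergence or abortion.
\<close>

datatype bop = Add | Sub | Mul | Div | Mod | And | Or | Xor | Shl | Shr | Less | Equal

fun bop_sem :: "bop \<Rightarrow> nat \<Rightarrow> nat \<Rightarrow> nat" where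
  "bop_sem Add x y = x + y"
| "bop_sem Sub x y = x - y"
| "bop_sem Mul x y = x * y"
| "bop_sem Div x y = x div y"
| "bop_sem Mod x y = x mod y"
| "bop_sem And x y = Bit_Operations.and x y"
| "bop_sem Or x y = Bit_Operations.or x y"
| "bop_sem Xor x y = Bit_Operations.xor x y"
| "bop_sem Shl x y = push_bit y x"
| "bop_sem Shr x y = drop_bit y x"
| "bop_sem Less x y = of_bool (x < y)"
| "bop_sem Equal x y = of_bool (x = y)"

datatype expr = Const nat | Read nat expr | Bop bop expr expr

datatype com =
    Skip
  | Write nat expr expr  \<comment> \<open>\<open>Write a i e\<close>: array \<open>a\<close> at index \<open>i\<close> becomes \<open>e\<close>\<close>
  | Rand nat expr expr   \<comment> \<open>\<open>Rand a i e\<close>: array \<open>a\<close> at index \<open>i\<close> becomes uniform on \<open>{..<e}\<close>\<close>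
  | Seq com com
  | Cond expr com com
  | While expr com

type_synonym mem = "nat \<Rightarrow> nat \<Rightarrow> nat"

type_synonym config = "mem \<times> nat"  \<comment> \<open>memory and the work spent so far\<close>

definition fit :: "nat \<Rightarrow> nat \<Rightarrow> nat option" where
  "fit B v = (if v < B then Some v else None)"

primrec eval :: "nat \<Rightarrow> mem \<Rightarrow> expr \<Rightarrow> nat option" where
  "eval B s (Const k) = fit B k"
| "eval B s (Read a e) = Option.bind (eval B s e) (\<lambda>i. fit B (s a i))"
| "eval B s (Bop f e1 e2) =
     Option.bind (eval B s e1) (\<lambda>x. Option.bind (eval B s e2) (\<lambda>y. fit B (bop_sem f x y)))"

primrec cost :: "expr \<Rightarrow> nat" where
  "cost (Const k) = 1"
| "cost (Read a e) = 1 + cost e"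
| "cost (Bop f e1 e2) = 1 + cost e1 + cost e2"

definition store :: "nat \<Rightarrow> nat \<Rightarrow> nat \<Rightarrow> mem \<Rightarrow> mem" where
  "store a i v s = s(a := (s a)(i := v))"

partial_function (spmf) loop ::
  "nat \<Rightarrow> expr \<Rightarrow> (config \<Rightarrow> config spmf) \<Rightarrow> config \<Rightarrow> config spmf" where
  "loop B e body \<sigma> =
     (case eval B (fst \<sigma>) e of
        None \<Rightarrow> return_pmf None
      | Some v \<Rightarrow>
          if v = 0 then return_spmf (fst \<sigma>, snd \<sigma> + 1 + cost e)
          else bind_spmf (body (fst \<sigma>, snd \<sigma> + 1 + cost e)) (loop B e body))"

primrec exec :: "nat \<Rightarrow> com \<Rightarrow> config \<Rightarrow> config spmf" where
  "exec B Skip \<sigma> = return_spmf (fst \<sigma>, snd \<sigma> + 1)"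
| "exec B (Write a e1 e2) \<sigma> =
     (case (eval B (fst \<sigma>) e1, eval B (fst \<sigma>) e2) of
        (Some i, Some v) \<Rightarrow> return_spmf (store a i v (fst \<sigma>), snd \<sigma> + 1 + cost e1 + cost e2)
      | _ \<Rightarrow> return_pmf None)"
| "exec B (Rand a e1 e2) \<sigma> =
     (case (eval B (fst \<sigma>) e1, eval B (fst \<sigma>) e2) of
        (Some i, Some k) \<Rightarrow>
          map_spmf (\<lambda>v. (store a i v (fst \<sigma>), snd \<sigma> + 1 + cost e1 + cost e2)) (spmf_of_set {..<k})
      | _ \<Rightarrow> return_pmf None)"
| "exec B (Seq c1 c2) \<sigma> = bind_spmf (exec B c1 \<sigma>) (exec B c2)"
| "exec B (Cond e c1 c2) \<sigma> =
     (case eval B (fst \<sigma>) e of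
        None \<Rightarrow> return_pmf None
      | Some v \<Rightarrow>
          if v = 0 then exec B c2 (fst \<sigma>, snd \<sigma> + 1 + cost e)
          else exec B c1 (fst \<sigma>, snd \<sigma> + 1 + cost e))"
| "exec B (While e c1) \<sigma> = loop B e (exec B c1) \<sigma>"

definition expected_work :: "config spmf \<Rightarrow> ennreal" where
  "expected_work p = (\<integral>\<^sup>+ \<sigma>. of_nat (snd \<sigma>) \<partial>measure_spmf p)"

text \<open>Arguments are passed in an initial segment of array \<open>0\<close>, results in its cell \<open>0\<close>.\<close>

definition put :: "nat list \<Rightarrow> mem \<Rightarrow> mem" where
  "put xs s = s(0 := (\<lambda>i. if i < length xs then xs ! i else s 0 i))"

definition result :: "config \<Rightarrow> nat" where
  "result \<sigma> = fst \<sigma> 0 0"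

definition empty_mem :: mem where
  "empty_mem = (\<lambda>a i. 0)"


section \<open>Graph classes\<close>

text \<open>A class of graphs is given by a condition on the numbers \<open>n\<close> of vertices and \<open>m\<close> of edges.\<close>

type_synonym gclass = "nat \<Rightarrow> nat \<Rightarrow> bool"

text \<open>
  Two senses of ``dense'': \<open>m \<ge> n\<^sup>1\<^sup>+\<^sup>\<gamma>\<close> for a constant \<open>\<gamma> > 0\<close>, and \<open>m = \<Omega>(n\<^sup>2)\<close>.
\<close>

definition all_graphs :: gclass where
  "all_graphs n m = True"

definition superlinear :: "real \<Rightarrow> gclass" where
  "superlinear \<gamma> n m \<longleftrightarrow> real m \<ge> real n powr (1 + \<gamma>)"

definition quadratic :: "real \<Rightarrow> gclass" where
  "quadratic \<kappa> n m \<longleftrightarrow> real m \<ge> \<kappa> * real n ^ 2"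


section \<open>Triangle detection\<close>

definition edges_of :: "(nat \<times> nat) list \<Rightarrow> nat set set" where
  "edges_of es = (\<lambda>(u, v). {u, v}) ` set es"

text \<open>Each edge is listed exactly once, in an arbitrary orientation.\<close>

definition simple_graph :: "nat \<Rightarrow> (nat \<times> nat) list \<Rightarrow> bool" where
  "simple_graph n es \<longleftrightarrow>
     (\<forall>(u, v) \<in> set es. u < n \<and> v < n \<and> u \<noteq> v) \<and> distinct (map (\<lambda>(u, v). {u, v}) es)"

definition has_triangle :: "nat set set \<Rightarrow> bool" where
  "has_triangle E \<longleftrightarrow>
     (\<exists>x y z. x \<noteq> y \<and> y \<noteq> z \<and> x \<noteq> z \<and> {x, y} \<in> E \<and> {y, z} \<in> E \<and> {x, z} \<in> E)"

definition triangle_run :: "nat \<Rightarrow> com \<Rightarrow> nat \<Rightarrow> (nat \<times> nat) list \<Rightarrow> config spmf" where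
  "triangle_run K c n es =
     exec ((n + 2) ^ K) c
       (put ([n, length es] @ concat (map (\<lambda>(u, v). [u, v]) es)) empty_mem, 0)"

definition triangle_instances :: "gclass \<Rightarrow> (nat \<times> (nat \<times> nat) list) set" where
  "triangle_instances Q = {(n, es). simple_graph n es \<and> Q n (length es)}"

text \<open>An algorithm is a program \<open>c\<close> together with the constant \<open>K\<close> in the word length.\<close>

definition detects_triangles :: "gclass \<Rightarrow> nat \<Rightarrow> com \<Rightarrow> bool" where
  "detects_triangles Q K c \<longleftrightarrow>
     (\<forall>(n, es) \<in> triangle_instances Q.
        lossless_spmf (triangle_run K c n es) \<and>
        (\<forall>\<sigma> \<in> set_spmf (triangle_run K c n es).
           result \<sigma> = of_bool (has_triangle (edges_of es))))"

definition triangle_work :: "gclass \<Rightarrow> nat \<Rightarrow> com \<Rightarrow> nat \<Rightarrow> ennreal" where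
  "triangle_work Q K c m =
     (SUP (n, es) \<in> {(n, es) \<in> triangle_instances Q. length es = m}.
        expected_work (triangle_run K c n es))"

text \<open>
  Here \<open>g\<close> is the \<open>o(1)\<close> term in the exponent. The \<open>\<Omega>\<close> is spelled out because the expected work
  may be infinite.
\<close>

definition triangle_conjecture :: "gclass \<Rightarrow> real \<Rightarrow> bool" where
  "triangle_conjecture Q \<delta> \<longleftrightarrow>
     (\<forall>K c. detects_triangles Q K c \<longrightarrow>
        (\<exists>g :: nat \<Rightarrow> real. \<exists>C > 0. g \<longlonglongrightarrow> 0 \<and>
           (\<forall>\<^sub>F m in sequentially.
              ennreal (C * real m powr (1 + \<delta> - g m)) \<le> triangle_work Q K c m)))"


section \<open>Approximate average-linkage agglomerative clustering\<close>

text \<open>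
  A weighted graph on the vertex set \<open>{0..<n}\<close> maps its edges, which are two-element sets of
  vertices, to their weights.
\<close>

type_synonym wgraph = "nat set \<Rightarrow> nat option"

definition edge_count :: "wgraph \<Rightarrow> nat" where
  "edge_count G = card (dom G)"

definition adjacent :: "wgraph \<Rightarrow> nat set \<Rightarrow> nat set \<Rightarrow> bool" where
  "adjacent G X Y \<longleftrightarrow> (\<exists>x \<in> X. \<exists>y \<in> Y. {x, y} \<in> dom G)"

definition similarity :: "wgraph \<Rightarrow> nat set \<Rightarrow> nat set \<Rightarrow> real" where
  "similarity G X Y =
     (\<Sum>e \<in> {e \<in> dom G. \<exists>x \<in> X. \<exists>y \<in> Y. e = {x, y}}. real (the (G e))) / (real (card X) * real (card Y))"

definition adjacent_pairs :: "wgraph \<Rightarrow> nat set set \<Rightarrow> (nat set \<times> nat set) set" where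
  "adjacent_pairs G P = {(X, Y). X \<in> P \<and> Y \<in> P \<and> X \<noteq> Y \<and> adjacent G X Y}"

definition max_similarity :: "wgraph \<Rightarrow> nat set set \<Rightarrow> real" where
  "max_similarity G P = Max ((\<lambda>(X, Y). similarity G X Y) ` adjacent_pairs G P)"

definition all_below :: "wgraph \<Rightarrow> real \<Rightarrow> nat set set \<Rightarrow> bool" where
  "all_below G \<theta> P \<longleftrightarrow> (\<forall>(X, Y) \<in> adjacent_pairs G P. similarity G X Y < \<theta>)"

definition merge_step :: "wgraph \<Rightarrow> real \<Rightarrow> nat set set \<Rightarrow> nat set set \<Rightarrow> bool" where
  "merge_step G lam P P' \<longleftrightarrow>
     (\<exists>(X, Y) \<in> adjacent_pairs G P.
        similarity G X Y \<ge> max_similarity G P / lam \<and> P' = insert (X \<union> Y) (P - {X, Y}))"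

definition singletons :: "nat \<Rightarrow> nat set set" where
  "singletons n = (\<lambda>v. {v}) ` {..<n}"

text \<open>
  \<open>k\<close> is the number of clusters at the moment when some \<open>lam\<close>-approximate agglomeration first has
  all similarities strictly below \<open>\<theta>\<close>; an approximate agglomeration need not be unique.
\<close>

definition cluster_count :: "nat \<Rightarrow> wgraph \<Rightarrow> real \<Rightarrow> real \<Rightarrow> nat \<Rightarrow> bool" where
  "cluster_count n G lam \<theta> k \<longleftrightarrow>
     (\<exists>P. (\<lambda>P P'. \<not> all_below G \<theta> P \<and> merge_step G lam P P')\<^sup>*\<^sup>* (singletons n) P \<and>
          all_below G \<theta> P \<and> card P = k)"


section \<open>Dynamic algorithms\<close>

text \<open>\<open>Query p q\<close> asks for the number of clusters at the threshold \<open>p/q\<close>.\<close>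

datatype op = Insert nat nat nat | Delete nat nat | Query nat nat

fun apply_op :: "op \<Rightarrow> wgraph \<Rightarrow> wgraph" where
  "apply_op (Insert u v x) G = G({u, v} \<mapsto> x)"
| "apply_op (Delete u v) G = G({u, v} := None)"
| "apply_op (Query p q) G = G"

text \<open>
  \<open>U\<close> bounds the vertices, weights and threshold components of an instance; words have
  \<open>O(log U)\<close> bits.
\<close>

fun legal_op :: "nat \<Rightarrow> nat \<Rightarrow> wgraph \<Rightarrow> op \<Rightarrow> bool" where
  "legal_op n U G (Insert u v x) \<longleftrightarrow>
     u < n \<and> v < n \<and> u \<noteq> v \<and> {u, v} \<notin> dom G \<and> 0 < x \<and> x \<le> U"
| "legal_op n U G (Delete u v) \<longleftrightarrow> {u, v} \<in> dom G \<and> u \<noteq> v"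
| "legal_op n U G (Query p q) \<longleftrightarrow> 0 < q \<and> p \<le> U \<and> q \<le> U"

fun is_query :: "op \<Rightarrow> bool" where
  "is_query (Query p q) = True"
| "is_query _ = False"

definition fully_dynamic :: "op \<Rightarrow> bool" where
  "fully_dynamic r = True"

definition incremental :: "op \<Rightarrow> bool" where
  "incremental r \<longleftrightarrow> (\<forall>u v. r \<noteq> Delete u v)"

definition decremental :: "op \<Rightarrow> bool" where
  "decremental r \<longleftrightarrow> (\<forall>u v x. r \<noteq> Insert u v x)"

text \<open>
  The graph has to be in \<open>Q\<close> at all times, and only operations of the kind \<open>A\<close> occur.
\<close>

primrec legal_ops :: "(op \<Rightarrow> bool) \<Rightarrow> gclass \<Rightarrow> nat \<Rightarrow> nat \<Rightarrow> wgraph \<Rightarrow> op list \<Rightarrow> bool" where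
  "legal_ops A Q n U G [] \<longleftrightarrow> Q n (edge_count G)"
| "legal_ops A Q n U G (r # rs) \<longleftrightarrow>
     Q n (edge_count G) \<and> A r \<and> legal_op n U G r \<and> legal_ops A Q n U (apply_op r G) rs"

definition wgraph_of :: "(nat \<times> nat \<times> nat) list \<Rightarrow> wgraph" where
  "wgraph_of es = map_of (map (\<lambda>(u, v, x). ({u, v}, x)) es)"

definition legal_input :: "nat \<Rightarrow> nat \<Rightarrow> (nat \<times> nat \<times> nat) list \<Rightarrow> bool" where
  "legal_input n U es \<longleftrightarrow> n \<le> U \<and>
     (\<forall>(u, v, x) \<in> set es. u < n \<and> v < n \<and> u \<noteq> v \<and> 0 < x \<and> x \<le> U) \<and>
     distinct (map (\<lambda>(u, v, x). {u, v}) es)"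

text \<open>
  The four programs share their memory, which persists between operations.
\<close>

record dyn_alg =
  word_const :: nat
  preprocess :: com
  insertion :: com
  deletion :: com
  query :: com

definition word_bound :: "dyn_alg \<Rightarrow> nat \<Rightarrow> nat" where
  "word_bound D U = (U + 2) ^ word_const D"

definition run_preprocess :: "dyn_alg \<Rightarrow> nat \<Rightarrow> nat \<Rightarrow> (nat \<times> nat \<times> nat) list \<Rightarrow> config spmf" where
  "run_preprocess D n U es =
     exec (word_bound D U) (preprocess D)
       (put ([n, length es, U] @ concat (map (\<lambda>(u, v, x). [u, v, x]) es)) empty_mem, 0)"

fun run_op :: "dyn_alg \<Rightarrow> nat \<Rightarrow> op \<Rightarrow> config \<Rightarrow> config spmf" where
  "run_op D U (Insert u v x) \<sigma> =
     exec (word_bound D U) (insertion D) (put [u, v, x] (fst \<sigma>), snd \<sigma>)"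
| "run_op D U (Delete u v) \<sigma> =
     exec (word_bound D U) (deletion D) (put [u, v] (fst \<sigma>), snd \<sigma>)"
| "run_op D U (Query p q) \<sigma> =
     exec (word_bound D U) (query D) (put [p, q] (fst \<sigma>), snd \<sigma>)"

primrec run_ops :: "dyn_alg \<Rightarrow> nat \<Rightarrow> op list \<Rightarrow> config \<Rightarrow> config spmf" where
  "run_ops D U [] \<sigma> = return_spmf \<sigma>"
| "run_ops D U (r # rs) \<sigma> = bind_spmf (run_op D U r \<sigma>) (run_ops D U rs)"

definition run_dyn ::
  "dyn_alg \<Rightarrow> nat \<Rightarrow> nat \<Rightarrow> (nat \<times> nat \<times> nat) list \<Rightarrow> op list \<Rightarrow> config spmf" where
  "run_dyn D n U es rs = bind_spmf (run_preprocess D n U es) (run_ops D U rs)"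

text \<open>The work of \<open>r\<close> alone, after the preprocessing and the operations \<open>rs\<close>.\<close>

definition op_work ::
  "dyn_alg \<Rightarrow> nat \<Rightarrow> nat \<Rightarrow> (nat \<times> nat \<times> nat) list \<Rightarrow> op list \<Rightarrow> op \<Rightarrow> ennreal" where
  "op_work D n U es rs r =
     expected_work (bind_spmf (run_dyn D n U es rs) (\<lambda>\<sigma>. run_op D U r (fst \<sigma>, 0)))"

definition solves_count_hac :: "(op \<Rightarrow> bool) \<Rightarrow> gclass \<Rightarrow> (nat \<Rightarrow> real) \<Rightarrow> dyn_alg \<Rightarrow> bool" where
  "solves_count_hac A Q lam D \<longleftrightarrow>
     (\<forall>n U es rs. legal_input n U es \<and> legal_ops A Q n U (wgraph_of es) rs \<longrightarrow>
        lossless_spmf (run_dyn D n U es rs) \<and>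
        (\<forall>rs' p q. rs = rs' @ [Query p q] \<longrightarrow>
           (let G = fold apply_op rs' (wgraph_of es) in
            \<forall>\<sigma> \<in> set_spmf (run_dyn D n U es rs).
              cluster_count n G (lam (edge_count G)) (real p / real q) (result \<sigma>))))"

definition worst_case_bounds ::
  "(op \<Rightarrow> bool) \<Rightarrow> gclass \<Rightarrow> (nat \<Rightarrow> real) \<Rightarrow> (nat \<Rightarrow> real) \<Rightarrow> (nat \<Rightarrow> real) \<Rightarrow> dyn_alg \<Rightarrow> bool" where
  "worst_case_bounds A Q tp tu tq D \<longleftrightarrow>
     (\<forall>n U es. legal_input n U es \<and> Q n (length es) \<longrightarrow>
        expected_work (run_preprocess D n U es) \<le> ennreal (tp (length es))) \<and>
     (\<forall>n U es rs r. legal_input n U es \<and> legal_ops A Q n U (wgraph_of es) (rs @ [r]) \<longrightarrow>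
        op_work D n U es rs r
          \<le> ennreal ((if is_query r then tq else tu)
                       (edge_count (fold apply_op rs (wgraph_of es)))))"

primrec op_budget :: "(nat \<Rightarrow> real) \<Rightarrow> (nat \<Rightarrow> real) \<Rightarrow> wgraph \<Rightarrow> op list \<Rightarrow> ennreal" where
  "op_budget tu tq G [] = 0"
| "op_budget tu tq G (r # rs) =
     ennreal ((if is_query r then tq else tu) (edge_count G)) + op_budget tu tq (apply_op r G) rs"

definition amortized_bounds ::
  "(op \<Rightarrow> bool) \<Rightarrow> gclass \<Rightarrow> (nat \<Rightarrow> real) \<Rightarrow> (nat \<Rightarrow> real) \<Rightarrow> (nat \<Rightarrow> real) \<Rightarrow> dyn_alg \<Rightarrow> bool" where
  "amortized_bounds A Q tp tu tq D \<longleftrightarrow>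
     (\<forall>n U es rs. legal_input n U es \<and> legal_ops A Q n U (wgraph_of es) rs \<longrightarrow>
        expected_work (run_dyn D n U es rs)
          \<le> ennreal (tp (length es)) + op_budget tu tq (wgraph_of es) rs)"

text \<open>
  \<open>O(m\<^sup>c)\<close>-approximate average-linkage HAC cluster counting is solvable with preprocessing work \<open>O(m\<^sup>a)\<close>, update
  work \<open>O(m\<^sup>b)\<close> and query work \<open>O(m\<^sup>d)\<close>, where \<open>m\<close> is the number of edges of the current graph.
\<close>

definition count_hac_solvable ::
  "((nat \<Rightarrow> real) \<Rightarrow> (nat \<Rightarrow> real) \<Rightarrow> (nat \<Rightarrow> real) \<Rightarrow> dyn_alg \<Rightarrow> bool) \<Rightarrow>
   (op \<Rightarrow> bool) \<Rightarrow> gclass \<Rightarrow> real \<Rightarrow> real \<Rightarrow> real \<Rightarrow> real \<Rightarrow> bool" where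
  "count_hac_solvable bounds A Q c a b d \<longleftrightarrow>
     (\<exists>D lam tp tu tq.
        lam \<in> O(\<lambda>m. real m powr c) \<and> (\<forall>m. lam m \<ge> 1) \<and>
        tp \<in> O(\<lambda>m. real m powr a) \<and>
        tu \<in> O(\<lambda>m. real m powr b) \<and>
        tq \<in> O(\<lambda>m. real m powr d) \<and>
        solves_count_hac A Q lam D \<and> bounds tp tu tq D)"

definition amortized_count_hac ::
  "(op \<Rightarrow> bool) \<Rightarrow> gclass \<Rightarrow> real \<Rightarrow> real \<Rightarrow> real \<Rightarrow> real \<Rightarrow> bool" where
  "amortized_count_hac A Q = count_hac_solvable (amortized_bounds A Q) A Q"

definition worst_case_count_hac ::
  "(op \<Rightarrow> bool) \<Rightarrow> gclass \<Rightarrow> real \<Rightarrow> real \<Rightarrow> real \<Rightarrow> real \<Rightarrow> bool" where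
  "worst_case_count_hac A Q = count_hac_solvable (worst_case_bounds A Q) A Q"

end

theory Submission imports Defs begin

text \<open>
  Triangles through a vertex of degree below \<open>\<Delta> \<approx> m\<^sup>r\<close>, where \<open>\<delta> - \<epsilon> < r < \<delta>\<close>, are found by brute
  force. The remaining \<open>N \<le> 2 m / \<Delta>\<close> vertices span the main part of a clustering instance: two of
  them that are adjacent are joined by an edge of weight \<open>2\<close>, and every vertex \<open>u\<close> is joined to a
  partner \<open>N + u\<close> by an edge whose weight exceeds \<open>2\<close> by more than the approximation factor.
  Agglomeration merges \<open>u\<close> with its partner first, after which its similarity to its neighbours is
  below the threshold \<open>2\<close>. For each vertex \<open>v\<close> in turn, the neighbours of \<open>v\<close> are kept single, by
  deleting or not inserting the partner edges, or by letting a still heavier edge draw the partners into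
  a large cluster. The number of clusters at the threshold \<open>2\<close> then tells whether two neighbours of \<open>v\<close>
  are adjacent. Weight-\<open>1\<close> edges on \<open>O(\<surd>m)\<close> further vertices keep the number of edges above \<open>m\<close>.
  There are \<open>O(m)\<close> updates and \<open>O(m / \<Delta>)\<close> queries in total. Fully dynamic updates are undone by
  inverse updates; otherwise the memory of the algorithm is rolled back, which is
  compatible with worst-case bounds.

  The weights are polynomial in the number of edges, which is harmless because only the number of
  edges enters the bounds on the work.
\<close>

section \<open>Expected work as a total-correctness functional\<close>

text \<open>The cut-off balances two costs. Brute force below degree m^r costs m^(1+r), and at most
  2 m^(1-r) queries cost m^(2 \<delta> - \<epsilon>) each. Both are below m^(1+\<delta>) by a power
  of m exactly when \<delta> - \<epsilon> < r < \<delta>. A rational r lets the machine find the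
  ceiling of m^r by integer powers.

  The work bounds refer to the current number of edges, their constants are valid only for large
  graphs and their exponents may be negative. So the number of edges has to stay between m and 10 m
  throughout.

  Rolling back reuses the random choices of the preprocessing in all phases. The phases are then
  dependent, but each of them, together with the preprocessing, is a genuine run, so linearity of
  expectation suffices. An amortized bound would not survive this: the same credit could be spent in
  every phase.

  Errors are charged infinite work. One finite bound on an expectation then yields termination,
  correctness and the work bound together.\<close>

definition tot :: "'a spmf \<Rightarrow> ('a \<Rightarrow> ennreal) \<Rightarrow> ennreal" where
  "tot p h = (\<integral>\<^sup>+ x. (case x of None \<Rightarrow> \<infinity> | Some y \<Rightarrow> h y) \<partial>measure_pmf p)"

lemma tot_return [simp]: "tot (return_spmf x) h = h x"
  by (simp add: tot_def nn_integral_return)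

lemma tot_None [simp]: "tot (return_pmf None) h = \<infinity>"
  by (simp add: tot_def nn_integral_return)

lemma tot_bind: "tot (bind_spmf p f) h = tot p (\<lambda>x. tot (f x) h)"
  unfolding tot_def bind_spmf_def
  by (subst nn_integral_bind_pmf)
    (auto intro!: nn_integral_cong simp: nn_integral_return split: option.split)

lemma tot_map: "tot (map_spmf g p) h = tot p (\<lambda>x. h (g x))"
  unfolding map_spmf_conv_bind_spmf tot_bind by simp

lemma tot_mono:
  assumes "\<And>x. x \<in> set_spmf p \<Longrightarrow> h x \<le> h' x"
  shows "tot p h \<le> tot p h'"
  unfolding tot_def
  by (rule nn_integral_mono_AE)
    (auto simp: AE_measure_pmf_iff in_set_spmf split: option.split intro!: assms)

lemma tot_cong: "(\<And>x. x \<in> set_spmf p \<Longrightarrow> h x = h' x) \<Longrightarrow> tot p h = tot p h'"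
  by (intro antisym tot_mono) auto

lemma tot_add: "tot p (\<lambda>x. h x + h' x) = tot p h + tot p h'"
  unfolding tot_def
  by (subst nn_integral_add[symmetric]) (auto intro!: nn_integral_cong split: option.split)

text \<open>The factor 0 is excluded because 0 times infinity is 0 in \<open>ennreal\<close>, which
  would forgive the missing mass.\<close>

lemma tot_cmult: "c \<noteq> 0 \<Longrightarrow> tot p (\<lambda>x. c * h x) = c * tot p h"
  unfolding tot_def
  by (subst nn_integral_cmult[symmetric])
    (auto intro!: nn_integral_cong simp: ennreal_mult_top split: option.split)

lemma tot_lossless:
  assumes "lossless_spmf p"
  shows "tot p h = (\<integral>\<^sup>+ x. h x \<partial>measure_spmf p)"
proof -
  have "None \<notin> set_pmf p"
    using assms by (simp add: lossless_iff_set_pmf_None)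
  then have "tot p h = (\<integral>\<^sup>+ x. (case x of None \<Rightarrow> 0 | Some y \<Rightarrow> h y) \<partial>measure_pmf p)"
    unfolding tot_def
    by (intro nn_integral_cong_AE) (auto simp: AE_measure_pmf_iff split: option.split, metis option.exhaust)
  also have "\<dots> = (\<integral>\<^sup>+ x. h (the x) * indicator (range Some) x \<partial>measure_pmf p)"
    by (intro nn_integral_cong) (simp split: option.split add: image_iff)
  also have "\<dots> = (\<integral>\<^sup>+ x. h (the x) \<partial>restrict_space (measure_pmf p) (range Some))"
    by (subst nn_integral_restrict_space) simp_all
  also have "\<dots> = (\<integral>\<^sup>+ x. h x \<partial>measure_spmf p)"
    unfolding measure_spmf_def
    by (subst nn_integral_distr) (simp_all add: measurable_restrict_space1)
  finally show ?thesis .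
qed

lemma tot_const: "lossless_spmf p \<Longrightarrow> tot p (\<lambda>_. c) = c"
  by (simp add: tot_lossless lossless_spmf_def measure_spmf.emeasure_eq_measure)

text \<open>Missing mass and outcomes of infinite cost enter with their probabilities, so a finite
  total leaves no room for either. With an infinite penalty on wrong results this becomes the source
  of all correctness claims.\<close>

lemma tot_finite:
  assumes "tot p h < \<infinity>"
  shows "lossless_spmf p" and "\<And>x. x \<in> set_spmf p \<Longrightarrow> h x < \<infinity>"
proof -
  have "AE x in measure_pmf p. (case x of None \<Rightarrow> \<infinity> | Some y \<Rightarrow> h y) \<noteq> \<infinity>"
    by (intro nn_integral_PInf_AE) (use assms in \<open>simp_all add: tot_def less_top\<close>)
  then have *: "\<And>x. x \<in> set_pmf p \<Longrightarrow> (case x of None \<Rightarrow> \<infinity> | Some y \<Rightarrow> h y) \<noteq> \<infinity>"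
    by (simp add: AE_measure_pmf_iff)
  show "lossless_spmf p"
    using *[of None] by (auto simp: lossless_iff_set_pmf_None)
  fix x assume "x \<in> set_spmf p"
  then show "h x < \<infinity>"
    using *[of "Some x"] by (auto simp: in_set_spmf less_top)
qed

text \<open>A lossless \<open>p\<close> has no mass left to gain, so being below \<open>q\<close>
  forces \<open>p = q\<close>; otherwise \<open>tot p h\<close> is infinite. Hence a simulation has
  to be proved in one direction of the approximation order only.\<close>

lemma tot_ord:
  assumes "ord_spmf (=) p q"
  shows "tot q h \<le> tot p h"
proof (cases "lossless_spmf p")
  case True
  have "ennreal (weight_spmf p) \<le> ennreal (weight_spmf q)"
    unfolding weight_spmf_eq_nn_integral_spmf
    by (intro nn_integral_mono ennreal_leI ord_spmf_eq_leD[OF assms])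
  with True have "weight_spmf q = 1"
    using weight_spmf_le_1[of q] by (simp add: lossless_spmf_def)
  with True have "p = q"
    by (intro ord_spmf_eq_pmf_None_eq[OF chain_empty assms]) (simp add: pmf_None_eq_weight_spmf lossless_spmf_def)
  then show ?thesis by simp
next
  case False
  then have "tot p h = \<infinity>"
    by (metis infinity_ennreal_def tot_finite(1) top.not_eq_extremum)
  then show ?thesis by simp
qed

lemma expected_work_tot: "lossless_spmf p \<Longrightarrow> expected_work p = tot p (\<lambda>\<sigma>. of_nat (snd \<sigma>))"
  by (simp add: expected_work_def tot_lossless)

section \<open>Additivity of work and the expected-run-time calculus\<close>

abbreviation add_work :: "nat \<Rightarrow> config \<Rightarrow> config" where
  "add_work w \<equiv> (\<lambda>(s, k). (s, k + w))"

lemma loop_add_work: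
  assumes "\<And>s k w. body (s, k + w) = map_spmf (add_work w) (body (s, k))"
  shows "loop B e body (s, k + w) = map_spmf (add_work w) (loop B e body (s, k))"
proof (induction arbitrary: s k w rule: loop.fixp_induct)
  case 1
  then show ?case
    by simp
next
  case 2
  then show ?case by simp
next
  case (3 f)
  have *: "bind_spmf (body (s, k + w + 1 + cost e)) (f B e body) =
        map_spmf (add_work w) (bind_spmf (body (s, k + 1 + cost e)) (f B e body))" for s k w
  proof -
    have "bind_spmf (body (s, k + w + 1 + cost e)) (f B e body) =
        bind_spmf (body (s, k + 1 + cost e)) (\<lambda>x. f B e body (fst x, snd x + w))"
      using assms[of s "k + 1 + cost e" w] 
      by (simp add: bind_map_spmf o_def add_ac case_prod_beta)
    also have "\<dots> = bind_spmf (body (s, k + 1 + cost e)) (\<lambda>x. map_spmf (add_work w) (f B e body x))"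
      using 3 by (intro bind_spmf_cong) auto
    finally show ?thesis by (simp add: map_spmf_bind_spmf o_def)
  qed
  show ?case
    using *[of s k w] by (simp split: option.split)
qed

lemma exec_add_work: "exec B c (s, k + w) = map_spmf (add_work w) (exec B c (s, k))"
proof (induction c arbitrary: s k w)
  case (Seq c1 c2)
  have "exec B (Seq c1 c2) (s, k + w) =
      bind_spmf (exec B c1 (s, k)) (\<lambda>x. exec B c2 (add_work w x))"
    by (simp only: exec.simps Seq.IH(1)[of s k w] bind_map_spmf o_def)
  also have "\<dots> = bind_spmf (exec B c1 (s, k)) (\<lambda>x. map_spmf (add_work w) (exec B c2 x))"
    by (intro bind_spmf_cong) (auto simp: Seq.IH(2))
  finally show ?case by (simp add: map_spmf_bind_spmf o_def)
next
  case (Cond e c1 c2)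
  show ?case
    using Cond[of s "k + 1 + cost e" w]
    by (simp split: option.split add: add.commute add.left_commute)
next
  case (While e c)
  then show ?case by (simp add: loop_add_work)
qed (simp_all split: option.split add: spmf.map_comp o_def add.commute add.left_commute)

lemma exec_work0: "exec B c (s, w) = map_spmf (add_work w) (exec B c (s, 0))"
  using exec_add_work[of B c s 0 w] by simp

text \<open>The expected-run-time transformer: a weakest precondition with values in
  \<open>ennreal\<close>, where \<open>F\<close> is the cost of whatever follows, as a function of
  the memory. Starting from work 0 loses nothing, since \<open>exec\<close> only adds to the
  counter.\<close>

definition ert :: "nat \<Rightarrow> com \<Rightarrow> (mem \<Rightarrow> ennreal) \<Rightarrow> mem \<Rightarrow> ennreal" where
  "ert B c F s = tot (exec B c (s, 0)) (\<lambda>\<sigma>. of_nat (snd \<sigma>) + F (fst \<sigma>))"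

lemma ert_work:
  "tot (exec B c (s, w)) (\<lambda>\<sigma>. of_nat (snd \<sigma>) + F (fst \<sigma>)) = of_nat w + ert B c F s"
proof (cases "lossless_spmf (exec B c (s, 0))")
  case True
  have "tot (exec B c (s, w)) (\<lambda>\<sigma>. of_nat (snd \<sigma>) + F (fst \<sigma>)) =
      tot (exec B c (s, 0)) (\<lambda>\<sigma>. of_nat w + (of_nat (snd \<sigma>) + F (fst \<sigma>)))"
    by (subst exec_work0) (auto simp: tot_map add_ac intro!: tot_cong)
  also have "\<dots> = of_nat w + ert B c F s"
    by (subst tot_add) (simp add: tot_const True ert_def)
  finally show ?thesis .
next
  case False
  then have "\<not> lossless_spmf (exec B c (s, w))"
    by (subst exec_work0) simp
  with False have "tot (exec B c (s, w)) (\<lambda>\<sigma>. of_nat (snd \<sigma>) + F (fst \<sigma>)) = \<infinity>" "ert B c F s = \<infinity>"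
    using tot_finite(1) unfolding ert_def by (metis infinity_ennreal_def less_top)+
  then show ?thesis by simp
qed

lemma ert_Seq: "ert B (Seq c1 c2) F s = ert B c1 (ert B c2 F) s"
  unfolding ert_def[of B "Seq c1 c2"] ert_def[of B c1] exec.simps tot_bind
  by (intro tot_cong) (use ert_work in auto)

lemma ert_Skip: "ert B Skip F s = 1 + F s"
  by (simp add: ert_def)

lemma ert_Write:
  "eval B s e1 = Some i \<Longrightarrow> eval B s e2 = Some v \<Longrightarrow>
   ert B (Write a e1 e2) F s = of_nat (1 + cost e1 + cost e2) + F (store a i v s)"
  by (simp add: ert_def)

lemma ert_Cond:
  "eval B s e = Some v \<Longrightarrow>
   ert B (Cond e c1 c2) F s = of_nat (1 + cost e) + ert B (if v = 0 then c2 else c1) F s"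
  by (simp add: ert_def ert_work[unfolded ert_def, of B _ s "Suc (cost e)"])

lemma ert_While:
  assumes "eval B s e = Some v"
  shows "ert B (While e c) F s =
    of_nat (1 + cost e) + (if v = 0 then F s else ert B c (ert B (While e c) F) s)"
proof -
  have w: "exec B (While e c) = loop B e (exec B c)"
    by (rule ext) simp
  have "exec B (While e c) (s, 0) = (if v = 0 then return_spmf (s, 1 + cost e)
          else bind_spmf (exec B c (s, 1 + cost e)) (exec B (While e c)))"
    unfolding w using assms by (simp add: loop.simps[of B e "exec B c" "(s, 0)"])
  then have "ert B (While e c) F s = (if v = 0 then of_nat (1 + cost e) + F s
     else tot (exec B c (s, 1 + cost e)) (\<lambda>x. of_nat (snd x) + ert B (While e c) F (fst x)))"
    unfolding ert_def[of B "While e c"]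
    by (auto simp: tot_bind ert_work[symmetric] ert_def[symmetric] simp del: exec.simps intro!: tot_cong)
  then show ?thesis by (simp only: ert_work) auto
qed

section \<open>Simulating a program with rollback\<close>

text \<open>
  Array \<open>a\<close> of the simulated program lives in the arrays \<open>val a\<close> and \<open>stamp a\<close>. The register
  \<open>1\<close> holds a phase number \<open>T\<close>. Cell \<open>i\<close> is stored at index \<open>2 i\<close> of \<open>val a\<close> (the base), unless
  \<open>T > 0\<close> and its stamp equals \<open>T\<close>: then it is stored at index \<open>2 i + 1\<close> (the overlay).
  Incrementing \<open>T\<close> thus discards everything written since the end of phase \<open>0\<close>, in constant time
  and without a log, whose length could not be bounded by the word size.
\<close>

abbreviation reg :: "nat \<Rightarrow> expr" where
  "reg r \<equiv> Read r (Const 0)"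

definition val :: "nat \<Rightarrow> nat" where "val a = 40 + 2 * a"
definition stamp :: "nat \<Rightarrow> nat" where "stamp a = 41 + 2 * a"

lemma val_stamp [simp]:
  "val a = val b \<longleftrightarrow> a = b" "stamp a = stamp b \<longleftrightarrow> a = b" "val a \<noteq> stamp b" "stamp b \<noteq> val a"
  "\<not> val a < 40" "\<not> stamp a < 40"
  unfolding val_def stamp_def by (auto, presburger+)

lemma val_stamp_small [simp]: "k < 40 \<Longrightarrow> val a \<noteq> k" "k < 40 \<Longrightarrow> stamp a \<noteq> k"
  "k < 40 \<Longrightarrow> k \<noteq> val a" "k < 40 \<Longrightarrow> k \<noteq> stamp a"
  unfolding val_def stamp_def by auto

definition cell :: "mem \<Rightarrow> nat \<Rightarrow> nat \<Rightarrow> nat" where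
  "cell s a i = 2 * i + of_bool (s (stamp a) i = s 1 0 \<and> 0 < s 1 0)"

definition view :: "mem \<Rightarrow> mem" where
  "view s = (\<lambda>a i. s (val a) (cell s a i))"

text \<open>The arrays of the driver itself. Register 2 is left out because every simulated write
  uses it as a scratch cell for the address.\<close>

definition own :: "mem \<Rightarrow> mem" where
  "own s = (\<lambda>a. if a < 40 \<and> a \<noteq> 2 then s a else (\<lambda>_. 0))"

text \<open>The snapshot to which a rollback returns. During phase 0 writes still go to the even
  cells and nothing is frozen; the constant 0 makes \<open>base\<close> invariant under simulated
  writes in that phase as well.\<close>

definition base :: "mem \<Rightarrow> mem" where
  "base s = (\<lambda>a i. if s 1 0 = 0 then 0 else s (val a) (2 * i))"

text \<open>Since no stamp exceeds the phase number, incrementing register 1 invalidates the whole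
  overlay at once.\<close>

definition ok_mem :: "nat \<Rightarrow> mem \<Rightarrow> bool" where
  "ok_mem B s \<longleftrightarrow> (\<forall>a i. s a i < B) \<and> (\<forall>a i. s (stamp a) i \<le> s 1 0)"

primrec tr_expr :: "expr \<Rightarrow> expr" where
  "tr_expr (Const k) = Const k"
| "tr_expr (Read a e) =
     Read (val a) (Bop Add (Bop Mul (Const 2) (tr_expr e))
       (Bop Mul (Bop Equal (Read (stamp a) (tr_expr e)) (reg 1)) (Bop Less (Const 0) (reg 1))))"
| "tr_expr (Bop f e1 e2) = Bop f (tr_expr e1) (tr_expr e2)"

lemma eval_less: "eval B s e = Some v \<Longrightarrow> v < B"
  by (cases e) (auto simp: fit_def split: if_splits Option.bind_splits)

text \<open>A simulated address \<open>i < Bd\<close> becomes at most \<open>2 * i + 1\<close>, so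
  the words of the host need twice the range. Only successful evaluations matter, because an
  aborting simulated run is least in the approximation order.\<close>

lemma eval_tr_expr:
  assumes "ok_mem B s" "2 * Bd + 2 \<le> B"
  shows "eval Bd (view s) e = Some v \<Longrightarrow> eval B s (tr_expr e) = Some v"
proof (induction e arbitrary: v)
  case (Read a e)
  then obtain i where i: "eval Bd (view s) e = Some i" "v = view s a i"
    by (auto simp: fit_def split: if_splits Option.bind_splits)
  have "i < Bd" using i eval_less by blast
  moreover have "s b j < B" for b j using assms by (simp add: ok_mem_def)
  ultimately show ?case
    using Read.IH[OF i(1)] i(2) assms(2) by (simp add: fit_def view_def cell_def)
next
  case (Bop f e1 e2)
  then show ?case
    using assms(2) by (auto simp: fit_def split: if_splits Option.bind_splits)
qed (use assms in \<open>auto simp: fit_def split: if_splits\<close>)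

section \<open>Translation of programs at an exact cost factor\<close>

primrec pad :: "nat \<Rightarrow> com \<Rightarrow> com" where
  "pad 0 c = c"
| "pad (Suc n) c = Seq Skip (pad n c)"

lemma exec_pad [simp]: "exec B (pad n c) (s, k) = exec B c (s, k + n)"
  by (induction n arbitrary: k) simp_all

abbreviation overlay_index :: expr where
  "overlay_index \<equiv> Bop Add (Bop Mul (Const 2) (reg 2)) (Bop Less (Const 0) (reg 1))"

definition cell_write :: "nat \<Rightarrow> expr \<Rightarrow> expr \<Rightarrow> com" where
  "cell_write a i e =
     Seq (Write 2 (Const 0) i) (Seq (Write (val a) overlay_index e) (Write (stamp a) (reg 2) (reg 1)))"

definition cell_rand :: "nat \<Rightarrow> expr \<Rightarrow> expr \<Rightarrow> com" where
  "cell_rand a i e =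
     Seq (Write 2 (Const 0) i) (Seq (Rand (val a) overlay_index e) (Write (stamp a) (reg 2) (reg 1)))"

text \<open>17 is what the three assignments of \<open>cell_write\<close> cost apart from the two
  given expressions. The value has to be exact because the padding is computed from it.\<close>

definition write_cost :: "expr \<Rightarrow> expr \<Rightarrow> nat" where
  "write_cost i e = cost i + cost e + 17"

text \<open>With \<open>C\<close> at least this large no subtraction in \<open>tr\<close> is
  truncated. A loop needs 2 instead of 1 because its exit test is padded after the loop, by a
  command that ends in a \<open>Skip\<close> of cost 1.\<close>

primrec tr_cost :: "com \<Rightarrow> nat" where
  "tr_cost Skip = 1"
| "tr_cost (Write a i e) = write_cost (tr_expr i) (tr_expr e)"
| "tr_cost (Rand a i e) = write_cost (tr_expr i) (tr_expr e)"
| "tr_cost (Seq c1 c2) = max (tr_cost c1) (tr_cost c2)"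
| "tr_cost (Cond e c1 c2) = max (1 + cost (tr_expr e)) (max (tr_cost c1) (tr_cost c2))"
| "tr_cost (While e c) = max (2 + cost (tr_expr e)) (tr_cost c)"

text \<open>Padding makes the simulation exactly \<open>C\<close> times as expensive as the simulated run.\<close>

primrec tr :: "nat \<Rightarrow> com \<Rightarrow> com" where
  "tr C Skip = pad (C - 1) Skip"
| "tr C (Write a i e) = pad (C * (1 + cost i + cost e) - write_cost (tr_expr i) (tr_expr e))
     (cell_write a (tr_expr i) (tr_expr e))"
| "tr C (Rand a i e) = pad (C * (1 + cost i + cost e) - write_cost (tr_expr i) (tr_expr e))
     (cell_rand a (tr_expr i) (tr_expr e))"
| "tr C (Seq c1 c2) = Seq (tr C c1) (tr C c2)"
| "tr C (Cond e c1 c2) = Cond (tr_expr e)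
     (pad (C * (1 + cost e) - (1 + cost (tr_expr e))) (tr C c1))
     (pad (C * (1 + cost e) - (1 + cost (tr_expr e))) (tr C c2))"
| "tr C (While e c) = Seq
     (While (tr_expr e) (pad (C * (1 + cost e) - (1 + cost (tr_expr e))) (tr C c)))
     (pad (C * (1 + cost e) - (2 + cost (tr_expr e))) Skip)"

lemma store_store: "store a i v s b = (if b = a then (s a)(i := v) else s b)"
  by (simp add: store_def)

lemma store_apply: "store a i v s b j = (if b = a \<and> j = i then v else s b j)"
  by (simp add: store_def)

definition after_write :: "nat \<Rightarrow> nat \<Rightarrow> nat \<Rightarrow> mem \<Rightarrow> mem" where
  "after_write a i v s = store (stamp a) i (s 1 0)
     (store (val a) (2 * i + of_bool (0 < s 1 0)) v (store 2 0 i s))"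

lemma double_parity:
  "2 * i + of_bool b = 2 * j + of_bool b' \<longleftrightarrow> i = j \<and> b = b'" for i j :: nat
  by (cases b; cases b') (simp_all, presburger+)

text \<open>In a positive phase the write goes to an odd index, so the even indices that
  \<open>base\<close> reads stay intact; in phase 0 \<open>base\<close> is constant.\<close>

lemma after_write:
  assumes "ok_mem B s" "v < B" "i < B"
  shows "view (after_write a i v s) = store a i v (view s)"
    and "own (after_write a i v s) = own s"
    and "base (after_write a i v s) = base s"
    and "ok_mem B (after_write a i v s)"
proof -
  let ?s = "after_write a i v s"
  have T: "?s 1 0 = s 1 0" by (simp add: after_write_def store_store)
  show "view ?s = store a i v (view s)"
  proof (intro ext)
    fix b j
    have "cell ?s b j = (if b = a \<and> j = i then 2 * i + of_bool (0 < s 1 0) else cell s b j)"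
      by (auto simp: cell_def T) (auto simp: after_write_def store_apply split: if_splits)
    then show "view ?s b j = store a i v (view s) b j"
      unfolding view_def
      by (auto simp: after_write_def store_apply cell_def double_parity simp del: of_bool_eq_iff)
  qed
  show "own ?s = own s"
    by (auto simp: own_def after_write_def store_store fun_eq_iff)
  have e: "2 * j = 2 * i + of_bool (0 < s 1 0) \<longleftrightarrow> i = j \<and> s 1 0 = 0" for j
    using double_parity[of j False i "0 < s 1 0"] by auto
  show "base ?s = base s"
    unfolding base_def T by (auto simp: after_write_def store_apply fun_eq_iff e) presburger+
  show "ok_mem B ?s"
    using assms unfolding ok_mem_def T by (auto simp: after_write_def store_apply)
qed

lemma view_store_small:
  assumes "a < 40" "a \<noteq> 1"
  shows "view (store a i v s) = view s" "base (store a i v s) = base s"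
  using assms by (auto simp: view_def cell_def base_def store_store fun_eq_iff)

lemma ok_mem_store:
  "ok_mem B s \<Longrightarrow> v < B \<Longrightarrow> a < 40 \<Longrightarrow> a \<noteq> 1 \<Longrightarrow> ok_mem B (store a i v s)"
  by (auto simp: ok_mem_def store_apply)

lemma exec_cell_write:
  assumes "ok_mem B s" "2 * j + 2 \<le> B" "2 < B"
    and e1: "eval B s i = Some j" and e2: "eval B (store 2 0 j s) e = Some v"
  shows "exec B (cell_write a i e) (s, k) = return_spmf (after_write a j v s, k + write_cost i e)"
    and "exec B (cell_rand a i e) (s, k) =
      map_spmf (\<lambda>v. (after_write a j v s, k + write_cost i e)) (spmf_of_set {..<v})"
proof -
  define s1 where "s1 = store 2 0 j s"
  note e2 = e2[folded s1_def]
  have T: "s1 1 0 = s 1 0" "s 1 0 < B" "s1 2 0 = j"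
    using assms(1) by (auto simp: s1_def store_store ok_mem_def)
  have ix: "eval B s1 overlay_index = Some (2 * j + of_bool (0 < s 1 0))"
    using T assms(2,3) by (simp add: fit_def)
  have st: "eval B (store (val a) x y s1) (reg 2) = Some j"
    "eval B (store (val a) x y s1) (reg 1) = Some (s 1 0)" for x y
    using T assms(2,3) by (simp_all add: fit_def store_store)
  have z: "eval B s (Const 0) = Some 0" using assms(3) by (simp add: fit_def)
  show "exec B (cell_write a i e) (s, k) = return_spmf (after_write a j v s, k + write_cost i e)"
    unfolding cell_write_def
    by (simp del: eval.simps One_nat_def add: z e1 e2 ix st s1_def[symmetric])
      (simp add: after_write_def s1_def write_cost_def)
  show "exec B (cell_rand a i e) (s, k) =
      map_spmf (\<lambda>v. (after_write a j v s, k + write_cost i e)) (spmf_of_set {..<v})"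
    unfolding cell_rand_def
    by (simp del: eval.simps One_nat_def add: z e1 e2 ix st s1_def[symmetric] bind_map_spmf o_def)
      (simp add: after_write_def s1_def write_cost_def map_spmf_conv_bind_spmf add.commute
        add.left_commute)
qed

text \<open>The value is evaluated when register 2 already holds the address. This is harmless: a
  translated expression reads only simulated arrays, stamps and register 1.\<close>

lemma exec_tr_write:
  assumes "ok_mem B s" "2 * Bd + 2 \<le> B"
    and "eval Bd (view s) i = Some j" "eval Bd (view s) e = Some v"
  shows "exec B (cell_write a (tr_expr i) (tr_expr e)) (s, k) =
      return_spmf (after_write a j v s, k + write_cost (tr_expr i) (tr_expr e))"
    and "exec B (cell_rand a (tr_expr i) (tr_expr e)) (s, k) =
      map_spmf (\<lambda>v. (after_write a j v s, k + write_cost (tr_expr i) (tr_expr e))) (spmf_of_set {..<v})"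
proof -
  have jv: "j < Bd" "v < Bd" using assms eval_less by blast+
  have i1: "ok_mem B (store 2 0 j s)"
    using assms jv by (intro ok_mem_store) auto
  have e1: "eval B s (tr_expr i) = Some j" and e2: "eval B (store 2 0 j s) (tr_expr e) = Some v"
    using eval_tr_expr[OF assms(1,2,3)] eval_tr_expr[OF i1 assms(2)] assms(4)
    by (simp_all add: view_store_small)
  note w = exec_cell_write[OF assms(1) _ _ e1 e2]
  show "exec B (cell_write a (tr_expr i) (tr_expr e)) (s, k) =
      return_spmf (after_write a j v s, k + write_cost (tr_expr i) (tr_expr e))"
    by (rule w(1)) (use jv assms(2) in auto)
  show "exec B (cell_rand a (tr_expr i) (tr_expr e)) (s, k) =
      map_spmf (\<lambda>v. (after_write a j v s, k + write_cost (tr_expr i) (tr_expr e))) (spmf_of_set {..<v})"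
    by (rule w(2)) (use jv assms(2) in auto)
qed

lemma ord_spmf_map_eq:
  "rel_pmf (ord_option (\<lambda>x y. R (f x) (g y))) p q \<longleftrightarrow> ord_spmf R (map_spmf f p) (map_spmf g q)"
  by (simp add: pmf.rel_map ord_option_map1[abs_def] ord_option_map2)

lemma ord_spmf_map_same:
  assumes "\<And>x. x \<in> set_spmf p \<Longrightarrow> R (f x) (g x)"
  shows "ord_spmf R (map_spmf f p) (map_spmf g p)"
  unfolding ord_spmf_map_eq[symmetric]
proof (rule pmf.rel_refl_strong)
  fix z assume "z \<in> set_pmf p"
  then show "ord_option (\<lambda>x y. R (f x) (g y)) z z"
    using assms by (cases z) (auto simp: in_set_spmf)
qed

section \<open>The simulation relation and its effect on expectations\<close>

definition simrel :: "nat \<Rightarrow> nat \<Rightarrow> nat \<Rightarrow> mem \<Rightarrow> mem \<Rightarrow> config \<Rightarrow> config \<Rightarrow> bool" where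
  "simrel B C k' ow ba = (\<lambda>(v, k) (s, x).
     v = view s \<and> ow = own s \<and> ba = base s \<and> ok_mem B s \<and> x = k' + C * k)"

text \<open>Equality of two images turns the relation into the order of the underlying complete
  partial order, for which admissibility, and thus fixpoint induction, is available. The component
  \<open>True\<close> says that the invariant of the host memory holds.\<close>

lemma ord_simrel_eq:
  "ord_spmf (simrel B C k' ow ba) p q \<longleftrightarrow>
   ord_spmf (=) (map_spmf (\<lambda>(v, k). (v, ow, ba, True, k' + C * k)) p)
     (map_spmf (\<lambda>(s, x). (view s, own s, base s, ok_mem B s, x)) q)"
proof -
  have *: "simrel B C k' ow ba = (\<lambda>x y. (\<lambda>(v, k). (v, ow, ba, True, k' + C * k)) x =
      (\<lambda>(s, x). (view s, own s, base s, ok_mem B s, x)) y)"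
    by (auto simp: fun_eq_iff simrel_def)
  show ?thesis
    unfolding * by (rule ord_spmf_map_eq)
qed

text \<open>The induction runs over the approximations of the simulated loop alone. The host loop
  enters as any \<open>R\<close> that satisfies the unrolled equation, which accommodates the
  padding \<open>p\<close> after the test, inside the loop as well as behind it.\<close>

lemma sim_loop:
  assumes sim: "\<And>s w. ok_mem B s \<Longrightarrow>
      ord_spmf (simrel B C k' (own s) (base s)) (body (view s, w)) (body' (s, k' + C * w))"
    and B: "2 * Bd + 2 \<le> B" and C: "1 + cost (tr_expr e) + p = C * (1 + cost e)"
    and R: "\<And>s x v. eval B s (tr_expr e) = Some v \<Longrightarrow>
      R (s, x) = (if v = 0 then return_spmf (s, x + 1 + cost (tr_expr e) + p)
                  else bind_spmf (body' (s, x + 1 + cost (tr_expr e) + p)) R)"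
  shows "ok_mem B s \<Longrightarrow> ord_spmf (simrel B C k' (own s) (base s)) (loop Bd e body (view s, w)) (R (s, k' + C * w))"
proof (induction arbitrary: s w rule: loop.fixp_induct)
  case 1
  show ?case
    unfolding ord_simrel_eq
    by (intro admissible_all admissible_imp' ccpo.admissible_leI[OF ccpo_spmf]) simp_all
next
  case 2
  then show ?case by simp
next
  case (3 f)
  show ?case
  proof (cases "eval Bd (view s) e")
    case (Some v)
    have Rs: "R (s, k' + C * w) = (if v = 0 then return_spmf (s, k' + C * (w + 1 + cost e))
                  else bind_spmf (body' (s, k' + C * (w + 1 + cost e))) R)"
    proof -
      have "k' + C * w + 1 + cost (tr_expr e) + p = k' + C * (w + 1 + cost e)"
        using C by (simp add: algebra_simps)
      then show ?thesis
        by (simp only: R[OF eval_tr_expr[OF 3(2) B Some], of "k' + C * w"])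
    qed
    show ?thesis
    proof (cases "v = 0")
      case True
      then show ?thesis using Some Rs 3(2) by (simp add: simrel_def)
    next
      case False
      have "ord_spmf (simrel B C k' (own s) (base s))
          (bind_spmf (body (view s, w + 1 + cost e)) (f Bd e body))
          (bind_spmf (body' (s, k' + C * (w + 1 + cost e))) R)"
        by (rule ord_spmf_bindI[OF sim[OF 3(2)]])
          (use 3(1) in \<open>auto simp: simrel_def split: prod.splits\<close>)
      then show ?thesis using Some Rs False by simp
    qed
  qed simp
qed

lemma sim_exec:
  assumes "2 * Bd + 2 \<le> B"
  shows "ok_mem B s \<Longrightarrow> tr_cost c \<le> C \<Longrightarrow>
    ord_spmf (simrel B C k' (own s) (base s)) (exec Bd c (view s, w)) (exec B (tr C c) (s, k' + C * w))"
proof (induction c arbitrary: s w)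
  case Skip
  then show ?case by (simp add: simrel_def)
next
  case (Write a i e)
  show ?case
  proof (cases "eval Bd (view s) i"; cases "eval Bd (view s) e")
    fix j v assume ev: "eval Bd (view s) i = Some j" "eval Bd (view s) e = Some v"
    then have "j < B" "v < B" using eval_less assms by fastforce+
    moreover have "write_cost (tr_expr i) (tr_expr e) \<le> C * (1 + cost i + cost e)"
      using Write by (simp add: trans_le_add1)
    ultimately show ?thesis
      using ev exec_tr_write(1)[OF Write(1) assms ev] after_write[OF Write(1)]
      by (simp add: simrel_def algebra_simps)
  qed (simp_all split: option.split)
next
  case (Rand a i e)
  show ?case
  proof (cases "eval Bd (view s) i"; cases "eval Bd (view s) e")
    fix j v assume ev: "eval Bd (view s) i = Some j" "eval Bd (view s) e = Some v"
    then have "j < B" "v < B" using eval_less assms by fastforce+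
    moreover have "write_cost (tr_expr i) (tr_expr e) \<le> C * (1 + cost i + cost e)"
      using Rand by (simp add: trans_le_add1)
    ultimately show ?thesis
      using ev exec_tr_write(2)[OF Rand(1) assms ev] after_write[OF Rand(1)]
      by (auto simp: simrel_def algebra_simps intro!: ord_spmf_map_same)
  qed (simp_all split: option.split)
next
  case (Seq c1 c2)
  show ?case
    unfolding exec.simps tr.simps
    by (rule ord_spmf_bindI[OF Seq.IH(1)])
      (use Seq.IH(2) Seq.prems in \<open>auto simp: simrel_def split: prod.splits\<close>)
next
  case (Cond e c1 c2)
  show ?case
  proof (cases "eval Bd (view s) e")
    case (Some v)
    have "1 + cost (tr_expr e) \<le> C * (1 + cost e)"
      using Cond.prems by (simp add: trans_le_add1)
    then show ?thesis
      using Some eval_tr_expr[OF Cond.prems(1) assms Some]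
        Cond.IH(1)[OF Cond.prems(1), of "w + 1 + cost e"] Cond.IH(2)[OF Cond.prems(1), of "w + 1 + cost e"] Cond.prems(2)
      by (simp add: algebra_simps)
  qed simp
next
  case (While e c)
  define p where "p = C * (1 + cost e) - (1 + cost (tr_expr e))"
  have p: "2 + cost (tr_expr e) \<le> C * (1 + cost e)"
    using While.prems by (simp add: trans_le_add1)
  have w: "exec B (While e c) = loop B e (exec B c)" for B e c
    by (rule ext) simp
  have "ord_spmf (simrel B C k' (own s) (base s)) (loop Bd e (exec Bd c) (view s, w))
     (exec B (tr C (While e c)) (s, k' + C * w))"
  proof (rule sim_loop[OF _ assms _ _ While.prems(1), where p = p and body' = "\<lambda>\<sigma>. exec B (tr C c) \<sigma>"])
    show "ord_spmf (simrel B C k' (own s) (base s)) (exec Bd c (view s, w)) (exec B (tr C c) (s, k' + C * w))"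
      if "ok_mem B s" for s w
      using While.IH[OF that] While.prems(2) by simp
    show "1 + cost (tr_expr e) + p = C * (1 + cost e)"
      using p by (simp add: p_def)
    fix s x v assume ev: "eval B s (tr_expr e) = Some v"
    let ?W = "While (tr_expr e) (pad p (tr C c))"
    have "exec B ?W (s, x) = (if v = 0 then return_spmf (s, x + 1 + cost (tr_expr e))
         else bind_spmf (exec B (tr C c) (s, x + 1 + cost (tr_expr e) + p)) (exec B ?W))"
      unfolding w using ev by (subst loop.simps) simp
    then show "exec B (tr C (While e c)) (s, x) =
        (if v = 0 then return_spmf (s, x + 1 + cost (tr_expr e) + p)
         else bind_spmf (exec B (tr C c) (s, x + 1 + cost (tr_expr e) + p)) (exec B (tr C (While e c))))"
      using p unfolding tr.simps exec.simps(4) p_def[symmetric]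
      by (simp add: p_def) (intro impI, linarith)
  qed
  then show ?case by simp
qed

lemma ert_tr:
  assumes "2 * Bd + 2 \<le> B" "ok_mem B s" "tr_cost c \<le> C"
    and F: "\<And>s'. ok_mem B s' \<Longrightarrow> own s' = own s \<Longrightarrow> base s' = base s \<Longrightarrow> F s' \<le> G (view s')"
  shows "ert B (tr C c) F s \<le> tot (exec Bd c (view s, 0)) (\<lambda>\<sigma>. of_nat (C * snd \<sigma>) + G (fst \<sigma>))"
proof -
  \<comment> \<open>The cost is made infinite where the invariants fail. The order between the
    images then transfers both the work and the invariants on which the bound for \<open>F\<close>
    rests.\<close>
  define h :: "mem \<times> mem \<times> mem \<times> bool \<times> nat \<Rightarrow> ennreal" where
    "h = (\<lambda>(v, ow, ba, i, x). if i \<and> ow = own s \<and> ba = base s then of_nat x + G v else \<infinity>)"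
  have "ert B (tr C c) F s \<le>
      tot (map_spmf (\<lambda>(s, x). (view s, own s, base s, ok_mem B s, x)) (exec B (tr C c) (s, 0))) h"
    unfolding ert_def tot_map
    by (intro tot_mono) (auto simp: h_def intro!: add_left_mono F split: prod.splits)
  also have "\<dots> \<le> tot (map_spmf (\<lambda>(v, k). (v, own s, base s, True, 0 + C * k)) (exec Bd c (view s, 0))) h"
    using sim_exec[OF assms(1,2,3), of 0 0] by (intro tot_ord) (simp add: ord_simrel_eq)
  also have "\<dots> = tot (exec Bd c (view s, 0)) (\<lambda>\<sigma>. of_nat (C * snd \<sigma>) + G (fst \<sigma>))"
    unfolding tot_map by (intro tot_cong) (auto simp: h_def)
  finally show ?thesis .
qed

lemma ert_cell_write:
  assumes "ok_mem B s" "2 * j + 2 \<le> B" "2 < B" "eval B s i = Some j"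
    "eval B (store 2 0 j s) e = Some v"
  shows "ert B (cell_write a i e) F s = of_nat (write_cost i e) + F (after_write a j v s)"
  unfolding ert_def by (simp add: exec_cell_write(1)[OF assms])

lemma own_eqD: "own s' = own s \<Longrightarrow> a < 40 \<Longrightarrow> a \<noteq> 2 \<Longrightarrow> s' a = s a"
  by (auto simp: own_def dest: fun_cong[of _ _ a])

section \<open>Running a script of operations\<close>

text \<open>
  \<open>Ask p q k t\<close> queries the threshold \<open>p / q\<close> and raises the flag in register \<open>7\<close> unless the
  answer is \<open>k\<close>; \<open>t\<close> is a ghost component saying whether the flag should be raised.
\<close>

datatype item = Ins nat nat nat | Del nat nat | Ask nat nat nat bool | Reset

fun code :: "item \<Rightarrow> nat list" where
  "code (Ins u v x) = [0, u, v, x]"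
| "code (Del u v) = [1, u, v, 0]"
| "code (Ask p q k t) = [2, p, q, k]"
| "code Reset = [3, 0, 0, 0]"

fun raises :: "item \<Rightarrow> bool" where
  "raises (Ask p q k t) = t"
| "raises _ = False"

text \<open>The cost of a script for the algorithm before translation, with current memory
  \<open>m\<close> and snapshot \<open>b\<close>. A query whose comparison with \<open>k\<close>
  contradicts the ghost \<open>t\<close> costs infinity. \<open>Reset\<close> is free here; its
  constant cost is charged to the driver.\<close>

fun script_work :: "dyn_alg \<Rightarrow> nat \<Rightarrow> item list \<Rightarrow> mem \<Rightarrow> mem \<Rightarrow> ennreal" where
  "script_work D U [] b m = 0"
| "script_work D U (Ins u v x # its) b m =
     tot (run_op D U (Insert u v x) (m, 0)) (\<lambda>\<sigma>. of_nat (snd \<sigma>) + script_work D U its b (fst \<sigma>))"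
| "script_work D U (Del u v # its) b m =
     tot (run_op D U (Delete u v) (m, 0)) (\<lambda>\<sigma>. of_nat (snd \<sigma>) + script_work D U its b (fst \<sigma>))"
| "script_work D U (Ask p q k t # its) b m =
     tot (run_op D U (Query p q) (m, 0))
       (\<lambda>\<sigma>. of_nat (snd \<sigma>) + ((if (result \<sigma> \<noteq> k) = t then 0 else \<infinity>) + script_work D U its b (fst \<sigma>)))"
| "script_work D U (Reset # its) b m = script_work D U its b b"

text \<open>Register 23 is the position in the script. The factor 2 comes from the layout of
  \<open>is_list\<close>, which occupies even indices only.\<close>

abbreviation arg :: "nat \<Rightarrow> expr" where
  "arg k \<equiv> Read 20 (Bop Mul (Const 2) (Bop Add (reg 23) (Const k)))"

abbreviation pass :: "nat \<Rightarrow> com" where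
  "pass k \<equiv> cell_write 0 (Const k) (arg (Suc k))"

definition item_step :: "nat \<Rightarrow> dyn_alg \<Rightarrow> com" where
  "item_step C D =
     Cond (Bop Equal (arg 0) (Const 0))
       (Seq (pass 0) (Seq (pass 1) (Seq (pass 2) (tr C (insertion D)))))
    (Cond (Bop Equal (arg 0) (Const 1))
       (Seq (pass 0) (Seq (pass 1) (tr C (deletion D))))
    (Cond (Bop Equal (arg 0) (Const 2))
       (Seq (pass 0) (Seq (pass 1) (Seq (tr C (query D))
         (Cond (Bop Equal (tr_expr (Read 0 (Const 0))) (arg 3)) Skip (Write 7 (Const 0) (Const 1))))))
       (Write 1 (Const 0) (Bop Add (reg 1) (Const 1)))))"

definition driver :: "nat \<Rightarrow> dyn_alg \<Rightarrow> com" where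
  "driver C D = Seq (Write 23 (Const 0) (Const 0))
     (While (Bop Less (reg 23) (reg 21))
       (Seq (item_step C D) (Write 23 (Const 0) (Bop Add (reg 23) (Const 4)))))"

definition holds_script :: "item list \<Rightarrow> mem \<Rightarrow> bool" where
  "holds_script its s \<longleftrightarrow> s 21 0 = 4 * length its \<and>
     (\<forall>j < 4 * length its. s 20 (2 * j) = concat (map code its) ! j)"

lemma length_code [simp]: "length (code it) = 4"
  by (cases it) simp_all

lemma length_codes [simp]: "length (concat (map code its)) = 4 * length its"
  by (induction its) simp_all

lemma holds_scriptD:
  assumes "holds_script (done @ it # rest) s" "k < 4"
  shows "s 20 (2 * (4 * length done + k)) = code it ! k"
proof -
  have "4 * length done + k < 4 * length (done @ it # rest)" using assms(2) by simp
  then have "s 20 (2 * (4 * length done + k)) = concat (map code (done @ it # rest)) ! (4 * length done + k)"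
    using assms(1) unfolding holds_script_def by blast
  also have "\<dots> = code it ! k"
    using assms(2) by (simp add: nth_append)
  finally show ?thesis .
qed

lemma tot_add_const_le: "tot p (\<lambda>x. h x + c) \<le> tot p h + c"
proof (cases "lossless_spmf p")
  case True
  then show ?thesis by (simp add: tot_add tot_const)
next
  case False
  then have "tot p h = \<infinity>"
    by (metis infinity_ennreal_def tot_finite(1) top.not_eq_extremum)
  then show ?thesis by simp
qed

lemma tot_scale_le:
  assumes "C > 0"
  shows "tot p (\<lambda>\<sigma>. of_nat (C * snd \<sigma>) + (of_nat C * g \<sigma> + z)) \<le> of_nat C * tot p (\<lambda>\<sigma>. of_nat (snd \<sigma>) + g \<sigma>) + z"
proof -
  have "tot p (\<lambda>\<sigma>. of_nat (C * snd \<sigma>) + (of_nat C * g \<sigma> + z)) =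
      tot p (\<lambda>\<sigma>. of_nat C * (of_nat (snd \<sigma>) + g \<sigma>) + z)"
    by (intro tot_cong) (simp add: distrib_left add_ac)
  also have "\<dots> \<le> tot p (\<lambda>\<sigma>. of_nat C * (of_nat (snd \<sigma>) + g \<sigma>)) + z"
    by (rule tot_add_const_le)
  also have "tot p (\<lambda>\<sigma>. of_nat C * (of_nat (snd \<sigma>) + g \<sigma>)) = of_nat C * tot p (\<lambda>\<sigma>. of_nat (snd \<sigma>) + g \<sigma>)"
    using assms by (intro tot_cmult) auto
  finally show ?thesis .
qed

lemma ennreal_of_nat_add_le:
  assumes "x \<le> of_nat a + r" "b + a \<le> c"
  shows "of_nat b + x \<le> of_nat c + (r :: ennreal)"
proof -
  have "of_nat b + x \<le> of_nat b + (of_nat a + r)"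
    by (rule add_left_mono) fact
  also have "\<dots> = of_nat (b + a) + r" by (simp add: add.assoc)
  also have "\<dots> \<le> of_nat c + r" using assms(2) by (intro add_right_mono) (simp only: of_nat_le_iff)
  finally show ?thesis .
qed

lemma put_store:
  "put [u, v] m = store 0 (Suc 0) v (store 0 0 u m)"
  "put [u, v, x] m = store 0 2 x (store 0 (Suc 0) v (store 0 0 u m))"
  by (auto simp: put_def store_def fun_eq_iff nth_Cons' numeral_2_eq_2)

section \<open>Verification of the driver\<close>

locale driver_ctx =
  fixes B U C :: nat and D :: dyn_alg
  assumes Bd: "2 * word_bound D U + 2 \<le> B" and B: "1000 < B"
    and C: "tr_cost (insertion D) \<le> C" "tr_cost (deletion D) \<le> C" "tr_cost (query D) \<le> C" "0 < C"
begin

definition at_item :: "nat \<Rightarrow> item \<Rightarrow> mem \<Rightarrow> bool" where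
  "at_item j it s \<longleftrightarrow> ok_mem B s \<and> 0 < s 1 0 \<and> s 1 0 + 1 < B \<and> s 23 0 = j \<and> 2 * (j + 4) < B \<and>
     (\<forall>k<4. s 20 (2 * (j + k)) = code it ! k)"

lemma eval_arg:
  assumes "at_item j it s" "k < 4" 
  shows "eval B s (arg k) = Some (code it ! k)"
proof -
  have "s 20 (2 * (j + k)) < B" "s 23 0 < B" using assms(1) by (auto simp: at_item_def ok_mem_def)
  then show ?thesis
    using assms B by (auto simp: at_item_def fit_def)
qed

lemma at_item_own:
  assumes "at_item j it s" "ok_mem B s'" "own s' = own s"
  shows "at_item j it s'"
  using assms own_eqD[OF assms(3), of 1] own_eqD[OF assms(3), of 23] own_eqD[OF assms(3), of 20]
  by (simp add: at_item_def)

lemma at_item_store2: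
  "at_item j it s \<Longrightarrow> i < B \<Longrightarrow> at_item j it (store 2 0 i s)"
  by (auto simp: at_item_def ok_mem_store store_apply)

text \<open>25 is the cost of \<open>pass k\<close>: 1 for the address, 7 for the argument and 17
  for the assignments. The numbers \<open>n\<close> and \<open>n'\<close> add up such costs along a
  sequence.\<close>

lemma ert_pass:
  assumes "at_item j it s" "k < 3"
    and G: "\<And>s'. ok_mem B s' \<Longrightarrow> own s' = own s \<Longrightarrow> base s' = base s \<Longrightarrow>
      view s' = store 0 k (code it ! Suc k) (view s) \<Longrightarrow> F s' \<le> of_nat n + G"
    and "25 + n \<le> n'"
  shows "ert B (pass k) F s \<le> of_nat n' + G"
proof -
  have s: "ok_mem B s" using assms(1) by (simp add: at_item_def)
  have v: "eval B (store 2 0 k s) (arg (Suc k)) = Some (code it ! Suc k)"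
    using assms B by (intro eval_arg at_item_store2) auto
  have "ert B (pass k) F s = of_nat (write_cost (Const k) (arg (Suc k))) + F (after_write 0 k (code it ! Suc k) s)"
    by (rule ert_cell_write[OF s _ _ _ v]) (use assms B in \<open>auto simp: fit_def\<close>)
  also have "\<dots> \<le> of_nat n' + G"
    using eval_less[OF v] assms B
    by (intro ennreal_of_nat_add_le[where a = n] G after_write[OF s]) (auto simp: write_cost_def)
  finally show ?thesis .
qed

fun branch :: "item \<Rightarrow> com" where
  "branch (Ins u v x) = Seq (pass 0) (Seq (pass 1) (Seq (pass 2) (tr C (insertion D))))"
| "branch (Del u v) = Seq (pass 0) (Seq (pass 1) (tr C (deletion D)))"
| "branch (Ask p q k t) = Seq (pass 0) (Seq (pass 1) (Seq (tr C (query D))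
         (Cond (Bop Equal (tr_expr (Read 0 (Const 0))) (arg 3)) Skip (Write 7 (Const 0) (Const 1)))))"
| "branch Reset = Write 1 (Const 0) (Bop Add (reg 1) (Const 1))"

text \<open>Each of the at most three tests costs 10; items recognised earlier are covered by the
  same bound.\<close>

lemma ert_item_step:
  assumes at: "at_item j it s" and le: "ert B (branch it) F s \<le> of_nat 120 + R"
  shows "ert B (item_step C D) F s \<le> of_nat 150 + R"
proof -
  have e0: "eval B s (arg 0) = Some (code it ! 0)" using eval_arg[OF at, of 0] by simp
  have cnd: "eval B s (Bop Equal (arg 0) (Const k)) = Some (of_bool (code it ! 0 = k))" if "k < 3" for k
    using that B e0 by (simp add: fit_def del: One_nat_def)
  have co: "ert B (Cond (Bop Equal (arg 0) (Const k)) c1 c2) F s =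
      of_nat 10 + ert B (if code it ! 0 = k then c1 else c2) F s" if "k < 3" for k c1 c2
    using that by (subst ert_Cond[OF cnd]) auto
  have e: "of_nat 10 + (of_nat 120 + R) = of_nat 130 + R" "of_nat 10 + (of_nat 130 + R) = of_nat 140 + R"
    "of_nat 10 + (of_nat 140 + R) = of_nat 150 + R"
    by (simp_all add: add.assoc[symmetric])
  have "ert B (item_step C D) F s \<le> of_nat 10 + (of_nat 10 + (of_nat 10 + ert B (branch it) F s))"
    by (cases it) (simp_all add: item_step_def co del: One_nat_def of_nat_numeral)
  also have "\<dots> \<le> of_nat 10 + (of_nat 10 + (of_nat 10 + (of_nat 120 + R)))"
    by (intro add_left_mono le)
  finally show ?thesis by (simp only: e)
qed

text \<open>\<open>F\<close> is the rest of the driver. Its hypothesis records what an item may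
  change: the simulated memory, the flag and the phase number, the latter by at most 1, so that it
  still fits into a word at the end of the script.\<close>

lemma ert_item:
  assumes at: "at_item j it s"
    and F: "\<And>s' m. ok_mem B s' \<Longrightarrow> base s' = base s \<Longrightarrow>
       s' 20 = s 20 \<Longrightarrow> s' 21 = s 21 \<Longrightarrow> s' 23 = s 23 \<Longrightarrow> 0 < s' 1 0 \<Longrightarrow> s' 1 0 \<le> s 1 0 + 1 \<Longrightarrow>
       s' 7 0 = (if raises it then 1 else s 7 0) \<Longrightarrow>
       F s' \<le> of_nat C * script_work D U its (base s) (view s') + Z"
  shows "ert B (item_step C D) F s \<le> of_nat 150 + (of_nat C * script_work D U (it # its) (base s) (view s) + Z)"
proof (rule ert_item_step[OF at])
  have s: "ok_mem B s" using at by (simp add: at_item_def)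
  have T: "0 < s 1 0" using at by (simp add: at_item_def)
  have keep: "s' 20 = s 20 \<and> s' 21 = s 21 \<and> s' 23 = s 23 \<and> s' 1 = s 1 \<and> s' 7 = s 7"
    if "own s' = own s" for s'
    using own_eqD[OF that] by simp
  have fin: "F s' \<le> of_nat C * script_work D U its (base s) (view s') + Z"
    if "ok_mem B s'" "own s' = own s" "base s' = base s" "\<not> raises it" for s'
    using that keep[OF that(2)] T by (intro F) auto
  show "ert B (branch it) F s \<le> of_nat 120 + (of_nat C * script_work D U (it # its) (base s) (view s) + Z)"
    (is "_ \<le> of_nat 120 + ?R")
  proof (cases it)
    case (Ins u v x)
    let ?c = "tr C (insertion D)"
    let ?p = "exec (word_bound D U) (insertion D) (put [u, v, x] (view s), 0)"
    have run: "ert B ?c F s' \<le> of_nat 0 + ?R"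
      if "ok_mem B s'" "own s' = own s" "base s' = base s" "view s' = put [u, v, x] (view s)" for s'
    proof -
      have "ert B ?c F s' \<le> tot (exec (word_bound D U) (insertion D) (view s', 0))
          (\<lambda>\<sigma>. of_nat (C * snd \<sigma>) + (of_nat C * script_work D U its (base s) (fst \<sigma>) + Z))"
        by (rule ert_tr[OF Bd that(1) C(1)]) (use that Ins in \<open>auto intro: fin\<close>)
      also have "\<dots> \<le> of_nat C * tot ?p (\<lambda>\<sigma>. of_nat (snd \<sigma>) + script_work D U its (base s) (fst \<sigma>)) + Z"
        unfolding that(4) by (rule tot_scale_le[OF C(4)])
      finally show ?thesis using Ins by simp
    qed
    show ?thesis
      unfolding Ins branch.simps ert_Seq
      apply (rule ert_pass[OF at, where n = 90], simp)
      subgoal for s1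
        apply (rule ert_pass[OF at_item_own[OF at], where n = 60], simp, simp, simp)
        subgoal for s2
          apply (rule ert_pass[OF at_item_own[OF at], where n = 0], simp, simp, simp)
          subgoal for s3
            using run[of s3] by (simp add: Ins put_store)
          by simp
        by simp
      by simp
  next
    case (Del u v)
    let ?c = "tr C (deletion D)"
    let ?p = "exec (word_bound D U) (deletion D) (put [u, v] (view s), 0)"
    have run: "ert B ?c F s' \<le> of_nat 0 + ?R"
      if "ok_mem B s'" "own s' = own s" "base s' = base s" "view s' = put [u, v] (view s)" for s'
    proof -
      have "ert B ?c F s' \<le> tot (exec (word_bound D U) (deletion D) (view s', 0))
          (\<lambda>\<sigma>. of_nat (C * snd \<sigma>) + (of_nat C * script_work D U its (base s) (fst \<sigma>) + Z))"
        by (rule ert_tr[OF Bd that(1) C(2)]) (use that Del in \<open>auto intro: fin\<close>)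
      also have "\<dots> \<le> of_nat C * tot ?p (\<lambda>\<sigma>. of_nat (snd \<sigma>) + script_work D U its (base s) (fst \<sigma>)) + Z"
        unfolding that(4) by (rule tot_scale_le[OF C(4)])
      finally show ?thesis using Del by simp
    qed
    show ?thesis
      unfolding Del branch.simps ert_Seq
      apply (rule ert_pass[OF at, where n = 90], simp)
      subgoal for s1
        apply (rule ert_pass[OF at_item_own[OF at], where n = 0], simp, simp, simp)
        subgoal for s2
          using run[of s2] by (simp add: Del put_store)
        by simp
      by simp
  next
    case (Ask p q k t)
    let ?c = "tr C (query D)"
    let ?k = "Cond (Bop Equal (tr_expr (Read 0 (Const 0))) (arg 3)) Skip (Write 7 (Const 0) (Const 1))"
    let ?p = "exec (word_bound D U) (query D) (put [p, q] (view s), 0)"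
    let ?G = "\<lambda>m. (if (m 0 0 \<noteq> k) = t then 0 else \<infinity>) + script_work D U its (base s) m"
    have chk: "ert B ?k F s' \<le> of_nat C * ?G (view s') + (of_nat 40 + Z)"
      if "ok_mem B s'" "own s' = own s" "base s' = base s" for s'
    proof (cases "(view s' 0 0 \<noteq> k) = t")
      case True
      note at' = at_item_own[OF at that(1,2)]
      have "s' a i < B" for a i using that(1) by (simp add: ok_mem_def)
      then have ev: "eval B s' (Bop Equal (tr_expr (Read 0 (Const 0))) (arg 3)) = Some (of_bool (view s' 0 0 = k))"
        using B eval_arg[OF at', of 3] Ask
        by (simp add: fit_def view_def cell_def del: One_nat_def)
      have "ert B ?k F s' = of_nat 24 + ert B (if view s' 0 0 = k then Skip else Write 7 (Const 0) (Const 1)) F s'"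
        by (subst ert_Cond[OF ev]) simp
      also have "\<dots> \<le> of_nat 40 + (of_nat C * script_work D U its (base s) (view s') + Z)"
      proof (rule ennreal_of_nat_add_le[where a = 3])
        show "ert B (if view s' 0 0 = k then Skip else Write 7 (Const 0) (Const 1)) F s'
          \<le> of_nat 3 + (of_nat C * script_work D U its (base s) (view s') + Z)"
        proof (cases "view s' 0 0 = k")
          case eq: True
          have "1 + F s' \<le> of_nat 3 + (of_nat C * script_work D U its (base s) (view s') + Z)"
            using True eq Ask that by (intro add_mono fin) auto
          then show ?thesis using eq by (simp add: ert_Skip)
        next
          case ne: False
          let ?s = "store 7 0 1 s'"
          have "F ?s \<le> of_nat C * script_work D U its (base s) (view ?s) + Z"
            using keep[OF that(2)] T B True ne Ask that
            by (intro F) (auto simp: store_store view_store_small intro!: ok_mem_store)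
          moreover have "ert B (Write 7 (Const 0) (Const 1)) F s' = of_nat 3 + F ?s"
            by (subst ert_Write[where i = 0 and v = 1]) (use B in \<open>auto simp: fit_def\<close>)
          ultimately show ?thesis using ne by (simp add: view_store_small add_left_mono)
        qed
      qed simp
      finally show ?thesis using True by (simp add: add_ac)
    next
      \<comment> \<open>The answer contradicts the ghost, so the right-hand side is infinite;
        positivity of \<open>C\<close> enters here.\<close>
      case False
      then show ?thesis using C(4) by (simp add: ennreal_mult_top)
    qed
    have run: "ert B ?c (ert B ?k F) s' \<le> of_nat 40 + ?R"
      if "ok_mem B s'" "own s' = own s" "base s' = base s" "view s' = put [p, q] (view s)" for s'
    proof -
      have "ert B ?c (ert B ?k F) s' \<le> tot (exec (word_bound D U) (query D) (view s', 0))
          (\<lambda>\<sigma>. of_nat (C * snd \<sigma>) + (of_nat C * ?G (fst \<sigma>) + (of_nat 40 + Z)))"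
        by (rule ert_tr[OF Bd that(1) C(3)], rule chk) (use that in simp_all)
      also have "\<dots> \<le> of_nat C * tot ?p (\<lambda>\<sigma>. of_nat (snd \<sigma>) + ?G (fst \<sigma>)) + (of_nat 40 + Z)"
        unfolding that(4) by (rule tot_scale_le[OF C(4)])
      finally show ?thesis using Ask by (simp add: result_def add_ac)
    qed
    show ?thesis
      unfolding Ask branch.simps ert_Seq
      apply (rule ert_pass[OF at, where n = 90], simp)
      subgoal for s1
        apply (rule ert_pass[OF at_item_own[OF at], where n = 40], simp, simp, simp)
        subgoal for s2
          using run[of s2] by (simp add: Ask put_store ert_Seq)
        by simp
      by simp
  next
    case Reset
    let ?s = "store 1 0 (s 1 0 + 1) s"
    have ok: "ok_mem B ?s"
      using at by (auto simp: at_item_def ok_mem_def store_apply le_SucI)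
    have ba: "base ?s = base s"
      using T by (auto simp: base_def store_apply fun_eq_iff)
    \<comment> \<open>No stamp exceeds the old phase number, hence all of them are stale now and the
      view falls back to the snapshot.\<close>
    have "s (stamp a) i \<noteq> s 1 0 + 1" for a i
      using s by (metis Suc_eq_plus1 Suc_n_not_le_n ok_mem_def)
    then have vi: "view ?s = base s"
      using T by (auto simp: view_def base_def cell_def store_apply fun_eq_iff)
    have "ert B (Write 1 (Const 0) (Bop Add (reg 1) (Const 1))) F s = of_nat 6 + F ?s"
      by (subst ert_Write[where i = 0 and v = "s 1 0 + 1"])
        (use at B in \<open>auto simp: at_item_def ok_mem_def fit_def\<close>)
    also have "\<dots> \<le> of_nat 120 + ?R"
    proof (rule ennreal_of_nat_add_le[where a = 0])
      have "F ?s \<le> of_nat C * script_work D U its (base s) (view ?s) + Z"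
        by (rule F[OF ok ba]) (use Reset in \<open>auto simp: store_apply store_store\<close>)
      then show "F ?s \<le> of_nat 0 + ?R"
        by (simp only: Reset vi script_work.simps of_nat_0 add_0)
    qed simp
    finally show ?thesis by (simp add: Reset)
  qed
qed

definition script_at :: "item list \<Rightarrow> item list \<Rightarrow> mem \<Rightarrow> bool" where
  "script_at done rest s \<longleftrightarrow> ok_mem B s \<and> 0 < s 1 0 \<and> s 1 0 + length rest < B \<and> s 23 0 = 4 * length done \<and>
     8 * length (done @ rest) + 8 < B \<and> holds_script (done @ rest) s \<and> s 7 0 \<le> 1"

text \<open>An item pays 6 for the loop test, at most 150 for its step and 6 for advancing the
  position, which 163 covers; the last 6 is the exit test. \<open>fl\<close> is the final flag,
  already determined by the ghosts of the remaining items.\<close>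

lemma ert_driver_loop:
  assumes F: "\<And>s'. ok_mem B s' \<Longrightarrow> s' 7 0 = of_bool fl \<Longrightarrow> F s' \<le> Z"
  shows "script_at done rest s \<Longrightarrow> fl = (s 7 0 = 1 \<or> list_ex raises rest) \<Longrightarrow>
    ert B (While (Bop Less (reg 23) (reg 21))
       (Seq (item_step C D) (Write 23 (Const 0) (Bop Add (reg 23) (Const 4))))) F s
    \<le> of_nat C * script_work D U rest (base s) (view s) + (of_nat (163 * length rest + 6) + Z)"
proof (induction rest arbitrary: "done" s)
  case Nil
  have "eval B s (Bop Less (reg 23) (reg 21)) = Some 0"
    using Nil.prems B by (auto simp: script_at_def ok_mem_def fit_def holds_script_def)
  moreover have "s 7 0 = of_bool fl" "ok_mem B s"
    using Nil.prems by (auto simp: script_at_def le_Suc_eq)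
  ultimately show ?case
    by (subst ert_While) (auto intro!: add_left_mono F)
next
  case (Cons it rest)
  let ?W = "While (Bop Less (reg 23) (reg 21))
       (Seq (item_step C D) (Write 23 (Const 0) (Bop Add (reg 23) (Const 4))))"
  let ?Z = "of_nat 6 + (of_nat (163 * length rest + 6) + Z)"
  have at: "at_item (4 * length done) it s"
    using Cons.prems(1) holds_scriptD[of "done" it rest s]
    by (auto simp: script_at_def at_item_def)
  have ev: "eval B s (Bop Less (reg 23) (reg 21)) = Some 1"
    using Cons.prems B by (auto simp: script_at_def ok_mem_def fit_def holds_script_def)
  have "ert B (item_step C D) (ert B (Write 23 (Const 0) (Bop Add (reg 23) (Const 4))) (ert B ?W F)) s
    \<le> of_nat 150 + (of_nat C * script_work D U (it # rest) (base s) (view s) + ?Z)"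
  proof (rule ert_item[OF at])
    fix s'
    assume s': "ok_mem B s'" "base s' = base s" "s' 20 = s 20" "s' 21 = s 21" "s' 23 = s 23"
      "0 < s' 1 0" "s' 1 0 \<le> s 1 0 + 1" "s' 7 0 = (if raises it then 1 else s 7 0)"
    let ?s = "store 23 0 (s' 23 0 + 4) s'"
    have "ert B (Write 23 (Const 0) (Bop Add (reg 23) (Const 4))) (ert B ?W F) s' = of_nat 6 + ert B ?W F ?s"
      by (subst ert_Write[where i = 0 and v = "s' 23 0 + 4"])
        (use s' Cons.prems(1) B in \<open>auto simp: script_at_def ok_mem_def fit_def\<close>)
    also have "\<dots> \<le> of_nat 6 + (of_nat C * script_work D U rest (base ?s) (view ?s) + (of_nat (163 * length rest + 6) + Z))"
    proof (intro add_left_mono Cons.IH)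
      show "script_at (done @ [it]) rest ?s"
        using s' Cons.prems(1) unfolding script_at_def
        by (auto simp: store_apply holds_script_def store_store intro!: ok_mem_store)
      show "fl = (?s 7 0 = 1 \<or> list_ex raises rest)"
        using s' Cons.prems(2) by (auto simp: store_apply)
    qed
    also have "\<dots> = of_nat C * script_work D U rest (base s) (view s') + ?Z"
      using s' by (simp add: view_store_small add_ac)
    finally show "ert B (Write 23 (Const 0) (Bop Add (reg 23) (Const 4))) (ert B ?W F) s'
      \<le> of_nat C * script_work D U rest (base s) (view s') + ?Z" .
  qed
  moreover have "ert B ?W F s = of_nat 6 +
      ert B (item_step C D) (ert B (Write 23 (Const 0) (Bop Add (reg 23) (Const 4))) (ert B ?W F)) s"
    by (subst ert_While[OF ev]) (simp add: ert_Seq)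
  ultimately have "ert B ?W F s \<le> of_nat 6 + (of_nat 150 + (of_nat C * script_work D U (it # rest) (base s) (view s) + ?Z))"
    by (simp only: add_left_mono)
  also have "\<dots> = of_nat C * script_work D U (it # rest) (base s) (view s) + (of_nat (6 + 150 + 6 + (163 * length rest + 6)) + Z)"
    by (simp only: of_nat_add) (simp only: add_ac)
  also have "\<dots> \<le> of_nat C * script_work D U (it # rest) (base s) (view s) + (of_nat (163 * length (it # rest) + 6) + Z)"
    by (intro add_left_mono add_right_mono) (simp only: of_nat_le_iff, simp)
  finally show ?case .
qed

lemma ert_driver:
  assumes "script_at [] its (store 23 0 0 s)" "ok_mem B s"
    and F: "\<And>s'. ok_mem B s' \<Longrightarrow> s' 7 0 = of_bool (s 7 0 = 1 \<or> list_ex raises its) \<Longrightarrow> F s' \<le> Z"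
  shows "ert B (driver C D) F s \<le>
    of_nat C * script_work D U its (base s) (view s) + (of_nat (163 * length its + 9) + Z)"
proof -
  let ?s = "store 23 0 0 s"
  have "ert B (driver C D) F s = of_nat 3 + ert B (While (Bop Less (reg 23) (reg 21))
       (Seq (item_step C D) (Write 23 (Const 0) (Bop Add (reg 23) (Const 4))))) F ?s"
    unfolding driver_def ert_Seq by (subst ert_Write[where i = 0 and v = 0]) (use B in \<open>auto simp: fit_def\<close>)
  also have "\<dots> \<le> of_nat 3 + (of_nat C * script_work D U its (base ?s) (view ?s) + (of_nat (163 * length its + 6) + Z))"
    by (intro add_left_mono ert_driver_loop[OF F assms(1)]) (auto simp: store_apply)
  also have "\<dots> = of_nat C * script_work D U its (base s) (view s) + (of_nat (3 + (163 * length its + 6)) + Z)"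
    by (simp only: of_nat_add view_store_small) (simp add: view_store_small add_ac)
  finally show ?thesis by (simp add: add_ac)
qed

end

section \<open>A logic for deterministic programs\<close>

primrec ev :: "mem \<Rightarrow> expr \<Rightarrow> nat" where
  "ev s (Const k) = k"
| "ev s (Read a e) = s a (ev s e)"
| "ev s (Bop f e1 e2) = bop_sem f (ev s e1) (ev s e2)"

primrec depth :: "expr \<Rightarrow> nat" where
  "depth (Const k) = 0"
| "depth (Read a e) = depth e"
| "depth (Bop f e1 e2) = Suc (max (depth e1) (depth e2))"

primrec arith :: "nat \<Rightarrow> expr \<Rightarrow> bool" where
  "arith V (Const k) \<longleftrightarrow> k < V"
| "arith V (Read a e) \<longleftrightarrow> arith V e"
| "arith V (Bop f e1 e2) \<longleftrightarrow> f \<in> {Add, Sub, Mul, Div, Mod, Less, Equal} \<and> arith V e1 \<and> arith V e2"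

primrec mods :: "com \<Rightarrow> nat set" where
  "mods Skip = {}"
| "mods (Write a i e) = {a}"
| "mods (Rand a i e) = {a}"
| "mods (Seq c1 c2) = mods c1 \<union> mods c2"
| "mods (Cond e c1 c2) = mods c1 \<union> mods c2"
| "mods (While e c) = mods c"

definition For :: "nat \<Rightarrow> expr \<Rightarrow> com \<Rightarrow> com" where
  "For r e c = Seq (Write r (Const 0) (Const 0))
     (While (Bop Less (reg r) e) (Seq c (Write r (Const 0) (Bop Add (reg r) (Const 1)))))"

lemma mods_For [simp]: "mods (For r e c) = insert r (mods c)"
  by (auto simp: For_def)

text \<open>
  Overflow is dealt with once and for all: when all memory cells are below \<open>V\<close>, an expression of
  depth \<open>d\<close> is below \<open>V\<close> to the power \<open>2\<^sup>d\<close>.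
\<close>

locale det_ctx =
  fixes B V z :: nat
  assumes V: "1000 < V" and VB: "V ^ (2 ^ z) \<le> B" and z: "40 \<le> z"
begin

definition small :: "expr \<Rightarrow> bool" where
  "small e \<longleftrightarrow> arith V e \<and> depth e \<le> z"

definition bnd :: "mem \<Rightarrow> bool" where
  "bnd s \<longleftrightarrow> (\<forall>a i. s a i < V)"

lemma bndD: "bnd s \<Longrightarrow> s a i < V"
  by (simp add: bnd_def)

lemma V_le_pow: "V \<le> V ^ (2 ^ d)"
  using V self_le_power[of V "2 ^ d"] by simp

lemma bop_less:
  assumes "x < X" "y < X" "2 \<le> X" "f \<in> {Add, Sub, Mul, Div, Mod, Less, Equal}"
  shows "bop_sem f x y < X * X"
proof -
  have XX: "X + X \<le> X * X" using mult_le_mono1[OF assms(3), of X] by (simp only: mult_2)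
  moreover have "x * y < X * X" using assms by (intro mult_strict_mono) auto
  moreover have "x div y < X" "x mod y < X"
    using assms(1) div_le_dividend[of x y] mod_less_eq_dividend[of x y] by linarith+
  ultimately show ?thesis using assms by auto
qed

lemma eval_ev:
  assumes s: "bnd s" 
  shows "arith V e \<Longrightarrow> ev s e < V ^ (2 ^ depth e) \<and>
    (V ^ (2 ^ depth e) \<le> B \<longrightarrow> eval B s e = Some (ev s e))"
proof (induction e)
  case (Const k)
  then show ?case by (simp add: fit_def)
next
  case (Read a e)
  then show ?case
    using bndD[OF s, of a "ev s e"] V_le_pow[of "depth e"] by (auto simp: fit_def)
next
  case (Bop f e1 e2)
  define d where "d = max (depth e1) (depth e2)"
  define X where "X = V ^ (2 ^ d)"
  have le: "V ^ (2 ^ depth e1) \<le> X" "V ^ (2 ^ depth e2) \<le> X"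
    unfolding X_def d_def using V by (intro power_increasing; simp)+
  have XX: "V ^ (2 ^ depth (Bop f e1 e2)) = X * X"
    unfolding X_def d_def by (simp add: power_add[symmetric] mult_2[symmetric])
  have X2: "2 \<le> X" using V_le_pow[of d] V by (simp add: X_def)
  have "X \<le> X * X" by simp
  moreover have "bop_sem f (ev s e1) (ev s e2) < X * X"
    using Bop le X2 by (intro bop_less) auto
  moreover have "eval B s e1 = Some (ev s e1)" "eval B s e2 = Some (ev s e2)" if "X * X \<le> B"
    using Bop le that \<open>X \<le> X * X\<close> by auto
  ultimately show ?case
    unfolding XX by (auto simp: fit_def)
qed

lemma eval_small: "bnd s \<Longrightarrow> small e \<Longrightarrow> eval B s e = Some (ev s e)"
proof -
  assume s: "bnd s" and e: "small e"
  have "V ^ (2 ^ depth e) \<le> V ^ (2 ^ z)"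
    using e V by (intro power_increasing) (auto simp: small_def)
  then show ?thesis using eval_ev[OF s, of e] e VB by (auto simp: small_def)
qed

text \<open>Total correctness with a time bound and a frame condition, for runs with a single
  outcome. Quantifying over \<open>w\<close> records that neither outcome nor time depends on the
  work spent before.\<close>

definition ok :: "com \<Rightarrow> mem \<Rightarrow> (mem \<Rightarrow> bool) \<Rightarrow> nat \<Rightarrow> bool" where
  "ok c s Q t \<longleftrightarrow> (\<exists>s' k. k \<le> t \<and> (\<forall>w. exec B c (s, w) = return_spmf (s', w + k)) \<and>
     bnd s' \<and> (\<forall>a. a \<notin> mods c \<longrightarrow> s' a = s a) \<and> Q s')"

lemma ok_conseq:
  assumes "ok c s Q t"
    and "\<And>s'. bnd s' \<Longrightarrow> (\<And>a. a \<notin> mods c \<Longrightarrow> s' a = s a) \<Longrightarrow> Q s' \<Longrightarrow> Q' s'" and "t \<le> t'"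
  shows "ok c s Q' t'"
  using assms unfolding ok_def by (meson order_trans)

lemma ok_Skip: "bnd s \<Longrightarrow> Q s \<Longrightarrow> 1 \<le> t \<Longrightarrow> ok Skip s Q t"
  unfolding ok_def by (intro exI[of _ s] exI[of _ 1]) simp

lemma ok_Write:
  assumes "bnd s" "small e1" "small e2" "ev s e2 < V" "Q (store a (ev s e1) (ev s e2) s)"
    "1 + cost e1 + cost e2 \<le> t"
  shows "ok (Write a e1 e2) s Q t"
  unfolding ok_def
  using assms
  by (intro exI[of _ "store a (ev s e1) (ev s e2) s"] exI[of _ "1 + cost e1 + cost e2"])
    (auto simp: eval_small bnd_def store_store)

lemma ok_Seq:
  assumes "ok c1 s Q1 t1"
    and "\<And>s1. bnd s1 \<Longrightarrow> (\<And>a. a \<notin> mods c1 \<Longrightarrow> s1 a = s a) \<Longrightarrow> Q1 s1 \<Longrightarrow> ok c2 s1 Q t2"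
    and "t1 + t2 \<le> t"
  shows "ok (Seq c1 c2) s Q t"
proof -
  obtain s1 k1 where 1: "k1 \<le> t1" "\<And>w. exec B c1 (s, w) = return_spmf (s1, w + k1)" "bnd s1"
    "\<And>a. a \<notin> mods c1 \<Longrightarrow> s1 a = s a" "Q1 s1"
    using assms(1) unfolding ok_def by blast
  obtain s2 k2 where 2: "k2 \<le> t2" "\<And>w. exec B c2 (s1, w) = return_spmf (s2, w + k2)" "bnd s2"
    "\<And>a. a \<notin> mods c2 \<Longrightarrow> s2 a = s1 a" "Q s2"
    using assms(2)[OF 1(3,4,5)] unfolding ok_def by blast
  show ?thesis
    unfolding ok_def using 1 2 assms(3)
    by (intro exI[of _ s2] exI[of _ "k1 + k2"]) (simp add: add.assoc)
qed

lemma ok_Cond: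
  assumes "bnd s" "small e" "ev s e \<noteq> 0 \<Longrightarrow> ok c1 s Q t1" "ev s e = 0 \<Longrightarrow> ok c2 s Q t1"
    "1 + cost e + t1 \<le> t"
  shows "ok (Cond e c1 c2) s Q t"
proof -
  obtain c where c: "c = (if ev s e = 0 then c2 else c1)" by blast
  have "ok c s Q t1" using assms(3,4) c by auto
  then obtain s1 k1 where 1: "k1 \<le> t1" "\<And>w. exec B c (s, w) = return_spmf (s1, w + k1)" "bnd s1"
    "\<And>a. a \<notin> mods c \<Longrightarrow> s1 a = s a" "Q s1"
    unfolding ok_def by blast
  show ?thesis
    unfolding ok_def using 1 assms(5) eval_small[OF assms(1,2)] c
    by (intro exI[of _ s1] exI[of _ "1 + cost e + k1"]) (auto simp: add.assoc)
qed

lemma ok_While: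
  assumes s: "bnd s" "I 0 s" and e: "small e"
    and step: "\<And>i s'. i < n \<Longrightarrow> I i s' \<Longrightarrow> bnd s' \<Longrightarrow> (\<And>a. a \<notin> mods c \<Longrightarrow> s' a = s a) \<Longrightarrow>
      ev s' e \<noteq> 0 \<and> ok c s' (I (Suc i)) (f i)"
    and stop: "\<And>s'. I n s' \<Longrightarrow> bnd s' \<Longrightarrow> (\<And>a. a \<notin> mods c \<Longrightarrow> s' a = s a) \<Longrightarrow> ev s' e = 0"
    and t: "(\<Sum>i<n. f i) + (n + 1) * (1 + cost e) \<le> t"
  shows "ok (While e c) s (I n) t"
proof -
  have "ok (While e c) s' (I n) ((\<Sum>i\<in>{i..<n}. f i) + (n - i + 1) * (1 + cost e))"
    if "i \<le> n" "I i s'" "bnd s'" "\<And>a. a \<notin> mods c \<Longrightarrow> s' a = s a" for i s'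
    using that
  proof (induction "n - i" arbitrary: i s')
    case 0
    then have [simp]: "i = n" by simp
    have "eval B s' e = Some 0" using eval_small[OF 0(4) e] stop[of s'] 0 by simp
    then show ?case
      unfolding ok_def using 0
      by (intro exI[of _ s'] exI[of _ "1 + cost e"]) (simp add: loop.simps)
  next
    case (Suc d)
    then have i: "i < n" by simp
    have nz: "ev s' e \<noteq> 0" and body: "ok c s' (I (Suc i)) (f i)" using step[OF i] Suc.prems by auto
    obtain s1 k1 where 1: "k1 \<le> f i" "\<And>w. exec B c (s', w) = return_spmf (s1, w + k1)" "bnd s1"
      "\<And>a. a \<notin> mods c \<Longrightarrow> s1 a = s' a" "I (Suc i) s1"
      using body unfolding ok_def by blast
    have "ok (While e c) s1 (I n) ((\<Sum>j\<in>{Suc i..<n}. f j) + (n - Suc i + 1) * (1 + cost e))"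
      using Suc.hyps(2) Suc.prems 1 i by (intro Suc.hyps(1)) auto
    then obtain s2 k2 where 2: "k2 \<le> (\<Sum>j\<in>{Suc i..<n}. f j) + (n - Suc i + 1) * (1 + cost e)"
      "\<And>w. exec B (While e c) (s1, w) = return_spmf (s2, w + k2)" "bnd s2"
      "\<And>a. a \<notin> mods (While e c) \<Longrightarrow> s2 a = s1 a" "I n s2"
      unfolding ok_def by blast
    have "exec B (While e c) (s', w) = return_spmf (s2, w + (1 + cost e + k1 + k2))" for w
      using 1(2) 2(2) nz eval_small[OF Suc.prems(3) e]
      by (simp add: loop.simps[of B e _ "(s', w)"] add_ac)
    moreover have "1 + cost e + k1 + k2 \<le> (\<Sum>j\<in>{i..<n}. f j) + (n - i + 1) * (1 + cost e)"
      using 1(1) 2(1) i by (simp add: sum.atLeast_Suc_lessThan Suc_diff_Suc[symmetric])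
    ultimately show ?case
      unfolding ok_def using 1 2 by (intro exI[of _ s2] exI[of _ "1 + cost e + k1 + k2"]) auto
  qed
  from this[of 0 s] s t show ?thesis
    by (auto simp: lessThan_atLeast0 elim: ok_conseq)
qed

text \<open>The invariant \<open>I i\<close> speaks of the memory whose counter already shows
  \<open>i\<close>. Test and increment together cost \<open>10 + cost e\<close>; the extra summand
  in \<open>n + 1\<close> pays for the exit test and the initial assignment.\<close>

lemma ok_For:
  assumes s: "bnd s" "I 0 (store r 0 0 s)" and e: "small e" "depth e < z"
    and n: "\<And>s' i. I i s' \<Longrightarrow> (\<And>a. a \<notin> insert r (mods c) \<Longrightarrow> s' a = s a) \<Longrightarrow> s' r 0 = i \<Longrightarrow> i \<le> n \<Longrightarrow> ev s' e = n"
    and nV: "n < V" and r: "r \<notin> mods c"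
    and step: "\<And>i s'. i < n \<Longrightarrow> I i s' \<Longrightarrow> bnd s' \<Longrightarrow> s' r 0 = i \<Longrightarrow>
      (\<And>a. a \<notin> insert r (mods c) \<Longrightarrow> s' a = s a) \<Longrightarrow>
      ok c s' (\<lambda>s''. I (Suc i) (store r 0 (Suc i) s'')) (f i)"
    and t: "(\<Sum>i<n. f i) + (n + 1) * (10 + cost e) \<le> t"
  shows "ok (For r e c) s (I n) t"
proof -
  define J where "J i s' \<longleftrightarrow> I i s' \<and> s' r 0 = i" for i s'
  have smr: "small (Bop Less (reg r) e)"
    using e z V by (simp add: small_def)
  have sm1: "small (Bop Add (reg r) (Const 1))" "small (Const 0)"
    using z V by (simp_all add: small_def)
  show ?thesis
    unfolding For_def
  proof (rule ok_Seq[where ?t1.0 = 3])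
    show "ok (Write r (Const 0) (Const 0)) s (J 0) 3"
      by (rule ok_Write) (use s sm1 V in \<open>auto simp: J_def store_store\<close>)
    fix s1 assume s1: "bnd s1" "\<And>a. a \<notin> mods (Write r (Const 0) (Const 0)) \<Longrightarrow> s1 a = s a" "J 0 s1"
    have "ok (While (Bop Less (reg r) e) (Seq c (Write r (Const 0) (Bop Add (reg r) (Const 1)))))
         s1 (J n) ((\<Sum>i<n. f i + 6) + (n + 1) * (1 + cost (Bop Less (reg r) e)))"
    proof (rule ok_While[where I = J])
      fix i s'
      assume i: "i < n" and J: "J i s'" and b: "bnd s'"
        and fr: "\<And>a. a \<notin> mods (Seq c (Write r (Const 0) (Bop Add (reg r) (Const 1)))) \<Longrightarrow> s' a = s1 a"
      have fr': "s' a = s a" if "a \<notin> insert r (mods c)" for a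
        using fr[of a] s1(2)[of a] that by simp
      show "ev s' (Bop Less (reg r) e) \<noteq> 0 \<and>
          ok (Seq c (Write r (Const 0) (Bop Add (reg r) (Const 1)))) s' (J (Suc i)) (f i + 6)"
      proof
        show "ev s' (Bop Less (reg r) e) \<noteq> 0"
          using n[of i s'] J fr' i by (simp add: J_def)
        show "ok (Seq c (Write r (Const 0) (Bop Add (reg r) (Const 1)))) s' (J (Suc i)) (f i + 6)"
        proof (rule ok_Seq[OF step[OF i _ b]])
          show "I i s'" "s' r 0 = i" using J by (simp_all add: J_def)
          show "s' a = s a" if "a \<notin> insert r (mods c)" for a using fr'[OF that] .
          fix s2 assume s2: "bnd s2" "\<And>a. a \<notin> mods c \<Longrightarrow> s2 a = s' a" "I (Suc i) (store r 0 (Suc i) s2)"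
          have "s2 r 0 = i" using s2(2)[of r] r J by (simp add: J_def)
          then show "ok (Write r (Const 0) (Bop Add (reg r) (Const 1))) s2 (J (Suc i)) 6"
            by (intro ok_Write) (use s2 sm1 i nV in \<open>auto simp: J_def store_store\<close>)
        qed simp
      qed
    next
      fix s'
      assume J: "J n s'"
        and fr: "\<And>a. a \<notin> mods (Seq c (Write r (Const 0) (Bop Add (reg r) (Const 1)))) \<Longrightarrow> s' a = s1 a"
      have "s' a = s a" if "a \<notin> insert r (mods c)" for a
        using fr[of a] s1(2)[of a] that by simp
      then show "ev s' (Bop Less (reg r) e) = 0"
        using n[of n s'] J by (simp add: J_def)
    qed (use s1 smr in auto)
    then show "ok (While (Bop Less (reg r) e) (Seq c (Write r (Const 0) (Bop Add (reg r) (Const 1)))))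
         s1 (I n) ((\<Sum>i<n. f i + 6) + (n + 1) * (1 + cost (Bop Less (reg r) e)))"
      by (rule ok_conseq) (auto simp: J_def)
  next
    show "3 + ((\<Sum>i<n. f i + 6) + (n + 1) * (1 + cost (Bop Less (reg r) e))) \<le> t"
      using t by (simp add: sum.distrib algebra_simps)
  qed
qed

section \<open>Symbolic execution of loop-free code\<close>

primrec wp :: "com \<Rightarrow> (mem \<Rightarrow> bool) \<Rightarrow> mem \<Rightarrow> bool" where
  "wp Skip Q s = Q s"
| "wp (Write a i e) Q s = (ev s e < V \<and> Q (store a (ev s i) (ev s e) s))"
| "wp (Rand a i e) Q s = False"
| "wp (Seq c1 c2) Q s = wp c1 (wp c2 Q) s"
| "wp (Cond e c1 c2) Q s = (if ev s e = 0 then wp c2 Q s else wp c1 Q s)"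
| "wp (While e c) Q s = False"

primrec small_com :: "com \<Rightarrow> bool" where
  "small_com Skip = True"
| "small_com (Write a i e) = (small i \<and> small e)"
| "small_com (Rand a i e) = False"
| "small_com (Seq c1 c2) = (small_com c1 \<and> small_com c2)"
| "small_com (Cond e c1 c2) = (small e \<and> small_com c1 \<and> small_com c2)"
| "small_com (While e c) = False"

primrec time :: "com \<Rightarrow> nat" where
  "time Skip = 1"
| "time (Write a i e) = 1 + cost i + cost e"
| "time (Rand a i e) = 0"
| "time (Seq c1 c2) = time c1 + time c2"
| "time (Cond e c1 c2) = 1 + cost e + max (time c1) (time c2)"
| "time (While e c) = 0"

lemma ok_wp: "bnd s \<Longrightarrow> small_com c \<Longrightarrow> wp c Q s \<Longrightarrow> time c \<le> t \<Longrightarrow> ok c s Q t"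
proof (induction c arbitrary: s Q t)
  case (Seq c1 c2)
  show ?case
  proof (rule ok_Seq[where ?t1.0 = "time c1" and ?t2.0 = "time c2"])
    show "ok c1 s (wp c2 Q) (time c1)" using Seq by auto
    show "ok c2 s1 Q (time c2)" if "bnd s1" "wp c2 Q s1" for s1
      using Seq that by auto
  qed (use Seq in auto)
next
  case (Cond e c1 c2)
  then show ?case
    by (intro ok_Cond[where ?t1.0 = "max (time c1) (time c2)"]) (auto split: if_splits)
qed (auto intro: ok_Skip ok_Write)

lemma ok_ert:
  assumes "ok c s Q t" and "\<And>s'. bnd s' \<Longrightarrow> (\<And>a. a \<notin> mods c \<Longrightarrow> s' a = s a) \<Longrightarrow> Q s' \<Longrightarrow> F s' \<le> Z"
  shows "ert B c F s \<le> of_nat t + Z"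
proof -
  obtain s1 k1 where 1: "k1 \<le> t" "\<And>w. exec B c (s, w) = return_spmf (s1, w + k1)" "bnd s1"
    "\<And>a. a \<notin> mods c \<Longrightarrow> s1 a = s a" "Q s1"
    using assms(1) unfolding ok_def by blast
  then have "ert B c F s = of_nat k1 + F s1" by (simp add: ert_def)
  then show ?thesis using 1 assms(2)[of s1] by (auto intro!: add_mono)
qed

end

section \<open>Clusterings of the gadget graph\<close>

subsection \<open>Average similarity\<close>

lemma finite_dom_pairs:
  assumes "finite X" "finite Y"
  shows "finite {e \<in> dom G. \<exists>x \<in> X. \<exists>y \<in> Y. e = {x, y}}"
proof (rule finite_subset)
  show "{e \<in> dom G. \<exists>x \<in> X. \<exists>y \<in> Y. e = {x, y}} \<subseteq> (\<lambda>(x, y). {x, y}) ` (X \<times> Y)" by auto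
qed (use assms in auto)

text \<open>At most \<open>card X * card Y\<close> unordered pairs occur as edges, each of weight at
  most \<open>c\<close>. If they all come from a proper subset \<open>Z\<close> of the pairs, the
  sum has fewer terms than the average has pairs, whence the strict bound.\<close>

lemma similarity_le:
  assumes fin: "finite X" "finite Y" "0 \<le> c" and Z: "Z \<subseteq> X \<times> Y" "Z \<noteq> X \<times> Y"
    and edges: "\<And>x y. x \<in> X \<Longrightarrow> y \<in> Y \<Longrightarrow> {x, y} \<in> dom G \<Longrightarrow> real (the (G {x, y})) \<le> c"
  shows "similarity G X Y \<le> c"
    and "(\<And>x y. x \<in> X \<Longrightarrow> y \<in> Y \<Longrightarrow> {x, y} \<in> dom G \<Longrightarrow> (x, y) \<in> Z) \<Longrightarrow> 0 < c \<Longrightarrow> similarity G X Y < c"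
proof -
  let ?E = "{e \<in> dom G. \<exists>x \<in> X. \<exists>y \<in> Y. e = {x, y}}"
  have sum: "(\<Sum>e\<in>?E. real (the (G e))) \<le> real (card ?E) * c"
    using edges by (intro sum_bounded_above) auto
  have nz: "X \<noteq> {}" "Y \<noteq> {}" using Z by auto
  then have pos: "0 < real (card X) * real (card Y)" using fin by (simp add: card_gt_0_iff)
  have sub: "?E \<subseteq> (\<lambda>(x, y). {x, y}) ` (X \<times> Y)" by auto
  have "card ?E \<le> card (X \<times> Y)"
    using fin by (intro surj_card_le[OF _ sub]) auto
  then have "real (card ?E) * c \<le> real (card (X \<times> Y)) * c"
    using fin(3) by (intro mult_right_mono) auto
  then have "(\<Sum>e\<in>?E. real (the (G e))) \<le> c * (real (card X) * real (card Y))"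
    using sum by (simp add: card_cartesian_product mult.commute)
  then show "similarity G X Y \<le> c"
    using pos by (simp add: similarity_def pos_divide_le_eq)
  assume in_Z: "\<And>x y. x \<in> X \<Longrightarrow> y \<in> Y \<Longrightarrow> {x, y} \<in> dom G \<Longrightarrow> (x, y) \<in> Z" and "0 < c"
  have "?E \<subseteq> (\<lambda>(x, y). {x, y}) ` Z" using in_Z by auto
  moreover have "finite Z" using Z(1) fin by (auto intro: finite_subset)
  ultimately have "card ?E \<le> card Z" by (intro surj_card_le)
  also have "card Z < card (X \<times> Y)" using Z fin by (intro psubset_card_mono) auto
  finally have "real (card ?E) * c < real (card (X \<times> Y)) * c" using \<open>0 < c\<close> by simp
  then have "(\<Sum>e\<in>?E. real (the (G e))) < c * (real (card X) * real (card Y))"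
    using sum by (simp add: card_cartesian_product mult.commute)
  then show "similarity G X Y < c"
    using pos by (simp add: similarity_def pos_divide_less_eq)
qed

lemma similarity_le_avg:
  assumes "finite X" "finite Y" "X \<noteq> {}" "Y \<noteq> {}" "0 \<le> c"
    and "\<And>x y. x \<in> X \<Longrightarrow> y \<in> Y \<Longrightarrow> {x, y} \<in> dom G \<Longrightarrow> real (the (G {x, y})) \<le> c"
  shows "similarity G X Y \<le> c"
  using assms by (intro similarity_le(1)[of X Y c "{}"]) auto

lemma similarity_single:
  assumes "finite X" "finite Y" 
    and "\<And>x y. x \<in> X \<Longrightarrow> y \<in> Y \<Longrightarrow> {x, y} \<in> dom G \<Longrightarrow> {x, y} = e"
  shows "similarity G X Y \<le> real (the (G e)) / (real (card X) * real (card Y))"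
proof -
  have "(\<Sum>e\<in>{e \<in> dom G. \<exists>x \<in> X. \<exists>y \<in> Y. e = {x, y}}. real (the (G e))) \<le> (\<Sum>e\<in>{e}. real (the (G e)))"
    using assms(3) by (intro sum_mono2) auto
  then show ?thesis
    unfolding similarity_def by (intro divide_right_mono) auto
qed

lemma similarity_ge:
  assumes "finite X" "finite Y" "x \<in> X" "y \<in> Y" "G {x, y} = Some w"
  shows "real w / (real (card X) * real (card Y)) \<le> similarity G X Y"
proof -
  have "(\<Sum>e\<in>{{x, y}}. real (the (G e))) \<le> (\<Sum>e\<in>{e \<in> dom G. \<exists>x \<in> X. \<exists>y \<in> Y. e = {x, y}}. real (the (G e)))"
    using assms by (intro sum_mono2 finite_dom_pairs) auto
  then show ?thesis
    unfolding similarity_def using assms by (intro divide_right_mono) auto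
qed

lemma max_similarity_ge:
  assumes "finite P" "(X, Y) \<in> adjacent_pairs G P"
  shows "similarity G X Y \<le> max_similarity G P"
proof -
  have "adjacent_pairs G P \<subseteq> P \<times> P" by (auto simp: adjacent_pairs_def)
  then have "finite (adjacent_pairs G P)" using assms(1) by (auto intro: finite_subset)
  then show ?thesis
    unfolding max_similarity_def using assms(2) by (intro Max_ge) force+
qed

lemma merge_step_card:
  assumes "finite P" "merge_step G lam P P'"
  shows "finite P'" "card P' < card P"
proof -
  obtain X Y where XY: "X \<in> P" "Y \<in> P" "X \<noteq> Y" "P' = insert (X \<union> Y) (P - {X, Y})"
    using assms(2) by (auto simp: merge_step_def adjacent_pairs_def)
  then show "finite P'" using assms(1) by simp
  have "card P' \<le> Suc (card (P - {X, Y}))"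
    unfolding XY(4) by (rule card_insert_le_m1) simp_all
  also have "card (P - {X, Y}) = card P - 2"
    using XY assms(1) by (subst card_Diff_subset) auto
  also have "Suc (card P - 2) < card P"
    using XY card_mono[of P "{X, Y}"] assms(1) by auto
  finally show "card P' < card P" .
qed

subsection \<open>The gadget\<close>

text \<open>
  The vertices below \<open>N\<close> carry the edges \<open>HE\<close> of the input graph. The vertex \<open>N + u\<close> is the
  private partner of \<open>u\<close>, \<open>2 N\<close> is a hub and the edges \<open>PE\<close> are padding. While \<open>u\<close> and its partner
  form a cluster, all similarities of this cluster are below \<open>2\<close>; \<open>u\<close> is unblocked by deleting the
  edge to its partner, or by letting the partner join the large cluster of the hub.
\<close>

definition gadget :: "nat \<Rightarrow> nat set set \<Rightarrow> nat set set \<Rightarrow> nat \<Rightarrow> nat \<Rightarrow> nat set \<Rightarrow> nat set \<Rightarrow> wgraph" where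
  "gadget N PE HE W W2 X Y = (\<lambda>e.
     if e \<in> PE then Some 1 else if e \<in> HE then Some 2
     else if e \<in> (\<lambda>u. {u, N + u}) ` X then Some W
     else if e \<in> (\<lambda>y. {2 * N, y}) ` Y then Some W2 else None)"

text \<open>\<open>blob\<close> concerns vertices whose partner belongs to the hub: the hub then has
  more than \<open>lb\<close> members, which dilutes a partner edge of weight \<open>W\<close> below
  2 and below \<open>W / lam\<close>.\<close>

locale gadget_ctx =
  fixes N n x0 lb :: nat and PE HE :: "nat set set" and X Y :: "nat set" and lam :: real
  assumes PE: "e \<in> PE \<Longrightarrow> \<exists>a b. e = {a, b} \<and> a \<noteq> b \<and> x0 \<le> a \<and> x0 \<le> b \<and> a < n \<and> b < n"
    and HE: "e \<in> HE \<Longrightarrow> \<exists>a b. e = {a, b} \<and> a \<noteq> b \<and> a < N \<and> b < N"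
    and X: "X \<subseteq> {..<N}" and Y: "Y \<subseteq> {N..<x0} - {2 * N}" and x0: "2 * N < x0" "x0 \<le> n"
    and lam: "1 \<le> lam" "lam \<le> real lb"
    and blob: "u \<in> X \<Longrightarrow> N + u \<in> Y \<Longrightarrow> lb \<le> card Y"
begin

text \<open>This number lies strictly between \<open>2 * lb\<close> and \<open>2 * (lb + 1)\<close>.
  As \<open>lam\<close> is at most \<open>lb\<close>, a pair beats similarity 2 by more than the
  factor \<open>lam\<close>, while averaging over \<open>lb + 1\<close> hub members brings
  \<open>W\<close> below 2.\<close>

definition W :: nat where "W = 2 * lb + 1"
text \<open>Even when averaged over a hub of \<open>n\<close> vertices this exceeds
  \<open>lam * W\<close>. So the hub is complete before any pair can be merged.\<close>

definition W2 :: nat where "W2 = lb * n * W + 1"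
abbreviation G :: wgraph where "G \<equiv> gadget N PE HE W W2 X Y"

definition A :: "nat set" where "A = {u \<in> X. N + u \<notin> Y}"
definition hub :: "nat set \<Rightarrow> nat set" where "hub Y' = insert (2 * N) Y'"

text \<open>The clustering at an intermediate moment: \<open>Y'\<close> has joined the hub, the
  vertices of \<open>X'\<close> have merged with their partners, and everything else is still
  single.\<close>

definition part :: "nat set \<Rightarrow> nat set \<Rightarrow> nat set set" where
  "part Y' X' = insert (hub Y') ((\<lambda>u. {u, N + u}) ` X' \<union>
     (\<lambda>x. {x}) ` ({..<n} - hub Y' - X' - (+) N ` X'))"

lemma lb: "1 \<le> lb" using lam by linarith

lemma edge_cases:
  assumes "{x, y} \<in> dom G"
  obtains (pad) "x0 \<le> x" "x0 \<le> y" "x \<noteq> y" "G {x, y} = Some 1"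
  | (inp) "x < N" "y < N" "x \<noteq> y" "{x, y} \<in> HE" "G {x, y} = Some 2"
  | (pair1) "x \<in> X" "y = N + x" "x < N" "G {x, y} = Some W"
  | (pair2) "y \<in> X" "x = N + y" "y < N" "G {x, y} = Some W"
  | (star1) "x = 2 * N" "y \<in> Y" "N \<le> y" "y < x0" "y \<noteq> x" "G {x, y} = Some W2"
  | (star2) "y = 2 * N" "x \<in> Y" "N \<le> x" "x < x0" "y \<noteq> x" "G {x, y} = Some W2"
proof -
  consider "{x, y} \<in> PE" | "{x, y} \<notin> PE" "{x, y} \<in> HE"
    | "{x, y} \<notin> PE" "{x, y} \<notin> HE" "{x, y} \<in> (\<lambda>u. {u, N + u}) ` X"
    | "{x, y} \<notin> PE" "{x, y} \<notin> HE" "{x, y} \<notin> (\<lambda>u. {u, N + u}) ` X" "{x, y} \<in> (\<lambda>y. {2 * N, y}) ` Y"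
    using assms by (auto simp: gadget_def split: if_splits)
  then show thesis
  proof cases
    case 1
    then show ?thesis using PE[OF 1] pad by (auto simp: doubleton_eq_iff gadget_def)
  next
    case 2
    then show ?thesis using HE[OF 2(2)] inp by (auto simp: doubleton_eq_iff gadget_def)
  next
    case 3
    then obtain u where u: "u \<in> X" "{x, y} = {u, N + u}" by auto
    moreover have "u < N" using u X by auto
    moreover have "G {x, y} = Some W" using 3 by (simp add: gadget_def)
    ultimately show ?thesis using pair1 pair2 by (auto simp: doubleton_eq_iff)
  next
    case 4
    then obtain v where v: "v \<in> Y" "{x, y} = {2 * N, v}" by auto
    moreover have "N \<le> v" "v < x0" "v \<noteq> 2 * N" using v Y by auto
    moreover have "G {x, y} = Some W2" using 4 by (simp add: gadget_def)
    ultimately show ?thesis using star1 star2 by (auto simp: doubleton_eq_iff)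
  qed
qed

lemma edge_pair: "u \<in> X \<Longrightarrow> G {u, N + u} = Some W"
proof -
  assume u: "u \<in> X"
  then have "u < N" using X by auto
  moreover have "{u, N + u} \<notin> PE"
    using PE[of "{u, N + u}"] \<open>u < N\<close> x0 by (auto simp: doubleton_eq_iff)
  moreover have "{u, N + u} \<notin> HE"
    using HE[of "{u, N + u}"] by (auto simp: doubleton_eq_iff)
  ultimately show ?thesis using u by (auto simp: gadget_def)
qed

lemma edge_star: "y \<in> Y \<Longrightarrow> G {2 * N, y} = Some W2"
proof -
  assume y: "y \<in> Y"
  then have y': "N \<le> y" "y < x0" "y \<noteq> 2 * N" using Y by auto
  have "{2 * N, y} \<notin> PE"
    using PE[of "{2 * N, y}"] x0 by (auto simp: doubleton_eq_iff)
  moreover have "{2 * N, y} \<notin> HE"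
    using HE[of "{2 * N, y}"] by (auto simp: doubleton_eq_iff)
  moreover have "{2 * N, y} \<notin> (\<lambda>u. {u, N + u}) ` X"
    using X y' by (auto simp: doubleton_eq_iff)
  ultimately show ?thesis using y by (auto simp: gadget_def)
qed

lemma edge_inp: "e \<in> HE \<Longrightarrow> G e = Some 2"
proof -
  assume e: "e \<in> HE"
  have "e \<notin> PE" using PE[of e] HE[OF e] x0 by (auto simp: doubleton_eq_iff)
  then show ?thesis using e by (simp add: gadget_def)
qed

text \<open>Weight 2 identifies input edges: padding has weight 1, \<open>W\<close> is odd and
  \<open>W2\<close> is larger.\<close>

lemma weight_two:
  assumes "{x, y} \<in> dom G" "the (G {x, y}) = 2"
  shows "x < N \<and> y < N \<and> {x, y} \<in> HE"
proof -
  have W: "W \<noteq> 2" unfolding W_def by presburger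
  have "1 * 1 * 3 \<le> lb * n * W" using lb x0 by (intro mult_le_mono) (auto simp: W_def)
  then have W2: "W2 \<noteq> 2" unfolding W2_def by linarith
  from assms(1) show ?thesis by (cases rule: edge_cases) (use assms(2) W W2 in simp_all)
qed

lemma finite_Y: "finite Y" using Y by (auto intro: finite_subset)
lemma finite_X: "finite X" using X by (auto intro: finite_subset)
lemma A_X: "A \<subseteq> X" by (auto simp: A_def)
lemma Y_less: "y \<in> Y \<Longrightarrow> y < n \<and> N \<le> y \<and> y \<noteq> 2 * N" using Y x0 by auto
lemma X_less: "u \<in> X \<Longrightarrow> u < N" using X by auto

context
  fixes Y' X' assumes Y': "Y' \<subseteq> Y" and X': "X' \<subseteq> A"
begin

lemma X'_less: "u \<in> X' \<Longrightarrow> u < N \<and> u \<in> X \<and> N + u \<notin> Y \<and> N + u \<notin> Y' \<and> u \<notin> Y'"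
  using X' Y' X_less Y_less by (force simp: A_def)

lemma Y'_less: "y \<in> Y' \<Longrightarrow> y \<in> Y \<and> y < n \<and> N \<le> y \<and> y \<noteq> 2 * N"
  using Y' Y_less by auto

lemma finite_part: "finite (part Y' X')"
  using finite_X X' A_X by (auto simp: part_def intro: finite_subset)

lemma part_cases:
  assumes "P \<in> part Y' X'"
  obtains (hub) "P = hub Y'" | (pair) u where "u \<in> X'" "P = {u, N + u}"
  | (single) x where "x < n" "x \<notin> hub Y'" "x \<notin> X'" "\<And>u. u \<in> X' \<Longrightarrow> x \<noteq> N + u" "P = {x}"
proof -
  from assms have "P = hub Y' \<or> P \<in> (\<lambda>u. {u, N + u}) ` X' \<or> P \<in> (\<lambda>x. {x}) ` ({..<n} - hub Y' - X' - (+) N ` X')"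
    unfolding part_def by simp
  then show thesis
  proof (elim disjE)
    assume "P \<in> (\<lambda>x. {x}) ` ({..<n} - hub Y' - X' - (+) N ` X')"
    then obtain x where x: "x \<in> {..<n} - hub Y' - X' - (+) N ` X'" "P = {x}" by (rule imageE)
    show thesis by (rule single[of x]) (use x in auto)
  next
    assume "P \<in> (\<lambda>u. {u, N + u}) ` X'"
    then obtain u where "P = {u, N + u}" "u \<in> X'" by (rule imageE)
    then show thesis by (intro pair)
  qed (rule hub)
qed

lemma part_finite: "P \<in> part Y' X' \<Longrightarrow> finite P \<and> P \<noteq> {} \<and> card P \<le> n"
proof (erule part_cases)
  assume P: "P = hub Y'"
  have sub: "hub Y' \<subseteq> {..<n}" using Y'_less x0 by (auto simp: hub_def)
  then show "finite P \<and> P \<noteq> {} \<and> card P \<le> n"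
    using P card_mono[OF _ sub] finite_subset[OF sub] by (auto simp: hub_def)
next
  fix u assume "u \<in> X'" "P = {u, N + u}"
  then show "finite P \<and> P \<noteq> {} \<and> card P \<le> n"
    using X'_less[of u] x0 by (auto simp: card_insert_if)
qed (use x0 in auto)

lemma part_disjoint: "P \<in> part Y' X' \<Longrightarrow> Q \<in> part Y' X' \<Longrightarrow> x \<in> P \<Longrightarrow> x \<in> Q \<Longrightarrow> P = Q"
  by (elim part_cases) (auto simp: hub_def dest: X'_less Y'_less)

lemma in_hub: "P \<in> part Y' X' \<Longrightarrow> x \<in> P \<Longrightarrow> x \<in> hub Y' \<Longrightarrow> P = hub Y'"
  using part_disjoint[of P "hub Y'" x] by (auto simp: part_def)

lemma low_cluster: "P \<in> part Y' X' \<Longrightarrow> x \<in> P \<Longrightarrow> x < N \<Longrightarrow> P = (if x \<in> X' then {x, N + x} else {x})"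
  by (elim part_cases) (auto simp: hub_def dest: X'_less Y'_less)

lemma outside_cluster: "P \<in> part Y' X' \<Longrightarrow> x \<in> P \<Longrightarrow> N \<le> x \<Longrightarrow> x \<notin> hub Y' \<Longrightarrow> (\<And>u. u \<in> X' \<Longrightarrow> x \<noteq> N + u) \<Longrightarrow> P = {x}"
  by (elim part_cases) (auto simp: hub_def dest: X'_less Y'_less)

text \<open>An edge heavier than 2 between two clusters is a star edge or a partner edge, which
  determines both clusters. Without one, the average is at most 2, with equality only if every pair
  of vertices across carries an input edge. A blocked vertex prevents this, as its partner has no
  such edge.\<close>

lemma adjacent_cases:
  assumes "P \<in> part Y' X'" "Q \<in> part Y' X'" "P \<noteq> Q"
  obtains (star) y where "y \<in> Y" "y \<notin> Y'" "{P, Q} = {hub Y', {y}}"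
  | (pair) u where "u \<in> X" "u \<notin> X'" "N + u \<notin> Y'" "{P, Q} = {{u}, {N + u}}"
  | (dilute) u where "u \<in> X" "N + u \<in> Y'" "similarity G P Q \<le> real W / real (card (hub Y'))"
  | (light) "similarity G P Q \<le> 2"
    "similarity G P Q = 2 \<Longrightarrow> \<exists>u v. {u, v} \<in> HE \<and> u \<notin> X' \<and> v \<notin> X'"
proof -
  note fP = part_finite[OF assms(1)] and fQ = part_finite[OF assms(2)]
  have disj: "x \<in> P \<Longrightarrow> x \<notin> Q" for x using part_disjoint[OF assms(1,2), of x] assms(3) by auto
  have hubpart: "hub Y' \<in> part Y' X'" by (simp add: part_def)
  have starlike: thesis if "R \<in> part Y' X'" "S \<in> part Y' X'" "{P, Q} = {R, S}" "R \<noteq> S" "2 * N \<in> R" "y \<in> S" "y \<in> Y" for R S y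
  proof -
    have R: "R = hub Y'" using in_hub[OF that(1,5)] by (simp add: hub_def)
    then have y: "y \<notin> hub Y'" using in_hub[OF that(2,6)] that(4) by auto
    have "S = {y}"
      using that y Y_less[OF that(7)] X'_less by (intro outside_cluster) auto
    then show thesis
      by (intro star[of y]) (use that R y in \<open>auto simp: hub_def\<close>)
  qed
  \<comment> \<open>The only edge between \<open>u\<close> and the hub is the partner edge, so its
    weight is averaged over the whole hub.\<close>
  have single: "similarity G R S \<le> real W / real (card (hub Y'))"
    if eqs: "{R, S} = {hub Y', {u}}" "u \<in> X" "N + u \<in> Y'" for R S u
  proof -
    have u: "u < N" "u \<notin> Y'" using X_less[OF eqs(2)] Y'_less by force+
    have e: "{x, y} = {u, N + u}" if "x \<in> hub Y'" "y \<in> {u}" "{x, y} \<in> dom G" for x y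
      using that(3) that(1,2) u x0 Y'_less[of x] by (cases rule: edge_cases) (auto simp: hub_def)
    have fin: "finite (hub Y')" using part_finite[OF hubpart] by simp
    have "R = hub Y' \<and> S = {u} \<or> R = {u} \<and> S = hub Y'" using eqs(1) by (simp only: doubleton_eq_iff)
    then consider "R = hub Y'" "S = {u}" | "S = hub Y'" "R = {u}" by blast
    then show ?thesis
    proof cases
      case 1
      then show ?thesis
        using similarity_single[of R S G "{u, N + u}"] e fin edge_pair[OF eqs(2)] by auto
    next
      case 2
      then have "{x, y} = {u, N + u}" if "x \<in> R" "y \<in> S" "{x, y} \<in> dom G" for x y
        using e[of y x] that by (auto simp: insert_commute)
      then show ?thesis
        using similarity_single[of R S G "{u, N + u}"] 2 fin edge_pair[OF eqs(2)] by auto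
    qed
  qed
  have pairlike: thesis if "R \<in> part Y' X'" "S \<in> part Y' X'" "{P, Q} = {R, S}" "R \<noteq> S" "u \<in> R" "N + u \<in> S" "u \<in> X" for R S u
  proof -
    have uX': "u \<notin> X'"
      using low_cluster[OF that(1,5) X_less[OF that(7)]] part_disjoint[OF that(1,2), of "N + u"] that(4,6)
      by auto
    then have R: "R = {u}" using low_cluster[OF that(1,5) X_less[OF that(7)]] by simp
    show thesis
    proof (cases "N + u \<in> Y'")
      case True
      then have "S = hub Y'" using in_hub[OF that(2,6)] by (simp add: hub_def)
      moreover have "{P, Q} = {S, R}" using that(3) by (simp only: insert_commute)
      ultimately have eqs: "{P, Q} = {hub Y', {u}}" using R by simp
      show thesis by (rule dilute[OF that(7) True single[OF eqs that(7) True]])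
    next
      case False
      have "N + u \<notin> hub Y'" using False X_less[OF that(7)] by (auto simp: hub_def)
      then have "S = {N + u}"
        using that uX' by (intro outside_cluster) auto
      then show thesis
        by (intro pair[of u]) (use that R False uX' in auto)
    qed
  qed
  show thesis
  proof (cases "\<exists>x\<in>P. \<exists>y\<in>Q. {x, y} \<in> dom G \<and> the (G {x, y}) > 2")
    case True
    then obtain x y where xy: "x \<in> P" "y \<in> Q" "{x, y} \<in> dom G" "the (G {x, y}) > 2"
      by (elim bexE conjE) (rule that)
    from xy(3) show ?thesis
    proof (cases rule: edge_cases)
      case pair1
      show ?thesis
        by (rule pairlike[of P Q x]) (use pair1 xy(1,2) assms(3) in \<open>simp_all add: assms(1,2) insert_commute\<close>)
    next
      case pair2
      show ?thesis
        by (rule pairlike[of Q P y]) (use pair2 xy(1,2) assms(3) in \<open>simp_all add: assms(1,2) insert_commute\<close>)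
    next
      case star1
      show ?thesis
        by (rule starlike[of P Q y]) (use star1 xy(1,2) assms(3) in \<open>simp_all add: assms(1,2) insert_commute\<close>)
    next
      case star2
      show ?thesis
        by (rule starlike[of Q P x]) (use star2 xy(1,2) assms(3) in \<open>simp_all add: assms(1,2) insert_commute\<close>)
    next
      case pad
      then show ?thesis using xy(4) by simp
    next
      case inp
      then show ?thesis using xy(4) by simp
    qed
  next
    case False
    then have le: "real (the (G {x, y})) \<le> 2" if "x \<in> P" "y \<in> Q" "{x, y} \<in> dom G" for x y
    proof -
      have "\<not> 2 < the (G {x, y})" using False that by blast
      then show ?thesis by simp
    qed
    have le2: "similarity G P Q \<le> 2"
      by (rule similarity_le_avg) (use fP fQ in \<open>simp_all\<close>, use le in simp)
    show ?thesis
    proof (rule light[OF le2])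
      assume eq: "similarity G P Q = 2"
      show "\<exists>u v. {u, v} \<in> HE \<and> u \<notin> X' \<and> v \<notin> X'"
      proof (rule ccontr)
        assume none: "\<not> ?thesis"
        \<comment> \<open>The pairs that attain the value 2. If these are all pairs, an endpoint in
          \<open>X'\<close> would bring its partner along as an endpoint of an input edge.\<close>
        define Z where "Z = {(x, y) \<in> P \<times> Q. {x, y} \<in> dom G \<and> the (G {x, y}) = 2}"
        show False
        proof (cases "Z = P \<times> Q")
          case True
          obtain x y where xy: "x \<in> P" "y \<in> Q" using fP fQ by auto
          then have "(x, y) \<in> Z" using True by blast
          then have "{x, y} \<in> dom G" "the (G {x, y}) = 2" unfolding Z_def by auto
          then have inp: "x < N" "y < N" "{x, y} \<in> HE"
            using weight_two by blast+
          then consider "x \<in> X'" | "y \<in> X'" using none by blast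
          then show False
          proof cases
            case 1
            then have "N + x \<in> P" using low_cluster[OF assms(1) xy(1) inp(1)] by auto
            then have "(N + x, y) \<in> Z" using True xy(2) by blast
            then have "{N + x, y} \<in> dom G" "the (G {N + x, y}) = 2" unfolding Z_def by auto
            then show False using weight_two by fastforce
          next
            case 2
            then have "N + y \<in> Q" using low_cluster[OF assms(2) xy(2) inp(2)] by auto
            then have "(x, N + y) \<in> Z" using True xy(1) by blast
            then have "{x, N + y} \<in> dom G" "the (G {x, N + y}) = 2" unfolding Z_def by auto
            then show False using weight_two by fastforce
          qed
        next
          case False
          \<comment> \<open>Some pair contributes at most \<open>1\<close> to the average.\<close>
          obtain x y where xy: "x \<in> P" "y \<in> Q" "(x, y) \<notin> Z" using False by (auto simp: Z_def)
          show False
          \<comment> \<open>An input edge between the clusters confines them to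
            \<open>{x', N + x'}\<close> and \<open>{y', N + y'}\<close>, where it is the only edge;
            without one, all weights are at most 1.\<close>
          proof (cases "\<exists>x\<in>P. \<exists>y\<in>Q. {x, y} \<in> dom G \<and> the (G {x, y}) = 2")
            case True
            then obtain x' y' where xy': "x' \<in> P" "y' \<in> Q" "{x', y'} \<in> dom G" "the (G {x', y'}) = 2" by blast
            then have inp: "x' < N" "y' < N" "{x', y'} \<in> HE"
              using weight_two by blast+
            have "similarity G P Q < 2"
            proof (rule similarity_le(2)[of P Q 2 Z])
              fix x y assume a: "x \<in> P" "y \<in> Q" "{x, y} \<in> dom G"
              have "P \<subseteq> {x', N + x'}" "Q \<subseteq> {y', N + y'}"
                using low_cluster[OF assms(1) xy'(1) inp(1)] low_cluster[OF assms(2) xy'(2) inp(2)]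
                by (auto split: if_splits)
              then have xy: "x = x' \<or> x = N + x'" "y = y' \<or> y = N + y'" using a by auto
              have ne: "x' \<noteq> y'" using disj xy' by auto
              from a(3) have "x = x' \<and> y = y'"
                by (cases rule: edge_cases) (use xy ne inp x0 in auto)
              then show "(x, y) \<in> Z" using xy' by (simp add: Z_def)
            qed (use fP fQ False le in \<open>auto simp: Z_def\<close>)
            then show False using eq by simp
          next
            case no2: False
            then have "real (the (G {x, y})) \<le> 1" if "x \<in> P" "y \<in> Q" "{x, y} \<in> dom G" for x y
              using le[OF that] that by force
            then have "similarity G P Q \<le> 1"
              using fP fQ by (intro similarity_le_avg) auto
            then show False using eq by simp
          qed
        qed
      qed
    qed
  qed
qed

end

text \<open>Pairs appear only after the hub is complete. The size of \<open>W2\<close> enforces this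
  order, so mixed situations need not be considered.\<close>

definition stage :: "nat set set \<Rightarrow> bool" where
  "stage P \<longleftrightarrow> (\<exists>Y' X'. Y' \<subseteq> Y \<and> X' \<subseteq> A \<and> (Y' = Y \<or> X' = {}) \<and> P = part Y' X')"

lemma stageI: "Y' \<subseteq> Y \<Longrightarrow> X' \<subseteq> A \<Longrightarrow> Y' = Y \<or> X' = {} \<Longrightarrow> stage (part Y' X')"
  unfolding stage_def by blast

lemma single_in_part:
  "x < n \<Longrightarrow> x \<notin> hub Y' \<Longrightarrow> x \<notin> X' \<Longrightarrow> (\<And>u. u \<in> X' \<Longrightarrow> x \<noteq> N + u) \<Longrightarrow> {x} \<in> part Y' X'"
  by (auto simp: part_def)

lemma W_bounds: "2 * lam < real W" "real W * lam < real W2 / real n" "2 \<le> real W2 / real n" "real W < 2 * real (lb + 1)"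
proof -
  have n: "1 \<le> real n" using x0 by simp
  show W: "2 * lam < real W" "real W < 2 * real (lb + 1)" using lam by (auto simp: W_def)
  have "lam * (real n * real W) \<le> real lb * (real n * real W)"
    using lam by (intro mult_right_mono) auto
  moreover have "real W2 = real lb * (real n * real W) + 1" by (simp add: W2_def)
  ultimately have "lam * (real n * real W) < real W2" by linarith
  then show 1: "real W * lam < real W2 / real n"
    using n by (simp add: pos_less_divide_eq mult_ac)
  have "2 * 1 \<le> real W * lam" using W lam by (intro mult_mono) auto
  then show "2 \<le> real W2 / real n" using 1 by simp
qed

lemma singletons_part: "singletons n = part {} {}"
  using x0 by (auto simp: singletons_def part_def hub_def)

lemma merge_star:
  assumes "Y' \<subseteq> Y" "y \<in> Y" "y \<notin> Y'"
  shows "insert (hub Y' \<union> {y}) (part Y' {} - {hub Y', {y}}) = part (insert y Y') {}"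
proof -
  have "y \<noteq> 2 * N" using Y_less assms by blast
  then have y: "y \<notin> hub Y'" using assms by (simp add: hub_def)
  have "hub Y' \<notin> (\<lambda>x. {x}) ` ({..<n} - hub Y')" by (auto simp: hub_def)
  then have "part Y' {} - {hub Y', {y}} = (\<lambda>x. {x}) ` ({..<n} - hub Y') - {{y}}"
    by (auto simp: part_def)
  also have "\<dots> = (\<lambda>x. {x}) ` ({..<n} - hub (insert y Y'))"
    by (auto simp: hub_def)
  finally show ?thesis
    by (simp add: part_def) (simp add: hub_def insert_commute)
qed

lemma merge_pair:
  assumes "X' \<subseteq> A" "u \<in> A" "u \<notin> X'"
  shows "insert ({u} \<union> {N + u}) (part Y X' - {{u}, {N + u}}) = part Y (insert u X')"
proof -
  have u: "u < N" "N + u \<notin> Y" "u \<in> X" using assms X_less by (auto simp: A_def)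
  then have nh: "u \<notin> hub Y" "N + u \<notin> hub Y" using Y_less by (auto simp: hub_def) force
  let ?V = "{..<n} - hub Y - X' - (+) N ` X'"
  have 1: "hub Y \<noteq> {u}" "hub Y \<noteq> {N + u}" using u by (auto simp: hub_def)
  have lt: "v < N" if "v \<in> X'" for v using that assms X_less by (auto simp: A_def)
  have 2: "(\<lambda>v. {v, N + v}) ` X' - {{u}, {N + u}} = (\<lambda>v. {v, N + v}) ` X'"
    using u lt by (auto simp: doubleton_eq_iff)
  have "part Y X' - {{u}, {N + u}} = insert (hub Y) ((\<lambda>v. {v, N + v}) ` X' \<union> (\<lambda>x. {x}) ` (?V - {u, N + u}))"
    unfolding part_def using 1 2 by auto
  moreover have "?V - {u, N + u} = {..<n} - hub Y - insert u X' - (+) N ` insert u X'" by auto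
  ultimately show ?thesis
    unfolding part_def by (simp add: insert_commute)
qed

lemma max_ge_adjacent:
  assumes "stage P" "R \<in> P" "S \<in> P" "R \<noteq> S" "x \<in> R" "y \<in> S" "G {x, y} = Some w"
  shows "(R, S) \<in> adjacent_pairs G P" "real w / (real (card R) * real (card S)) \<le> similarity G R S"
    "real w / (real (card R) * real (card S)) \<le> max_similarity G P"
proof -
  obtain Y' X' where st: "Y' \<subseteq> Y" "X' \<subseteq> A" "P = part Y' X'" using assms(1) by (auto simp: stage_def)
  show adj: "(R, S) \<in> adjacent_pairs G P"
    using assms by (auto simp: adjacent_pairs_def adjacent_def)
  show 1: "real w / (real (card R) * real (card S)) \<le> similarity G R S"
    using part_finite[OF st(1,2)] assms st by (intro similarity_ge) auto
  then show "real w / (real (card R) * real (card S)) \<le> max_similarity G P"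
    using max_similarity_ge[OF _ adj] finite_part[OF st(1,2)] st(3) by auto
qed

text \<open>As long as the final stage is not reached, a merge towards it is available whose
  similarity exceeds that of every other kind of merge by more than the factor \<open>lam\<close>.
  So even an approximate agglomeration is forced, up to the order of merges of the same
  kind.\<close>

lemma stage_step:
  assumes st: "stage P" and ne: "P \<noteq> part Y A"
  shows "\<not> all_below G 2 P" and "merge_step G lam P P' \<Longrightarrow> stage P'"
proof -
  have goal: "\<not> all_below G 2 P \<and> (merge_step G lam P P' \<longrightarrow> stage P')"
  proof -
  obtain Y' X' where YX: "Y' \<subseteq> Y" "X' \<subseteq> A" "Y' = Y \<or> X' = {}" and P: "P = part Y' X'"
    using st by (auto simp: stage_def)
  have l0: "0 < lam" using lam by simp
  show ?thesis
  proof (cases "Y' = Y")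
    case False
    then have X': "X' = {}" using YX by simp
    obtain y where y: "y \<in> Y" "y \<notin> Y'" using False YX by auto
    have hubP: "hub Y' \<in> P" by (simp add: P part_def)
    have yP: "{y} \<in> P" using y Y_less[OF y(1)] X' by (auto simp: P part_def hub_def)
    have yh: "y \<notin> hub Y'" using y Y_less[OF y(1)] by (simp add: hub_def)
    note mx = max_ge_adjacent[OF st hubP yP, of "2 * N" y W2]
    have mx': "(hub Y', {y}) \<in> adjacent_pairs G P" "real W2 / real (card (hub Y')) \<le> similarity G (hub Y') {y}"
      "real W2 / real (card (hub Y')) \<le> max_similarity G P"
      using mx yh edge_star[OF y(1)] by (auto simp: hub_def)
    have ch: "0 < card (hub Y')" "card (hub Y') \<le> n"
      using part_finite[OF YX(1,2)] hubP P by (auto simp: card_gt_0_iff)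
    then have le: "real W2 / real n \<le> real W2 / real (card (hub Y'))"
      by (intro divide_left_mono) auto
    have nb: "\<not> all_below G 2 P"
      using mx'(1,2) le W_bounds(3) by (fastforce simp: all_below_def)
    have "stage P'" if ms: "merge_step G lam P P'"
    proof -
      obtain R S where RS: "R \<in> P" "S \<in> P" "R \<noteq> S" "similarity G R S \<ge> max_similarity G P / lam"
        "P' = insert (R \<union> S) (P - {R, S})"
        using ms by (auto simp: merge_step_def adjacent_pairs_def)
      \<comment> \<open>Every admissible merge is now more similar than \<open>W\<close>, which only
        a star edge can achieve.\<close>
      have "real W * lam < max_similarity G P" using W_bounds(2) le mx'(3) by linarith
      then have "real W < max_similarity G P / lam" using l0 by (simp add: pos_less_divide_eq)
      then have big: "real W < similarity G R S" using RS(4) by linarith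
      have RS': "R \<in> part Y' X'" "S \<in> part Y' X'" using RS P by auto
      show ?thesis
      proof (rule adjacent_cases[OF YX(1,2) RS' RS(3)])
        fix y assume y: "y \<in> Y" "y \<notin> Y'" "{R, S} = {hub Y', {y}}"
        then have "R \<union> S = hub Y' \<union> {y}" by (auto simp: doubleton_eq_iff)
        then have "P' = part (insert y Y') {}"
          using merge_star[OF YX(1) y(1,2)] RS(5) y(3) P X' by simp
        then show ?thesis using y YX stageI[of "insert y Y'" "{}"] by simp
      next
        fix u assume u: "u \<in> X" "{R, S} = {{u}, {N + u}}"
        have "similarity G R S \<le> real W"
        proof (rule similarity_le_avg)
          fix x z assume xz: "x \<in> R" "z \<in> S" 
          then have "{x, z} = {u, N + u}" using u(2) RS(3) by (auto simp: doubleton_eq_iff)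
          then show "real (the (G {x, z})) \<le> real W" using edge_pair[OF u(1)] by simp
        qed (use part_finite[OF YX(1,2)] RS' in auto)
        then show ?thesis using big by simp
      next
        fix u assume "similarity G R S \<le> real W / real (card (hub Y'))"
        moreover have "real W / real (card (hub Y')) \<le> real W / 1" using ch by (intro divide_left_mono) auto
        ultimately show ?thesis using big by simp
      next
        assume "similarity G R S \<le> 2"
        then show ?thesis using big lb by (simp add: W_def)
      qed
    qed
    then show ?thesis using nb by blast
  next
    case True
    then have "X' \<noteq> A" using ne P by auto
    then obtain u where u: "u \<in> A" "u \<notin> X'" using YX(2) by auto
    then have uX: "u \<in> X" "u < N" "N + u \<notin> Y" using A_X X_less by (auto simp: A_def)
    have nh: "u \<notin> hub Y" "N + u \<notin> hub Y" using uX Y_less[of u] by (auto simp: hub_def)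
    have lt: "v < N" if "v \<in> X'" for v using that YX(2) A_X X_less by auto
    have P1: "{u} \<in> P"
      unfolding P True by (rule single_in_part) (use uX u x0 nh in auto)
    have P2: "{N + u} \<in> P"
      unfolding P True by (rule single_in_part) (use uX u x0 nh lt in force)+
    note mx = max_ge_adjacent[OF st P1 P2 _ _ _ edge_pair[OF uX(1)]]
    have mx': "({u}, {N + u}) \<in> adjacent_pairs G P" "real W \<le> similarity G {u} {N + u}" "real W \<le> max_similarity G P"
      using mx uX by auto
    have W2': "2 < real W" using W_bounds(1) lam by linarith
    have nb: "\<not> all_below G 2 P"
      using mx'(1,2) W2' by (fastforce simp: all_below_def)
    have "stage P'" if ms: "merge_step G lam P P'"
    proof -
      obtain R S where RS: "R \<in> P" "S \<in> P" "R \<noteq> S" "similarity G R S \<ge> max_similarity G P / lam"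
        "P' = insert (R \<union> S) (P - {R, S})"
        using ms by (auto simp: merge_step_def adjacent_pairs_def)
      \<comment> \<open>An admissible merge has similarity at least \<open>W / lam\<close>. Light
        pairs stay at 2 and diluted ones at \<open>W / card (hub Y)\<close>, both below it.\<close>
      have "real W / lam \<le> max_similarity G P / lam" using mx'(3) l0 by (intro divide_right_mono) auto
      then have big: "real W / lam \<le> similarity G R S" using RS(4) by linarith
      have RS': "R \<in> part Y' X'" "S \<in> part Y' X'" using RS P by auto
      show ?thesis
      proof (rule adjacent_cases[OF YX(1,2) RS' RS(3)])
        fix y assume "y \<in> Y" "y \<notin> Y'"
        then show ?thesis using True by simp
      next
        fix v assume v: "v \<in> X" "v \<notin> X'" "N + v \<notin> Y'" "{R, S} = {{v}, {N + v}}"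
        then have "v \<in> A" using True by (simp add: A_def)
        have "R \<union> S = {v} \<union> {N + v}" using v(4) by (auto simp: doubleton_eq_iff)
        then have "P' = part Y (insert v X')"
          using merge_pair[OF YX(2) \<open>v \<in> A\<close> v(2)] RS(5) v(4) P True by simp
        then show ?thesis using \<open>v \<in> A\<close> YX stageI[of Y "insert v X'"] by simp
      next
        fix v assume v: "v \<in> X" "N + v \<in> Y'" and le: "similarity G R S \<le> real W / real (card (hub Y'))"
        have "card (hub Y') = Suc (card Y)"
          unfolding hub_def True using finite_Y Y_less by (subst card_insert_disjoint) auto
        then have "lam < real (card (hub Y'))" using blob[OF v(1)] v(2) True lam by simp
        then have "real W / real (card (hub Y')) < real W / lam"
          using l0 W2' by (intro divide_strict_left_mono) auto
        then show ?thesis using big le by linarith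
      next
        assume "similarity G R S \<le> 2"
        moreover have "2 < real W / lam" using W_bounds(1) l0 by (simp add: pos_less_divide_eq)
        ultimately show ?thesis using big by linarith
      qed
    qed
    then show ?thesis using nb by blast
  qed
  qed
  then show "\<not> all_below G 2 P" "merge_step G lam P P' \<Longrightarrow> stage P'" by blast+
qed

lemma all_below_final:
  "all_below G 2 (part Y A) \<longleftrightarrow> \<not> (\<exists>u v. {u, v} \<in> HE \<and> u \<notin> A \<and> v \<notin> A)"
proof
  assume ab: "all_below G 2 (part Y A)"
  show "\<not> (\<exists>u v. {u, v} \<in> HE \<and> u \<notin> A \<and> v \<notin> A)"
  proof
    assume "\<exists>u v. {u, v} \<in> HE \<and> u \<notin> A \<and> v \<notin> A"
    then obtain u v where uv: "{u, v} \<in> HE" "u \<notin> A" "v \<notin> A" by blast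
    then have l: "u < N" "v < N" "u \<noteq> v" using HE[OF uv(1)] by (auto simp: doubleton_eq_iff)
    have P1: "{u} \<in> part Y A" "{v} \<in> part Y A"
      using uv l x0 Y_less unfolding part_def hub_def by (auto, force+)
    have "stage (part Y A)" by (auto simp: stage_def)
    note mx = max_ge_adjacent[OF this P1 _ _ _ edge_inp[OF uv(1)]]
    show False using mx(1,2) l ab by (fastforce simp: all_below_def)
  qed
next
  assume none: "\<not> (\<exists>u v. {u, v} \<in> HE \<and> u \<notin> A \<and> v \<notin> A)"
  show "all_below G 2 (part Y A)"
    unfolding all_below_def
  proof (safe)
    fix R S assume "(R, S) \<in> adjacent_pairs G (part Y A)"
    then have RS: "R \<in> part Y A" "S \<in> part Y A" "R \<noteq> S" by (auto simp: adjacent_pairs_def)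
    show "similarity G R S < 2"
    proof (rule adjacent_cases[OF subset_refl subset_refl RS])
      fix u assume u: "u \<in> X" "N + u \<in> Y" and le: "similarity G R S \<le> real W / real (card (hub Y))"
      have "card (hub Y) = Suc (card Y)"
        unfolding hub_def using finite_Y Y_less by (subst card_insert_disjoint) auto
      then have "real (lb + 1) \<le> real (card (hub Y))" using blob[OF u] by simp
      then have "real W / real (card (hub Y)) \<le> real W / real (lb + 1)"
        by (intro divide_left_mono) auto
      also have "\<dots> < 2" using W_bounds(4) by (simp add: pos_divide_less_eq)
      finally show ?thesis using le by simp
    next
      assume "similarity G R S \<le> 2" "similarity G R S = 2 \<Longrightarrow> \<exists>u v. {u, v} \<in> HE \<and> u \<notin> A \<and> v \<notin> A"
      then show ?thesis using none by (cases "similarity G R S = 2") auto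
    qed (auto simp: A_def)
  qed
qed

text \<open>Each element of \<open>Y\<close> and of \<open>A\<close> accounts for one merge, and a
  merge removes one cluster. The additive form avoids truncated subtraction.\<close>

lemma card_final: "card (part Y A) + card Y + card A = n"
proof -
  have fA: "finite A" using finite_X A_X by (rule finite_subset[rotated])
  have ah: "card (hub Y) = Suc (card Y)"
    unfolding hub_def using finite_Y Y_less by (subst card_insert_disjoint) auto
  have Al: "u < N \<and> N + u \<notin> Y \<and> N + u \<noteq> 2 * N \<and> u \<notin> Y" if "u \<in> A" for u
    using that A_X X_less Y_less by (force simp: A_def)
  let ?D = "hub Y \<union> A \<union> (+) N ` A"
  have sub: "?D \<subseteq> {..<n}" using Y_less x0 Al by (fastforce simp: hub_def)
  have cD: "card ?D = Suc (card Y) + card A + card A"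
  proof -
    have "card ?D = card (hub Y \<union> A) + card ((+) N ` A)"
      using fA finite_Y by (intro card_Un_disjoint) (auto simp: hub_def dest: Al)
    also have "card (hub Y \<union> A) = card (hub Y) + card A"
      using fA finite_Y by (intro card_Un_disjoint) (auto simp: hub_def dest: Al)
    also have "card ((+) N ` A) = card A" by (intro card_image) auto
    finally show ?thesis using ah by simp
  qed
  have fin: "finite ?D" using sub by (rule finite_subset) simp
  have sing: "card ((\<lambda>x. {x}) ` ({..<n} - ?D)) = n - card ?D"
    using card_Diff_subset[OF fin sub] by (simp add: card_image)
  have le: "card ?D \<le> n" using card_mono[OF _ sub] by simp
  have pairs: "card ((\<lambda>u. {u, N + u}) ` A) = card A"
    using Al by (intro card_image inj_onI) (auto simp: doubleton_eq_iff)
  have ds: "(\<lambda>u. {u, N + u}) ` A \<inter> (\<lambda>x. {x}) ` ({..<n} - ?D) = {}"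
    by auto
  have hn: "hub Y \<notin> (\<lambda>u. {u, N + u}) ` A \<union> (\<lambda>x. {x}) ` ({..<n} - ?D)"
  proof
    assume "hub Y \<in> (\<lambda>u. {u, N + u}) ` A \<union> (\<lambda>x. {x}) ` ({..<n} - ?D)"
    then consider u where "u \<in> A" "hub Y = {u, N + u}" | x where "x \<notin> hub Y" "hub Y = {x}" by auto
    then show False
    proof cases
      case 1
      have "2 * N \<in> hub Y" by (simp add: hub_def)
      then have "2 * N \<in> {u, N + u}" unfolding 1(2) .
      then show False using Al[OF 1(1)] by auto
    qed auto
  qed
  have "part Y A = insert (hub Y) ((\<lambda>u. {u, N + u}) ` A \<union> (\<lambda>x. {x}) ` ({..<n} - ?D))"
    by (simp add: part_def Diff_eq Int_assoc)
  then have "card (part Y A) = Suc (card A + (n - card ?D))"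
    using hn ds fA fin pairs sing by (simp add: card_Un_disjoint)
  then show ?thesis using cD le by simp
qed

text \<open>Every agglomeration passes through \<open>part Y A\<close>. It halts there if no input
  edge joins two unblocked vertices; otherwise it goes on and ends with strictly fewer clusters. How
  many fewer depends on the choices made, so only the comparison is informative.\<close>

lemma cluster_count_gadget:
  assumes "cluster_count n G lam 2 k"
  shows "k = n - card Y - card A \<longleftrightarrow> \<not> (\<exists>u v. {u, v} \<in> HE \<and> u \<notin> A \<and> v \<notin> A)"
proof -
  let ?R = "\<lambda>P P'. \<not> all_below G 2 P \<and> merge_step G lam P P'"
  let ?F = "part Y A"
  obtain P where P: "?R\<^sup>*\<^sup>* (singletons n) P" "all_below G 2 P" "card P = k"
    using assms by (auto simp: cluster_count_def)
  \<comment> \<open>A run is either still on its way to \<open>?F\<close> or has passed it. An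
    earlier stage cannot be its end, since some similarity is still at least 2 there.\<close>
  have "stage P \<or> ?R\<^sup>*\<^sup>* ?F P"
    using P(1)
  proof (induction rule: rtranclp_induct)
    case base
    show ?case unfolding singletons_part by (auto simp: stage_def)
  next
    case (step P P')
    then show ?case
      using stage_step(2)[of P P'] by (cases "P = ?F") (auto intro: rtranclp.rtrancl_into_rtrancl)
  qed
  then have R: "?R\<^sup>*\<^sup>* ?F P"
    using stage_step(1)[of P] P(2) by (cases "P = ?F") auto
  have fin: "finite ?F" by (rule finite_part) auto
  have card: "finite Q \<and> (Q = ?F \<or> \<not> all_below G 2 ?F \<and> card Q < card ?F)" if "?R\<^sup>*\<^sup>* ?F Q" for Q
    using that
  proof (induction rule: rtranclp_induct)
    case base
    then show ?case using fin by simp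
  next
    case (step Q Q')
    then show ?case using merge_step_card[of Q G lam Q'] by auto
  qed
  have n: "card ?F = n - card Y - card A" using card_final by simp
  show ?thesis
  proof (cases "all_below G 2 ?F")
    case True
    then show ?thesis using card[OF R] P(3) n all_below_final by simp
  next
    case False
    then have "P \<noteq> ?F" using P(2) by auto
    then show ?thesis using card[OF R] P(3) n all_below_final False by auto
  qed
qed

end

section \<open>Program fragments\<close>

primrec reads :: "expr \<Rightarrow> nat set" where
  "reads (Const k) = {}"
| "reads (Read a e) = insert a (reads e)"
| "reads (Bop f e1 e2) = reads e1 \<union> reads e2"

lemma ev_cong: "(\<And>a. a \<in> reads e \<Longrightarrow> s' a = s a) \<Longrightarrow> ev s' e = ev s e"
  by (induction e) auto

primrec pow_expr :: "expr \<Rightarrow> nat \<Rightarrow> expr" where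
  "pow_expr e 0 = Const 1"
| "pow_expr e (Suc q) = Bop Mul e (pow_expr e q)"

lemma ev_pow_expr [simp]: "ev s (pow_expr e q) = ev s e ^ q"
  by (induction q) simp_all

lemma depth_pow_expr: "depth (pow_expr e q) \<le> q + depth e"
  by (induction q) auto

lemma cost_pow_expr: "cost (pow_expr e q) = q * (1 + cost e) + 1"
  by (induction q) simp_all

lemma arith_pow_expr: "1 < V \<Longrightarrow> arith V e \<Longrightarrow> arith V (pow_expr e q)"
  by (induction q) simp_all

text \<open>The ceiling of the real power \<open>m powr (p / q)\<close>, expressed by integer powers
  so that a program can search for it.\<close>

definition ceil_root :: "nat \<Rightarrow> nat \<Rightarrow> nat \<Rightarrow> nat" where
  "ceil_root p q m = (LEAST d. m ^ p \<le> d ^ q)"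

lemma ceil_root:
  assumes "1 \<le> q"
  shows "m ^ p \<le> ceil_root p q m ^ q" "d < ceil_root p q m \<Longrightarrow> d ^ q < m ^ p" "ceil_root p q m \<le> m ^ p"
proof -
  have ex: "m ^ p \<le> (m ^ p) ^ q"
    using assms self_le_power[of "m ^ p" q] by (cases "m ^ p = 0") (simp_all add: power_0_left)
  show "m ^ p \<le> ceil_root p q m ^ q"
    unfolding ceil_root_def using ex by (rule LeastI)
  show "ceil_root p q m \<le> m ^ p"
    unfolding ceil_root_def using ex by (rule Least_le)
  show "d ^ q < m ^ p" if "d < ceil_root p q m"
    using not_less_Least[OF that[unfolded ceil_root_def]] by simp
qed

text \<open>Linear search is affordable: the time is proportional to the result, and the roots
  needed are \<Delta>, \<open>lb\<close> and \<open>P\<close>.\<close>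

definition root_com :: "nat \<Rightarrow> nat \<Rightarrow> nat \<Rightarrow> com" where
  "root_com p q r = Seq (Write r (Const 0) (Const 0))
     (While (Bop Less (pow_expr (reg r) q) (pow_expr (Read 0 (Const 1)) p))
       (Write r (Const 0) (Bop Add (reg r) (Const 1))))"

text \<open>The list sits at the even indices and the rest of the array is 0. For
  \<open>A = 40\<close>, which is \<open>val 0\<close>, it is then the base part of the simulated
  array 0, so the input of the algorithm is built in place.\<close>

definition is_list :: "nat \<Rightarrow> nat \<Rightarrow> mem \<Rightarrow> nat list \<Rightarrow> bool" where
  "is_list A r s xs \<longleftrightarrow> s r 0 = length xs \<and>
     s A = (\<lambda>i. if even i \<and> i div 2 < length xs then xs ! (i div 2) else 0)"

definition push :: "nat \<Rightarrow> nat \<Rightarrow> expr \<Rightarrow> com" where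
  "push A r e = Seq (Write A (Bop Mul (Const 2) (reg r)) e) (Write r (Const 0) (Bop Add (reg r) (Const 1)))"

primrec pushes :: "nat \<Rightarrow> nat \<Rightarrow> expr list \<Rightarrow> com" where
  "pushes A r [] = Skip"
| "pushes A r (e # es) = Seq (push A r e) (pushes A r es)"

lemma mods_push [simp]: "mods (push A r e) = {A, r}"
  by (auto simp: push_def)

lemma mods_pushes: "mods (pushes A r es) \<subseteq> {A, r}"
  by (induction es) auto

lemma mods_pushes_Cons [simp]: "es \<noteq> [] \<Longrightarrow> mods (pushes A r es) = {A, r}"
  by (cases es, simp, insert mods_pushes, simp, blast)

context det_ctx
begin

lemma const_less [simp]: "(numeral k :: nat) \<le> 1000 \<Longrightarrow> numeral k < V" "0 < V" "Suc 0 < V"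
  by (rule order.strict_trans1[OF _ V], assumption) (use V in simp_all)

lemma small_shallow [simp]: "arith V e \<Longrightarrow> depth e \<le> 20 \<Longrightarrow> small e"
  using z by (simp add: small_def)

lemma ok_root:
  assumes s: "bnd s" and m: "s 0 1 = m" and q: "1 \<le> q" "q < z" "p < z" and r: "r \<noteq> 0"
    and d: "ceil_root p q m < V"
  shows "ok (root_com p q r) s (\<lambda>s'. s' r 0 = ceil_root p q m) ((ceil_root p q m + 1) * (20 + 3 * p + 3 * q))"
proof -
  let ?d = "ceil_root p q m"
  let ?e = "Bop Less (pow_expr (reg r) q) (pow_expr (Read 0 (Const 1)) p)"
  have "depth ?e \<le> z"
    using q depth_pow_expr[of "reg r" q] depth_pow_expr[of "Read 0 (Const 1)" p] by simp
  then have sm: "small ?e"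
    using V by (simp add: small_def arith_pow_expr)
  show ?thesis
    unfolding root_com_def
  proof (rule ok_Seq[where ?t1.0 = 3])
    show "ok (Write r (Const 0) (Const 0)) s (\<lambda>s. s r 0 = 0) 3"
      by (rule ok_Write) (use s in \<open>auto simp: store_store\<close>)
    fix s1 assume s1: "bnd s1" "\<And>a. a \<notin> mods (Write r (Const 0) (Const 0)) \<Longrightarrow> s1 a = s a" "s1 r 0 = 0"
    show "ok (While ?e (Write r (Const 0) (Bop Add (reg r) (Const 1)))) s1 (\<lambda>s. s r 0 = ?d)
       ((\<Sum>i<?d. 6) + (?d + 1) * (1 + cost ?e))"
    proof (rule ok_While[where I = "\<lambda>i s. s r 0 = i"])
      fix i s' assume i: "i < ?d" "s' r 0 = i" "bnd s'"
        and fr: "\<And>a. a \<notin> mods (Write r (Const 0) (Bop Add (reg r) (Const 1))) \<Longrightarrow> s' a = s1 a"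
      have "s' 0 1 = m" using fr[of 0] s1(2)[of 0] r m by simp
      then show "ev s' ?e \<noteq> 0 \<and> ok (Write r (Const 0) (Bop Add (reg r) (Const 1))) s' (\<lambda>s. s r 0 = Suc i) 6"
        using i ceil_root(2)[OF q(1) i(1)] d by (auto simp: store_store intro!: ok_Write)
    next
      fix s' assume i: "s' r 0 = ?d" 
        and fr: "\<And>a. a \<notin> mods (Write r (Const 0) (Bop Add (reg r) (Const 1))) \<Longrightarrow> s' a = s1 a"
      have "s' 0 1 = m" using fr[of 0] s1(2)[of 0] r m by simp
      then show "ev s' ?e = 0" using i ceil_root(1)[OF q(1), of m p] by simp
    qed (use s1 sm in auto)
  next
    show "3 + ((\<Sum>i<?d. 6) + (?d + 1) * (1 + cost ?e)) \<le> (?d + 1) * (20 + 3 * p + 3 * q)"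
      by (simp add: cost_pow_expr algebra_simps)
  qed
qed

lemma ok_push:
  assumes s: "bnd s" and xs: "is_list A r s xs" and e: "small e" "ev s e < V" and len: "length xs + 1 < V" and Ar: "A \<noteq> r"
  shows "ok (push A r e) s (\<lambda>s'. is_list A r s' (xs @ [ev s e])) (cost e + 11)"
  unfolding push_def
proof (rule ok_Seq[where ?t1.0 = "cost e + 5" and ?t2.0 = 6])
  let ?Q = "\<lambda>s'. s' A = (s A)(2 * length xs := ev s e) \<and> s' r = s r"
  show "ok (Write A (Bop Mul (Const 2) (reg r)) e) s ?Q (cost e + 5)"
    by (rule ok_Write) (use s xs e Ar in \<open>auto simp: store_store is_list_def\<close>)
  fix s1 assume s1: "bnd s1" "?Q s1"
  have "s1 r 0 = length xs" using s1 xs by (simp add: is_list_def)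
  then show "ok (Write r (Const 0) (Bop Add (reg r) (Const 1))) s1 (\<lambda>s'. is_list A r s' (xs @ [ev s e])) 6"
    by (intro ok_Write)
      (use s1 xs Ar len in \<open>auto simp: store_store is_list_def fun_eq_iff nth_append less_Suc_eq\<close>)
qed simp

lemma ok_pushes:
  assumes "bnd s" "is_list A r s xs" "\<And>e. e \<in> set es \<Longrightarrow> small e \<and> ev s e < V \<and> A \<notin> reads e \<and> r \<notin> reads e"
    "length xs + length es < V" "A \<noteq> r"
  shows "ok (pushes A r es) s (\<lambda>s'. is_list A r s' (xs @ map (ev s) es)) (sum_list (map cost es) + 11 * length es + 1)"
  using assms
proof (induction es arbitrary: s xs)
  case Nil
  then show ?case by (auto intro!: ok_Skip)
next
  case (Cons e es)
  have "ok (Seq (push A r e) (pushes A r es)) s (\<lambda>s'. is_list A r s' ((xs @ [ev s e]) @ map (ev s) es))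
    (sum_list (map cost (e # es)) + 11 * length (e # es) + 1)"
  proof (rule ok_Seq[where ?t1.0 = "cost e + 11"])
    show "ok (push A r e) s (\<lambda>s'. is_list A r s' (xs @ [ev s e])) (cost e + 11)"
      using Cons.prems by (intro ok_push) auto
    fix s1 assume s1: "bnd s1" "\<And>a. a \<notin> mods (push A r e) \<Longrightarrow> s1 a = s a" "is_list A r s1 (xs @ [ev s e])"
    have ev1: "ev s1 e' = ev s e'" if "e' \<in> set es" for e'
      by (rule ev_cong, rule s1(2)) (use Cons.prems(3)[of e'] that in auto)
    have "ok (pushes A r es) s1 (\<lambda>s'. is_list A r s' ((xs @ [ev s e]) @ map (ev s1) es)) (sum_list (map cost es) + 11 * length es + 1)"
      using s1 Cons.prems ev1 by (intro Cons.IH) auto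
    moreover have "map (ev s1) es = map (ev s) es" using ev1 by simp
    ultimately show "ok (pushes A r es) s1 (\<lambda>s'. is_list A r s' ((xs @ [ev s e]) @ map (ev s) es)) (sum_list (map cost es) + 11 * length es + 1)"
      by simp
  qed simp
  then show ?case by simp
qed

text \<open>The length hypothesis handed to the body bounds the output so far by its final length,
  so overflow is checked once for the whole list.\<close>

lemma ok_emit_For:
  assumes s: "bnd s" "is_list A r s xs" and e: "small e" "depth e < z" "ev s e = n" "n < V"
    and re: "j \<notin> reads e" "mods c \<inter> reads e = {}" and j: "j \<notin> mods c" "j \<noteq> A" "j \<noteq> r"
    and body: "\<And>i s' ys. i < n \<Longrightarrow> bnd s' \<Longrightarrow> s' j 0 = i \<Longrightarrow> (\<And>a. a \<notin> insert j (mods c) \<Longrightarrow> s' a = s a) \<Longrightarrow>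
      is_list A r s' ys \<Longrightarrow> length ys + length (g i) \<le> length xs + length (concat (map g [0..<n])) \<Longrightarrow>
      ok c s' (\<lambda>s''. is_list A r s'' (ys @ g i)) (t i)"
    and T: "(\<Sum>i<n. t i) + (n + 1) * (10 + cost e) \<le> T"
  shows "ok (For j e c) s (\<lambda>s'. is_list A r s' (xs @ concat (map g [0..<n]))) T"
proof (rule ok_For[where I = "\<lambda>i s'. is_list A r s' (xs @ concat (map g [0..<i]))", OF s(1) _ e(1,2) _ e(4) j(1) _ T])
  show "is_list A r (store j 0 0 s) (xs @ concat (map g [0..<0]))"
    using s(2) j by (simp add: is_list_def store_store)
  show "ev s' e = n" if "\<And>a. a \<notin> insert j (mods c) \<Longrightarrow> s' a = s a" for s'
    unfolding e(3)[symmetric] by (rule ev_cong, rule that) (use re in auto)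
  fix i s' assume i: "i < n" and l: "is_list A r s' (xs @ concat (map g [0..<i]))" and s': "bnd s'" "s' j 0 = i"
    "\<And>a. a \<notin> insert j (mods c) \<Longrightarrow> s' a = s a"
  have "[0..<n] = [0..<i] @ i # [Suc i..<n]" using i by (metis le0 less_imp_le_nat upt_add_eq_append upt_conv_Cons le_add_diff_inverse)
  then have len: "length (xs @ concat (map g [0..<i])) + length (g i) \<le> length xs + length (concat (map g [0..<n]))"
    by simp
  show "ok c s' (\<lambda>s''. is_list A r (store j 0 (Suc i) s'') (xs @ concat (map g [0..<Suc i]))) (t i)"
    by (rule ok_conseq[OF body[OF i s' l len]]) (use j in \<open>auto simp: is_list_def store_store\<close>)
qed

end

section \<open>The input graph\<close>

text \<open>Toggles the lowest bit. Positions \<open>2 * i\<close> and \<open>2 * i + 1\<close>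
  stand for the two orientations of edge \<open>i\<close>, so this reverses an arc.\<close>

definition flip :: "nat \<Rightarrow> nat" where "flip j = j + 1 - 2 * (j mod 2)"

locale input_graph =
  fixes n :: nat and es :: "(nat \<times> nat) list"
  assumes simple: "simple_graph n es"
begin

abbreviation m :: nat where "m \<equiv> length es"

definition tail :: "nat \<Rightarrow> nat" where
  "tail j = concat (map (\<lambda>(u, v). [u, v]) es) ! j"

definition head :: "nat \<Rightarrow> nat" where "head j = tail (flip j)"

text \<open>Cutting off after \<open>i\<close> arcs provides the invariant of the loop that fills
  the adjacency lists; at \<open>2 * m\<close> the list of neighbours is complete.\<close>

definition nbrs_upto :: "nat \<Rightarrow> nat \<Rightarrow> nat list" where
  "nbrs_upto i x = map head (filter (\<lambda>j. tail j = x) [0..<i])"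

abbreviation nbrs :: "nat \<Rightarrow> nat list" where "nbrs \<equiv> nbrs_upto (2 * m)"
abbreviation deg :: "nat \<Rightarrow> nat" where "deg x \<equiv> length (nbrs x)"

lemma nth_concat_pairs:
  "i < length xs \<Longrightarrow> concat (map (\<lambda>(u, v). [u, v]) xs) ! (2 * i) = fst (xs ! i)"
  "i < length xs \<Longrightarrow> concat (map (\<lambda>(u, v). [u, v]) xs) ! (2 * i + 1) = snd (xs ! i)"
proof (induction xs arbitrary: i)
  case (Cons x xs)
  { case 1 then show ?case using Cons.IH(1) by (cases i; cases x) auto }
  { case 2 then show ?case using Cons.IH(2) by (cases i; cases x) auto }
qed simp_all

lemma tail_even: "i < m \<Longrightarrow> tail (2 * i) = fst (es ! i)"
  and tail_odd: "i < m \<Longrightarrow> tail (2 * i + 1) = snd (es ! i)"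
  unfolding tail_def by (rule nth_concat_pairs; simp)+

lemma flip_even: "flip (2 * i) = 2 * i + 1" and flip_odd: "flip (2 * i + 1) = 2 * i"
  by (simp_all add: flip_def)

lemma arc_cases:
  assumes "j < 2 * m"
  obtains i where "i < m" "j = 2 * i" "tail j = fst (es ! i)" "head j = snd (es ! i)"
  | i where "i < m" "j = 2 * i + 1" "tail j = snd (es ! i)" "head j = fst (es ! i)"
proof (cases "even j")
  case True
  then obtain i where "j = 2 * i" by blast
  then show ?thesis using assms that(1)[of i] by (simp add: head_def tail_even tail_odd[simplified] flip_even[simplified])
next
  case False
  then obtain i where "j = 2 * i + 1" by (elim oddE)
  then show ?thesis using assms that(2)[of i] by (simp add: head_def tail_even tail_odd[simplified] flip_odd[simplified])
qed

lemma edge_props: "i < m \<Longrightarrow> fst (es ! i) < n \<and> snd (es ! i) < n \<and> fst (es ! i) \<noteq> snd (es ! i)"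
  using simple nth_mem[of i es] unfolding simple_graph_def case_prod_beta by blast

lemma edge_inj:
  assumes "i < m" "k < m" "{fst (es ! i), snd (es ! i)} = {fst (es ! k), snd (es ! k)}"
  shows "i = k"
proof -
  have "distinct (map (\<lambda>(u, v). {u, v}) es)" using simple by (simp add: simple_graph_def)
  then show ?thesis using assms by (auto simp: distinct_conv_nth case_prod_beta)
qed

lemma arc_props: "j < 2 * m \<Longrightarrow> tail j < n \<and> head j < n \<and> tail j \<noteq> head j"
proof (erule arc_cases)
  fix i assume "i < m" "tail j = fst (es ! i)" "head j = snd (es ! i)"
  then show ?thesis using edge_props[of i] by simp
next
  fix i assume "i < m" "tail j = snd (es ! i)" "head j = fst (es ! i)"
  then show ?thesis using edge_props[of i] by simp
qed

lemma arc_inj: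
  assumes "j < 2 * m" "k < 2 * m" "tail j = tail k" "head j = head k"
  shows "j = k"
  using assms(1)
proof (cases rule: arc_cases)
  case j: (1 i)
  from assms(2) show ?thesis
  proof (cases rule: arc_cases)
    case (1 i')
    then show ?thesis using j assms edge_inj[of i i'] by simp
  next
    case (2 i')
    then have "i = i'" using j assms edge_inj[of i i'] by (simp add: insert_commute)
    then show ?thesis using j 2 assms edge_props[of i] by simp
  qed
next
  case j: (2 i)
  from assms(2) show ?thesis
  proof (cases rule: arc_cases)
    case (1 i')
    then have "i = i'" using j assms edge_inj[of i i'] by (simp add: insert_commute)
    then show ?thesis using j 1 assms edge_props[of i] by simp
  next
    case (2 i')
    then show ?thesis using j assms edge_inj[of i i'] by simp
  qed
qed

lemma edge_iff_arc: "{x, y} \<in> edges_of es \<longleftrightarrow> (\<exists>j < 2 * m. tail j = x \<and> head j = y)"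
proof
  assume "{x, y} \<in> edges_of es"
  then obtain e where "e \<in> set es" "{x, y} = {fst e, snd e}" by (auto simp: edges_of_def)
  then obtain i where i: "i < m" "{x, y} = {fst (es ! i), snd (es ! i)}" by (auto simp: in_set_conv_nth)
  then consider "x = fst (es ! i)" "y = snd (es ! i)" | "x = snd (es ! i)" "y = fst (es ! i)"
    by (auto simp: doubleton_eq_iff)
  then show "\<exists>j < 2 * m. tail j = x \<and> head j = y"
  proof cases
    case 1
    then show ?thesis using i tail_even[of i] tail_odd[of i]
      by (intro exI[of _ "2 * i"]) (simp add: head_def flip_even[simplified])
  next
    case 2
    then show ?thesis using i tail_even[of i] tail_odd[of i]
      by (intro exI[of _ "2 * i + 1"]) (simp add: head_def flip_odd[simplified])
  qed
next
  assume "\<exists>j < 2 * m. tail j = x \<and> head j = y"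
  then obtain j where j: "j < 2 * m" "tail j = x" "head j = y" by blast
  from j(1) show "{x, y} \<in> edges_of es"
  proof (cases rule: arc_cases)
    case (1 i)
    then show ?thesis using j nth_mem[of i es] by (force simp: edges_of_def)
  next
    case (2 i)
    then show ?thesis using j nth_mem[of i es] by (force simp: edges_of_def insert_commute)
  qed
qed

lemma set_nbrs: "y \<in> set (nbrs x) \<longleftrightarrow> {x, y} \<in> edges_of es"
  unfolding edge_iff_arc by (auto simp: nbrs_upto_def)

lemma distinct_nbrs: "distinct (nbrs x)"
proof -
  have "inj_on head (set (filter (\<lambda>j. tail j = x) [0..<2 * m]))"
    by (rule inj_onI, rule arc_inj) simp_all
  then show ?thesis by (simp add: nbrs_upto_def distinct_map)
qed

lemma nbrs_upto_Suc: "nbrs_upto (Suc i) x = nbrs_upto i x @ (if tail i = x then [head i] else [])"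
  by (simp add: nbrs_upto_def)

lemma length_nbrs_upto: "length (nbrs_upto i x) \<le> i"
  using length_filter_le[of "\<lambda>j. tail j = x" "[0..<i]"] by (simp add: nbrs_upto_def)

lemma sum_deg:
  assumes "finite X"
  shows "(\<Sum>x\<in>X. deg x) \<le> 2 * m"
proof -
  have "(\<Sum>x\<in>X. length (nbrs_upto i x)) \<le> i" for i
  proof (induction i)
    case (Suc i)
    have "(\<Sum>x\<in>X. length (nbrs_upto (Suc i) x)) =
        (\<Sum>x\<in>X. length (nbrs_upto i x)) + (\<Sum>x\<in>X. if tail i = x then 1 else 0)"
      unfolding sum.distrib[symmetric] by (intro sum.cong) (auto simp: nbrs_upto_Suc)
    also have "(\<Sum>x\<in>X. if tail i = x then 1 else 0 :: nat) \<le> 1" using assms by simp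
    finally show ?case using Suc by simp
  qed (simp add: nbrs_upto_def)
  then show ?thesis .
qed

section \<open>Vertices of high degree and their new names\<close>

primrec high_upto :: "nat \<Rightarrow> nat \<Rightarrow> nat list" where
  "high_upto \<Delta> 0 = []"
| "high_upto \<Delta> (Suc i) = (if \<Delta> \<le> deg (tail i) \<and> tail i \<notin> set (high_upto \<Delta> i)
     then high_upto \<Delta> i @ [tail i] else high_upto \<Delta> i)"

abbreviation high :: "nat \<Rightarrow> nat list" where "high \<Delta> \<equiv> high_upto \<Delta> (2 * m)"

lemma distinct_high: "distinct (high_upto \<Delta> i)"
  by (induction i) auto

lemma set_high_upto: "set (high_upto \<Delta> i) = {x \<in> tail ` {..<i}. \<Delta> \<le> deg x}"
  by (induction i) (auto simp: lessThan_Suc)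

lemma set_high: "1 \<le> \<Delta> \<Longrightarrow> x \<in> set (high \<Delta>) \<longleftrightarrow> \<Delta> \<le> deg x"
proof -
  assume D: "1 \<le> \<Delta>"
  have "x \<in> tail ` {..<2 * m}" if "\<Delta> \<le> deg x"
  proof -
    have "nbrs x \<noteq> []" using that D by auto
    then show ?thesis by (auto simp: nbrs_upto_def filter_empty_conv)
  qed
  then show ?thesis by (auto simp: set_high_upto)
qed

lemma high_less: "x \<in> set (high \<Delta>) \<Longrightarrow> x < n"
  using arc_props by (auto simp: set_high_upto)

lemma length_high_upto: "length (high_upto \<Delta> i) \<le> i"
  by (induction i) auto

text \<open>The last bound counts arcs: each listed vertex is the tail of at least \<Delta> of the
  \<open>2 * m\<close> arcs.\<close>

lemma length_high: "length (high \<Delta>) \<le> 2 * m" "length (high \<Delta>) \<le> n" "length (high \<Delta>) * \<Delta> \<le> 2 * m"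
proof -
  show "length (high \<Delta>) \<le> 2 * m" by (rule length_high_upto)
  have "card (set (high \<Delta>)) \<le> card {..<n}"
    using high_less by (intro card_mono) auto
  then show "length (high \<Delta>) \<le> n" by (simp add: distinct_card[OF distinct_high])
  have "card (set (high \<Delta>)) * \<Delta> \<le> (\<Sum>x\<in>set (high \<Delta>). deg x)"
    using sum_bounded_below[of "set (high \<Delta>)" \<Delta> deg] by (auto simp: set_high_upto)
  then show "length (high \<Delta>) * \<Delta> \<le> 2 * m"
    using sum_deg[of "set (high \<Delta>)"] by (simp add: distinct_card[OF distinct_high])
qed

text \<open>Positions are shifted by one, so that memory filled with 0 represents the empty
  labelling.\<close>

definition label :: "nat list \<Rightarrow> nat \<Rightarrow> nat" where
  "label h x = (if x \<in> set h then Suc (LEAST k. k < length h \<and> h ! k = x) else 0)"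

lemma label_nth: "distinct h \<Longrightarrow> k < length h \<Longrightarrow> label h (h ! k) = Suc k"
  unfolding label_def by (auto intro!: Least_equality simp: nth_eq_iff_index_eq)

lemma label_snoc:
  assumes "x \<notin> set h" "distinct h"
  shows "label (h @ [x]) = (label h)(x := Suc (length h))"
proof
  fix y
  have d: "distinct (h @ [x])" using assms by simp
  show "label (h @ [x]) y = ((label h)(x := Suc (length h))) y"
  proof (cases "y \<in> set (h @ [x])")
    case True
    then obtain k where k: "k < length (h @ [x])" "y = (h @ [x]) ! k"
      unfolding in_set_conv_nth by blast
    then show ?thesis
      using label_nth[OF d k(1)] label_nth[OF assms(2), of k] assms(1)
      by (cases "k < length h") (auto simp: nth_append less_Suc_eq)
  next
    case False
    then show ?thesis by (auto simp: label_def)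
  qed
qed

lemma label_pos: "label h x \<noteq> 0 \<longleftrightarrow> x \<in> set h"
  by (simp add: label_def)

lemma label_le:
  assumes "distinct h"
  shows "label h x \<le> length h" "x \<in> set h \<Longrightarrow> h ! (label h x - 1) = x \<and> label h x - 1 < length h"
proof -
  have *: "label h x \<le> length h \<and> h ! (label h x - 1) = x \<and> label h x - 1 < length h" if x: "x \<in> set h"
  proof -
    obtain k where "k < length h" "x = h ! k" using x unfolding in_set_conv_nth by blast
    then show ?thesis using label_nth[OF assms, of k] by simp
  qed
  show "label h x \<le> length h" using * by (cases "x \<in> set h") (simp_all add: label_def)
  show "x \<in> set h \<Longrightarrow> h ! (label h x - 1) = x \<and> label h x - 1 < length h" using * by simp
qed

end

section \<open>The reduction as a program\<close>

text \<open>The ways to keep the neighbours of \<open>v\<close> single. \<open>Dec\<close> and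
  \<open>Full\<close> delete their partner edges, and \<open>Full\<close> reinserts them afterwards.
  \<open>Quad\<close> starts without partner edges and inserts those of the non-neighbours, which
  needs \<open>n ^ 2\<close> to be of order \<open>m\<close>. \<open>Sup\<close>, also restricted to
  insertions, cannot afford this and ties the partners of the neighbours to the hub.\<close>

datatype design = Dec | Full | Quad | Sup

abbreviation plus :: "expr \<Rightarrow> expr \<Rightarrow> expr" where "plus \<equiv> Bop Add"
abbreviation times :: "expr \<Rightarrow> expr \<Rightarrow> expr" where "times \<equiv> Bop Mul"

definition vertices :: expr where "vertices = Read 0 (Const 0)"
definition edges :: expr where "edges = Read 0 (Const 1)"
definition tail_expr :: expr where "tail_expr = Read 0 (plus (Const 2) (reg 12))"
definition head_expr :: expr where
  "head_expr = Read 0 (plus (Const 2) (Bop Sub (plus (reg 12) (Const 1)) (times (Const 2) (Bop Mod (reg 12) (Const 2)))))"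
definition arcs :: expr where "arcs = times (Const 2) edges"

lemma expr_simps [simp]:
  "reads vertices = {0}" "reads edges = {0}" "reads tail_expr = {0, 12}" "reads head_expr = {0, 12}" "reads arcs = {0}"
  "depth vertices = 0" "depth edges = 0" "depth tail_expr = 1" "depth head_expr = 4" "depth arcs = 1"
  "cost vertices = 2" "cost edges = 2" "cost tail_expr = 5" "cost head_expr = 14" "cost arcs = 4"
  "1000 < V \<Longrightarrow> arith V vertices" "1000 < V \<Longrightarrow> arith V edges" "1000 < V \<Longrightarrow> arith V tail_expr"
  "1000 < V \<Longrightarrow> arith V head_expr" "1000 < V \<Longrightarrow> arith V arcs"
  by (auto simp: vertices_def edges_def tail_expr_def head_expr_def arcs_def)

lemma ev_store [simp]: "a \<notin> reads e \<Longrightarrow> ev (store a i v s) e = ev s e"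
  by (rule ev_cong) (auto simp: store_store)

text \<open>Array 14 holds degrees, array 15 neighbour lists in rows of length \<open>2 * m\<close>,
  and array 16 the adjacency matrix. The matrix is never cleared: memory starts at 0, so it costs
  O(m) time despite its \<open>n ^ 2\<close> cells.\<close>

definition adj_com :: com where
  "adj_com = For 12 arcs
     (Seq (Write 15 (plus (times tail_expr arcs) (Read 14 tail_expr)) head_expr)
     (Seq (Write 16 (plus (times tail_expr vertices) head_expr) (Const 1))
       (Write 14 tail_expr (plus (Read 14 tail_expr) (Const 1)))))"

text \<open>For an arc whose head has degree below \<Delta>, the neighbours of the head are looked
  up in the row of the tail. With constant time per lookup this takes O(m \<Delta>) in
  total.\<close>

definition brute_com :: com where
  "brute_com = For 12 arcs
     (Cond (Bop Less (Read 14 head_expr) (reg 3))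
       (For 13 (Read 14 head_expr)
         (Cond (Read 16 (plus (times tail_expr vertices) (Read 15 (plus (times head_expr arcs) (reg 13)))))
           (Write 7 (Const 0) (Const 1)) Skip))
       Skip)"

text \<open>Array 18 lists the vertices of degree at least \<Delta>, array 17 is the inverse map
  shifted by one, and register 6 counts them.\<close>

definition relabel_com :: com where
  "relabel_com = For 12 arcs
     (Cond (Bop Less (Read 14 tail_expr) (reg 3)) Skip
       (Cond (Read 17 tail_expr) Skip
         (Seq (Write 18 (reg 6) tail_expr)
         (Seq (Write 6 (Const 0) (plus (reg 6) (Const 1))) (Write 17 tail_expr (reg 6))))))"

text \<open>The condition on \<open>P\<close> makes room for \<open>m\<close> padding edges in a
  bipartite graph with \<open>P\<close> vertices on either side.\<close>

locale prog_ctx = det_ctx B V z + input_graph n es for B V z n es +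
  fixes \<Delta> lb P :: nat
  assumes big: "(n + length es + \<Delta> + lb + P + 10) ^ 6 \<le> V"
    and \<Delta>: "1 \<le> \<Delta>" and P: "length es \<le> P ^ 2"
begin

definition S :: nat where "S = n + m + \<Delta> + lb + P + 10"

text \<open>The numbers computed are at most cubic in the parameters, \<open>W2\<close> being the
  critical one. As \<open>S\<close> is at least 10, the factor 100 is absorbed by another
  \<open>S ^ 3\<close>, whence the sixth power in \<open>big\<close>.\<close>

lemma S_bound: "x \<le> 100 * S ^ 3 \<Longrightarrow> x < V"
proof -
  have S: "10 \<le> S" by (simp add: S_def)
  have "100 * S ^ 3 < 10 ^ 3 * S ^ 3" using S by simp
  also have "10 ^ 3 * S ^ 3 \<le> S ^ 3 * S ^ 3" using S by (intro mult_right_mono power_mono) auto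
  also have "\<dots> \<le> V" using big by (simp add: S_def flip: power_add)
  finally show "x \<le> 100 * S ^ 3 \<Longrightarrow> x < V" by simp
qed

lemma S_mono: "x \<le> 100 * S \<Longrightarrow> x < V"
proof (rule S_bound)
  assume "x \<le> 100 * S"
  also have "S \<le> S ^ 3" by (rule self_le_power) (auto simp: S_def)
  finally show "x \<le> 100 * S ^ 3" by simp
qed

lemma less_V: "n < V" "m < V" "2 * m < V" "\<Delta> < V" "lb < V" "P < V"
  by (rule S_mono; simp add: S_def)+

definition has_input :: "mem \<Rightarrow> bool" where
  "has_input s \<longleftrightarrow> s 0 0 = n \<and> s 0 1 = m \<and> (\<forall>j < 2 * m. s 0 (2 + j) = tail j)"

lemma has_input_ev:
  assumes "has_input s"
  shows "ev s vertices = n" "ev s edges = m" "ev s arcs = 2 * m"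
    "s 12 0 < 2 * m \<Longrightarrow> ev s tail_expr = tail (s 12 0)" "s 12 0 < 2 * m \<Longrightarrow> ev s head_expr = head (s 12 0)"
proof -
  show "ev s vertices = n" "ev s edges = m" "ev s arcs = 2 * m"
    using assms by (simp_all add: has_input_def vertices_def edges_def arcs_def)
  show "s 12 0 < 2 * m \<Longrightarrow> ev s tail_expr = tail (s 12 0)"
    using assms unfolding has_input_def tail_expr_def by (simp del: add_2_eq_Suc)
  assume lt: "s 12 0 < 2 * m"
  have "flip j < 2 * m" if "j < 2 * m" for j
    using that by (cases "even j") (auto simp: flip_def elim!: evenE oddE)
  from this[OF lt] have "s 0 (2 + flip (s 12 0)) = tail (flip (s 12 0))"
    using assms unfolding has_input_def by blast
  moreover have "ev s head_expr = s 0 (2 + flip (s 12 0))"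
    by (simp only: head_expr_def ev.simps bop_sem.simps flip_def)
  ultimately show "ev s head_expr = head (s 12 0)" by (simp add: head_def)
qed

lemma has_input_cong: "s' 0 = s 0 \<Longrightarrow> has_input s' = has_input s"
  by (simp add: has_input_def)

lemma ok_For_arcs:
  assumes s: "bnd s" "has_input s" "I 0 (store 12 0 0 s)" and c: "12 \<notin> mods c" "0 \<notin> mods c"
    and step: "\<And>i s'. i < 2 * m \<Longrightarrow> I i s' \<Longrightarrow> bnd s' \<Longrightarrow> s' 12 0 = i \<Longrightarrow>
      (\<And>a. a \<notin> insert 12 (mods c) \<Longrightarrow> s' a = s a) \<Longrightarrow>
      ok c s' (\<lambda>s''. I (Suc i) (store 12 0 (Suc i) s'')) t"
    and T: "2 * m * t + (2 * m + 1) * 14 \<le> T"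
  shows "ok (For 12 arcs c) s (I (2 * m)) T"
proof (rule ok_For[where f = "\<lambda>_. t" and I = I, OF s(1,3) _ _ _ less_V(3) c(1) step])
  show "ev s' arcs = 2 * m" if "\<And>a. a \<notin> insert 12 (mods c) \<Longrightarrow> s' a = s a" for s'
  proof -
    have "s' 0 = s 0" using that[of 0] c by simp
    then have "has_input s'" using s(2) by (simp add: has_input_def)
    then show ?thesis by (rule has_input_ev(3))
  qed
qed (use z V T in simp_all)

lemma pair_index:
  fixes b :: nat
  assumes "k < b" "l < b"
  shows "x * b + k = y * b + l \<longleftrightarrow> x = y \<and> k = l"
proof
  assume e: "x * b + k = y * b + l"
  have "(x * b + k) div b = x" "(y * b + l) div b = y" using assms by auto
  then show "x = y \<and> k = l" using e by auto
qed simp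

definition has_adj :: "nat \<Rightarrow> mem \<Rightarrow> bool" where
  "has_adj i s \<longleftrightarrow> s 14 = (\<lambda>x. length (nbrs_upto i x)) \<and>
     (\<forall>x k. k < length (nbrs_upto i x) \<longrightarrow> s 15 (x * (2 * m) + k) = nbrs_upto i x ! k) \<and>
     (\<forall>x < n. \<forall>y < n. s 16 (x * n + y) = of_bool (y \<in> set (nbrs_upto i x)))"

abbreviation adj :: "mem \<Rightarrow> bool" where "adj \<equiv> has_adj (2 * m)"

lemma has_adj_cong: "s' 14 = s 14 \<Longrightarrow> s' 15 = s 15 \<Longrightarrow> s' 16 = s 16 \<Longrightarrow> has_adj i s' = has_adj i s"
  by (simp add: has_adj_def)

lemma ok_adj:
  assumes "bnd s" "has_input s" "s 14 = (\<lambda>_. 0)" "s 16 = (\<lambda>_. 0)"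
  shows "ok adj_com s adj (200 * (m + 1))"
  unfolding adj_com_def
proof (rule ok_For_arcs[where t = 80, OF assms(1,2)])
  show "has_adj 0 (store 12 0 0 s)"
    using assms by (simp add: has_adj_def nbrs_upto_def store_store)
  fix i s' assume i: "i < 2 * m" and I: "has_adj i s'" and b: "bnd s'" and si: "s' 12 0 = i"
    and fr: "\<And>a. a \<notin> insert 12 (mods (Seq (Write 15 (plus (times tail_expr arcs) (Read 14 tail_expr)) head_expr)
       (Seq (Write 16 (plus (times tail_expr vertices) head_expr) (Const 1))
         (Write 14 tail_expr (plus (Read 14 tail_expr) (Const 1)))))) \<Longrightarrow> s' a = s a"
  have inp: "has_input s'" using has_input_cong[of s' s] fr[of 0] assms by simp
  note e = has_input_ev[OF inp]
  have te: "ev s' tail_expr = tail i" and he: "ev s' head_expr = head i" using e(4,5) si i by simp_all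
  have ti: "tail i < n" "head i < n" using arc_props[OF i] by auto
  have li: "length (nbrs_upto i x) < 2 * m" for x using length_nbrs_upto[of i x] i by simp
  let ?s = "store 12 0 (Suc i) (store 14 (tail i) (Suc (s' 14 (tail i)))
     (store 16 (tail i * n + head i) 1 (store 15 (tail i * (2 * m) + s' 14 (tail i)) (head i) s')))"
  have "has_adj (Suc i) ?s"
    unfolding has_adj_def
  proof (intro conjI allI impI)
    show "?s 14 = (\<lambda>x. length (nbrs_upto (Suc i) x))"
      using I by (auto simp: store_apply has_adj_def nbrs_upto_Suc fun_eq_iff)
    show "?s 15 (x * (2 * m) + k) = nbrs_upto (Suc i) x ! k" if "k < length (nbrs_upto (Suc i) x)" for x k
    proof -
      have "k < 2 * m" using that length_nbrs_upto[of "Suc i" x] i by simp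
      then have ix: "x * (2 * m) + k = tail i * (2 * m) + s' 14 (tail i) \<longleftrightarrow> x = tail i \<and> k = length (nbrs_upto i x)"
        using I li[of "tail i"] by (subst pair_index) (auto simp: has_adj_def)
      show ?thesis
        using that I ix unfolding has_adj_def
        by (cases "x = tail i") (auto simp: store_apply nbrs_upto_Suc nth_append less_Suc_eq split: if_splits)
    qed
    show "?s 16 (x * n + y) = of_bool (y \<in> set (nbrs_upto (Suc i) x))" if "x < n" "y < n" for x y
      using that I pair_index[of y n "head i" x "tail i"] ti
      by (auto simp: store_apply has_adj_def nbrs_upto_Suc)
  qed
  moreover have "s' 14 (tail i) < 2 * m" using I li by (simp add: has_adj_def)
  ultimately show "ok (Seq (Write 15 (plus (times tail_expr arcs) (Read 14 tail_expr)) head_expr)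
       (Seq (Write 16 (plus (times tail_expr vertices) head_expr) (Const 1))
         (Write 14 tail_expr (plus (Read 14 tail_expr) (Const 1))))) s' (\<lambda>s''. has_adj (Suc i) (store 12 0 (Suc i) s'')) 80"
    using ti less_V V by (intro ok_wp b) (simp_all add: te he e store_store)
qed simp_all

definition low_triangle :: "nat \<Rightarrow> bool" where
  "low_triangle i \<longleftrightarrow> (\<exists>j < i. deg (head j) < \<Delta> \<and> (\<exists>w \<in> set (nbrs (head j)). w \<in> set (nbrs (tail j))))"

lemma nbrs_less: "y \<in> set (nbrs x) \<Longrightarrow> x < n \<and> y < n \<and> x \<noteq> y"
proof -
  assume "y \<in> set (nbrs x)"
  then obtain j where "j < 2 * m" "tail j = x" "head j = y" by (auto simp: nbrs_upto_def)
  then show ?thesis using arc_props[of j] by simp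
qed

lemma ok_brute:
  assumes "bnd s" "has_input s" "adj s" "s 3 0 = \<Delta>" "s 7 0 = 0"
  shows "ok brute_com s (\<lambda>s'. s' 7 0 = of_bool (low_triangle (2 * m))) (200 * (m + 1) * (\<Delta> + 1))"
  unfolding brute_com_def
proof (rule ok_For_arcs[where t = "85 * (\<Delta> + 1)" and I = "\<lambda>i s. s 7 0 = of_bool (low_triangle i)", OF assms(1,2)])
  let ?c = "Cond (Read 16 (plus (times tail_expr vertices) (Read 15 (plus (times head_expr arcs) (reg 13)))))
           (Write 7 (Const 0) (Const 1)) Skip"
  fix i s' assume i: "i < 2 * m" and I: "s' 7 0 = of_bool (low_triangle i)" and b: "bnd s'" and si: "s' 12 0 = i"
    and fr: "\<And>a. a \<notin> insert 12 (mods (Cond (Bop Less (Read 14 head_expr) (reg 3)) (For 13 (Read 14 head_expr) ?c) Skip)) \<Longrightarrow> s' a = s a"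
  have inp: "has_input s'" using has_input_cong[of s' s] fr[of 0] assms by simp
  have ad: "adj s'" using has_adj_cong[of s' s] fr assms by simp
  note e = has_input_ev[OF inp]
  have te: "ev s' tail_expr = tail i" and he: "ev s' head_expr = head i" using e(4,5) si i by simp_all
  have ti: "tail i < n" "head i < n" using arc_props[OF i] by auto
  have d: "s' 14 (head i) = deg (head i)" and s3: "s' 3 0 = \<Delta>"
    using ad fr[of 3] assms by (simp_all add: has_adj_def)
  show "ok (Cond (Bop Less (Read 14 head_expr) (reg 3)) (For 13 (Read 14 head_expr) ?c) Skip) s'
     (\<lambda>s''. store 12 0 (Suc i) s'' 7 0 = of_bool (low_triangle (Suc i))) (85 * (\<Delta> + 1))"
  proof (rule ok_Cond[OF b, where ?t1.0 = "\<Delta> * 50 + (\<Delta> + 1) * 25"])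
    assume "ev s' (Bop Less (Read 14 head_expr) (reg 3)) \<noteq> 0"
    then have low: "deg (head i) < \<Delta>" using he d s3 by (simp split: if_splits)
    let ?Q = "\<lambda>k. low_triangle i \<or> (\<exists>l<k. nbrs (head i) ! l \<in> set (nbrs (tail i)))"
    have "ok (For 13 (Read 14 head_expr) ?c) s' (\<lambda>s''. s'' 7 0 = of_bool (?Q (deg (head i)))) (\<Delta> * 50 + (\<Delta> + 1) * 25)"
    proof (rule ok_For[where f = "\<lambda>_. 50" and I = "\<lambda>k s''. s'' 7 0 = of_bool (?Q k)", OF b])
      show "store 13 0 0 s' 7 0 = of_bool (?Q 0)" using I by (simp add: store_store)
      show "ev s'' (Read 14 head_expr) = deg (head i)"
        if "\<And>a. a \<notin> insert 13 (mods ?c) \<Longrightarrow> s'' a = s' a" for s''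
      proof -
        have "ev s'' (Read 14 head_expr) = ev s' (Read 14 head_expr)"
          by (rule ev_cong, rule that) auto
        then show ?thesis using he d by simp
      qed
      fix k s'' assume k: "k < deg (head i)" and J: "s'' 7 0 = of_bool (?Q k)" and b2: "bnd s''" "s'' 13 0 = k"
        and fr2: "\<And>a. a \<notin> insert 13 (mods ?c) \<Longrightarrow> s'' a = s' a"
      have inp2: "has_input s''" using has_input_cong[of s'' s'] fr2[of 0] inp by simp
      have ad2: "adj s''" using has_adj_cong[of s'' s'] fr2 ad by simp
      note e2 = has_input_ev[OF inp2]
      have te2: "ev s'' tail_expr = tail i" "ev s'' head_expr = head i"
        using e2(4,5) si i fr2[of 12] by simp_all
      have nb: "s'' 15 (head i * (2 * m) + k) = nbrs (head i) ! k"
        using ad2 k by (simp add: has_adj_def)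
      have "nbrs (head i) ! k < n" using nbrs_less k nth_mem by blast
      then have a16: "s'' 16 (tail i * n + nbrs (head i) ! k) = of_bool (nbrs (head i) ! k \<in> set (nbrs (tail i)))"
        using ad2 ti by (simp add: has_adj_def)
      have "?Q (Suc k) \<longleftrightarrow> ?Q k \<or> nbrs (head i) ! k \<in> set (nbrs (tail i))"
        by (auto simp: less_Suc_eq)
      then show "ok ?c s'' (\<lambda>s3. store 13 0 (Suc k) s3 7 0 = of_bool (?Q (Suc k))) 50"
        using J V b2(2) nb a16 by (intro ok_wp b2(1)) (simp_all add: te2 e2 store_store)
    next
      show "deg (head i) < V" using low less_V by simp
      have "deg (head i) * 50 + (deg (head i) + 1) * 25 \<le> \<Delta> * 50 + (\<Delta> + 1) * 25"
        using low by (intro add_mono mult_right_mono) auto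
      then show "(\<Sum>k<deg (head i). 50) + (deg (head i) + 1) * (10 + cost (Read 14 head_expr)) \<le> \<Delta> * 50 + (\<Delta> + 1) * 25"
        by simp
    qed (use V z in simp_all)
    then show "ok (For 13 (Read 14 head_expr) ?c) s' (\<lambda>s''. store 12 0 (Suc i) s'' 7 0 = of_bool (low_triangle (Suc i))) (\<Delta> * 50 + (\<Delta> + 1) * 25)"
    proof (rule ok_conseq)
      fix s'' :: mem assume "s'' 7 0 = of_bool (?Q (deg (head i)))"
      moreover have "?Q (deg (head i)) = low_triangle (Suc i)"
        using low unfolding low_triangle_def by (auto simp: less_Suc_eq in_set_conv_nth Bex_def)
      ultimately show "store 12 0 (Suc i) s'' 7 0 = of_bool (low_triangle (Suc i))"
        by (simp add: store_store)
    qed simp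
  next
    assume "ev s' (Bop Less (Read 14 head_expr) (reg 3)) = 0"
    then have "\<not> deg (head i) < \<Delta>" using he d s3 by (simp split: if_splits)
    then have "low_triangle (Suc i) = low_triangle i" by (auto simp: low_triangle_def less_Suc_eq)
    then show "ok Skip s' (\<lambda>s''. store 12 0 (Suc i) s'' 7 0 = of_bool (low_triangle (Suc i))) (\<Delta> * 50 + (\<Delta> + 1) * 25)"
      using I b by (intro ok_Skip) (simp_all add: store_store)
  qed (use V in simp_all)
next
  have "(2 * m + 1) * 14 \<le> 28 * (m + 1) * (\<Delta> + 1)" by (simp add: algebra_simps)
  then show "2 * m * (85 * (\<Delta> + 1)) + (2 * m + 1) * 14 \<le> 200 * (m + 1) * (\<Delta> + 1)"
    by (simp add: algebra_simps)
  show "store 12 0 0 s 7 0 = of_bool (low_triangle 0)"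
    using assms by (simp add: low_triangle_def store_store)
qed simp_all

definition has_high :: "nat \<Rightarrow> mem \<Rightarrow> bool" where
  "has_high i s \<longleftrightarrow> s 6 0 = length (high_upto \<Delta> i) \<and>
     (\<forall>k < length (high_upto \<Delta> i). s 18 k = high_upto \<Delta> i ! k) \<and> s 17 = label (high_upto \<Delta> i)"

lemma ok_relabel:
  assumes "bnd s" "has_input s" "adj s" "s 3 0 = \<Delta>" "s 6 0 = 0" "s 17 = (\<lambda>_. 0)"
  shows "ok relabel_com s (has_high (2 * m)) (200 * (m + 1))"
  unfolding relabel_com_def
proof (rule ok_For_arcs[where t = 60, OF assms(1,2)])
  let ?c = "Cond (Bop Less (Read 14 tail_expr) (reg 3)) Skip
       (Cond (Read 17 tail_expr) Skip
         (Seq (Write 18 (reg 6) tail_expr)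
         (Seq (Write 6 (Const 0) (plus (reg 6) (Const 1))) (Write 17 tail_expr (reg 6)))))"
  show "has_high 0 (store 12 0 0 s)"
    using assms by (simp add: has_high_def store_store label_def fun_eq_iff)
  fix i s' assume i: "i < 2 * m" and I: "has_high i s'" and b: "bnd s'" and si: "s' 12 0 = i"
    and fr: "\<And>a. a \<notin> insert 12 (mods ?c) \<Longrightarrow> s' a = s a"
  have inp: "has_input s'" using has_input_cong[of s' s] fr[of 0] assms by simp
  have ad: "adj s'" using has_adj_cong[of s' s] fr assms by simp
  have te: "ev s' tail_expr = tail i" using has_input_ev(4)[OF inp] si i by simp
  have ti: "tail i < n" using arc_props[OF i] by auto
  have d: "s' 14 (tail i) = deg (tail i)" and s3: "s' 3 0 = \<Delta>"
    using ad fr[of 3] assms by (simp_all add: has_adj_def)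
  have l: "length (high_upto \<Delta> i) < 2 * m" using length_high_upto[of \<Delta> i] i by simp
  have lb: "s' 17 (tail i) \<noteq> 0 \<longleftrightarrow> tail i \<in> set (high_upto \<Delta> i)" and s6: "s' 6 0 = length (high_upto \<Delta> i)"
    using I label_pos by (auto simp: has_high_def)
  have nxt: "has_high (Suc i) (store 12 0 (Suc i) (store 17 (tail i) (Suc (length (high_upto \<Delta> i)))
      (store 6 0 (Suc (length (high_upto \<Delta> i))) (store 18 (length (high_upto \<Delta> i)) (tail i) s'))))"
    if "\<Delta> \<le> deg (tail i)" "tail i \<notin> set (high_upto \<Delta> i)"
    using that I label_snoc[OF that(2) distinct_high]
    by (auto simp: has_high_def store_store nth_append less_Suc_eq)
  have stay: "has_high (Suc i) (store 12 0 (Suc i) s')"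
    if "\<not> (\<Delta> \<le> deg (tail i) \<and> tail i \<notin> set (high_upto \<Delta> i))"
    using that I by (auto simp: has_high_def store_store)
  show "ok ?c s' (\<lambda>s''. has_high (Suc i) (store 12 0 (Suc i) s'')) 60"
    using V less_V ti l nxt stay lb
    by (intro ok_wp b) (auto simp: te d s3 s6 store_store)
qed simp_all

end

section \<open>Emission of the instance and of the script\<close>

definition quot_rem :: "expr \<Rightarrow> expr \<Rightarrow> expr list" where
  "quot_rem a b = [plus a (Bop Div (reg 12) b), plus (plus a b) (Bop Mod (reg 12) b), Const 1]"

definition pad_base :: expr where "pad_base = plus (plus (times (Const 2) (reg 6)) (Const 1)) (reg 11)"

definition consts_com :: "design \<Rightarrow> com" where
  "consts_com d =
     Seq (Write 11 (Const 0) (if d = Sup then reg 4 else Const 0))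
     (Seq (Write 10 (Const 0) (plus pad_base (times (Const 2) (reg 5))))
     (Seq (Write 8 (Const 0) (plus (times (Const 2) (reg 4)) (Const 1)))
       (Write 9 (Const 0) (plus (times (times (reg 4) (reg 10)) (reg 8)) (Const 1)))))"

definition end_label :: "nat \<Rightarrow> expr" where
  "end_label k = Read 17 (Read 0 (plus (Const k) (times (Const 2) (reg 12))))"

text \<open>The number of edges is known only at the end. Its word is first emitted as 0 and then
  overwritten at index 2, the place of list position 1. The value follows from the length of the
  list: three header words and three words per edge.\<close>

definition input_com :: "design \<Rightarrow> com" where
  "input_com d =
     Seq (pushes 40 19 [reg 10, Const 0, reg 9])
     (Seq (For 12 edges (pushes 40 19 (quot_rem pad_base (reg 5))))
     (Seq (For 12 edges (Cond (times (end_label 2) (end_label 3))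
         (pushes 40 19 [Bop Sub (end_label 2) (Const 1), Bop Sub (end_label 3) (Const 1), Const 2]) Skip))
     (Seq (For 12 (if d = Quad then Const 0 else reg 6) (pushes 40 19 [reg 12, plus (reg 6) (reg 12), reg 8]))
     (Seq (For 12 (reg 11) (pushes 40 19 [times (Const 2) (reg 6), plus (plus (times (Const 2) (reg 6)) (Const 1)) (reg 12), reg 9]))
       (Write 40 (Const 2) (Bop Div (Bop Sub (reg 19) (Const 3)) (Const 3)))))))"

text \<open>Register \<open>24\<close> holds the label plus one of a candidate, or \<open>0\<close> if it has to be skipped.\<close>

definition cand_bound :: "design \<Rightarrow> expr" where
  "cand_bound d = (if d = Quad then reg 6 else Read 14 (Read 18 (reg 12)))"

definition cand_expr :: "design \<Rightarrow> expr" where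
  "cand_expr d = (if d = Quad
     then times (plus (reg 13) (Const 1)) (Bop Sub (Const 1) (Read 16 (plus (times (Read 18 (reg 12)) vertices) (Read 18 (reg 13)))))
     else Read 17 (Read 15 (plus (times (Read 18 (reg 12)) arcs) (reg 13))))"

abbreviation cand :: expr where "cand \<equiv> Bop Sub (reg 24) (Const 1)"

definition mark_exprs :: "design \<Rightarrow> expr list" where
  "mark_exprs d = (case d of
       Sup \<Rightarrow> [Const 0, plus (reg 6) cand, times (Const 2) (reg 6), reg 9]
     | Quad \<Rightarrow> [Const 0, cand, plus (reg 6) cand, reg 8]
     | _ \<Rightarrow> [Const 1, cand, plus (reg 6) cand, Const 0])"

definition unmark_exprs :: "expr list" where
  "unmark_exprs = [Const 0, cand, plus (reg 6) cand, reg 8]"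

definition cand_loop :: "design \<Rightarrow> expr list \<Rightarrow> com" where
  "cand_loop d xs = For 13 (cand_bound d)
     (Seq (Write 24 (Const 0) (cand_expr d)) (Cond (reg 24) (pushes 20 21 xs) Skip))"

definition answer_expr :: "design \<Rightarrow> expr" where
  "answer_expr d = (case d of
       Sup \<Rightarrow> Bop Sub (Bop Sub (reg 10) (reg 11)) (reg 6)
     | Quad \<Rightarrow> Bop Sub (reg 10) (reg 25)
     | _ \<Rightarrow> Bop Sub (plus (reg 10) (reg 25)) (reg 6))"

definition phase_com :: "design \<Rightarrow> com" where
  "phase_com d =
     Seq (Write 22 (Const 0) (reg 21))
     (Seq (cand_loop d (mark_exprs d))
     (Seq (Write 25 (Const 0) (Bop Div (Bop Sub (reg 21) (reg 22)) (Const 4)))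
     (Seq (pushes 20 21 [Const 2, Const 2, Const 1, answer_expr d])
       (if d = Full then cand_loop d unmark_exprs else pushes 20 21 [Const 3, Const 0, Const 0, Const 0]))))"

definition script_com :: "design \<Rightarrow> com" where
  "script_com d = For 12 (reg 6) (phase_com d)"

definition flat3 :: "(nat \<times> nat \<times> nat) list \<Rightarrow> nat list" where
  "flat3 xs = concat (map (\<lambda>(a, b, w). [a, b, w]) xs)"

lemma flat3_simps [simp]: "flat3 [] = []" "flat3 ((a, b, w) # xs) = a # b # w # flat3 xs" "flat3 (xs @ ys) = flat3 xs @ flat3 ys"
  by (simp_all add: flat3_def)

lemma flat3_concat: "flat3 (concat (map f is)) = concat (map (\<lambda>i. flat3 (f i)) is)"
  by (induction "is") simp_all

lemma flat3_map: "flat3 (map f is) = concat (map (\<lambda>i. flat3 [f i]) is)"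
  by (induction "is") (auto simp: flat3_def)

lemma length_flat3: "length (flat3 xs) = 3 * length xs"
  by (induction xs) auto

lemma length_concat_le: "(\<And>i. i < n \<Longrightarrow> length (f i) \<le> k) \<Longrightarrow> length (concat (map f [0..<n])) \<le> n * k"
  by (induction n) (auto simp: add.commute[of k] intro!: add_mono)

section \<open>The emitted lists in mathematical terms\<close>

context prog_ctx
begin

abbreviation hs :: "nat list" where "hs \<equiv> high \<Delta>"
definition N :: nat where "N = length hs"
definition L :: "design \<Rightarrow> nat" where "L d = (if d = Sup then lb else 0)"
definition x0 :: "design \<Rightarrow> nat" where "x0 d = 2 * N + 1 + L d"
definition n' :: "design \<Rightarrow> nat" where "n' d = x0 d + 2 * P"
definition W :: nat where "W = 2 * lb + 1"
definition W2 :: "design \<Rightarrow> nat" where "W2 d = lb * n' d * W + 1"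

text \<open>The first \<open>m\<close> edges of a complete bipartite graph with \<open>P\<close>
  vertices on each side. Weight 1 keeps them below the threshold, and \<open>P\<close> near the
  square root of \<open>m\<close> keeps the vertices few, as density requires.\<close>

definition pads :: "design \<Rightarrow> (nat \<times> nat \<times> nat) list" where
  "pads d = map (\<lambda>i. (x0 d + i div P, x0 d + P + i mod P, 1)) [0..<m]"

definition inner_edge :: "nat \<Rightarrow> (nat \<times> nat \<times> nat) list" where
  "inner_edge i = (if label hs (fst (es ! i)) \<noteq> 0 \<and> label hs (snd (es ! i)) \<noteq> 0
     then [(label hs (fst (es ! i)) - 1, label hs (snd (es ! i)) - 1, 2)] else [])"

definition inner :: "(nat \<times> nat \<times> nat) list" where "inner = concat (map inner_edge [0..<m])"

definition pairs :: "design \<Rightarrow> (nat \<times> nat \<times> nat) list" where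
  "pairs d = map (\<lambda>u. (u, N + u, W)) [0..<(if d = Quad then 0 else N)]"

definition leaves :: "design \<Rightarrow> (nat \<times> nat \<times> nat) list" where
  "leaves d = map (\<lambda>i. (2 * N, 2 * N + 1 + i, W2 d)) [0..<L d]"

definition input :: "design \<Rightarrow> (nat \<times> nat \<times> nat) list" where
  "input d = pads d @ inner @ pairs d @ leaves d"

definition cand_num :: "design \<Rightarrow> nat \<Rightarrow> nat" where
  "cand_num d v = (if d = Quad then N else deg (hs ! v))"

text \<open>Candidates are what has to be marked for \<open>v\<close>: its neighbours of high
  degree, or for \<open>Quad\<close> the high vertices that are not neighbours, \<open>v\<close>
  itself among them. The value 0 means that position \<open>i\<close> yields none.\<close>

definition cand_label :: "design \<Rightarrow> nat \<Rightarrow> nat \<Rightarrow> nat" where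
  "cand_label d v i = (if d = Quad then (i + 1) * (1 - of_bool (hs ! i \<in> set (nbrs (hs ! v))))
     else label hs (nbrs (hs ! v) ! i))"

definition cands :: "design \<Rightarrow> nat \<Rightarrow> nat list" where
  "cands d v = concat (map (\<lambda>i. if cand_label d v i = 0 then [] else [cand_label d v i - 1]) [0..<cand_num d v])"

definition mark :: "design \<Rightarrow> nat \<Rightarrow> item" where
  "mark d u = (case d of Sup \<Rightarrow> Ins (N + u) (2 * N) (W2 d) | Quad \<Rightarrow> Ins u (N + u) W | _ \<Rightarrow> Del u (N + u))"

text \<open>The number \<open>n' - card Y - card A\<close> of clusters when the agglomeration stops
  at the final stage, in terms of the number \<open>k\<close> of candidates. In \<open>Sup\<close> a
  mark moves one unit from \<open>A\<close> to \<open>Y\<close>, so \<open>k\<close>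
  cancels.\<close>

definition answer :: "design \<Rightarrow> nat \<Rightarrow> nat" where
  "answer d k = (case d of Sup \<Rightarrow> n' d - L d - N | Quad \<Rightarrow> n' d - k | _ \<Rightarrow> n' d + k - N)"

definition phase :: "design \<Rightarrow> (nat \<Rightarrow> bool) \<Rightarrow> nat \<Rightarrow> item list" where
  "phase d tri v = map (mark d) (cands d v) @ [Ask 2 1 (answer d (length (cands d v))) (tri v)] @
     (if d = Full then map (\<lambda>u. Ins u (N + u) W) (cands d v) else [Reset])"

definition script :: "design \<Rightarrow> (nat \<Rightarrow> bool) \<Rightarrow> item list" where
  "script d tri = concat (map (phase d tri) [0..<N])"

lemma N_bounds: "N \<le> 2 * m" "N \<le> n" "N * \<Delta> \<le> 2 * m"
  using length_high by (simp_all add: N_def)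

lemma S_ge: "10 \<le> S" "n \<le> S" "m \<le> S" "lb \<le> S" "P \<le> S" "N \<le> S"
  using N_bounds by (simp_all add: S_def)

lemma W_bound: "W \<le> 3 * S"
  using S_ge by (auto simp: W_def)

lemma const_bounds: "L d \<le> S" "x0 d \<le> 4 * S" "n' d \<le> 6 * S" "W2 d \<le> 19 * S ^ 3"
proof -
  show 1: "L d \<le> S" "x0 d \<le> 4 * S" "n' d \<le> 6 * S"
    using S_ge by (auto simp: L_def x0_def n'_def)
  have "lb * n' d * W \<le> S * (6 * S) * (3 * S)"
    using 1 S_ge W_bound by (intro mult_le_mono) auto
  then have "W2 d \<le> 18 * S ^ 3 + 1" by (simp add: W2_def power3_eq_cube)
  moreover have "1 \<le> S ^ 3" using S_ge(1) by (intro one_le_power) simp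
  ultimately show "W2 d \<le> 19 * S ^ 3" by linarith
qed

lemma const_less_V: "N < V" "W < V"
  by (rule S_mono, use S_ge W_bound in simp)+

lemma design_less_V: "L d < V" "x0 d < V" "n' d < V" "W2 d < V"
proof -
  show "L d < V" "x0 d < V" "n' d < V"
    by (rule S_mono, use const_bounds[of d] in simp)+
  show "W2 d < V" by (rule S_bound) (use const_bounds(4)[of d] in simp)
qed

definition has_consts :: "design \<Rightarrow> mem \<Rightarrow> bool" where
  "has_consts d s \<longleftrightarrow> s 4 0 = lb \<and> s 5 0 = P \<and> s 6 0 = N \<and> s 8 0 = W \<and> s 9 0 = W2 d \<and> s 10 0 = n' d \<and> s 11 0 = L d"

lemma ok_consts:
  assumes "bnd s" "s 4 0 = lb" "s 5 0 = P" "s 6 0 = N"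
  shows "ok (consts_com d) s (has_consts d) 100"
proof (rule ok_wp[OF assms(1)])
  show "small_com (consts_com d)" by (auto simp: consts_com_def pad_base_def)
  show "wp (consts_com d) (has_consts d) s"
    using const_less_V design_less_V[of d] less_V assms
    by (auto simp: consts_com_def pad_base_def store_store has_consts_def L_def x0_def n'_def W_def W2_def)
  show "time (consts_com d) \<le> 100" by (auto simp: consts_com_def pad_base_def)
qed

definition ready :: "design \<Rightarrow> mem \<Rightarrow> bool" where
  "ready d s \<longleftrightarrow> has_input s \<and> adj s \<and> has_high (2 * m) s \<and> has_consts d s"

lemma ready_cong:
  assumes "ready d s" "\<And>a. a \<in> {0, 4, 5, 6, 8, 9, 10, 11, 14, 15, 16, 17, 18} \<Longrightarrow> s' a = s a"
  shows "ready d s'"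
  using assms unfolding ready_def has_input_def has_adj_def has_high_def has_consts_def by simp

lemma readyD:
  assumes "ready d s"
  shows "s 0 0 = n" "s 0 1 = m" "s 4 0 = lb" "s 5 0 = P" "s 6 0 = N" "s 8 0 = W" "s 9 0 = W2 d" "s 10 0 = n' d" "s 11 0 = L d"
    "j < 2 * m \<Longrightarrow> s 0 (2 + j) = tail j" "s 14 = (\<lambda>x. deg x)"
    "k < deg x \<Longrightarrow> s 15 (x * (2 * m) + k) = nbrs x ! k"
    "x < n \<Longrightarrow> y < n \<Longrightarrow> s 16 (x * n + y) = of_bool (y \<in> set (nbrs x))"
    "k < N \<Longrightarrow> s 18 k = hs ! k" "s 17 = label hs"
  using assms unfolding ready_def has_input_def has_adj_def has_high_def has_consts_def N_def by auto

lemma P_pos: "0 < m \<Longrightarrow> 0 < P"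
  using P by (cases P) auto

lemma length_input: "length (input d) \<le> 2 * m + N + L d" "m \<le> length (input d)"
proof -
  have "length inner \<le> m * 1" unfolding inner_def by (intro length_concat_le) (simp add: inner_edge_def)
  then show "length (input d) \<le> 2 * m + N + L d" by (simp add: input_def pads_def pairs_def leaves_def)
  show "m \<le> length (input d)" by (simp add: input_def pads_def)
qed

text \<open>The whole array is described, zeros included, because it has to agree exactly with the
  initial memory of the simulated algorithm.\<close>

lemma ok_input:
  assumes s: "bnd s" "ready d s" "is_list 40 19 s []"
  shows "ok (input_com d) s (\<lambda>s'. s' 40 = (\<lambda>i. if even i \<and> i div 2 < 3 + 3 * length (input d)
       then ([n' d, length (input d), W2 d] @ flat3 (input d)) ! (i div 2) else 0))
     (500 * (m + N + L d + 1))"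
proof -
  define bound where "bound = 3 + 3 * (2 * m + N + L d)"
  have bV: "bound < V" using S_ge const_bounds[of d] by (intro S_mono) (simp add: bound_def)
  let ?pre = "[n' d, 0, W2 d] :: nat list"
  let ?A = "concat (map (\<lambda>i. flat3 [(x0 d + i div P, x0 d + P + i mod P, 1)]) [0..<m])"
  let ?B = "concat (map (\<lambda>i. flat3 (inner_edge i)) [0..<m])"
  let ?C = "concat (map (\<lambda>u. flat3 [(u, N + u, W)]) [0..<(if d = Quad then 0 else N)])"
  let ?D = "concat (map (\<lambda>i. flat3 [(2 * N, 2 * N + 1 + i, W2 d)]) [0..<L d])"
  have flat: "?pre @ flat3 (input d) = (((?pre @ ?A) @ ?B) @ ?C) @ ?D"
    by (simp add: input_def pads_def inner_def pairs_def leaves_def flat3_concat flat3_map)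
  have lenle: "length ((((?pre @ ?A) @ ?B) @ ?C) @ ?D) \<le> bound"
    unfolding flat[symmetric] using length_input(1)[of d] by (simp add: length_flat3 bound_def)
  have lens: "length (?pre @ ?A) \<le> bound" "length ((?pre @ ?A) @ ?B) \<le> bound" "length (((?pre @ ?A) @ ?B) @ ?C) \<le> bound"
    using lenle by auto
  have sm3: "arith V pad_base" "depth pad_base = 3" "cost pad_base = 9" "reads pad_base = {6, 11}"
    "arith V (end_label 2)" "arith V (end_label 3)" "depth (end_label k) = 2" "cost (end_label k) = 8" "reads (end_label k) = {0, 12, 17}" for k
    by (auto simp: pad_base_def end_label_def)
  show ?thesis
    unfolding input_com_def
  proof (rule ok_Seq[where ?t1.0 = 50])
    show "ok (pushes 40 19 [reg 10, Const 0, reg 9]) s (\<lambda>s'. is_list 40 19 s' ?pre) 50"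
    proof (rule ok_conseq[OF ok_pushes[OF s(1,3)]])
      show "length [] + length [reg 10, Const 0, reg 9] < V" using V by (simp only: list.size)
    qed (use readyD[OF s(2)] const_less_V design_less_V[of d] in auto)
    fix s1 assume s1: "bnd s1" "\<And>a. a \<notin> mods (pushes 40 19 [reg 10, Const 0, reg 9]) \<Longrightarrow> s1 a = s a" "is_list 40 19 s1 ?pre"
    have r1: "ready d s1" by (rule ready_cong[OF s(2)]) (use s1(2) in auto)
    note R1 = readyD[OF r1]
    show "ok (Seq (For 12 edges (pushes 40 19 (quot_rem pad_base (reg 5))))
     (Seq (For 12 edges (Cond (times (end_label 2) (end_label 3))
         (pushes 40 19 [Bop Sub (end_label 2) (Const 1), Bop Sub (end_label 3) (Const 1), Const 2]) Skip))
     (Seq (For 12 (if d = Quad then Const 0 else reg 6) (pushes 40 19 [reg 12, plus (reg 6) (reg 12), reg 8]))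
     (Seq (For 12 (reg 11) (pushes 40 19 [times (Const 2) (reg 6), plus (plus (times (Const 2) (reg 6)) (Const 1)) (reg 12), reg 9]))
       (Write 40 (Const 2) (Bop Div (Bop Sub (reg 19) (Const 3)) (Const 3))))))) s1
       (\<lambda>s'. s' 40 = (\<lambda>i. if even i \<and> i div 2 < 3 + 3 * length (input d)
       then ([n' d, length (input d), W2 d] @ flat3 (input d)) ! (i div 2) else 0)) (450 * (m + N + L d + 1))"
    proof (rule ok_Seq[where ?t1.0 = "100 * (m + 1)"])
      show "ok (For 12 edges (pushes 40 19 (quot_rem pad_base (reg 5)))) s1 (\<lambda>s'. is_list 40 19 s' (?pre @ ?A)) (100 * (m + 1))"
      proof (rule ok_emit_For[OF s1(1,3), where n = m and t = "\<lambda>_. 85"])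
        fix i s' ys assume i: "i < m" and b: "bnd s'" "s' 12 0 = i" "is_list 40 19 s' ys"
          and fr: "\<And>a. a \<notin> insert 12 (mods (pushes 40 19 (quot_rem pad_base (reg 5)))) \<Longrightarrow> s' a = s1 a"
          and len: "length ys + length (flat3 [(x0 d + i div P, x0 d + P + i mod P, 1)]) \<le> length ?pre + length ?A"
        have fr': "s' a = s1 a" if "a \<notin> {12, 40, 19}" for a
          by (rule fr) (use that in \<open>simp add: quot_rem_def\<close>)
        have "0 < m" using i by linarith
        then have P0: "0 < P" by (rule P_pos)
        have "i div P < P" using i P P0 by (simp add: less_mult_imp_div_less power2_eq_square)
        moreover have "i mod P < P" using P0 by simp
        ultimately have vals: "x0 d + i div P < n' d" "x0 d + P + i mod P < n' d" by (simp_all add: n'_def)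
        have e: "map (ev s') (quot_rem pad_base (reg 5)) = flat3 [(x0 d + i div P, x0 d + P + i mod P, 1)]"
          using b R1 fr' by (simp add: quot_rem_def pad_base_def x0_def)
        show "ok (pushes 40 19 (quot_rem pad_base (reg 5))) s' (\<lambda>s''. is_list 40 19 s'' (ys @ flat3 [(x0 d + i div P, x0 d + P + i mod P, 1)])) 85"
        proof (rule ok_conseq[OF ok_pushes[OF b(1,3)]])
          show "small e \<and> ev s' e < V \<and> 40 \<notin> reads e \<and> 19 \<notin> reads e" if e': "e \<in> set (quot_rem pad_base (reg 5))" for e
          proof -
            have "ev s' e \<in> set (map (ev s') (quot_rem pad_base (reg 5)))" using e' by simp
            then have "ev s' e < V" unfolding e using vals const_less_V design_less_V[of d] V by auto
            then show ?thesis using e' sm3 by (auto simp: quot_rem_def)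
          qed
        qed (use len lens(1) bV sm3 e in \<open>auto simp: quot_rem_def\<close>)
      qed (use R1 V z less_V in \<open>auto simp: quot_rem_def edges_def\<close>)
      fix s2 assume s2: "bnd s2" "\<And>a. a \<notin> mods (For 12 edges (pushes 40 19 (quot_rem pad_base (reg 5)))) \<Longrightarrow> s2 a = s1 a" "is_list 40 19 s2 (?pre @ ?A)"
      have r2: "ready d s2" by (rule ready_cong[OF r1]) (use s2(2) in \<open>auto simp: quot_rem_def\<close>)
      note R2 = readyD[OF r2]
      let ?c2 = "Cond (times (end_label 2) (end_label 3))
         (pushes 40 19 [Bop Sub (end_label 2) (Const 1), Bop Sub (end_label 3) (Const 1), Const 2]) Skip"
      show "ok (Seq (For 12 edges ?c2)
       (Seq (For 12 (if d = Quad then Const 0 else reg 6) (pushes 40 19 [reg 12, plus (reg 6) (reg 12), reg 8]))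
       (Seq (For 12 (reg 11) (pushes 40 19 [times (Const 2) (reg 6), plus (plus (times (Const 2) (reg 6)) (Const 1)) (reg 12), reg 9]))
         (Write 40 (Const 2) (Bop Div (Bop Sub (reg 19) (Const 3)) (Const 3)))))) s2
         (\<lambda>s'. s' 40 = (\<lambda>i. if even i \<and> i div 2 < 3 + 3 * length (input d)
         then ([n' d, length (input d), W2 d] @ flat3 (input d)) ! (i div 2) else 0)) (350 * (m + N + L d + 1))"
      proof (rule ok_Seq[where ?t1.0 = "120 * (m + 1)"])
        show "ok (For 12 edges ?c2) s2 (\<lambda>s'. is_list 40 19 s' ((?pre @ ?A) @ ?B)) (120 * (m + 1))"
        proof (rule ok_emit_For[OF s2(1,3), where n = m and t = "\<lambda>_. 90"])
          fix i s' ys assume i: "i < m" and b: "bnd s'" "s' 12 0 = i" "is_list 40 19 s' ys"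
            and fr: "\<And>a. a \<notin> insert 12 (mods ?c2) \<Longrightarrow> s' a = s2 a"
            and len: "length ys + length (flat3 (inner_edge i)) \<le> length (?pre @ ?A) + length ?B"
          have fr': "s' a = s2 a" if "a \<notin> {12, 40, 19}" for a
            by (rule fr) (use that in simp)
          have t: "s' 0 (2 + 2 * i) = fst (es ! i)" "s' 0 (2 + (2 * i + 1)) = snd (es ! i)"
            using R2(10)[of "2 * i"] R2(10)[of "2 * i + 1"] i tail_even[OF i] tail_odd[OF i] fr' by auto
          have e2: "ev s' (end_label 2) = label hs (fst (es ! i))"
            using t(1) R2(15) fr' b(2) by (simp add: end_label_def)
          have e3: "ev s' (end_label 3) = label hs (snd (es ! i))"
            using t(2) R2(15) fr' b(2) by (simp add: end_label_def numeral_3_eq_3)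
          have lV: "label hs x < V" for x
            using label_le(1)[OF distinct_high, of \<Delta> "2 * m" x] const_less_V(1) by (simp add: N_def)
          show "ok ?c2 s' (\<lambda>s''. is_list 40 19 s'' (ys @ flat3 (inner_edge i))) 90"
          proof (rule ok_Cond[OF b(1), where ?t1.0 = 70])
            assume "ev s' (times (end_label 2) (end_label 3)) \<noteq> 0"
            then have g: "inner_edge i = [(label hs (fst (es ! i)) - 1, label hs (snd (es ! i)) - 1, 2)]"
              using e2 e3 by (simp add: inner_edge_def)
            show "ok (pushes 40 19 [Bop Sub (end_label 2) (Const 1), Bop Sub (end_label 3) (Const 1), Const 2]) s'
               (\<lambda>s''. is_list 40 19 s'' (ys @ flat3 (inner_edge i))) 70"
            proof (rule ok_conseq[OF ok_pushes[OF b(1,3)]])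
              show "small e \<and> ev s' e < V \<and> 40 \<notin> reads e \<and> 19 \<notin> reads e"
                if "e \<in> set [Bop Sub (end_label 2) (Const 1), Bop Sub (end_label 3) (Const 1), Const 2]" for e
                using that sm3 e2 e3 lV[of "fst (es ! i)"] lV[of "snd (es ! i)"] V by auto
            qed (use len lens(2) bV sm3 e2 e3 g in auto)
          next
            assume "ev s' (times (end_label 2) (end_label 3)) = 0"
            then have "inner_edge i = []" using e2 e3 by (auto simp: inner_edge_def)
            then show "ok Skip s' (\<lambda>s''. is_list 40 19 s'' (ys @ flat3 (inner_edge i))) 70"
              using b by (intro ok_Skip) auto
          qed (use sm3 in auto)
        qed (use R2 V z less_V in \<open>auto simp: edges_def\<close>)
        fix s3 assume s3: "bnd s3" "\<And>a. a \<notin> mods (For 12 edges ?c2) \<Longrightarrow> s3 a = s2 a" "is_list 40 19 s3 ((?pre @ ?A) @ ?B)"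
        have r3: "ready d s3" by (rule ready_cong[OF r2]) (use s3(2) in auto)
        note R3 = readyD[OF r3]
        let ?n3 = "if d = Quad then 0 else N"
        let ?c3 = "pushes 40 19 [reg 12, plus (reg 6) (reg 12), reg 8]"
        show "ok (Seq (For 12 (if d = Quad then Const 0 else reg 6) ?c3)
         (Seq (For 12 (reg 11) (pushes 40 19 [times (Const 2) (reg 6), plus (plus (times (Const 2) (reg 6)) (Const 1)) (reg 12), reg 9]))
           (Write 40 (Const 2) (Bop Div (Bop Sub (reg 19) (Const 3)) (Const 3))))) s3
           (\<lambda>s'. s' 40 = (\<lambda>i. if even i \<and> i div 2 < 3 + 3 * length (input d)
           then ([n' d, length (input d), W2 d] @ flat3 (input d)) ! (i div 2) else 0)) (230 * (N + L d + 1))"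
        proof (rule ok_Seq[where ?t1.0 = "80 * (N + 1)"])
          show "ok (For 12 (if d = Quad then Const 0 else reg 6) ?c3) s3 (\<lambda>s'. is_list 40 19 s' (((?pre @ ?A) @ ?B) @ ?C)) (80 * (N + 1))"
          proof (rule ok_emit_For[OF s3(1,3), where n = ?n3 and t = "\<lambda>_. 60"])
            fix i s' ys assume i: "i < ?n3" and b: "bnd s'" "s' 12 0 = i" "is_list 40 19 s' ys"
              and fr: "\<And>a. a \<notin> insert 12 (mods ?c3) \<Longrightarrow> s' a = s3 a"
              and len: "length ys + length (flat3 [(i, N + i, W)]) \<le> length ((?pre @ ?A) @ ?B) + length ?C"
            have fr': "s' a = s3 a" if "a \<notin> {12, 40, 19}" for a
              by (rule fr) (use that in simp)
            have "i < N" using i by (simp split: if_splits)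
            then have "N + i < n' d" by (simp add: n'_def x0_def)
            then have iV: "i < V" "N + i < V" using const_less_V design_less_V[of d] by auto
            show "ok ?c3 s' (\<lambda>s''. is_list 40 19 s'' (ys @ flat3 [(i, N + i, W)])) 60"
            proof (rule ok_conseq[OF ok_pushes[OF b(1,3)]])
              show "small e \<and> ev s' e < V \<and> 40 \<notin> reads e \<and> 19 \<notin> reads e"
                if "e \<in> set [reg 12, plus (reg 6) (reg 12), reg 8]" for e
                using that b R3 fr' iV const_less_V design_less_V[of d] by auto
            qed (use len lens(3) bV b R3 fr' in auto)
          qed (use R3 V z const_less_V design_less_V[of d] in \<open>auto split: if_splits\<close>)
          fix s4 assume s4: "bnd s4" "\<And>a. a \<notin> mods (For 12 (if d = Quad then Const 0 else reg 6) ?c3) \<Longrightarrow> s4 a = s3 a"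
            "is_list 40 19 s4 (((?pre @ ?A) @ ?B) @ ?C)"
          have r4: "ready d s4" by (rule ready_cong[OF r3]) (use s4(2) in auto)
          note R4 = readyD[OF r4]
          let ?c4 = "pushes 40 19 [times (Const 2) (reg 6), plus (plus (times (Const 2) (reg 6)) (Const 1)) (reg 12), reg 9]"
          show "ok (Seq (For 12 (reg 11) ?c4) (Write 40 (Const 2) (Bop Div (Bop Sub (reg 19) (Const 3)) (Const 3)))) s4
             (\<lambda>s'. s' 40 = (\<lambda>i. if even i \<and> i div 2 < 3 + 3 * length (input d)
             then ([n' d, length (input d), W2 d] @ flat3 (input d)) ! (i div 2) else 0)) (100 * (L d + 1) + 20)"
          proof (rule ok_Seq[where ?t1.0 = "100 * (L d + 1)" and ?t2.0 = 20])
            show "ok (For 12 (reg 11) ?c4) s4 (\<lambda>s'. is_list 40 19 s' ((((?pre @ ?A) @ ?B) @ ?C) @ ?D)) (100 * (L d + 1))"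
            proof (rule ok_emit_For[OF s4(1,3), where n = "L d" and t = "\<lambda>_. 70"])
              fix i s' ys assume i: "i < L d" and b: "bnd s'" "s' 12 0 = i" "is_list 40 19 s' ys"
                and fr: "\<And>a. a \<notin> insert 12 (mods ?c4) \<Longrightarrow> s' a = s4 a"
                and len: "length ys + length (flat3 [(2 * N, 2 * N + 1 + i, W2 d)]) \<le> length (((?pre @ ?A) @ ?B) @ ?C) + length ?D"
              have fr': "s' a = s4 a" if "a \<notin> {12, 40, 19}" for a
                by (rule fr) (use that in simp)
              have "2 * N + 1 + i < n' d" "2 * N < n' d" using i by (auto simp: n'_def x0_def)
              then have iV: "2 * N < V" "2 * N + 1 + i < V" using const_less_V design_less_V[of d] by auto
              show "ok ?c4 s' (\<lambda>s''. is_list 40 19 s'' (ys @ flat3 [(2 * N, 2 * N + 1 + i, W2 d)])) 70"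
              proof (rule ok_conseq[OF ok_pushes[OF b(1,3)]])
                show "small e \<and> ev s' e < V \<and> 40 \<notin> reads e \<and> 19 \<notin> reads e"
                  if "e \<in> set [times (Const 2) (reg 6), plus (plus (times (Const 2) (reg 6)) (Const 1)) (reg 12), reg 9]" for e
                  using that b R4 fr' iV const_less_V design_less_V[of d] by auto
              qed (use len lenle bV b R4 fr' in auto)
            qed (use R4 V z const_less_V design_less_V[of d] in auto)
            fix s5 assume s5: "bnd s5" "is_list 40 19 s5 ((((?pre @ ?A) @ ?B) @ ?C) @ ?D)"
            have l5: "s5 19 0 = 3 + 3 * length (input d)"
              using s5(2) unfolding flat[symmetric] by (simp add: is_list_def length_flat3)
            have a5: "s5 40 = (\<lambda>i. if even i \<and> i div 2 < 3 + 3 * length (input d) then (?pre @ flat3 (input d)) ! (i div 2) else 0)"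
              using s5(2) unfolding flat[symmetric] by (simp add: is_list_def length_flat3 numeral_3_eq_3 cong: if_cong)
            have lV: "length (input d) < V" using length_input(1)[of d] bV by (simp add: bound_def)
            have "(s5 40)(2 := length (input d)) = (\<lambda>i. if even i \<and> i div 2 < 3 + 3 * length (input d)
             then ([n' d, length (input d), W2 d] @ flat3 (input d)) ! (i div 2) else 0)"
              unfolding a5
            proof
              fix i :: nat
              \<comment> \<open>Index 2 is the only even index with quotient 1, so the patch changes
                nothing but the edge count.\<close>
              have "i div 2 \<noteq> 1" if "i \<noteq> 2" "even i" using that by (auto elim!: evenE)
              then show "((\<lambda>i. if even i \<and> i div 2 < 3 + 3 * length (input d) then (?pre @ flat3 (input d)) ! (i div 2) else 0)(2 := length (input d))) i
                 = (if even i \<and> i div 2 < 3 + 3 * length (input d) then ([n' d, length (input d), W2 d] @ flat3 (input d)) ! (i div 2) else 0)"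
                by (auto simp: nth_Cons')
            qed
            then show "ok (Write 40 (Const 2) (Bop Div (Bop Sub (reg 19) (Const 3)) (Const 3))) s5
               (\<lambda>s'. s' 40 = (\<lambda>i. if even i \<and> i div 2 < 3 + 3 * length (input d)
               then ([n' d, length (input d), W2 d] @ flat3 (input d)) ! (i div 2) else 0)) 20"
              using l5 lV by (intro ok_Write[OF s5(1)]) (simp_all add: store_store)
          qed simp
        qed simp
      qed simp
    qed simp
  qed simp
qed

end

section \<open>Length and construction of the script\<close>

context prog_ctx
begin

lemma hs_less: "v < N \<Longrightarrow> hs ! v < n"
  using high_less[of "hs ! v" \<Delta>] by (simp add: N_def)

lemma cand_label_le:
  assumes "v < N" "i < cand_num d v"
  shows "cand_label d v i \<le> N"
  using assms label_le(1)[OF distinct_high, of \<Delta> "2 * m"]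
  by (auto simp: cand_label_def cand_num_def N_def split: if_splits)

lemma cand_num_le: "cand_num d v \<le> 2 * m"
  using N_bounds length_nbrs_upto[of "2 * m" "hs ! v"] by (simp add: cand_num_def)

lemma length_cands: "length (cands d v) \<le> cand_num d v"
proof -
  have "length (cands d v) \<le> cand_num d v * 1" unfolding cands_def by (intro length_concat_le) simp
  then show ?thesis by simp
qed

lemma length_phase: "length (phase d tri v) \<le> 2 * cand_num d v + 2"
  using length_cands[of d v] by (auto simp: phase_def)

lemma length_script: "length (script d tri) \<le> (\<Sum>v<N. 2 * cand_num d v + 2)"
proof -
  have "length (concat (map f [0..<k])) = (\<Sum>v<k. length (f v))" for f :: "nat \<Rightarrow> item list" and k
    by (induction k) auto
  then have "length (script d tri) = (\<Sum>v<N. length (phase d tri v))"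
    unfolding script_def by simp
  also have "\<dots> \<le> (\<Sum>v<N. 2 * cand_num d v + 2)"
    by (rule sum_mono) (rule length_phase)
  finally show ?thesis .
qed

lemma length_script_V: "4 * length (script d tri) + 10 < V"
proof (rule S_bound)
  have "length (script d tri) \<le> (\<Sum>v<N. 4 * S + 2)"
  proof -
    have "2 * cand_num d v + 2 \<le> 4 * S + 2" for v using cand_num_le[of d v] S_ge by linarith
    then show ?thesis by (intro order_trans[OF length_script] sum_mono)
  qed
  also have "\<dots> \<le> S * (4 * S + 2)" using mult_le_mono1[OF S_ge(6), of "4 * S + 2"] by simp
  finally have "4 * length (script d tri) + 10 \<le> 4 * (S * (4 * S + 2)) + 10" by simp
  also have "\<dots> = 16 * (S * S) + 8 * S + 10" by (simp add: algebra_simps)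
  also have "\<dots> \<le> 26 * S ^ 2"
    using S_ge(1) mult_le_mono1[OF S_ge(1), of S] unfolding power2_eq_square by linarith
  also have "\<dots> \<le> 100 * S ^ 3" using S_ge(1) by (intro mult_mono power_increasing) auto
  finally show "4 * length (script d tri) + 10 \<le> 100 * S ^ 3" .
qed

lemma ok_cand_loop:
  assumes s: "bnd s" "ready d s" "s 12 0 = v" "v < N" "is_list 20 21 s ys"
    and xs: "\<And>s' l. ready d s' \<Longrightarrow> s' 24 0 = Suc l \<Longrightarrow> l < N \<Longrightarrow> map (ev s') xs = code (it l) \<and> (\<forall>y \<in> set (code (it l)). y < V)"
    and xs2: "\<And>e. e \<in> set xs \<Longrightarrow> arith V e \<and> depth e \<le> 10 \<and> 20 \<notin> reads e \<and> 21 \<notin> reads e" "xs \<noteq> []" "sum_list (map cost xs) + 11 * length xs + 1 \<le> 100"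
    and len: "length ys + 4 * length (cands d v) < V"
  shows "ok (cand_loop d xs) s (\<lambda>s'. is_list 20 21 s' (ys @ concat (map code (map it (cands d v))))) (200 * (cand_num d v + 1))"
proof -
  let ?g = "\<lambda>i. if cand_label d v i = 0 then [] else code (it (cand_label d v i - 1))"
  let ?c = "Seq (Write 24 (Const 0) (cand_expr d)) (Cond (reg 24) (pushes 20 21 xs) Skip)"
  have conc: "concat (map code (map it (cands d v))) = concat (map ?g [0..<cand_num d v])"
  proof -
    have "concat (map code (map it (concat (map (\<lambda>i. if cand_label d v i = 0 then [] else [cand_label d v i - 1]) is)))) = concat (map ?g is)" for "is"
      by (induction "is") auto
    then show ?thesis by (simp add: cands_def)
  qed
  have sme: "small (cand_expr d)" "small (cand_bound d)" "depth (cand_bound d) < z" "cost (cand_expr d) \<le> 40" "cost (cand_bound d) \<le> 10"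
    "13 \<notin> reads (cand_bound d)" "20 \<notin> reads (cand_bound d)" "21 \<notin> reads (cand_bound d)" "24 \<notin> reads (cand_bound d)"
    using z by (auto simp: cand_expr_def cand_bound_def)
  have bd: "ev s (cand_bound d) = cand_num d v"
    using readyD[OF s(2)] s(3,4) by (simp add: cand_bound_def cand_num_def)
  have lenV: "length ys + length (concat (map ?g [0..<cand_num d v])) < V"
    using len unfolding conc[symmetric] by (simp only: length_codes length_map)
  have cV: "cand_num d v < V" using cand_num_le[of d v] less_V by simp
  have "ok (cand_loop d xs) s (\<lambda>s'. is_list 20 21 s' (ys @ concat (map ?g [0..<cand_num d v]))) (200 * (cand_num d v + 1))"
    unfolding cand_loop_def
  proof (rule ok_emit_For[OF s(1,5) sme(2,3) bd cV sme(6), where t = "\<lambda>_. 160"])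
    fix i s' zs assume i: "i < cand_num d v" and b: "bnd s'" "s' 13 0 = i" "is_list 20 21 s' zs"
      and fr: "\<And>a. a \<notin> insert 13 (mods ?c) \<Longrightarrow> s' a = s a"
      and ln: "length zs + length (?g i) \<le> length ys + length (concat (map ?g [0..<cand_num d v]))"
    have fr': "s' a = s a" if "a \<notin> {13, 24, 20, 21}" for a
      by (rule fr) (use that xs2(2) in simp)
    have r': "ready d s'" by (rule ready_cong[OF s(2)]) (use fr' in auto)
    note R = readyD[OF r']
    have ce: "ev s' (cand_expr d) = cand_label d v i"
    proof (cases "d = Quad")
      case True
      then have "i < N" using i by (simp add: cand_num_def)
      then show ?thesis
        using True R(1,14) R(13)[OF hs_less[OF s(4)] hs_less[of i]] b(2) s(3,4) fr'[of 12]
        by (simp add: cand_expr_def cand_label_def vertices_def)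
    next
      case False
      then have "i < deg (hs ! v)" using i by (simp add: cand_num_def)
      then show ?thesis
        using False R(2,14,15) R(12)[of i "hs ! v"] b(2) s(3,4) fr'[of 12]
        by (simp add: cand_expr_def cand_label_def arcs_def edges_def)
    qed
    have cl: "cand_label d v i \<le> N" using cand_label_le[OF s(4) i] .
    show "ok ?c s' (\<lambda>s''. is_list 20 21 s'' (zs @ ?g i)) 160"
    proof (rule ok_Seq[where ?t1.0 = 50 and ?t2.0 = 105])
      show "ok (Write 24 (Const 0) (cand_expr d)) s' (\<lambda>s''. s'' 24 0 = cand_label d v i) 50"
        by (rule ok_Write[OF b(1)]) (use sme ce cl const_less_V in \<open>auto simp: store_store\<close>)
      fix s2 assume s2: "bnd s2" "\<And>a. a \<notin> mods (Write 24 (Const 0) (cand_expr d)) \<Longrightarrow> s2 a = s' a" "s2 24 0 = cand_label d v i"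
      have r2: "ready d s2" by (rule ready_cong[OF r']) (use s2(2) in auto)
      have l2: "is_list 20 21 s2 zs" using b(3) s2(2)[of 20] s2(2)[of 21] by (simp add: is_list_def)
      show "ok (Cond (reg 24) (pushes 20 21 xs) Skip) s2 (\<lambda>s''. is_list 20 21 s'' (zs @ ?g i)) 105"
      proof (rule ok_Cond[OF s2(1), where ?t1.0 = 100])
        assume "ev s2 (reg 24) \<noteq> 0"
        then obtain l where l: "cand_label d v i = Suc l" using s2(3) by (cases "cand_label d v i") auto
        have e: "map (ev s2) xs = ?g i" "\<forall>y \<in> set (map (ev s2) xs). y < V"
          using xs[OF r2, of l] s2(3) l cl by auto
        show "ok (pushes 20 21 xs) s2 (\<lambda>s''. is_list 20 21 s'' (zs @ ?g i)) 100"
        proof (rule ok_conseq[OF ok_pushes[OF s2(1) l2]])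
          show "small e \<and> ev s2 e < V \<and> 20 \<notin> reads e \<and> 21 \<notin> reads e" if "e \<in> set xs" for e
            using xs2(1)[OF that] e(2) that by auto
          have "length xs = length (?g i)" using e(1) by (metis length_map)
          then show "length zs + length xs < V" using ln lenV by linarith
        qed (use e xs2(3) in auto)
      next
        assume "ev s2 (reg 24) = 0"
        then show "ok Skip s2 (\<lambda>s''. is_list 20 21 s'' (zs @ ?g i)) 100"
          using s2 l2 by (intro ok_Skip) auto
      qed auto
    qed simp
  next
    have "(cand_num d v + 1) * (10 + cost (cand_bound d)) \<le> (cand_num d v + 1) * 20"
      using sme(5) by (intro mult_left_mono) auto
    then show "(\<Sum>i<cand_num d v. 160) + (cand_num d v + 1) * (10 + cost (cand_bound d)) \<le> 200 * (cand_num d v + 1)"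
      by simp
  qed (use sme xs2(2) in auto)
  then show ?thesis by (simp only: conc)
qed

lemma ok_script:
  assumes s: "bnd s" "ready d s" "is_list 20 21 s []"
  shows "ok (script_com d) s (\<lambda>s'. is_list 20 21 s' (concat (map code (script d tri))))
    ((\<Sum>v<N. 400 * cand_num d v + 700) + (N + 1) * 12)"
proof -
  let ?g = "\<lambda>v. concat (map code (phase d tri v))"
  have conc: "concat (map code (script d tri)) = concat (map ?g [0..<N])"
  proof -
    have "concat (map code (concat (map (phase d tri) is))) = concat (map ?g is)" for "is"
      by (induction "is") auto
    then show ?thesis by (simp add: script_def)
  qed
  have lenV: "length (concat (map ?g [0..<N])) + 10 < V"
    using length_script_V[of d tri] unfolding conc[symmetric] by simp
  have md: "mods (cand_loop d xs) \<subseteq> {13, 20, 21, 24}" for xs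
    using mods_pushes[of 20 21 xs] by (auto simp: cand_loop_def)
  have mp: "mods (phase_com d) \<subseteq> {13, 20, 21, 22, 24, 25}"
    using md[of "mark_exprs d"] md[of unmark_exprs] by (auto simp: phase_com_def)
  have "ok (script_com d) s (\<lambda>s'. is_list 20 21 s' ([] @ concat (map ?g [0..<N])))
    ((\<Sum>v<N. 400 * cand_num d v + 700) + (N + 1) * 12)"
    unfolding script_com_def
  proof (rule ok_emit_For[OF s(1,3), where t = "\<lambda>v. 400 * cand_num d v + 700"])
    show "ev s (reg 6) = N" using readyD[OF s(2)] by simp
    fix v s' ys assume v: "v < N" and b: "bnd s'" "s' 12 0 = v" "is_list 20 21 s' ys"
      and fr: "\<And>a. a \<notin> insert 12 (mods (phase_com d)) \<Longrightarrow> s' a = s a"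
      and ln: "length ys + length (?g v) \<le> length ([] :: nat list) + length (concat (map ?g [0..<N]))"
    have fr': "s' a = s a" if "a \<notin> {12, 13, 20, 21, 22, 24, 25}" for a
      by (rule fr) (use that mp in auto)
    have r': "ready d s'" by (rule ready_cong[OF s(2)]) (use fr' in auto)
    have nb: "N + l < V \<and> 2 * N < V \<and> l < V" if "l < N" for l
    proof -
      have "N + l < n' d" "2 * N < n' d" using that by (auto simp: n'_def x0_def)
      then show ?thesis using design_less_V[of d] by simp
    qed
    have mk: "map (ev s') (mark_exprs d) = code (mark d l) \<and> (\<forall>y \<in> set (code (mark d l)). y < V)"
      if "ready d s'" "s' 24 0 = Suc l" "l < N" for s' l
      using readyD[OF that(1)] that(2) nb[OF that(3)] const_less_V design_less_V[of d]
      by (cases d) (simp_all add: mark_exprs_def mark_def)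
    have um: "map (ev s') unmark_exprs = code (Ins l (N + l) W) \<and> (\<forall>y \<in> set (code (Ins l (N + l) W)). y < V)"
      if "ready d s'" "s' 24 0 = Suc l" "l < N" for s' l
      using readyD[OF that(1)] that(2) nb[OF that(3)] const_less_V
      by (simp add: unmark_exprs_def)
    let ?k = "length (cands d v)"
    have kV: "?k < V" using length_cands[of d v] cand_num_le[of d v] less_V by simp
    let ?M = "concat (map code (map (mark d) (cands d v)))"
    let ?A = "code (Ask 2 1 (answer d ?k) (tri v))"
    let ?Z = "if d = Full then concat (map code (map (\<lambda>u. Ins u (N + u) W) (cands d v))) else code Reset"
    have gv: "?g v = ?M @ ?A @ ?Z" by (simp add: phase_def)
    have ys: "length ys + length (?M @ ?A @ ?Z) + 10 < V" using ln lenV unfolding gv by simp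
    have lM: "length ?M = 4 * ?k" by (simp only: length_codes length_map)
    have ready_frame: "ready d s2" if "ready d s1" "\<And>a. a \<notin> {13, 20, 21, 22, 24, 25} \<Longrightarrow> s2 a = s1 a" for s1 s2
      by (rule ready_cong[OF that(1)]) (use that(2) in auto)
    show "ok (phase_com d) s' (\<lambda>s''. is_list 20 21 s'' (ys @ ?g v)) (400 * cand_num d v + 700)"
      unfolding phase_com_def gv
    proof (rule ok_Seq[where ?t1.0 = 10 and ?t2.0 = "400 * cand_num d v + 690"])
      show "ok (Write 22 (Const 0) (reg 21)) s' (\<lambda>s1. s1 22 0 = length ys) 10"
        by (rule ok_Write[OF b(1)]) (use b(3) ys in \<open>auto simp: store_store is_list_def\<close>)
      fix s1 assume s1: "bnd s1" "\<And>a. a \<notin> mods (Write 22 (Const 0) (reg 21)) \<Longrightarrow> s1 a = s' a" "s1 22 0 = length ys"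
      have r1: "ready d s1" by (rule ready_frame[OF r']) (use s1(2) in auto)
      have l1: "is_list 20 21 s1 ys" "s1 12 0 = v" using b s1(2) by (simp_all add: is_list_def)
      show "ok (Seq (cand_loop d (mark_exprs d))
         (Seq (Write 25 (Const 0) (Bop Div (Bop Sub (reg 21) (reg 22)) (Const 4)))
         (Seq (pushes 20 21 [Const 2, Const 2, Const 1, answer_expr d])
           (if d = Full then cand_loop d unmark_exprs else pushes 20 21 [Const 3, Const 0, Const 0, Const 0])))) s1
         (\<lambda>s''. is_list 20 21 s'' (ys @ ?M @ ?A @ ?Z)) (400 * cand_num d v + 690)"
      proof (rule ok_Seq[where ?t1.0 = "200 * (cand_num d v + 1)" and ?t2.0 = "200 * cand_num d v + 480"])
        show "ok (cand_loop d (mark_exprs d)) s1 (\<lambda>s2. is_list 20 21 s2 (ys @ ?M)) (200 * (cand_num d v + 1))"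
        proof (rule ok_cand_loop[OF s1(1) r1 l1(2) v l1(1) mk])
          show "length ys + 4 * length (cands d v) < V" using ys lM by simp
          show "arith V e \<and> depth e \<le> 10 \<and> 20 \<notin> reads e \<and> 21 \<notin> reads e" if "e \<in> set (mark_exprs d)" for e
            using that V by (cases d) (auto simp: mark_exprs_def)
          show "mark_exprs d \<noteq> []" "sum_list (map cost (mark_exprs d)) + 11 * length (mark_exprs d) + 1 \<le> 100"
            by (cases d; simp add: mark_exprs_def)+
        qed
        fix s2 assume s2: "bnd s2" "\<And>a. a \<notin> mods (cand_loop d (mark_exprs d)) \<Longrightarrow> s2 a = s1 a" "is_list 20 21 s2 (ys @ ?M)"
        have fr2: "s2 a = s1 a" if "a \<notin> {13, 20, 21, 24}" for a by (rule s2(2)) (use that md in blast)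
        have r2: "ready d s2" by (rule ready_frame[OF r1]) (use fr2 in auto)
        have l2: "s2 12 0 = v" "s2 22 0 = length ys" using l1 s1(3) fr2 by simp_all
        show "ok (Seq (Write 25 (Const 0) (Bop Div (Bop Sub (reg 21) (reg 22)) (Const 4)))
           (Seq (pushes 20 21 [Const 2, Const 2, Const 1, answer_expr d])
             (if d = Full then cand_loop d unmark_exprs else pushes 20 21 [Const 3, Const 0, Const 0, Const 0]))) s2
           (\<lambda>s''. is_list 20 21 s'' (ys @ ?M @ ?A @ ?Z)) (200 * cand_num d v + 480)"
        proof (rule ok_Seq[where ?t1.0 = 20 and ?t2.0 = "200 * cand_num d v + 450"])
          \<comment> \<open>The number of candidates is read off the growth of the script, at four
            words per item; register 22 holds the length before the phase.\<close>
          have "s2 21 0 = length ys + 4 * ?k" using s2(3) lM by (simp only: is_list_def length_append)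
          then show "ok (Write 25 (Const 0) (Bop Div (Bop Sub (reg 21) (reg 22)) (Const 4))) s2 (\<lambda>s3. s3 25 0 = ?k) 20"
            by (intro ok_Write[OF s2(1)]) (use l2 kV in \<open>auto simp: store_store\<close>)
          fix s3 assume s3: "bnd s3" "\<And>a. a \<notin> mods (Write 25 (Const 0) (Bop Div (Bop Sub (reg 21) (reg 22)) (Const 4))) \<Longrightarrow> s3 a = s2 a" "s3 25 0 = ?k"
          have r3: "ready d s3" by (rule ready_frame[OF r2]) (use s3(2) in auto)
          have l3: "s3 12 0 = v" "is_list 20 21 s3 (ys @ ?M)" using l2 s2(3) s3(2) by (simp_all add: is_list_def)
          note R3 = readyD[OF r3]
          have an: "ev s3 (answer_expr d) = answer d ?k" using R3 s3(3) by (cases d) (simp_all add: answer_expr_def answer_def)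
          have anV: "answer d ?k < V"
          proof -
            have "?k \<le> 2 * S" using length_cands[of d v] cand_num_le[of d v] S_ge by simp
            then have "answer d ?k \<le> 100 * S" using const_bounds(3)[of d] by (cases d) (simp_all add: answer_def)
            then show ?thesis by (rule S_mono)
          qed
          show "ok (Seq (pushes 20 21 [Const 2, Const 2, Const 1, answer_expr d])
             (if d = Full then cand_loop d unmark_exprs else pushes 20 21 [Const 3, Const 0, Const 0, Const 0])) s3
             (\<lambda>s''. is_list 20 21 s'' (ys @ ?M @ ?A @ ?Z)) (200 * cand_num d v + 450)"
          proof (rule ok_Seq[where ?t1.0 = 100 and ?t2.0 = "200 * cand_num d v + 300"])
            show "ok (pushes 20 21 [Const 2, Const 2, Const 1, answer_expr d]) s3 (\<lambda>s4. is_list 20 21 s4 ((ys @ ?M) @ ?A)) 100"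
            proof (rule ok_conseq[OF ok_pushes[OF s3(1) l3(2)]])
              show "small e \<and> ev s3 e < V \<and> 20 \<notin> reads e \<and> 21 \<notin> reads e" if "e \<in> set [Const 2, Const 2, Const 1, answer_expr d]" for e
                using that an anV by (cases d) (auto simp: answer_expr_def)
              show "length (ys @ ?M) + length [Const 2, Const 2, Const 1, answer_expr d] < V" using ys by simp
              show "sum_list (map cost [Const 2, Const 2, Const 1, answer_expr d]) + 11 * length [Const 2, Const 2, Const 1, answer_expr d] + 1 \<le> 100"
                by (cases d) (simp_all add: answer_expr_def)
            qed (use an in auto)
            fix s4 assume s4: "bnd s4" "\<And>a. a \<notin> mods (pushes 20 21 [Const 2, Const 2, Const 1, answer_expr d]) \<Longrightarrow> s4 a = s3 a" "is_list 20 21 s4 ((ys @ ?M) @ ?A)"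
            have r4: "ready d s4" by (rule ready_frame[OF r3]) (use s4(2) in auto)
            have l4: "s4 12 0 = v" using l3 s4(2) by simp
            show "ok (if d = Full then cand_loop d unmark_exprs else pushes 20 21 [Const 3, Const 0, Const 0, Const 0]) s4
               (\<lambda>s''. is_list 20 21 s'' (ys @ ?M @ ?A @ ?Z)) (200 * cand_num d v + 300)"
            proof (cases "d = Full")
              case True
              have "ok (cand_loop d unmark_exprs) s4 (\<lambda>s''. is_list 20 21 s'' (((ys @ ?M) @ ?A) @ concat (map code (map (\<lambda>u. Ins u (N + u) W) (cands d v))))) (200 * (cand_num d v + 1))"
              proof (rule ok_cand_loop[OF s4(1) r4 l4 v s4(3) um])
                have "length (concat (map code (map (\<lambda>u. Ins u (N + u) W) (cands d v)))) = 4 * length (cands d v)"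
                  by (simp only: length_codes length_map)
                then show "length ((ys @ ?M) @ ?A) + 4 * length (cands d v) < V" using ys True by simp
                show "arith V e \<and> depth e \<le> 10 \<and> 20 \<notin> reads e \<and> 21 \<notin> reads e" if "e \<in> set unmark_exprs" for e
                  using that V by (auto simp: unmark_exprs_def)
              qed (simp_all add: unmark_exprs_def)
              then show ?thesis using True by (simp add: ok_conseq)
            next
              case False
              have "ok (pushes 20 21 [Const 3, Const 0, Const 0, Const 0]) s4 (\<lambda>s''. is_list 20 21 s'' (((ys @ ?M) @ ?A) @ code Reset)) 100"
                by (rule ok_conseq[OF ok_pushes[OF s4(1,3)]]) (use ys False in auto)
              then show ?thesis using False by (auto elim!: ok_conseq)
            qed
          qed simp
        qed simp
      qed simp
    qed simp
  qed (use s z V const_less_V mp in auto)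
  then show ?thesis by (simp add: conc)
qed

end

section \<open>The clustering instance\<close>

text \<open>The value at \<open>Reset\<close> is a dummy: histories of the dynamic algorithm are
  formed only from other items.\<close>

fun op_of :: "item \<Rightarrow> op" where
  "op_of (Ins u v x) = Insert u v x"
| "op_of (Del u v) = Delete u v"
| "op_of (Ask p q k t) = Query p q"
| "op_of Reset = Query 0 1"

definition kind :: "design \<Rightarrow> op \<Rightarrow> bool" where
  "kind d = (case d of Dec \<Rightarrow> decremental | Full \<Rightarrow> fully_dynamic | _ \<Rightarrow> incremental)"

lemma map_of_const: "map_of (map (\<lambda>i. (k i, w)) xs) = (\<lambda>e. if e \<in> k ` set xs then Some w else None)"
  by (induction xs) (auto simp: fun_eq_iff)

lemma concat_if: "concat (map (\<lambda>i. if c i then [f i] else []) xs) = map f (filter c xs)"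
  by (induction xs) auto

context prog_ctx
begin

definition PE :: "design \<Rightarrow> nat set set" where
  "PE d = (\<lambda>i. {x0 d + i div P, x0 d + P + i mod P}) ` {..<m}"

abbreviation inner_ix :: "nat list" where
  "inner_ix \<equiv> filter (\<lambda>i. label hs (fst (es ! i)) \<noteq> 0 \<and> label hs (snd (es ! i)) \<noteq> 0) [0..<m]"

definition HE :: "nat set set" where
  "HE = (\<lambda>i. {label hs (fst (es ! i)) - 1, label hs (snd (es ! i)) - 1}) ` set inner_ix"

lemma label_hs: "u < N \<Longrightarrow> label hs (hs ! u) = Suc u"
  by (simp add: N_def label_nth distinct_high)

lemma label_hs_cases:
  assumes "label hs x \<noteq> 0"
  obtains u where "u < N" "x = hs ! u" "label hs x = Suc u"
proof -
  have x: "x \<in> set hs" using assms by (simp only: label_pos)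
  have "hs ! (label hs x - 1) = x \<and> label hs x - 1 < length hs"
    by (rule label_le(2)[OF distinct_high x])
  then show thesis using assms by (intro that[of "label hs x - 1"]) (auto simp: N_def)
qed

lemma HE_iff: "{u, v} \<in> HE \<longleftrightarrow> u < N \<and> v < N \<and> {hs ! u, hs ! v} \<in> edges_of es"
proof
  assume "{u, v} \<in> HE"
  then obtain i where i: "i < m" "label hs (fst (es ! i)) \<noteq> 0" "label hs (snd (es ! i)) \<noteq> 0"
    "{u, v} = {label hs (fst (es ! i)) - 1, label hs (snd (es ! i)) - 1}"
    unfolding HE_def by auto
  obtain a where a: "a < N" "fst (es ! i) = hs ! a" "label hs (fst (es ! i)) = Suc a" using label_hs_cases[OF i(2)] .
  obtain b where b: "b < N" "snd (es ! i) = hs ! b" "label hs (snd (es ! i)) = Suc b" using label_hs_cases[OF i(3)] .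
  have "{u, v} = {a, b}" using i(4) a b by simp
  moreover have "{hs ! a, hs ! b} \<in> edges_of es"
    unfolding edges_of_def using i(1) a b nth_mem[of i es] by (auto simp: case_prod_beta intro!: image_eqI[of _ _ "es ! i"])
  ultimately show "u < N \<and> v < N \<and> {hs ! u, hs ! v} \<in> edges_of es"
    using a(1) b(1) by (auto simp: doubleton_eq_iff insert_commute)
next
  assume a: "u < N \<and> v < N \<and> {hs ! u, hs ! v} \<in> edges_of es"
  then obtain e where "e \<in> set es" "{hs ! u, hs ! v} = {fst e, snd e}" by (auto simp: edges_of_def)
  then obtain i where i: "i < m" "{hs ! u, hs ! v} = {fst (es ! i), snd (es ! i)}" by (auto simp: in_set_conv_nth)
  then have "{label hs (fst (es ! i)), label hs (snd (es ! i))} = {Suc u, Suc v}"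
    using a label_hs[of u] label_hs[of v] by (auto simp: doubleton_eq_iff)
  then have "label hs (fst (es ! i)) = Suc u \<and> label hs (snd (es ! i)) = Suc v \<or>
      label hs (fst (es ! i)) = Suc v \<and> label hs (snd (es ! i)) = Suc u"
    by (simp only: doubleton_eq_iff)
  then show "{u, v} \<in> HE"
    unfolding HE_def using i(1) by (intro image_eqI[of _ _ i]) auto
qed

definition X0 :: "design \<Rightarrow> nat set" where "X0 d = {..<(if d = Quad then 0 else N)}"
definition Y0 :: "design \<Rightarrow> nat set" where "Y0 d = (\<lambda>i. 2 * N + 1 + i) ` {..<L d}"

abbreviation gad :: "design \<Rightarrow> nat set \<Rightarrow> nat set \<Rightarrow> wgraph" where
  "gad d \<equiv> gadget N (PE d) HE W (W2 d)"

text \<open>In \<open>map_of\<close> the earlier entries win, which matches the order of the cases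
  in \<open>gadget\<close>.\<close>

lemma wgraph_input: "wgraph_of (input d) = gad d (X0 d) (Y0 d)"
proof -
  have 1: "map (\<lambda>(u, v, x). ({u, v}, x)) (pads d) = map (\<lambda>i. ({x0 d + i div P, x0 d + P + i mod P}, 1)) [0..<m]"
    by (simp add: pads_def)
  have 2: "map (\<lambda>(u, v, x). ({u, v}, x)) inner = map (\<lambda>i. ({label hs (fst (es ! i)) - 1, label hs (snd (es ! i)) - 1}, 2)) inner_ix"
    unfolding inner_def inner_edge_def concat_if by simp
  have 3: "map (\<lambda>(u, v, x). ({u, v}, x)) (pairs d) = map (\<lambda>u. ({u, N + u}, W)) [0..<(if d = Quad then 0 else N)]"
    by (simp add: pairs_def)
  have 4: "map (\<lambda>(u, v, x). ({u, v}, x)) (leaves d) = map (\<lambda>i. ({2 * N, 2 * N + 1 + i}, W2 d)) [0..<L d]"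
    by (simp add: leaves_def)
  show ?thesis
    unfolding wgraph_of_def input_def map_append map_of_append 1 2 3 4 map_of_const
    by (auto simp: fun_eq_iff gadget_def map_add_def PE_def HE_def X0_def Y0_def atLeast0LessThan image_image)
qed

lemma PE_props: "e \<in> PE d \<Longrightarrow> \<exists>a b. e = {a, b} \<and> a \<noteq> b \<and> x0 d \<le> a \<and> x0 d \<le> b \<and> a < n' d \<and> b < n' d"
proof -
  assume "e \<in> PE d"
  then obtain i where i: "i < m" "e = {x0 d + i div P, x0 d + P + i mod P}" by (auto simp: PE_def)
  have "0 < m" using i by linarith
  then have P0: "0 < P" by (rule P_pos)
  have "i div P < P" using i P P0 by (simp add: less_mult_imp_div_less power2_eq_square)
  moreover have "i mod P < P" using P0 by simp
  ultimately show ?thesis using i(2)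
    by (intro exI[of _ "x0 d + i div P"] exI[of _ "x0 d + P + i mod P"]) (simp add: n'_def)
qed

lemma HE_props: "e \<in> HE \<Longrightarrow> \<exists>a b. e = {a, b} \<and> a \<noteq> b \<and> a < N \<and> b < N"
proof -
  assume e: "e \<in> HE"
  then obtain a b where ab: "e = {a, b}" by (auto simp: HE_def)
  then have *: "a < N" "b < N" "{hs ! a, hs ! b} \<in> edges_of es" using e HE_iff by auto
  have "hs ! a \<noteq> hs ! b" using *(3) nbrs_less[of "hs ! b" "hs ! a"] by (simp add: set_nbrs)
  then show ?thesis using ab * by auto
qed

lemma pad_keys_inj:
  assumes "i < m" "j < m" "{x0 d + i div P, x0 d + P + i mod P} = {x0 d + j div P, x0 d + P + j mod P}"
  shows "i = j"
proof -
  have "0 < m" using assms by linarith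
  then have P0: "0 < P" by (rule P_pos)
  have "i div P < P" "j div P < P"
    using assms P P0 by (simp_all add: less_mult_imp_div_less power2_eq_square)
  then have "i div P = j div P" "i mod P = j mod P"
    using assms(3) by (auto simp: doubleton_eq_iff)
  then show ?thesis by (metis div_mult_mod_eq)
qed

lemma pad_inj: "inj_on (\<lambda>i. {x0 d + i div P, x0 d + P + i mod P}) {..<m}"
  by (rule inj_onI, rule pad_keys_inj) auto

lemma card_PE: "card (PE d) = m"
  unfolding PE_def using card_image[OF pad_inj] by simp

lemma W2_ge: "1 \<le> lb \<Longrightarrow> n' d \<le> W2 d \<and> W \<le> W2 d \<and> 2 \<le> W2 d"
proof -
  assume "1 \<le> lb"
  then have "1 * n' d * 3 \<le> lb * n' d * W" "1 * 1 * W \<le> lb * n' d * W" "1 * 1 * 3 \<le> lb * n' d * W"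
    by (intro mult_le_mono; simp add: W_def n'_def x0_def)+
  then show ?thesis unfolding W2_def by (intro conjI; linarith)
qed

text \<open>\<open>W2 d\<close> serves as the bound \<open>U\<close> because it dominates all
  vertices and weights. Keys of the four kinds of edges differ since they live on different ranges
  of vertices.\<close>

lemma legal_input_input:
  assumes "1 \<le> lb"
  shows "legal_input (n' d) (W2 d) (input d)"
  unfolding legal_input_def
proof (intro conjI)
  note W2 = W2_ge[OF assms, of d]
  show "n' d \<le> W2 d" using W2 by simp
  have nn: "2 * N + 1 + L d \<le> n' d" by (simp add: n'_def x0_def)
  show "\<forall>(u, v, x)\<in>set (input d). u < n' d \<and> v < n' d \<and> u \<noteq> v \<and> 0 < x \<and> x \<le> W2 d"
  proof (clarify)
    fix u v x assume "(u, v, x) \<in> set (input d)"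
    then consider "(u, v, x) \<in> set (pads d)" | "(u, v, x) \<in> set inner" | "(u, v, x) \<in> set (pairs d)" | "(u, v, x) \<in> set (leaves d)"
      by (auto simp: input_def)
    then show "u < n' d \<and> v < n' d \<and> u \<noteq> v \<and> 0 < x \<and> x \<le> W2 d"
    proof cases
      case 1
      then have "{u, v} \<in> PE d" "x = 1" by (auto simp: pads_def PE_def)
      then show ?thesis using PE_props[of "{u, v}" d] W2 by (auto simp: doubleton_eq_iff)
    next
      case 2
      then have "{u, v} \<in> HE" "x = 2" unfolding inner_def inner_edge_def concat_if HE_def by auto
      then show ?thesis using HE_props[of "{u, v}"] W2 nn by (auto simp: doubleton_eq_iff)
    next
      case 3
      then show ?thesis using W2 nn by (auto simp: pairs_def W_def split: if_splits)
    next
      case 4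
      then show ?thesis using W2 nn by (auto simp: leaves_def)
    qed
  qed
  let ?k = "\<lambda>(u :: nat, v, x :: nat). {u, v}"
  have s1: "set (map ?k (pads d)) = PE d" by (auto simp: pads_def PE_def atLeast0LessThan)
  have s2: "map ?k inner = map (\<lambda>i. {label hs (fst (es ! i)) - 1, label hs (snd (es ! i)) - 1}) inner_ix"
    unfolding inner_def inner_edge_def concat_if by simp
  then have s2': "set (map ?k inner) = HE" by (simp add: HE_def)
  have s3: "set (map ?k (pairs d)) \<subseteq> {{u, N + u} |u. u < N}" by (auto simp: pairs_def split: if_splits)
  have s4: "set (map ?k (leaves d)) \<subseteq> {{2 * N, 2 * N + 1 + i} |i. i < L d}" by (auto simp: leaves_def)
  have d1: "distinct (map ?k (pads d))"
    using pad_inj[of d] by (simp add: pads_def distinct_map o_def atLeast0LessThan)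
  have d2: "distinct (map ?k inner)"
    unfolding s2 distinct_map
  proof (intro conjI inj_onI)
    fix i j assume ij: "i \<in> set inner_ix" "j \<in> set inner_ix"
      and eq: "{label hs (fst (es ! i)) - 1, label hs (snd (es ! i)) - 1} = {label hs (fst (es ! j)) - 1, label hs (snd (es ! j)) - 1}"
    have inj: "label hs x - 1 = label hs y - 1 \<Longrightarrow> x = y" if "label hs x \<noteq> 0" "label hs y \<noteq> 0" for x y
      using label_hs_cases[OF that(1)] label_hs_cases[OF that(2)] by (metis diff_Suc_1)
    have "{fst (es ! i), snd (es ! i)} = {fst (es ! j), snd (es ! j)}"
    proof -
      have nz: "label hs (fst (es ! i)) \<noteq> 0" "label hs (snd (es ! i)) \<noteq> 0" "label hs (fst (es ! j)) \<noteq> 0" "label hs (snd (es ! j)) \<noteq> 0"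
        using ij by simp_all
      show ?thesis
        using eq inj[OF nz(1,3)] inj[OF nz(2,4)] inj[OF nz(1,4)] inj[OF nz(2,3)]
        unfolding doubleton_eq_iff by argo
    qed
    then show "i = j" using ij by (intro edge_inj) auto
  qed simp
  have d3: "distinct (map ?k (pairs d))" unfolding pairs_def by (auto simp: distinct_map inj_on_def doubleton_eq_iff)
  have d4: "distinct (map ?k (leaves d))" unfolding leaves_def by (auto simp: distinct_map inj_on_def doubleton_eq_iff)
  have x0N: "2 * N < x0 d" "2 * N + 1 + i < x0 d" if "i < L d" for i using that by (auto simp: x0_def)
  have x0N': "2 * N < x0 d" by (simp add: x0_def)
  have c12: "PE d \<inter> HE = {}" using PE_props HE_props x0N' by (fastforce simp: doubleton_eq_iff)
  have pe: "e \<in> PE d \<Longrightarrow> x \<in> e \<Longrightarrow> x0 d \<le> x" for e x using PE_props[of e d] by auto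
  have he: "e \<in> HE \<Longrightarrow> x \<in> e \<Longrightarrow> x < N" for e x using HE_props[of e] by auto
  have c13: "PE d \<inter> {{u, N + u} |u. u < N} = {}" using pe x0N' by fastforce
  have c14: "PE d \<inter> {{2 * N, 2 * N + 1 + i} |i. i < L d} = {}" using pe x0N' by fastforce
  have c23: "HE \<inter> {{u, N + u} |u. u < N} = {}" using he by fastforce
  have c24: "HE \<inter> {{2 * N, 2 * N + 1 + i} |i. i < L d} = {}" using he by fastforce
  have c34: "{{u, N + u} |u. u < N} \<inter> {{2 * N, 2 * N + 1 + i} |i. i < L d} = {}" by (auto simp: doubleton_eq_iff)
  show "distinct (map (\<lambda>(u, v, x). {u, v}) (input d))"
    unfolding input_def map_append distinct_append set_append s1 s2'
  proof -
    let ?c = "set (map ?k (pairs d))" and ?l = "set (map ?k (leaves d))"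
    have i: "PE d \<inter> ?c = {}" "PE d \<inter> ?l = {}" "HE \<inter> ?c = {}" "HE \<inter> ?l = {}" "?c \<inter> ?l = {}"
      using Int_mono[OF subset_refl s3, of "PE d"] Int_mono[OF subset_refl s4, of "PE d"]
        Int_mono[OF subset_refl s3, of HE] Int_mono[OF subset_refl s4, of HE] Int_mono[OF s3 s4]
      unfolding c13 c14 c23 c24 c34 by simp_all
    show "distinct (map ?k (pads d)) \<and> (distinct (map ?k inner) \<and> (distinct (map ?k (pairs d)) \<and> distinct (map ?k (leaves d)) \<and> ?c \<inter> ?l = {}) \<and>
       HE \<inter> (?c \<union> ?l) = {}) \<and> PE d \<inter> (HE \<union> (?c \<union> ?l)) = {}"
      unfolding Int_Un_distrib i c12 using d1 d2 d3 d4 by simp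
  qed
qed

subsection \<open>Edge counts\<close>

text \<open>The padding edges alone give the lower bound, and \<open>N\<close> being at most
  \<open>2 * m\<close> gives the upper one. Bounds in the current number of edges thus become bounds
  in \<open>m\<close>.\<close>

lemma edge_count_gad:
  assumes "X \<subseteq> {..<N}" "Y \<subseteq> {N..<x0 d}"
  shows "m \<le> edge_count (gad d X Y)" "edge_count (gad d X Y) \<le> 8 * m + L d + 1"
proof -
  have fin: "finite X" "finite Y" using assms by (auto intro: finite_subset)
  have dom: "dom (gad d X Y) = PE d \<union> HE \<union> (\<lambda>u. {u, N + u}) ` X \<union> (\<lambda>y. {2 * N, y}) ` Y"
    by (auto simp: gadget_def split: if_splits)
  have fP: "finite (PE d)" "finite HE" by (simp_all add: PE_def HE_def)
  have "card (PE d) \<le> card (dom (gad d X Y))"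
    unfolding dom by (rule card_mono) (use fP fin in auto)
  then show "m \<le> edge_count (gad d X Y)" by (simp add: edge_count_def card_PE)
  have "card HE \<le> card (set inner_ix)" unfolding HE_def by (rule card_image_le) simp
  also have "\<dots> \<le> card {..<m}" by (rule card_mono) auto
  finally have "card HE \<le> m" by simp
  moreover have "card ((\<lambda>u. {u, N + u}) ` X) \<le> N"
    by (rule order_trans[OF card_image_le]) (use fin card_mono[OF _ assms(1)] in auto)
  moreover have "card ((\<lambda>y. {2 * N, y}) ` Y) \<le> N + 1 + L d"
    by (rule order_trans[OF card_image_le]) (use fin card_mono[OF _ assms(2)] in \<open>auto simp: x0_def\<close>)
  moreover have "card (dom (gad d X Y)) \<le> card (PE d) + card HE + card ((\<lambda>u. {u, N + u}) ` X) + card ((\<lambda>y. {2 * N, y}) ` Y)"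
    unfolding dom by (intro order_trans[OF card_Un_le] add_mono order_refl)
  ultimately have "edge_count (gad d X Y) \<le> m + m + N + (N + 1 + L d)"
    by (simp add: edge_count_def card_PE)
  then show "edge_count (gad d X Y) \<le> 8 * m + L d + 1" using N_bounds by linarith
qed

subsection \<open>Candidates\<close>

definition marked :: "nat \<Rightarrow> nat set" where
  "marked v = {u. u < N \<and> hs ! u \<in> set (nbrs (hs ! v))}"

lemma cands_nbr:
  assumes "d \<noteq> Quad" "v < N"
  shows "distinct (cands d v)" "set (cands d v) = marked v"
proof -
  let ?l = "nbrs (hs ! v)"
  have c: "cands d v = map (\<lambda>i. label hs (?l ! i) - 1) (filter (\<lambda>i. label hs (?l ! i) \<noteq> 0) [0..<length ?l])"
    using assms unfolding cands_def cand_label_def cand_num_def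
    by (subst concat_if[symmetric]) (auto intro!: arg_cong[where f = concat])
  show "distinct (cands d v)"
    unfolding c distinct_map
  proof (intro conjI inj_onI)
    fix i j assume ij: "i \<in> set (filter (\<lambda>i. label hs (?l ! i) \<noteq> 0) [0..<length ?l])" "j \<in> set (filter (\<lambda>i. label hs (?l ! i) \<noteq> 0) [0..<length ?l])"
      "label hs (?l ! i) - 1 = label hs (?l ! j) - 1"
    then have "label hs (?l ! i) \<noteq> 0" "label hs (?l ! j) \<noteq> 0" by auto
    then have "?l ! i = ?l ! j" using ij(3) by (metis label_hs_cases diff_Suc_1)
    then show "i = j" using ij distinct_nbrs[of "hs ! v"] by (auto simp: nth_eq_iff_index_eq)
  qed simp
  show "set (cands d v) = marked v"
  proof
    show "set (cands d v) \<subseteq> marked v"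
    proof
      fix u assume "u \<in> set (cands d v)"
      then obtain i where i: "i < length ?l" "label hs (?l ! i) \<noteq> 0" "u = label hs (?l ! i) - 1" unfolding c by auto
      obtain a where a: "a < N" "?l ! i = hs ! a" "label hs (?l ! i) = Suc a" using label_hs_cases[OF i(2)] .
      then show "u \<in> marked v" using i nth_mem[OF i(1)] by (simp add: marked_def)
    qed
    show "marked v \<subseteq> set (cands d v)"
    proof
      fix u assume u: "u \<in> marked v"
      then obtain i where i: "i < length ?l" "hs ! u = ?l ! i" by (auto simp: marked_def in_set_conv_nth)
      have "label hs (?l ! i) = Suc u" using u label_hs[of u] i(2) by (simp add: marked_def)
      then show "u \<in> set (cands d v)" unfolding c using i(1) by (auto intro!: image_eqI[of _ _ i])
    qed
  qed
qed

lemma cands_quad: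
  assumes "v < N"
  shows "distinct (cands Quad v)" "set (cands Quad v) = {..<N} - marked v"
proof -
  have c: "cands Quad v = filter (\<lambda>i. hs ! i \<notin> set (nbrs (hs ! v))) [0..<N]"
  proof -
    have "cands Quad v = concat (map (\<lambda>i. if hs ! i \<notin> set (nbrs (hs ! v)) then [i] else []) [0..<N])"
      unfolding cands_def cand_label_def cand_num_def by (auto intro!: arg_cong[where f = concat])
    also have "\<dots> = filter (\<lambda>i. hs ! i \<notin> set (nbrs (hs ! v))) [0..<N]" by (subst concat_if) simp
    finally show ?thesis .
  qed
  show "distinct (cands Quad v)" "set (cands Quad v) = {..<N} - marked v"
    unfolding c by (auto simp: marked_def)
qed

subsection \<open>The states of the graph\<close>

text \<open>The component \<open>X\<close> of the gadget once the labels in \<open>us\<close> are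
  marked; \<open>stY\<close> is its counterpart for \<open>Y\<close>.\<close>

definition stX :: "design \<Rightarrow> nat set \<Rightarrow> nat set" where
  "stX d us = (case d of Sup \<Rightarrow> {..<N} | Quad \<Rightarrow> us | _ \<Rightarrow> {..<N} - us)"
definition stY :: "design \<Rightarrow> nat set \<Rightarrow> nat set" where
  "stY d us = (case d of Sup \<Rightarrow> Y0 d \<union> (+) N ` us | _ \<Rightarrow> {})"
definition st :: "design \<Rightarrow> nat set \<Rightarrow> wgraph" where
  "st d us = gad d (stX d us) (stY d us)"

lemma st_empty: "wgraph_of (input d) = st d {}"
  unfolding wgraph_input st_def by (cases d) (auto simp: X0_def Y0_def stX_def stY_def L_def)

lemma st_sub:
  assumes "us \<subseteq> {..<N}"
  shows "stX d us \<subseteq> {..<N}" "stY d us \<subseteq> {N..<x0 d} - {2 * N}"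
proof -
  show "stX d us \<subseteq> {..<N}" using assms by (cases d) (auto simp: stX_def)
  show "stY d us \<subseteq> {N..<x0 d} - {2 * N}"
    using assms by (cases d) (auto simp: stY_def Y0_def x0_def)
qed

lemma edge_count_st:
  assumes "us \<subseteq> {..<N}"
  shows "m \<le> edge_count (st d us)" "edge_count (st d us) \<le> 8 * m + L d + 1"
  unfolding st_def using edge_count_gad[of "stX d us" "stY d us" d] st_sub[OF assms, of d] by auto

lemma pair_key: "u < N \<Longrightarrow> {u, N + u} \<notin> PE d \<and> {u, N + u} \<notin> HE"
proof -
  assume u: "u < N"
  have "u \<in> {u, N + u}" "N + u \<in> {u, N + u}" by auto
  then show ?thesis using PE_props[of "{u, N + u}" d] HE_props[of "{u, N + u}"] u by (auto simp: x0_def doubleton_eq_iff)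
qed

lemma star_key: "y < x0 d \<Longrightarrow> {2 * N, y} \<notin> PE d \<and> {2 * N, y} \<notin> HE"
  using PE_props[of "{2 * N, y}" d] HE_props[of "{2 * N, y}"] by (auto simp: x0_def doubleton_eq_iff)

lemma pair_image_diff: "(\<lambda>v. {v, N + v}) ` (X - {u}) = (\<lambda>v. {v, N + v}) ` X - {{u, N + u}}"
proof -
  have "inj (\<lambda>v. {v, N + v})" by (auto simp: inj_def doubleton_eq_iff)
  then show ?thesis by (simp add: image_set_diff)
qed

lemma remove_pair:
  assumes "u < N"
  shows "(gad d X {})({u, N + u} := None) = gad d (X - {u}) {}"
proof
  fix e
  show "((gad d X {})({u, N + u} := None)) e = gad d (X - {u}) {} e"
    using pair_key[OF assms, of d] unfolding gadget_def pair_image_diff by (cases "e = {u, N + u}") simp_all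
qed

lemma apply_mark:
  assumes u: "u < N" "u \<notin> us" "us \<subseteq> {..<N}"
  shows "apply_op (op_of (mark d u)) (st d us) = st d (insert u us)"
proof -
  have inj: "{u, N + u} = {v, N + v} \<longleftrightarrow> u = v" for v by (auto simp: doubleton_eq_iff)
  have st: "{u, N + u} \<noteq> {2 * N, y}" "{2 * N, N + u} \<noteq> {v, N + v}" if "v < N" for y v
    using u that by (auto simp: doubleton_eq_iff)
  note pk = pair_key[OF u(1), of d]
  have sk: "{2 * N, N + u} \<notin> PE d \<and> {2 * N, N + u} \<notin> HE" using u by (intro star_key) (simp add: x0_def)
  have i2: "{2 * N, N + u} = {2 * N, y} \<longleftrightarrow> y = N + u" for y by (auto simp: doubleton_eq_iff)
  show ?thesis
  proof (cases d)
    case Sup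
    have "(gad d X Y)({N + u, 2 * N} \<mapsto> W2 d) = gad d X (insert (N + u) Y)" if "X \<subseteq> {..<N}" for X Y
    proof
      fix e
      show "((gad d X Y)({N + u, 2 * N} \<mapsto> W2 d)) e = gad d X (insert (N + u) Y) e"
        using sk st(2) that by (auto simp: gadget_def insert_commute[of "N + u"])
    qed
    from this[of "{..<N}"] Sup show ?thesis by (simp add: st_def stX_def stY_def mark_def)
  next
    case Quad
    have "(gad d X Y)({u, N + u} \<mapsto> W) = gad d (insert u X) Y" for X Y
      using pk by (auto simp: gadget_def fun_eq_iff)
    then show ?thesis using Quad by (simp add: st_def stX_def stY_def mark_def)
  next
    case Dec
    note remove_pair[OF u(1)]
    moreover have "{..<N} - insert u us = {..<N} - us - {u}" by auto
    ultimately show ?thesis using Dec by (simp add: st_def stX_def stY_def mark_def)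
  next
    case Full
    note remove_pair[OF u(1)]
    moreover have "{..<N} - insert u us = {..<N} - us - {u}" by auto
    ultimately show ?thesis using Full by (simp add: st_def stX_def stY_def mark_def)
  qed
qed

lemma apply_unmark:
  assumes u: "u < N" "u \<in> us" "us \<subseteq> {..<N}"
  shows "apply_op (Insert u (N + u) W) (st Full us) = st Full (us - {u})"
proof -
  note pk = pair_key[OF u(1), of Full]
  have "(gad Full X {})({u, N + u} \<mapsto> W) = gad Full (insert u X) {}" for X
    using pk by (auto simp: gadget_def fun_eq_iff)
  moreover have "{..<N} - (us - {u}) = insert u ({..<N} - us)" using u by auto
  ultimately show ?thesis by (simp add: st_def stX_def stY_def)
qed

lemma legal_mark:
  assumes u: "u < N" "u \<notin> us" "us \<subseteq> {..<N}" and lb: "1 \<le> lb"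
  shows "legal_op (n' d) (W2 d) (st d us) (op_of (mark d u))" "kind d (op_of (mark d u))"
proof -
  have nn: "u < n' d" "N + u < n' d" "2 * N < n' d" using u by (simp_all add: n'_def x0_def)
  note pk = pair_key[OF u(1), of d] and W2 = W2_ge[OF lb, of d]
  have sk: "{2 * N, N + u} \<notin> PE d \<and> {2 * N, N + u} \<notin> HE" using u by (intro star_key) (simp add: x0_def)
  have st: "{u, N + u} \<noteq> {2 * N, y}" "v < N \<Longrightarrow> {2 * N, N + u} \<noteq> {v, N + v}" for y v
    using u by (auto simp: doubleton_eq_iff)
  show "legal_op (n' d) (W2 d) (st d us) (op_of (mark d u))"
  proof (cases d)
    case Sup
    have "N + u \<notin> Y0 d" using u by (auto simp: Y0_def)
    then have "{2 * N, N + u} \<notin> (\<lambda>y. {2 * N, y}) ` (Y0 d \<union> (+) N ` us)" using u by (auto simp: doubleton_eq_iff)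
    moreover have "{2 * N, N + u} \<notin> (\<lambda>v. {v, N + v}) ` {..<N}"
      using st(2) unfolding image_iff lessThan_iff by blast
    ultimately have "{N + u, 2 * N} \<notin> dom (st d us)"
      using sk Sup by (simp add: st_def stX_def stY_def gadget_def insert_commute[of "N + u"] domIff)
    then show ?thesis using nn u W2 Sup by (simp add: mark_def)
  next
    case Quad
    have "{u, N + u} \<notin> (\<lambda>u. {u, N + u}) ` us" using u by (auto simp: doubleton_eq_iff)
    then have "{u, N + u} \<notin> dom (st d us)"
      using pk Quad by (auto simp: st_def stX_def stY_def gadget_def split: if_splits)
    then show ?thesis using nn u W2 Quad by (simp add: mark_def W_def)
  next
    case Dec
    have "{u, N + u} \<in> dom (st d us)" using u Dec pk by (auto simp: st_def stX_def stY_def gadget_def)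
    then show ?thesis using Dec u by (simp add: mark_def)
  next
    case Full
    have "{u, N + u} \<in> dom (st d us)" using u Full pk by (auto simp: st_def stX_def stY_def gadget_def)
    then show ?thesis using Full u by (simp add: mark_def)
  qed
  show "kind d (op_of (mark d u))"
    by (cases d) (auto simp: kind_def mark_def incremental_def decremental_def fully_dynamic_def)
qed

lemma legal_unmark:
  assumes u: "u < N" "u \<in> us" "us \<subseteq> {..<N}" and lb: "1 \<le> lb"
  shows "legal_op (n' Full) (W2 Full) (st Full us) (Insert u (N + u) W)"
proof -
  note pk = pair_key[OF u(1), of Full] and W2 = W2_ge[OF lb, of Full]
  have "{u, N + u} \<notin> (\<lambda>u. {u, N + u}) ` ({..<N} - us)" using u by (auto simp: doubleton_eq_iff)
  then have "{u, N + u} \<notin> dom (st Full us)"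
    using pk by (auto simp: st_def stX_def stY_def gadget_def split: if_splits)
  then show ?thesis using u W2 by (simp add: W_def n'_def x0_def)
qed

definition tri :: "nat \<Rightarrow> bool" where
  "tri v \<longleftrightarrow> (\<exists>a b. {a, b} \<in> HE \<and> a \<in> marked v \<and> b \<in> marked v)"

lemma cands_props:
  assumes "v < N"
  shows "distinct (cands d v)" "set (cands d v) \<subseteq> {..<N}"
  using cands_nbr[of d v] cands_quad[of v] assms by (cases "d = Quad"; auto simp: marked_def)+

text \<open>In all four designs the blocked set is the complement of \<open>marked v\<close>. So the
  unblocked vertices are exactly the high neighbours of \<open>v\<close>, and an edge between two of
  them closes a triangle.\<close>

lemma answer_correct:
  assumes v: "v < N" and lam: "1 \<le> lam" "lam \<le> real lb"
    and cc: "cluster_count (n' d) (st d (set (cands d v))) lam 2 k"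
  shows "(k \<noteq> answer d (length (cands d v))) = tri v"
proof -
  let ?us = "set (cands d v)"
  note cp = cands_props[OF v, of d]
  have len: "length (cands d v) = card ?us" using cp(1) by (simp add: distinct_card)
  have fm: "finite (marked v)" "marked v \<subseteq> {..<N}" by (auto simp: marked_def)
  then have cm: "card (marked v) \<le> N" using card_mono[OF _ fm(2)] by simp
  have cY0: "card (Y0 d) = L d" "finite (Y0 d)" unfolding Y0_def by (simp_all add: card_image inj_on_def)
  interpret g: gadget_ctx N "n' d" "x0 d" lb "PE d" HE "stX d ?us" "stY d ?us" lam
  proof
    \<comment> \<open>Only \<open>Sup\<close> lets partners join the hub; its \<open>lb\<close>
      leaves make the hub large enough from the start.\<close>
    show "lb \<le> card (stY d ?us)" if "u \<in> stX d ?us" "N + u \<in> stY d ?us" for u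
    proof (cases "d = Sup")
      case True
      have "card (Y0 d) \<le> card (Y0 d \<union> (+) N ` ?us)" using cY0(2) by (intro card_mono) auto
      then show ?thesis using True cY0(1) by (simp add: stY_def L_def)
    next
      case False
      then show ?thesis using that by (cases d) (simp_all add: stY_def)
    qed
  next
    show "\<exists>a b. e = {a, b} \<and> a \<noteq> b \<and> x0 d \<le> a \<and> x0 d \<le> b \<and> a < n' d \<and> b < n' d" if "e \<in> PE d" for e
      using that by (rule PE_props)
    show "\<exists>a b. e = {a, b} \<and> a \<noteq> b \<and> a < N \<and> b < N" if "e \<in> HE" for e
      using that by (rule HE_props)
    show "stX d ?us \<subseteq> {..<N}" "stY d ?us \<subseteq> {N..<x0 d} - {2 * N}" using st_sub[OF cp(2), of d] .
    show "2 * N < x0 d" "x0 d \<le> n' d" by (simp_all add: x0_def n'_def)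
    show "1 \<le> lam" "lam \<le> real lb" using lam .
  qed
  have W: "g.W = W" by (simp add: g.W_def W_def)
  have W2: "g.W2 = W2 d" by (simp add: g.W2_def W W2_def)
  have nY0: "N + u \<notin> Y0 d" if "u < N" for u using that by (auto simp: Y0_def)
  have gA: "g.A = {u \<in> stX d ?us. N + u \<notin> stY d ?us}" by (rule g.A_def)
  have A: "g.A = {..<N} - marked v"
  proof (cases d)
    case Quad
    have "g.A = ?us" unfolding gA unfolding stX_def stY_def Quad by simp
    then show ?thesis using cands_quad(2)[OF v] Quad by simp
  next
    case Sup
    have us: "?us = marked v" using cands_nbr(2)[of d v] v Sup by simp
    have "N + u \<in> (+) N ` ?us \<longleftrightarrow> u \<in> ?us" for u by auto
    then have "g.A = {u. u < N \<and> u \<notin> ?us}" using nY0 unfolding gA unfolding stX_def stY_def Sup by auto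
    then show ?thesis unfolding us by auto
  next
    case Dec
    have us: "?us = marked v" using cands_nbr(2)[of d v] v Dec by simp
    have "g.A = {..<N} - ?us" unfolding gA unfolding stX_def stY_def Dec by auto
    then show ?thesis unfolding us .
  next
    case Full
    have us: "?us = marked v" using cands_nbr(2)[of d v] v Full by simp
    have "g.A = {..<N} - ?us" unfolding gA unfolding stX_def stY_def Full by auto
    then show ?thesis unfolding us .
  qed
  have cA: "card g.A = N - card (marked v)" unfolding A using fm by (simp add: card_Diff_subset)
  have an: "answer d (length (cands d v)) = n' d - card (stY d ?us) - card g.A"
  proof (cases d)
    case Sup
    have "card (Y0 d \<union> (+) N ` marked v) = L d + card (marked v)"
      using cY0 fm nY0 by (subst card_Un_disjoint) (auto simp: card_image marked_def)
    then show ?thesis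
      using Sup cands_nbr[of d v] v cm cA len by (simp add: answer_def stY_def)
  next
    case Quad
    then show ?thesis using cands_quad[OF v] cA len fm by (simp add: answer_def stY_def card_Diff_subset)
  next
    case Dec
    then show ?thesis using cands_nbr[of d v] v cm cA len by (simp add: answer_def stY_def n'_def x0_def)
  next
    case Full
    then show ?thesis using cands_nbr[of d v] v cm cA len by (simp add: answer_def stY_def n'_def x0_def)
  qed
  have "(k = n' d - card (stY d ?us) - card g.A) \<longleftrightarrow> \<not> (\<exists>a b. {a, b} \<in> HE \<and> a \<notin> g.A \<and> b \<notin> g.A)"
    by (rule g.cluster_count_gadget) (use cc in \<open>simp add: st_def W W2\<close>)
  moreover have "(\<exists>a b. {a, b} \<in> HE \<and> a \<notin> g.A \<and> b \<notin> g.A) \<longleftrightarrow> tri v"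
    unfolding tri_def A using HE_iff by auto
  ultimately show ?thesis using an by auto
qed

text \<open>A triangle either has a vertex of low degree, which is the head of some arc of the
  triangle, or three high vertices, each of which sees an edge between two of its marked
  neighbours.\<close>

lemma triangle_iff: "has_triangle (edges_of es) \<longleftrightarrow> low_triangle (2 * m) \<or> (\<exists>v < N. tri v)"
proof
  assume "has_triangle (edges_of es)"
  then obtain x y w where t: "{x, y} \<in> edges_of es" "{y, w} \<in> edges_of es" "{x, w} \<in> edges_of es"
    by (auto simp: has_triangle_def)
  have sym: "{a, b} \<in> edges_of es \<Longrightarrow> {b, a} \<in> edges_of es" for a b by (simp add: insert_commute)
  have low: "low_triangle (2 * m)" if abc: "{a, b} \<in> edges_of es" "{b, c} \<in> edges_of es" "{a, c} \<in> edges_of es" "deg b < \<Delta>" for a b c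
  proof -
    obtain j where j: "j < 2 * m" "tail j = a" "head j = b" using abc(1) unfolding edge_iff_arc by blast
    show ?thesis
      unfolding low_triangle_def using j abc by (intro exI[of _ j]) (auto simp: set_nbrs)
  qed
  show "low_triangle (2 * m) \<or> (\<exists>v < N. tri v)"
  proof (cases "deg x < \<Delta> \<or> deg y < \<Delta> \<or> deg w < \<Delta>")
    case True
    then show ?thesis
      using low[of y x w] low[of x y w] low[of x w y] t sym by blast
  next
    case False
    then have "x \<in> set hs" "y \<in> set hs" "w \<in> set hs" using set_high[OF \<Delta>] by auto
    then obtain a b c where abc: "a < N" "x = hs ! a" "b < N" "y = hs ! b" "c < N" "w = hs ! c"
      unfolding in_set_conv_nth N_def by blast
    have "tri a"
      unfolding tri_def marked_def using abc t
      by (intro exI[of _ b] exI[of _ c]) (simp add: HE_iff set_nbrs)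
    then show ?thesis using abc(1) by blast
  qed
next
  have tr: "has_triangle (edges_of es)" if "{a, b} \<in> edges_of es" "{b, c} \<in> edges_of es" "{a, c} \<in> edges_of es" for a b c
  proof -
    have "a \<noteq> b" "b \<noteq> c" "a \<noteq> c"
      using nbrs_less[of b a] nbrs_less[of c b] nbrs_less[of c a] that by (simp_all add: set_nbrs)
    then show ?thesis unfolding has_triangle_def using that by blast
  qed
  assume "low_triangle (2 * m) \<or> (\<exists>v < N. tri v)"
  then show "has_triangle (edges_of es)"
  proof
    assume "low_triangle (2 * m)"
    then obtain j w where j: "j < 2 * m" "w \<in> set (nbrs (head j))" "w \<in> set (nbrs (tail j))"
      by (auto simp: low_triangle_def)
    then have "{tail j, head j} \<in> edges_of es" unfolding edge_iff_arc by blast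
    then show ?thesis using j by (intro tr[of "tail j" "head j" w]) (simp_all add: set_nbrs)
  next
    assume "\<exists>v < N. tri v"
    then obtain v a b where "{a, b} \<in> HE" "a \<in> marked v" "b \<in> marked v" by (auto simp: tri_def)
    then show ?thesis
      by (intro tr[of "hs ! v" "hs ! a" "hs ! b"]) (simp_all add: HE_iff marked_def set_nbrs)
  qed
qed

end

section \<open>Expected work of the clustering algorithm on the script\<close>

lemma run_op_add_work: "run_op D U r (s, w) = map_spmf (add_work w) (run_op D U r (s, 0))"
  by (cases r) (simp_all add: exec_work0[of _ _ _ w])

lemma run_ops_snoc: "run_ops D U (rs @ [r]) = (\<lambda>\<sigma>. bind_spmf (run_ops D U rs \<sigma>) (run_op D U r))"
proof (induction rs)
  case Nil
  have "run_ops D U [] = return_spmf" by (rule ext) simp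
  then show ?case by (intro ext) simp
next
  case (Cons a rs)
  show ?case by (rule ext) (simp add: Cons.IH)
qed

lemma run_dyn_snoc: "run_dyn D n U es (rs @ [r]) = bind_spmf (run_dyn D n U es rs) (run_op D U r)"
  by (simp add: run_dyn_def run_ops_snoc)

lemma tot_run_op_fst:
  "tot (run_op D U r \<sigma>) (\<lambda>\<sigma>'. H (fst \<sigma>')) = tot (run_op D U r (fst \<sigma>, 0)) (\<lambda>\<sigma>'. H (fst \<sigma>'))"
proof -
  obtain s w where \<sigma>: "\<sigma> = (s, w)" by (cases \<sigma>)
  show ?thesis unfolding \<sigma> fst_conv run_op_add_work[of D U r s w] by (simp add: tot_map case_prod_beta)
qed

lemma tot_run_op_work:
  assumes "lossless_spmf (run_op D U r \<sigma>)"
  shows "of_nat (snd \<sigma>) + tot (run_op D U r (fst \<sigma>, 0)) (\<lambda>\<sigma>'. of_nat (snd \<sigma>') + H (fst \<sigma>')) =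
    tot (run_op D U r \<sigma>) (\<lambda>\<sigma>'. of_nat (snd \<sigma>') + H (fst \<sigma>'))"
proof -
  obtain s w where \<sigma>: "\<sigma> = (s, w)" by (cases \<sigma>)
  have ll: "lossless_spmf (run_op D U r (s, 0))"
    using assms unfolding \<sigma> run_op_add_work[of D U r s w] by simp
  have "tot (run_op D U r (s, w)) (\<lambda>\<sigma>'. of_nat (snd \<sigma>') + H (fst \<sigma>')) =
      tot (run_op D U r (s, 0)) (\<lambda>\<sigma>'. of_nat w + (of_nat (snd \<sigma>') + H (fst \<sigma>')))"
    unfolding run_op_add_work[of D U r s w] by (auto simp: tot_map case_prod_beta add_ac intro!: tot_cong)
  also have "\<dots> = of_nat w + tot (run_op D U r (s, 0)) (\<lambda>\<sigma>'. of_nat (snd \<sigma>') + H (fst \<sigma>'))"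
    by (simp add: tot_add tot_const[OF ll])
  finally show ?thesis by (simp add: \<sigma>)
qed

lemma legal_ops_snoc:
  "legal_ops A Q n U G rs \<Longrightarrow> A r \<Longrightarrow> legal_op n U (fold apply_op rs G) r \<Longrightarrow>
   Q n (edge_count (apply_op r (fold apply_op rs G))) \<Longrightarrow> legal_ops A Q n U G (rs @ [r])"
proof (induction rs arbitrary: G)
  case Nil
  then show ?case by simp
next
  case (Cons a rs)
  then show ?case by simp
qed

fun penalty :: "item \<Rightarrow> mem \<Rightarrow> ennreal" where
  "penalty (Ask p q k t) m = (if (m 0 0 \<noteq> k) = t then 0 else \<infinity>)"
| "penalty _ m = 0"

lemma script_work_Cons:
  "it \<noteq> Reset \<Longrightarrow> script_work D U (it # its) b m =
    tot (run_op D U (op_of it) (m, 0)) (\<lambda>\<sigma>. of_nat (snd \<sigma>) + (penalty it (fst \<sigma>) + script_work D U its b (fst \<sigma>)))"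
  by (cases it) (simp_all add: result_def)

text \<open>What follows a \<open>Reset\<close> starts from \<open>b\<close> whatever came before,
  so its cost is a constant that can be taken out of the expectation.\<close>

lemma script_work_Reset_le:
  "Reset \<notin> set ph \<Longrightarrow> script_work D U (ph @ Reset # rest) b m \<le> script_work D U ph b m + script_work D U rest b b"
proof (induction ph arbitrary: m)
  case (Cons it ph)
  then have it: "it \<noteq> Reset" and ph: "Reset \<notin> set ph" by auto
  let ?R = "run_op D U (op_of it) (m, 0)"
  have "script_work D U ((it # ph) @ Reset # rest) b m =
      tot ?R (\<lambda>\<sigma>. of_nat (snd \<sigma>) + (penalty it (fst \<sigma>) + script_work D U (ph @ Reset # rest) b (fst \<sigma>)))"
    using script_work_Cons[OF it] by simp
  also have "\<dots> \<le> tot ?R (\<lambda>\<sigma>. (of_nat (snd \<sigma>) + (penalty it (fst \<sigma>) + script_work D U ph b (fst \<sigma>))) + script_work D U rest b b)"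
  proof (rule tot_mono)
    fix \<sigma> :: config
    have "script_work D U (ph @ Reset # rest) b (fst \<sigma>) \<le> script_work D U ph b (fst \<sigma>) + script_work D U rest b b"
      by (rule Cons.IH[OF ph])
    then show "of_nat (snd \<sigma>) + (penalty it (fst \<sigma>) + script_work D U (ph @ Reset # rest) b (fst \<sigma>)) \<le>
        (of_nat (snd \<sigma>) + (penalty it (fst \<sigma>) + script_work D U ph b (fst \<sigma>))) + script_work D U rest b b"
      unfolding add.assoc by (intro add_left_mono)
  qed
  also have "\<dots> \<le> script_work D U (it # ph) b m + script_work D U rest b b"
    unfolding script_work_Cons[OF it] by (rule tot_add_const_le)
  finally show ?case .
qed simp

lemma script_work_phases_le:
  assumes "\<And>v. v \<in> set vs \<Longrightarrow> Reset \<notin> set (ph v)"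
  shows "script_work D U (concat (map (\<lambda>v. ph v @ [Reset]) vs)) b b \<le> (\<Sum>v\<leftarrow>vs. script_work D U (ph v) b b)"
  using assms
proof (induction vs)
  case (Cons v vs)
  have "script_work D U (concat (map (\<lambda>v. ph v @ [Reset]) (v # vs))) b b =
      script_work D U (ph v @ Reset # concat (map (\<lambda>v. ph v @ [Reset]) vs)) b b" by simp
  also have "\<dots> \<le> script_work D U (ph v) b b + script_work D U (concat (map (\<lambda>v. ph v @ [Reset]) vs)) b b"
    using Cons.prems by (intro script_work_Reset_le) simp
  also have "\<dots> \<le> script_work D U (ph v) b b + (\<Sum>v\<leftarrow>vs. script_work D U (ph v) b b)"
    using Cons by (intro add_left_mono Cons.IH) simp
  finally show ?case by simp
qed simp

text \<open>Without \<open>Reset\<close> the snapshot is never consulted. This lets a fixed dummy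
  replace the random memory left by the preprocessing, as the bounds for single histories
  expect.\<close>

lemma script_work_base: "Reset \<notin> set its \<Longrightarrow> script_work D U its b m = script_work D U its b' m"
proof (induction its arbitrary: m)
  case (Cons it its)
  then have it: "it \<noteq> Reset" and "Reset \<notin> set its" by auto
  then have "script_work D U its b = script_work D U its b'" using Cons.IH by (intro ext) simp
  then show ?case unfolding script_work_Cons[OF it] by simp
qed simp

text \<open>\<open>TP\<close>, \<open>TU\<close> and \<open>TQ\<close> bound the three costs
  uniformly over all edge counts that can occur, which removes the dependence on the current
  graph.\<close>

locale red_ctx = prog_ctx B V z n es \<Delta> lb P for B V z n es \<Delta> lb P +
  fixes D :: dyn_alg and d :: design and lamf tp tu tq :: "nat \<Rightarrow> real" and Qc :: gclass and TP TU TQ :: ennreal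
  assumes solves: "solves_count_hac (kind d) Qc lamf D"
    and Qc: "\<And>k. length es \<le> k \<Longrightarrow> Qc (n' d) k"
    and lamf: "\<And>k. length es \<le> k \<Longrightarrow> k \<le> 8 * length es + lb + 1 \<Longrightarrow> 1 \<le> lamf k \<and> lamf k \<le> real lb"
    and TU: "\<And>k. length es \<le> k \<Longrightarrow> k \<le> 8 * length es + lb + 1 \<Longrightarrow> ennreal (tu k) \<le> TU"
    and TQ: "\<And>k. length es \<le> k \<Longrightarrow> k \<le> 8 * length es + lb + 1 \<Longrightarrow> ennreal (tq k) \<le> TQ"
    and TP: "\<And>k. length es \<le> k \<Longrightarrow> k \<le> 8 * length es + lb + 1 \<Longrightarrow> ennreal (tp k) \<le> TP"
    and bounds: "if d = Full then amortized_bounds (kind d) Qc tp tu tq D else worst_case_bounds (kind d) Qc tp tu tq D"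
begin

abbreviation U :: nat where "U \<equiv> W2 d"

lemma lb_pos: "1 \<le> lb"
  using lamf[of m] by simp

definition in_range :: "wgraph \<Rightarrow> bool" where
  "in_range G \<longleftrightarrow> m \<le> edge_count G \<and> edge_count G \<le> 8 * m + lb + 1"

lemma in_range_st: "us \<subseteq> {..<N} \<Longrightarrow> in_range (st d us)"
  using edge_count_st[of us d] by (simp add: in_range_def L_def split: if_splits)

definition correct_ask :: "wgraph \<Rightarrow> item \<Rightarrow> bool" where
  "correct_ask G it \<longleftrightarrow> (\<forall>p q c t. it = Ask p q c t \<longrightarrow> p = 2 \<and> q = 1 \<and>
     (\<exists>v < N. c = answer d (length (cands d v)) \<and> t = tri v \<and> G = st d (set (cands d v))))"

text \<open>Legality of every operation in the state that it meets, together with soundness of the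
  ghosts: what it takes to run the items as one honest history of the dynamic algorithm.\<close>

primrec good :: "item list \<Rightarrow> wgraph \<Rightarrow> bool" where
  "good [] G \<longleftrightarrow> in_range G"
| "good (it # its) G \<longleftrightarrow> in_range G \<and> it \<noteq> Reset \<and> kind d (op_of it) \<and> legal_op (n' d) U G (op_of it) \<and>
     correct_ask G it \<and> good its (apply_op (op_of it) G)"

lemma good_in_range: "good its G \<Longrightarrow> in_range G"
  by (cases its) simp_all

lemma good_no_Reset: "good its G \<Longrightarrow> Reset \<notin> set its"
  by (induction its arbitrary: G) auto

lemma mark_simps [simp]: "mark d' u \<noteq> Reset" "mark d' u \<noteq> Ask p q c t"
  by (cases d'; simp add: mark_def)+

lemma good_marks:
  "distinct us \<Longrightarrow> set us \<subseteq> {..<N} \<Longrightarrow> A \<subseteq> {..<N} \<Longrightarrow> A \<inter> set us = {} \<Longrightarrow> good rest (st d (A \<union> set us)) \<Longrightarrow>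
   good (map (mark d) us @ rest) (st d A)"
proof (induction us arbitrary: A)
  case (Cons u us)
  have u: "u < N" "u \<notin> A" using Cons.prems by auto
  have c: "correct_ask (st d A) (mark d u)" by (simp add: correct_ask_def)
  have e: "insert u A \<union> set us = A \<union> set (u # us)" by auto
  have "distinct us" "set us \<subseteq> {..<N}" "insert u A \<subseteq> {..<N}" "insert u A \<inter> set us = {}"
    using Cons.prems(1-4) u by auto
  moreover have "good rest (st d (insert u A \<union> set us))" unfolding e by (rule Cons.prems(5))
  ultimately have g: "good (map (mark d) us @ rest) (st d (insert u A))"
    by (rule Cons.IH)
  have "in_range (st d A)" by (rule in_range_st[OF Cons.prems(3)])
  then show ?case
    using legal_mark[OF u Cons.prems(3) lb_pos, of d] c g
    by (simp only: list.map append_Cons good.simps apply_mark[OF u Cons.prems(3), of d] mark_simps simp_thms)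
qed simp

lemma good_unmarks:
  assumes "d = Full"
  shows "distinct us \<Longrightarrow> set us \<subseteq> A \<Longrightarrow> A \<subseteq> {..<N} \<Longrightarrow> good rest (st d (A - set us)) \<Longrightarrow>
   good (map (\<lambda>u. Ins u (N + u) W) us @ rest) (st d A)"
proof (induction us arbitrary: A)
  case (Cons u us)
  have u: "u < N" "u \<in> A" using Cons.prems by auto
  have "A - insert u (set us) = (A - {u}) - set us" by auto
  then have "good (map (\<lambda>u. Ins u (N + u) W) us @ rest) (st d (A - {u}))"
    using Cons.prems by (intro Cons.IH) auto
  moreover have "legal_op (n' d) U (st d A) (op_of (Ins u (N + u) W))"
    using legal_unmark[OF u Cons.prems(3) lb_pos] assms by simp
  moreover have "apply_op (op_of (Ins u (N + u) W)) (st d A) = st d (A - {u})"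
    using apply_unmark[OF u Cons.prems(3)] assms by simp
  moreover have "kind d (op_of (Ins u (N + u) W))" using assms by (simp add: kind_def fully_dynamic_def)
  moreover have "correct_ask (st d A) (Ins u (N + u) W)" by (simp add: correct_ask_def)
  moreover have "in_range (st d A)" by (rule in_range_st[OF Cons.prems(3)])
  ultimately show ?case by (simp only: list.map append_Cons good.simps item.distinct simp_thms)
qed simp

lemma good_ask:
  assumes "v < N" "good rest (st d (set (cands d v)))"
  shows "good (Ask 2 1 (answer d (length (cands d v))) (tri v) # rest) (st d (set (cands d v)))"
proof -
  have "2 \<le> U" using W2_ge[OF lb_pos, of d] by simp
  moreover have "kind d (Query 2 1)"
    by (cases d) (simp_all add: kind_def incremental_def decremental_def fully_dynamic_def)
  ultimately show ?thesis
    using assms good_in_range[OF assms(2)] by (auto simp: correct_ask_def)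
qed

text \<open>A phase up to its rollback, that is, the part that the algorithm sees as one continuous
  history.\<close>

definition probe :: "nat \<Rightarrow> item list" where
  "probe v = map (mark d) (cands d v) @ [Ask 2 1 (answer d (length (cands d v))) (tri v)]"

lemma good_probe: "v < N \<Longrightarrow> good (probe v) (st d {})"
  unfolding probe_def
proof (rule good_marks)
  assume v: "v < N"
  note cp = cands_props[OF v, of d]
  have "good [] (st d (set (cands d v)))" using in_range_st[OF cp(2)] by simp
  then show "good [Ask 2 1 (answer d (length (cands d v))) (tri v)] (st d ({} \<union> set (cands d v)))"
    unfolding Un_empty_left by (rule good_ask[OF v])
qed (use cands_props[of v d] in auto)

lemma good_full:
  assumes "d = Full" "set vs \<subseteq> {..<N}"
  shows "good (concat (map (phase d tri) vs)) (st d {})"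
  using assms(2)
proof (induction vs)
  case Nil
  then show ?case using in_range_st[of "{}"] by simp
next
  case (Cons v vs)
  then have v: "v < N" by simp
  note cp = cands_props[OF v, of d]
  have "good (map (\<lambda>u. Ins u (N + u) W) (cands d v) @ concat (map (phase d tri) vs)) (st d (set (cands d v)))"
    using Cons cp by (intro good_unmarks[OF assms(1)]) auto
  then have "good (Ask 2 1 (answer d (length (cands d v))) (tri v) #
      (map (\<lambda>u. Ins u (N + u) W) (cands d v) @ concat (map (phase d tri) vs))) (st d (set (cands d v)))"
    by (rule good_ask[OF v])
  then have "good (map (mark d) (cands d v) @ Ask 2 1 (answer d (length (cands d v))) (tri v) #
      (map (\<lambda>u. Ins u (N + u) W) (cands d v) @ concat (map (phase d tri) vs))) (st d {})"
    using cp by (intro good_marks) auto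
  moreover have "phase d tri v = map (mark d) (cands d v) @ Ask 2 1 (answer d (length (cands d v))) (tri v) #
      map (\<lambda>u. Ins u (N + u) W) (cands d v)"
    using assms(1) by (simp add: phase_def)
  ultimately show ?case by (simp only: list.map concat.simps append_assoc append_Cons)
qed

abbreviation G0 :: wgraph where "G0 \<equiv> wgraph_of (input d)"
abbreviation run :: "op list \<Rightarrow> config spmf" where "run \<equiv> run_dyn D (n' d) U (input d)"
abbreviation legal :: "op list \<Rightarrow> bool" where "legal \<equiv> legal_ops (kind d) Qc (n' d) U G0"

lemma legal_in: "legal_input (n' d) U (input d)"
  by (rule legal_input_input[OF lb_pos])

lemma run_lossless: "legal rs \<Longrightarrow> lossless_spmf (run rs)"
  using solves legal_in unfolding solves_count_hac_def by blast

lemma good_legal_snoc: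
  assumes "legal rs" "good (it # its) (fold apply_op rs G0)"
  shows "legal (rs @ [op_of it])"
proof (rule legal_ops_snoc[OF assms(1)])
  have "in_range (apply_op (op_of it) (fold apply_op rs G0))" using assms(2) good_in_range unfolding good.simps by blast
  then show "Qc (n' d) (edge_count (apply_op (op_of it) (fold apply_op rs G0)))"
    by (intro Qc) (simp add: in_range_def)
qed (use assms(2) in auto)

lemma no_penalty:
  assumes "legal rs" "good (it # its) (fold apply_op rs G0)" "\<sigma> \<in> set_spmf (run (rs @ [op_of it]))"
  shows "penalty it (fst \<sigma>) = 0"
proof (cases it)
  case (Ask p q c t)
  let ?G = "fold apply_op rs G0"
  have l: "legal (rs @ [Query p q])" using good_legal_snoc[OF assms(1,2)] Ask by simp
  obtain v where v: "p = 2" "q = 1" "v < N" "c = answer d (length (cands d v))" "t = tri v" "?G = st d (set (cands d v))"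
    using assms(2) Ask by (auto simp: correct_ask_def)
  have "\<forall>rs' p' q'. rs @ [Query p q] = rs' @ [Query p' q'] \<longrightarrow>
      (let G = fold apply_op rs' G0 in \<forall>\<sigma>\<in>set_spmf (run (rs @ [Query p q])).
         cluster_count (n' d) G (lamf (edge_count G)) (real p' / real q') (result \<sigma>))"
    using solves legal_in l unfolding solves_count_hac_def by blast
  then have "cluster_count (n' d) ?G (lamf (edge_count ?G)) (real p / real q) (result \<sigma>)"
    using assms(3) Ask unfolding Let_def by auto
  then have cc: "cluster_count (n' d) (st d (set (cands d v))) (lamf (edge_count ?G)) 2 (result \<sigma>)"
    using v by simp
  have "in_range ?G" using good_in_range[OF assms(2)] .
  then have lam: "1 \<le> lamf (edge_count ?G)" "lamf (edge_count ?G) \<le> real lb"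
    using lamf by (auto simp: in_range_def)
  show ?thesis
    using answer_correct[OF v(3) lam cc] v Ask by (simp add: result_def)
qed simp_all

definition item_budget :: "item \<Rightarrow> ennreal" where
  "item_budget it = (if is_query (op_of it) then TQ else TU)"

lemma item_budget:
  "in_range G \<Longrightarrow> ennreal ((if is_query (op_of it) then tq else tu) (edge_count G)) \<le> item_budget it"
  using TU TQ by (simp add: item_budget_def in_range_def)

text \<open>The prefix \<open>rs\<close> already executed is generalised. The cost of the next item,
  averaged over the memories that \<open>rs\<close> leaves behind, is its \<open>op_work\<close>,
  which the hypothesis bounds after every legal history.\<close>

lemma worst_case_work:
  assumes "d \<noteq> Full"
  shows "legal rs \<Longrightarrow> good its (fold apply_op rs G0) \<Longrightarrow>
    tot (run rs) (\<lambda>\<sigma>. script_work D U its b (fst \<sigma>)) \<le> (\<Sum>it\<leftarrow>its. item_budget it)"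
proof (induction its arbitrary: rs)
  case Nil
  then show ?case using tot_const[OF run_lossless, of rs 0] by simp
next
  case (Cons it its)
  let ?r = "op_of it"
  have it: "it \<noteq> Reset" using Cons.prems by simp
  have l: "legal (rs @ [?r])" by (rule good_legal_snoc[OF Cons.prems])
  let ?H = "\<lambda>m. penalty it m + script_work D U its b m"
  have "tot (run rs) (\<lambda>\<sigma>. script_work D U (it # its) b (fst \<sigma>)) =
      tot (run rs) (\<lambda>\<sigma>. tot (run_op D U ?r (fst \<sigma>, 0)) (\<lambda>\<sigma>'. of_nat (snd \<sigma>')) + tot (run_op D U ?r (fst \<sigma>, 0)) (\<lambda>\<sigma>'. ?H (fst \<sigma>')))"
    by (simp only: script_work_Cons[OF it] tot_add)
  also have "\<dots> = tot (run rs) (\<lambda>\<sigma>. tot (run_op D U ?r (fst \<sigma>, 0)) (\<lambda>\<sigma>'. of_nat (snd \<sigma>'))) + tot (run (rs @ [?r])) (\<lambda>\<sigma>'. ?H (fst \<sigma>'))"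
  proof -
    have "tot (run (rs @ [?r])) (\<lambda>\<sigma>'. ?H (fst \<sigma>')) = tot (run rs) (\<lambda>\<sigma>. tot (run_op D U ?r \<sigma>) (\<lambda>\<sigma>'. ?H (fst \<sigma>')))"
      unfolding run_dyn_snoc by (rule tot_bind)
    also have "\<dots> = tot (run rs) (\<lambda>\<sigma>. tot (run_op D U ?r (fst \<sigma>, 0)) (\<lambda>\<sigma>'. ?H (fst \<sigma>')))"
      by (intro tot_cong tot_run_op_fst[of D U ?r _ ?H])
    finally show ?thesis by (simp only: tot_add)
  qed
  also have "tot (run rs) (\<lambda>\<sigma>. tot (run_op D U ?r (fst \<sigma>, 0)) (\<lambda>\<sigma>'. of_nat (snd \<sigma>'))) = op_work D (n' d) U (input d) rs ?r"
  proof -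
    have "lossless_spmf (bind_spmf (run rs) (run_op D U ?r))" using run_lossless[OF l] by (simp add: run_dyn_snoc)
    then have "lossless_spmf (run_op D U ?r (s, w))" if "(s, w) \<in> set_spmf (run rs)" for s w using that by simp
    moreover have "lossless_spmf (run_op D U ?r (s, w)) = lossless_spmf (run_op D U ?r (s, 0))" for s w
      unfolding run_op_add_work[of D U ?r s w] by simp
    ultimately have "lossless_spmf (run_op D U ?r (fst \<sigma>, 0))" if "\<sigma> \<in> set_spmf (run rs)" for \<sigma>
      using that by (metis prod.collapse)
    then have "lossless_spmf (bind_spmf (run rs) (\<lambda>\<sigma>. run_op D U ?r (fst \<sigma>, 0)))"
      using run_lossless[OF Cons.prems(1)] by simp
    then show ?thesis unfolding op_work_def by (simp add: expected_work_tot tot_bind)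
  qed
  also have "\<dots> \<le> item_budget it"
  proof (rule order_trans[OF _ item_budget])
    show "in_range (fold apply_op rs G0)" using good_in_range[OF Cons.prems(2)] .
    show "op_work D (n' d) U (input d) rs ?r \<le> ennreal ((if is_query ?r then tq else tu) (edge_count (fold apply_op rs G0)))"
      using bounds assms legal_in l unfolding worst_case_bounds_def by auto
  qed
  also have "tot (run (rs @ [?r])) (\<lambda>\<sigma>'. ?H (fst \<sigma>')) = tot (run (rs @ [?r])) (\<lambda>\<sigma>'. script_work D U its b (fst \<sigma>'))"
    using no_penalty[OF Cons.prems] by (intro tot_cong) simp
  also have "\<dots> \<le> (\<Sum>it\<leftarrow>its. item_budget it)"
    using Cons.prems by (intro Cons.IH l) simp
  finally show ?case by (simp add: add_left_mono add_right_mono)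
qed

text \<open>Amortized bounds speak of whole histories only, so the script is compared with the total
  work of its full history instead of being summed item by item.\<close>

lemma amortized_work:
  shows "legal rs \<Longrightarrow> good its (fold apply_op rs G0) \<Longrightarrow>
    legal (rs @ map op_of its) \<and>
    tot (run rs) (\<lambda>\<sigma>. of_nat (snd \<sigma>) + script_work D U its b (fst \<sigma>)) \<le> expected_work (run (rs @ map op_of its))"
proof (induction its arbitrary: rs)
  case Nil
  then show ?case using expected_work_tot[OF run_lossless, of rs] by simp
next
  case (Cons it its)
  let ?r = "op_of it"
  have it: "it \<noteq> Reset" using Cons.prems by simp
  have l: "legal (rs @ [?r])" by (rule good_legal_snoc[OF Cons.prems])
  let ?H = "\<lambda>m. penalty it m + script_work D U its b m"
  have ll: "lossless_spmf (run_op D U ?r \<sigma>)" if "\<sigma> \<in> set_spmf (run rs)" for \<sigma>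
    using run_lossless[OF l] that by (simp add: run_dyn_snoc)
  have "tot (run rs) (\<lambda>\<sigma>. of_nat (snd \<sigma>) + script_work D U (it # its) b (fst \<sigma>)) =
      tot (run rs) (\<lambda>\<sigma>. tot (run_op D U ?r \<sigma>) (\<lambda>\<sigma>'. of_nat (snd \<sigma>') + ?H (fst \<sigma>')))"
    unfolding script_work_Cons[OF it] by (intro tot_cong tot_run_op_work ll)
  also have "\<dots> = tot (run (rs @ [?r])) (\<lambda>\<sigma>'. of_nat (snd \<sigma>') + ?H (fst \<sigma>'))"
    by (simp add: run_dyn_snoc tot_bind)
  also have "\<dots> = tot (run (rs @ [?r])) (\<lambda>\<sigma>'. of_nat (snd \<sigma>') + script_work D U its b (fst \<sigma>'))"
    using no_penalty[OF Cons.prems] by (intro tot_cong) simp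
  finally show ?case
    using Cons.IH[OF l] Cons.prems by simp
qed

lemma budget_le: "good its G \<Longrightarrow> op_budget tu tq G (map op_of its) \<le> (\<Sum>it\<leftarrow>its. item_budget it)"
proof (induction its arbitrary: G)
  case (Cons it its)
  then show ?case using item_budget[of G it] by (auto intro!: add_mono)
qed simp

lemma is_query_simps [simp]: "is_query (op_of (mark d' u)) = False"
  by (cases d') (simp_all add: mark_def)

lemma budget_phase: "(\<Sum>it\<leftarrow>probe v. item_budget it) \<le> of_nat (2 * cand_num d v) * TU + TQ"
  "d = Full \<Longrightarrow> (\<Sum>it\<leftarrow>phase d tri v. item_budget it) \<le> of_nat (2 * cand_num d v) * TU + TQ"
proof -
  have m: "(\<Sum>it\<leftarrow>map (mark d) us. item_budget it) = of_nat (length us) * TU" for us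
    by (induction us) (simp_all add: item_budget_def distrib_right)
  have i: "(\<Sum>it\<leftarrow>map (\<lambda>u. Ins u (N + u) W) us. item_budget it) = of_nat (length us) * TU" for us
    by (induction us) (simp_all add: item_budget_def distrib_right)
  have l: "length (cands d v) \<le> cand_num d v" by (rule length_cands)
  have 1: "of_nat (length (cands d v)) * TU + TQ \<le> of_nat (2 * cand_num d v) * TU + TQ"
    using l by (intro add_right_mono mult_right_mono) (simp only: of_nat_le_iff, simp)
  have "(\<Sum>it\<leftarrow>probe v. item_budget it) = of_nat (length (cands d v)) * TU + TQ"
    unfolding probe_def map_append sum_list.append m by (simp add: item_budget_def)
  then show "(\<Sum>it\<leftarrow>probe v. item_budget it) \<le> of_nat (2 * cand_num d v) * TU + TQ" using 1 by simp
  assume F: "d = Full"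
  have q: "item_budget (Ask p q k t) = TQ" for p q k t by (simp add: item_budget_def)
  have "(\<Sum>it\<leftarrow>phase d tri v. item_budget it) =
      of_nat (length (cands d v)) * TU + (TQ + of_nat (length (cands d v)) * TU)"
    unfolding phase_def if_P[OF F] map_append list.map sum_list.append sum_list.Cons sum_list.Nil m i q add_0_right by (rule refl)
  also have "\<dots> = of_nat (length (cands d v) + length (cands d v)) * TU + TQ"
    by (simp only: of_nat_add distrib_right add_ac)
  also have "\<dots> \<le> of_nat (2 * cand_num d v) * TU + TQ"
    using l by (intro add_right_mono mult_right_mono) (simp only: of_nat_le_iff, simp_all)
  finally show "(\<Sum>it\<leftarrow>phase d tri v. item_budget it) \<le> of_nat (2 * cand_num d v) * TU + TQ" .
qed

lemma legal_Nil: "legal []"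
proof -
  have "in_range G0" unfolding st_empty by (rule in_range_st) simp
  then show ?thesis by (simp add: Qc in_range_def)
qed

theorem total_work:
  "tot (run_preprocess D (n' d) U (input d)) (\<lambda>\<sigma>. of_nat (snd \<sigma>) + script_work D U (script d tri) (fst \<sigma>) (fst \<sigma>))
    \<le> TP + (\<Sum>v<N. of_nat (2 * cand_num d v) * TU + TQ)"
proof -
  let ?pre = "run_preprocess D (n' d) U (input d)"
  have runN: "run [] = ?pre" 
  proof -
    have "run_ops D U [] = return_spmf" by (rule ext) simp
    then show ?thesis by (simp add: run_dyn_def)
  qed
  have len: "m \<le> length (input d)" "length (input d) \<le> 8 * m + lb + 1"
    using length_input[of d] N_bounds by (auto simp: L_def split: if_splits)
  have sl: "(\<Sum>v\<leftarrow>[0..<N]. f v) = (\<Sum>v<N. f v)" for f :: "nat \<Rightarrow> ennreal"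
    by (simp add: interv_sum_list_conv_sum_set_nat atLeast0LessThan)
  show ?thesis
  proof (cases "d = Full")
    case True
    let ?its = "script d tri"
    have g: "good ?its G0" unfolding script_def st_empty by (rule good_full[OF True]) auto
    have nr: "Reset \<notin> set ?its" by (rule good_no_Reset[OF g])
    have aw: "legal (map op_of ?its)" "tot ?pre (\<lambda>\<sigma>. of_nat (snd \<sigma>) + script_work D U ?its undefined (fst \<sigma>)) \<le> expected_work (run (map op_of ?its))"
      using amortized_work[OF legal_Nil, of ?its undefined] g runN by simp_all
    have "tot ?pre (\<lambda>\<sigma>. of_nat (snd \<sigma>) + script_work D U ?its (fst \<sigma>) (fst \<sigma>)) =
        tot ?pre (\<lambda>\<sigma>. of_nat (snd \<sigma>) + script_work D U ?its undefined (fst \<sigma>))"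
      by (intro tot_cong arg_cong2[where f = "(+)"] script_work_base[OF nr] refl)
    also have "\<dots> \<le> expected_work (run (map op_of ?its))" by (rule aw(2))
    also have "\<dots> \<le> ennreal (tp (length (input d))) + op_budget tu tq G0 (map op_of ?its)"
      using bounds True legal_in aw(1) unfolding amortized_bounds_def by simp
    also have "\<dots> \<le> TP + (\<Sum>it\<leftarrow>?its. item_budget it)"
      by (intro add_mono TP len budget_le g)
    also have "(\<Sum>it\<leftarrow>?its. item_budget it) = (\<Sum>v\<leftarrow>[0..<N]. \<Sum>it\<leftarrow>phase d tri v. item_budget it)"
    proof -
      have "(\<Sum>it\<leftarrow>concat (map (phase d tri) vs). item_budget it) = (\<Sum>v\<leftarrow>vs. \<Sum>it\<leftarrow>phase d tri v. item_budget it)" for vs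
        by (induction vs) simp_all
      then show ?thesis by (simp only: script_def)
    qed
    also have "\<dots> \<le> (\<Sum>v\<leftarrow>[0..<N]. of_nat (2 * cand_num d v) * TU + TQ)"
      by (intro sum_list_mono budget_phase(2)[OF True])
    finally show ?thesis unfolding sl by (simp add: add_left_mono)
  next
    case False
    have sc: "script d tri = concat (map (\<lambda>v. probe v @ [Reset]) [0..<N])"
    proof -
      have "phase d tri = (\<lambda>v. probe v @ [Reset])"
        unfolding phase_def if_not_P[OF False] probe_def by (rule ext) simp
      then show ?thesis by (simp only: script_def)
    qed
    have nr: "Reset \<notin> set (probe v)" if "v < N" for v using good_no_Reset[OF good_probe[OF that]] .
    \<comment> \<open>Thanks to the rollbacks every probe starts from the memory left by the
      preprocessing. Linearity allows the probes to be bounded one at a time, as histories of their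
      own, although they share the random choices made there.\<close>
    have "tot ?pre (\<lambda>\<sigma>. of_nat (snd \<sigma>) + script_work D U (script d tri) (fst \<sigma>) (fst \<sigma>)) \<le>
        tot ?pre (\<lambda>\<sigma>. of_nat (snd \<sigma>) + (\<Sum>v\<leftarrow>[0..<N]. script_work D U (probe v) undefined (fst \<sigma>)))"
    proof (rule tot_mono)
      fix \<sigma> :: config
      have "script_work D U (script d tri) (fst \<sigma>) (fst \<sigma>) \<le> (\<Sum>v\<leftarrow>[0..<N]. script_work D U (probe v) (fst \<sigma>) (fst \<sigma>))"
        unfolding sc by (rule script_work_phases_le) (use nr in simp)
      also have "\<dots> = (\<Sum>v\<leftarrow>[0..<N]. script_work D U (probe v) undefined (fst \<sigma>))"
        by (intro arg_cong[where f = sum_list] map_cong refl script_work_base nr) simp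
      finally show "of_nat (snd \<sigma>) + script_work D U (script d tri) (fst \<sigma>) (fst \<sigma>) \<le>
          of_nat (snd \<sigma>) + (\<Sum>v\<leftarrow>[0..<N]. script_work D U (probe v) undefined (fst \<sigma>))"
        by (rule add_left_mono)
    qed
    also have "\<dots> = tot ?pre (\<lambda>\<sigma>. of_nat (snd \<sigma>)) + tot ?pre (\<lambda>\<sigma>. \<Sum>v\<leftarrow>[0..<N]. script_work D U (probe v) undefined (fst \<sigma>))"
      by (rule tot_add)
    also have "tot ?pre (\<lambda>\<sigma>. of_nat (snd \<sigma>)) \<le> TP"
    proof -
      have "tot ?pre (\<lambda>\<sigma>. of_nat (snd \<sigma>)) = expected_work ?pre"
        using run_lossless[OF legal_Nil] runN by (simp add: expected_work_tot)
      also have "\<dots> \<le> ennreal (tp (length (input d)))"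
        using bounds False legal_in Qc[OF len(1)] unfolding worst_case_bounds_def by simp
      also have "\<dots> \<le> TP" by (intro TP len)
      finally show ?thesis .
    qed
    also have "tot ?pre (\<lambda>\<sigma>. \<Sum>v\<leftarrow>[0..<N]. script_work D U (probe v) undefined (fst \<sigma>)) \<le>
       (\<Sum>v\<leftarrow>[0..<N]. of_nat (2 * cand_num d v) * TU + TQ)"
    proof -
      have "tot ?pre (\<lambda>\<sigma>. \<Sum>v\<leftarrow>vs. script_work D U (probe v) undefined (fst \<sigma>)) \<le>
          (\<Sum>v\<leftarrow>vs. of_nat (2 * cand_num d v) * TU + TQ)" if "set vs \<subseteq> {..<N}" for vs
        using that
      proof (induction vs)
        case Nil
        then show ?case using tot_const[OF run_lossless[OF legal_Nil], of 0] runN by simp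
      next
        case (Cons v vs)
        have "tot ?pre (\<lambda>\<sigma>. script_work D U (probe v) undefined (fst \<sigma>)) \<le> (\<Sum>it\<leftarrow>probe v. item_budget it)"
          using worst_case_work[OF False legal_Nil, of "probe v" undefined] good_probe[of v] Cons.prems runN
          by (simp add: st_empty)
        also have "\<dots> \<le> of_nat (2 * cand_num d v) * TU + TQ" by (rule budget_phase(1))
        finally show ?case
          using Cons by (simp add: tot_add add_mono)
      qed
      then show ?thesis by (metis atLeast_upt subset_refl)
    qed
    finally show ?thesis unfolding sl by (simp add: add_left_mono add_right_mono)
  qed
qed

end

section \<open>The complete detection program\<close>

definition prep_com :: "design \<Rightarrow> nat \<Rightarrow> nat \<Rightarrow> com" where
  "prep_com d p q = Seq (root_com p q 4) (Seq (root_com 1 2 5) (Seq relabel_com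
     (Seq (consts_com d) (Seq (input_com d) (script_com d)))))"

definition solve_com :: "nat \<Rightarrow> dyn_alg \<Rightarrow> design \<Rightarrow> nat \<Rightarrow> nat \<Rightarrow> com" where
  "solve_com C D d p q = Seq (prep_com d p q) (Seq (tr C (preprocess D))
     (Seq (Write 1 (Const 0) (Const 1)) (driver C D)))"

definition few :: "nat \<Rightarrow> expr" where "few M = Bop Less edges (Const M)"

text \<open>On fewer than \<open>M\<close> edges \<Delta> is set above every degree, so brute force
  decides alone. This settles the inputs on which the asymptotic bounds say nothing.\<close>

definition front_com :: "nat \<Rightarrow> nat \<Rightarrow> nat \<Rightarrow> com" where
  "front_com M p q = Seq (Cond (few M) (Write 3 (Const 0) (plus arcs (Const 1))) (root_com p q 3))
     (Seq adj_com brute_com)"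

definition detect_com :: "nat \<Rightarrow> dyn_alg \<Rightarrow> design \<Rightarrow> nat \<Rightarrow> nat \<Rightarrow> nat \<Rightarrow> nat \<Rightarrow> nat \<Rightarrow> com" where
  "detect_com C D d M p1 q1 p2 q2 = Seq (front_com M p1 q1)
     (Seq (Cond (few M) Skip (solve_com C D d p2 q2)) (Write 0 (Const 0) (reg 7)))"

lemma mods_coms:
  "mods (root_com p q r) = {r}" "mods relabel_com \<subseteq> {6, 12, 17, 18}" "mods (consts_com d) \<subseteq> {8, 9, 10, 11}"
  "mods (input_com d) \<subseteq> {12, 19, 40}" "mods (script_com d) \<subseteq> {12, 13, 20, 21, 22, 24, 25}"
  "mods adj_com \<subseteq> {12, 14, 15, 16}" "mods brute_com \<subseteq> {7, 12, 13}"
proof -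
  show "mods (input_com d) \<subseteq> {12, 19, 40}" using mods_pushes[of 40 19] by (auto simp: input_com_def)
  have "mods (cand_loop d xs) \<subseteq> {13, 24, 20, 21}" for xs using mods_pushes[of 20 21 xs] by (auto simp: cand_loop_def)
  then show "mods (script_com d) \<subseteq> {12, 13, 20, 21, 22, 24, 25}"
    using mods_pushes[of 20 21] by (auto simp: script_com_def phase_com_def)
qed (auto simp: root_com_def relabel_com_def consts_com_def adj_com_def brute_com_def)

context prog_ctx
begin

definition prep_time :: "design \<Rightarrow> nat \<Rightarrow> nat \<Rightarrow> nat" where
  "prep_time d p q = (lb + 1) * (20 + 3 * p + 3 * q) + ((P + 1) * 29 + (200 * (m + 1) + (100 +
     (500 * (m + N + L d + 1) + ((\<Sum>v<N. 400 * cand_num d v + 700) + (N + 1) * 12)))))"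

lemma ok_prep:
  assumes s: "bnd s" "has_input s" "adj s" "s 3 0 = \<Delta>" "s 6 = (\<lambda>_. 0)" "s 17 = (\<lambda>_. 0)" "s 19 = (\<lambda>_. 0)"
      "s 20 = (\<lambda>_. 0)" "s 21 = (\<lambda>_. 0)" "s 40 = (\<lambda>_. 0)"
    and q: "1 \<le> q" "q < z" "p < z" and lb: "lb = ceil_root p q m" and P: "P = ceil_root 1 2 m"
  shows "ok (prep_com d p q) s (\<lambda>s'. is_list 20 21 s' (concat (map code (script d tri))) \<and>
     s' 40 = (\<lambda>i. if even i \<and> i div 2 < 3 + 3 * length (input d)
       then ([n' d, length (input d), W2 d] @ flat3 (input d)) ! (i div 2) else 0)) (prep_time d p q)"
    (is "ok _ _ ?Q _")
proof -
  let ?t6 = "(\<Sum>v<N. 400 * cand_num d v + 700) + (N + 1) * 12"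
  let ?t5 = "500 * (m + N + L d + 1) + ?t6"
  let ?t4 = "100 + ?t5"
  let ?t3 = "200 * (m + 1) + ?t4"
  let ?t2 = "(P + 1) * 29 + ?t3"
  have s01: "s 0 1 = m" using s(2) by (simp add: has_input_def)
  have r1: "ok (root_com p q 4) s (\<lambda>s'. s' 4 0 = ceil_root p q m) ((ceil_root p q m + 1) * (20 + 3 * p + 3 * q))"
    by (rule ok_root[OF s(1) s01 q]) (use less_V lb in simp_all)
  show ?thesis unfolding prep_com_def
  proof (rule ok_Seq[where ?t2.0 = ?t2, OF r1])
    fix s1 assume b1: "bnd s1" and f1: "\<And>a. a \<notin> mods (root_com p q 4) \<Longrightarrow> s1 a = s a" and q1: "s1 4 0 = ceil_root p q m"
    have k1: "s1 a = s a" if "a \<noteq> 4" for a using f1[of a] that by (simp add: mods_coms)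
    have s11: "s1 0 1 = m" using s01 k1 by simp
    have r2: "ok (root_com 1 2 5) s1 (\<lambda>s'. s' 5 0 = P) ((P + 1) * 29)"
      using ok_root[OF b1 s11, of 2 1 5] z less_V P by simp
    show "ok (Seq (root_com 1 2 5) (Seq relabel_com (Seq (consts_com d) (Seq (input_com d) (script_com d))))) s1 ?Q ?t2"
    proof (rule ok_Seq[where ?t2.0 = ?t3, OF r2])
      fix s2 assume b2: "bnd s2" and f2: "\<And>a. a \<notin> mods (root_com 1 2 5) \<Longrightarrow> s2 a = s1 a" and q2: "s2 5 0 = P"
      have k2: "s2 a = s1 a" if "a \<noteq> 5" for a using f2[of a] that by (simp add: mods_coms)
      have i2: "has_input s2" using has_input_cong[of s2 s] k1 k2 s by simp
      have a2: "adj s2" using has_adj_cong[of s2 s] k1 k2 s by simp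
      have r3: "ok relabel_com s2 (has_high (2 * m)) (200 * (m + 1))"
        by (rule ok_relabel[OF b2 i2 a2]) (use k1 k2 s in simp_all)
      show "ok (Seq relabel_com (Seq (consts_com d) (Seq (input_com d) (script_com d)))) s2 ?Q ?t3"
      proof (rule ok_Seq[where ?t2.0 = ?t4, OF r3])
        fix s3 assume b3: "bnd s3" and f3: "\<And>a. a \<notin> mods relabel_com \<Longrightarrow> s3 a = s2 a" and q3: "has_high (2 * m) s3"
        have k3: "s3 a = s2 a" if "a \<notin> {6, 12, 17, 18}" for a using that mods_coms(2) by (intro f3) blast
        have r4: "ok (consts_com d) s3 (has_consts d) 100"
          by (rule ok_consts[OF b3]) (use k1 k2 k3 q1 q2 q3 lb in \<open>simp_all add: has_high_def N_def\<close>)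
        show "ok (Seq (consts_com d) (Seq (input_com d) (script_com d))) s3 ?Q ?t4"
        proof (rule ok_Seq[where ?t2.0 = ?t5, OF r4])
          fix s4 assume b4: "bnd s4" and f4: "\<And>a. a \<notin> mods (consts_com d) \<Longrightarrow> s4 a = s3 a" and q4: "has_consts d s4"
          have k4: "s4 a = s3 a" if "a \<notin> {8, 9, 10, 11}" for a using that mods_coms(3)[of d] by (intro f4) blast
          have i4: "has_input s4" using has_input_cong[of s4 s2] k3 k4 i2 by simp
          have a4: "adj s4" using has_adj_cong[of s4 s2] k3 k4 a2 by simp
          have "has_high (2 * m) s4" using q3 k4 unfolding has_high_def by simp
          then have rd: "ready d s4" using i4 a4 q4 by (simp add: ready_def)
          have "is_list 40 19 s4 []" using k1 k2 k3 k4 s by (simp add: is_list_def)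
          note r5 = ok_input[OF b4 rd this]
          show "ok (Seq (input_com d) (script_com d)) s4 ?Q ?t5"
          proof (rule ok_Seq[where ?t2.0 = ?t6, OF r5])
            fix s5 assume b5: "bnd s5" and f5: "\<And>a. a \<notin> mods (input_com d) \<Longrightarrow> s5 a = s4 a"
              and q5: "s5 40 = (\<lambda>i. if even i \<and> i div 2 < 3 + 3 * length (input d)
                then ([n' d, length (input d), W2 d] @ flat3 (input d)) ! (i div 2) else 0)"
            have k5: "s5 a = s4 a" if "a \<notin> {12, 19, 40}" for a using that mods_coms(4)[of d] by (intro f5) blast
            have rd5: "ready d s5" by (rule ready_cong[OF rd]) (auto intro!: k5)
            have "is_list 20 21 s5 []" using k1 k2 k3 k4 k5 s by (simp add: is_list_def)
            note r6 = ok_script[OF b5 rd5 this]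
            show "ok (script_com d) s5 ?Q ?t6"
            proof (rule ok_conseq[OF r6])
              fix s6 assume f6: "\<And>a. a \<notin> mods (script_com d) \<Longrightarrow> s6 a = s5 a"
                and q6: "is_list 20 21 s6 (concat (map code (script d tri)))"
              have "s6 40 = s5 40" using mods_coms(5)[of d] by (intro f6) auto
              then show "?Q s6" using q5 q6 by simp
            qed simp
          qed simp
        qed simp
      qed simp
    qed simp
  next
    show "(ceil_root p q m + 1) * (20 + 3 * p + 3 * q) + ?t2 \<le> prep_time d p q"
      unfolding prep_time_def lb[symmetric] by simp
  qed
qed

lemma mods_prep: "mods (prep_com d p q) \<subseteq> {4..25} \<union> {40}"
  unfolding prep_com_def mods.simps mods_coms(1)
  by (intro Un_least order_trans[OF mods_coms(2)] order_trans[OF mods_coms(3)] order_trans[OF mods_coms(4)]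
      order_trans[OF mods_coms(5)]) auto

definition front_time :: "nat \<Rightarrow> nat \<Rightarrow> nat" where
  "front_time p q = (20 + (\<Delta> + 1) * (20 + 3 * p + 3 * q)) + (200 * (m + 1) + 200 * (m + 1) * (\<Delta> + 1))"

lemma ok_front:
  assumes s: "bnd s" "has_input s" "\<And>a. a \<noteq> 0 \<Longrightarrow> s a = (\<lambda>_. 0)" and M: "M < V"
    and q: "1 \<le> q" "q < z" "p < z" and \<Delta>_eq: "\<Delta> = (if m < M then 2 * m + 1 else ceil_root p q m)"
  shows "ok (front_com M p q) s (\<lambda>s'. adj s' \<and> s' 3 0 = \<Delta> \<and> s' 7 0 = of_bool (low_triangle (2 * m))) (front_time p q)"
    (is "ok _ _ ?Q _")
proof -
  note e = has_input_ev[OF s(2)]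
  have s01: "s 0 1 = m" using s(2) by (simp add: has_input_def)
  have sm: "small (few M)" using M V z by (simp add: small_def few_def)
  have r1: "ok (Cond (few M) (Write 3 (Const 0) (plus arcs (Const 1))) (root_com p q 3)) s (\<lambda>s'. s' 3 0 = \<Delta>)
      (20 + (\<Delta> + 1) * (20 + 3 * p + 3 * q))"
  proof (rule ok_Cond[OF s(1) sm, where ?t1.0 = "10 + (\<Delta> + 1) * (20 + 3 * p + 3 * q)"])
    assume "ev s (few M) \<noteq> 0"
    then have "m < M" by (simp add: few_def e split: if_splits)
    then show "ok (Write 3 (Const 0) (plus arcs (Const 1))) s (\<lambda>s'. s' 3 0 = \<Delta>) (10 + (\<Delta> + 1) * (20 + 3 * p + 3 * q))"
      using \<Delta>_eq less_V(4) V z by (intro ok_Write s(1)) (simp_all add: small_def e store_apply)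
  next
    assume "ev s (few M) = 0"
    then have "\<not> m < M" by (simp add: few_def e split: if_splits)
    then have eq: "\<Delta> = ceil_root p q m" using \<Delta>_eq by simp
    show "ok (root_com p q 3) s (\<lambda>s'. s' 3 0 = \<Delta>) (10 + (\<Delta> + 1) * (20 + 3 * p + 3 * q))"
      by (rule ok_conseq[OF ok_root[OF s(1) s01 q]]) (use less_V eq in simp_all)
  qed (simp add: few_def)
  show ?thesis unfolding front_com_def
  proof (rule ok_Seq[where ?t2.0 = "200 * (m + 1) + 200 * (m + 1) * (\<Delta> + 1)", OF r1])
    fix s1 assume b1: "bnd s1" and q1: "s1 3 0 = \<Delta>"
      and f1: "\<And>a. a \<notin> mods (Cond (few M) (Write 3 (Const 0) (plus arcs (Const 1))) (root_com p q 3)) \<Longrightarrow> s1 a = s a"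
    have k1: "s1 a = s a" if "a \<noteq> 3" for a using f1[of a] that by (simp add: mods_coms)
    have i1: "has_input s1" using has_input_cong[of s1 s] k1 s by simp
    have r2: "ok adj_com s1 adj (200 * (m + 1))"
      by (rule ok_adj[OF b1 i1]) (use k1 s in simp_all)
    show "ok (Seq adj_com brute_com) s1 ?Q (200 * (m + 1) + 200 * (m + 1) * (\<Delta> + 1))"
    proof (rule ok_Seq[where ?t2.0 = "200 * (m + 1) * (\<Delta> + 1)", OF r2])
      fix s2 assume b2: "bnd s2" and q2: "adj s2" and f2: "\<And>a. a \<notin> mods adj_com \<Longrightarrow> s2 a = s1 a"
      have k2: "s2 a = s1 a" if "a \<notin> {12, 14, 15, 16}" for a using that mods_coms(6) by (intro f2) blast
      have i2: "has_input s2" using has_input_cong[of s2 s1] k2 i1 by simp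
      have "ok brute_com s2 (\<lambda>s'. s' 7 0 = of_bool (low_triangle (2 * m))) (200 * (m + 1) * (\<Delta> + 1))"
        by (rule ok_brute[OF b2 i2 q2]) (use k1 k2 s q1 in simp_all)
      then show "ok brute_com s2 ?Q (200 * (m + 1) * (\<Delta> + 1))"
      proof (rule ok_conseq)
        fix s3 assume f3: "\<And>a. a \<notin> mods brute_com \<Longrightarrow> s3 a = s2 a" and q3: "s3 7 0 = of_bool (low_triangle (2 * m))"
        have k3: "s3 a = s2 a" if "a \<notin> {7, 12, 13}" for a using that mods_coms(7) by (intro f3) blast
        show "?Q s3" using has_adj_cong[of s3 s2] k2 k3 q1 q2 q3 by simp
      qed simp
    qed simp
  qed (simp add: front_time_def)
qed

lemma mods_front: "mods (front_com M p q) \<subseteq> {3, 7, 12, 13, 14, 15, 16}"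
  using mods_coms(6,7) by (auto simp: front_com_def mods_coms(1))

lemma V_le_B: "V \<le> B" "2 * V \<le> B"
proof -
  show "V \<le> B" using V_le_pow[of z] VB by linarith
  have V2: "2 \<le> V" "1 \<le> V" using V by linarith+
  have "2 * V \<le> V ^ 2" unfolding power2_eq_square by (rule mult_le_mono1[OF V2(1)])
  also have "\<dots> \<le> V ^ (2 ^ z)" using z self_le_power[of 2 z] by (intro power_increasing V2(2)) auto
  finally show "2 * V \<le> B" using VB by linarith
qed

lemma ert_result:
  assumes "ok_mem B s" "F (store 0 0 (s 7 0) s) \<le> Z"
  shows "ert B (Write 0 (Const 0) (reg 7)) F s \<le> of_nat 4 + Z"
proof -
  have "s 7 0 < B" using assms(1) by (simp add: ok_mem_def)
  then have "ert B (Write 0 (Const 0) (reg 7)) F s = of_nat 4 + F (store 0 0 (s 7 0) s)"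
    using V V_le_B by (subst ert_Write[where i = 0 and v = "s 7 0"]) (auto simp: fit_def)
  then show ?thesis using assms(2) by (simp add: add_left_mono)
qed

lemma ok_mem_bnd: "bnd s \<Longrightarrow> (\<And>a. s (stamp a) = (\<lambda>_. 0)) \<Longrightarrow> ok_mem B s"
  using V_le_B(1) by (auto simp: ok_mem_def bnd_def intro: less_le_trans)

lemma eval_few:
  assumes "has_input s" "M < V"
  shows "eval B s (few M) = Some (of_bool (m < M))"
  using assms V V_le_B less_V by (auto simp: few_def edges_def fit_def has_input_def)

lemma ert_detect_few:
  assumes s: "bnd s" "has_input s" "\<And>a. a \<noteq> 0 \<Longrightarrow> s a = (\<lambda>_. 0)" and M: "M < V" "m < M"
    and q: "1 \<le> q1" "q1 < z" "p1 < z" and \<Delta>_eq: "\<Delta> = 2 * m + 1"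
    and F: "\<And>s'. s' 0 0 = of_bool (has_triangle (edges_of es)) \<Longrightarrow> F s' \<le> Z"
  shows "ert B (detect_com C D d M p1 q1 p2 q2) F s \<le> of_nat (front_time p1 q1) + (of_nat 10 + Z)"
  unfolding detect_com_def ert_Seq[of B "front_com M p1 q1"]
proof (rule ok_ert[OF ok_front[OF s M(1) q]])
  show "\<Delta> = (if m < M then 2 * m + 1 else ceil_root p1 q1 m)" using M \<Delta>_eq by simp
  fix s' assume b: "bnd s'" and fr: "\<And>a. a \<notin> mods (front_com M p1 q1) \<Longrightarrow> s' a = s a"
    and Q: "adj s' \<and> s' 3 0 = \<Delta> \<and> s' 7 0 = of_bool (low_triangle (2 * m))"
  have k: "s' a = s a" if "a \<notin> {3, 7, 12, 13, 14, 15, 16}" for a using that mods_front[of M p1 q1] by (intro fr) blast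
  have i: "has_input s'" using has_input_cong[of s' s] k s by simp
  have okm: "ok_mem B s'" by (rule ok_mem_bnd[OF b]) (use k s in \<open>simp add: stamp_def\<close>)
  \<comment> \<open>\<open>N * \<Delta>\<close> is at most \<open>2 * m\<close>, which is less than
    \<Delta>.\<close>
  have "N = 0" using N_bounds(3) \<Delta>_eq by (cases N) auto
  then have "low_triangle (2 * m) = has_triangle (edges_of es)" unfolding triangle_iff by simp
  then have "F (store 0 0 (s' 7 0) s') \<le> Z" using Q by (intro F) (simp add: store_apply)
  then have "ert B (Write 0 (Const 0) (reg 7)) F s' \<le> of_nat 4 + Z" by (rule ert_result[OF okm])
  then have "of_nat 6 + ert B (Write 0 (Const 0) (reg 7)) F s' \<le> of_nat 10 + Z"
    by (rule ennreal_of_nat_add_le) simp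
  then show "ert B (Seq (Cond (few M) Skip (solve_com C D d p2 q2)) (Write 0 (Const 0) (reg 7))) F s' \<le> of_nat 10 + Z"
    unfolding ert_Seq using M by (subst ert_Cond[OF eval_few[OF i M(1)]]) (simp add: ert_Skip few_def add.assoc[symmetric])
qed

end

section \<open>The complete run on an input with many edges\<close>

context red_ctx
begin

definition solve_time :: "nat \<Rightarrow> nat \<Rightarrow> nat" where
  "solve_time p q = prep_time d p q + (163 * length (script d tri) + 12)"

definition dyn_work :: ennreal where
  "dyn_work = TP + (\<Sum>v<N. of_nat (2 * cand_num d v) * TU + TQ)"

lemma raises_script: "list_ex raises (script d tri) \<longleftrightarrow> (\<exists>v<N. tri v)"
proof -
  have "\<not> raises (mark d u)" for u by (cases d) (simp_all add: mark_def)
  then have "list_ex raises (phase d tri v) \<longleftrightarrow> tri v" for v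
    by (auto simp: phase_def list_ex_iff)
  then show ?thesis by (auto simp: script_def list_ex_iff)
qed

lemma ert_solve:
  assumes s: "bnd s" "has_input s" "adj s" "s 3 0 = \<Delta>" "s 7 0 = of_bool (low_triangle (2 * m))"
      "\<And>a. a \<notin> {0, 3, 7, 12, 13, 14, 15, 16} \<Longrightarrow> s a = (\<lambda>_. 0)"
    and q: "1 \<le> q" "q < z" "p < z" and lb: "lb = ceil_root p q m" and P: "P = ceil_root 1 2 m"
    and Bd: "2 * word_bound D U + 2 \<le> B"
    and C: "tr_cost (preprocess D) \<le> C" "tr_cost (insertion D) \<le> C" "tr_cost (deletion D) \<le> C" "tr_cost (query D) \<le> C" "0 < C"
    and F: "\<And>s'. ok_mem B s' \<Longrightarrow> s' 7 0 = of_bool (has_triangle (edges_of es)) \<Longrightarrow> F s' \<le> Z"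
  shows "ert B (solve_com C D d p q) F s \<le> of_nat (solve_time p q) + (of_nat C * dyn_work + Z)"
proof -
  let ?its = "script d tri"
  let ?z = "of_nat (163 * length ?its + 12) + Z"
  have prep: "ok (prep_com d p q) s (\<lambda>s'. is_list 20 21 s' (concat (map code ?its)) \<and>
     s' 40 = (\<lambda>i. if even i \<and> i div 2 < 3 + 3 * length (input d)
       then ([n' d, length (input d), U] @ flat3 (input d)) ! (i div 2) else 0)) (prep_time d p q)"
    by (rule ok_prep[OF s(1-4) _ _ _ _ _ _ q lb P]) (use s(6) in simp_all)
  have B1: "1000 < B" using V V_le_B by linarith
  have ctx: "driver_ctx B U C D" by standard (use Bd B1 C in simp_all)
  have "ert B (solve_com C D d p q) F s \<le> of_nat (prep_time d p q) + (of_nat C * dyn_work + ?z)"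
    unfolding solve_com_def ert_Seq[of B "prep_com d p q"]
  proof (rule ok_ert[OF prep])
    fix s1 assume b1: "bnd s1" and f1: "\<And>a. a \<notin> mods (prep_com d p q) \<Longrightarrow> s1 a = s a"
      and Q: "is_list 20 21 s1 (concat (map code ?its)) \<and>
     s1 40 = (\<lambda>i. if even i \<and> i div 2 < 3 + 3 * length (input d)
       then ([n' d, length (input d), U] @ flat3 (input d)) ! (i div 2) else 0)"
    have k1: "s1 a = s a" if "a \<notin> {4..25} \<union> {40}" for a using that mods_prep[of d p q] by (intro f1) blast
    have "7 \<notin> mods (prep_com d p q)"
      unfolding prep_com_def mods.simps mods_coms(1) using mods_coms(2) mods_coms(3)[of d] mods_coms(4)[of d] mods_coms(5)[of d]
      by auto
    then have s17: "s1 7 = s 7" by (rule f1)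
    have T0: "s1 1 0 = 0" using k1 s(6) by simp
    have st: "s1 (stamp a) = (\<lambda>_. 0)" for a using k1[of "stamp a"] s(6)[of "stamp a"] by (simp add: stamp_def)
    have ok1: "ok_mem B s1" by (rule ok_mem_bnd[OF b1 st])
    \<comment> \<open>In phase 0 cells are read at even indices only, and array 40 is the simulated
      array 0. The list built there is thus exactly the input of the preprocessing, in an otherwise
      empty memory.\<close>
    have view: "view s1 = put ([n' d, length (input d), U] @ flat3 (input d)) empty_mem"
    proof (intro ext)
      fix a i
      show "view s1 a i = put ([n' d, length (input d), U] @ flat3 (input d)) empty_mem a i"
      proof (cases "a = 0")
        case True
        have "view s1 0 i = s1 40 (2 * i)" using T0 by (simp add: view_def cell_def val_def)
        then show ?thesis using Q True by (simp add: put_def empty_mem_def length_flat3)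
      next
        case False
        have "s1 (val a) = (\<lambda>_. 0)" using False k1[of "val a"] s(6)[of "val a"] by (simp add: val_def)
        then show ?thesis using False by (simp add: view_def put_def empty_mem_def)
      qed
    qed
    let ?G = "\<lambda>x. of_nat C * script_work D U ?its x x + ?z"
    let ?K = "Seq (Write 1 (Const 0) (Const 1)) (driver C D)"
    have step: "ert B ?K F s2 \<le> ?G (view s2)"
      if ok2: "ok_mem B s2" and ow: "own s2 = own s1" and "base s2 = base s1" for s2
    proof -
      let ?t = "store 1 0 1 s2"
      have k2: "s2 a = s1 a" if "a < 40" "a \<noteq> 2" for a by (rule own_eqD[OF ow that])
      have T2: "s2 1 0 = 0" using T0 k2 by simp
      have st2: "s2 (stamp a) i = 0" for a i using ok2 T2 by (simp add: ok_mem_def)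
      have okt: "ok_mem B ?t" using ok2 B1 st2 by (auto simp: ok_mem_def store_apply)
      \<comment> \<open>Setting the phase number to 1 freezes the state: all stamps are 0, so view
        and snapshot both equal the memory after the preprocessing.\<close>
      have vt: "view ?t = view s2" "base ?t = view s2"
        using T2 st2 by (auto simp: view_def base_def cell_def store_apply fun_eq_iff)
      have lens: "4 * length ?its + 10 < V" by (rule length_script_V)
      have okt': "ok_mem B (store 23 0 0 ?t)" by (rule ok_mem_store[OF okt]) (use B1 in simp_all)
      have hs: "holds_script ?its (store 23 0 0 ?t)"
        using Q k2 unfolding holds_script_def is_list_def by (simp add: store_apply)
      have sa: "driver_ctx.script_at B [] ?its (store 23 0 0 ?t)"
        using okt' hs lens V_le_B k2 s17 s(5) unfolding driver_ctx.script_at_def[OF ctx] by (simp add: store_apply)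
      have drv: "ert B (driver C D) F ?t \<le> of_nat C * script_work D U ?its (base ?t) (view ?t) + (of_nat (163 * length ?its + 9) + Z)"
      proof (rule driver_ctx.ert_driver[OF ctx sa okt])
        fix s' assume "ok_mem B s'" and f: "s' 7 0 = of_bool (?t 7 0 = 1 \<or> list_ex raises ?its)"
        moreover have "?t 7 0 = of_bool (low_triangle (2 * m))" using k2 s17 s(5) by (simp add: store_apply)
        ultimately show "F s' \<le> Z" using triangle_iff by (intro F) (simp_all add: raises_script)
      qed
      have "ert B ?K F s2 = of_nat 3 + ert B (driver C D) F ?t"
        unfolding ert_Seq using B1 by (subst ert_Write[where i = 0 and v = 1]) (auto simp: fit_def)
      also have "\<dots> \<le> of_nat 3 + (of_nat C * script_work D U ?its (base ?t) (view ?t) + (of_nat (163 * length ?its + 9) + Z))"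
        by (rule add_left_mono[OF drv])
      also have "\<dots> = ?G (view s2)" unfolding vt by (simp add: add_ac)
      finally show ?thesis .
    qed
    have pre: "run_preprocess D (n' d) U (input d) = exec (word_bound D U) (preprocess D) (view s1, 0)"
      by (simp add: run_preprocess_def view flat3_def)
    have "ert B (Seq (tr C (preprocess D)) ?K) F s1 = ert B (tr C (preprocess D)) (ert B ?K F) s1" by (rule ert_Seq)
    also have "\<dots> \<le> tot (exec (word_bound D U) (preprocess D) (view s1, 0)) (\<lambda>\<sigma>. of_nat (C * snd \<sigma>) + ?G (fst \<sigma>))"
      by (rule ert_tr[OF Bd ok1 C(1), where G = ?G]) (rule step)
    also have "\<dots> \<le> of_nat C * tot (run_preprocess D (n' d) U (input d)) (\<lambda>\<sigma>. of_nat (snd \<sigma>) + script_work D U ?its (fst \<sigma>) (fst \<sigma>)) + ?z"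
      unfolding pre by (rule tot_scale_le[OF C(5)])
    also have "\<dots> \<le> of_nat C * dyn_work + ?z"
      unfolding dyn_work_def by (intro add_right_mono mult_left_mono total_work) simp
    finally show "ert B (Seq (tr C (preprocess D)) ?K) F s1 \<le> of_nat C * dyn_work + ?z" .
  qed
  also have "\<dots> = of_nat (solve_time p q) + (of_nat C * dyn_work + Z)"
    by (simp add: solve_time_def add_ac)
  finally show ?thesis .
qed

lemma ert_detect_many:
  assumes s: "bnd s" "has_input s" "\<And>a. a \<noteq> 0 \<Longrightarrow> s a = (\<lambda>_. 0)" and M: "M < V" "\<not> m < M"
    and q1: "1 \<le> q1" "q1 < z" "p1 < z" and q2: "1 \<le> q2" "q2 < z" "p2 < z"
    and par: "\<Delta> = ceil_root p1 q1 m" "lb = ceil_root p2 q2 m" "P = ceil_root 1 2 m"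
    and Bd: "2 * word_bound D U + 2 \<le> B"
    and C: "tr_cost (preprocess D) \<le> C" "tr_cost (insertion D) \<le> C" "tr_cost (deletion D) \<le> C" "tr_cost (query D) \<le> C" "0 < C"
    and F: "\<And>s'. s' 0 0 = of_bool (has_triangle (edges_of es)) \<Longrightarrow> F s' \<le> Z"
  shows "ert B (detect_com C D d M p1 q1 p2 q2) F s \<le>
    of_nat (front_time p1 q1) + (of_nat 5 + (of_nat (solve_time p2 q2) + (of_nat C * dyn_work + (of_nat 4 + Z))))"
  unfolding detect_com_def ert_Seq[of B "front_com M p1 q1"]
proof (rule ok_ert[OF ok_front[OF s M(1) q1]])
  show "\<Delta> = (if m < M then 2 * m + 1 else ceil_root p1 q1 m)" using M par by simp
  fix s' assume b: "bnd s'" and fr: "\<And>a. a \<notin> mods (front_com M p1 q1) \<Longrightarrow> s' a = s a"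
    and Q: "adj s' \<and> s' 3 0 = \<Delta> \<and> s' 7 0 = of_bool (low_triangle (2 * m))"
  have k: "s' a = s a" if "a \<notin> {3, 7, 12, 13, 14, 15, 16}" for a using that mods_front[of M p1 q1] by (intro fr) blast
  have i: "has_input s'" using has_input_cong[of s' s] k s by simp
  have z': "s' a = (\<lambda>_. 0)" if "a \<notin> {0, 3, 7, 12, 13, 14, 15, 16}" for a using k[of a] s(3)[of a] that by simp
  have "ert B (solve_com C D d p2 q2) (ert B (Write 0 (Const 0) (reg 7)) F) s' \<le>
      of_nat (solve_time p2 q2) + (of_nat C * dyn_work + (of_nat 4 + Z))"
  proof (rule ert_solve[OF b i _ _ _ z' q2 par(2,3) Bd C])
    fix s2 assume "ok_mem B s2" "s2 7 0 = of_bool (has_triangle (edges_of es))"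
    then show "ert B (Write 0 (Const 0) (reg 7)) F s2 \<le> of_nat 4 + Z"
      by (intro ert_result F) (simp_all add: store_apply)
  qed (use Q in simp_all)
  then show "ert B (Seq (Cond (few M) Skip (solve_com C D d p2 q2)) (Write 0 (Const 0) (reg 7))) F s' \<le>
      of_nat 5 + (of_nat (solve_time p2 q2) + (of_nat C * dyn_work + (of_nat 4 + Z)))"
    unfolding ert_Seq using M by (subst ert_Cond[OF eval_few[OF i M(1)]]) (auto simp: few_def intro!: add_mono)
qed

end

section \<open>Asymptotics\<close>

text \<open>The continuation costs infinity on a wrong result, so one finite bound yields
  losslessness, correctness and the bound on the work.\<close>

lemma run_from_ert:
  assumes "ert B c (\<lambda>s. if s 0 0 = k then 0 else \<infinity>) s \<le> R" "R < \<infinity>"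
  shows "lossless_spmf (exec B c (s, 0))" "\<sigma> \<in> set_spmf (exec B c (s, 0)) \<Longrightarrow> result \<sigma> = k"
    "expected_work (exec B c (s, 0)) \<le> R"
proof -
  let ?h = "\<lambda>\<sigma> :: config. of_nat (snd \<sigma>) + (if fst \<sigma> 0 0 = k then 0 else \<infinity>) :: ennreal"
  have e: "tot (exec B c (s, 0)) ?h \<le> R" using assms(1) by (simp add: ert_def)
  then have fin: "tot (exec B c (s, 0)) ?h < \<infinity>" using assms(2) by (rule le_less_trans)
  show ll: "lossless_spmf (exec B c (s, 0))" by (rule tot_finite(1)[OF fin])
  show "result \<sigma> = k" if "\<sigma> \<in> set_spmf (exec B c (s, 0))"
    using tot_finite(2)[OF fin that] by (auto simp: result_def split: if_splits)
  have "expected_work (exec B c (s, 0)) \<le> tot (exec B c (s, 0)) ?h"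
    unfolding expected_work_tot[OF ll] by (rule tot_mono) simp
  then show "expected_work (exec B c (s, 0)) \<le> R" using e by (rule order_trans)
qed

lemma simple_graph_edges_le:
  assumes "simple_graph n es"
  shows "length es \<le> n ^ 2"
proof -
  let ?f = "\<lambda>(u, v). {u, v :: nat}"
  have "length es = card (?f ` set es)"
    using assms distinct_card[of "map ?f es"] by (simp add: simple_graph_def)
  also have "\<dots> \<le> card (?f ` ({..<n} \<times> {..<n}))"
    using assms by (intro card_mono image_mono) (auto simp: simple_graph_def)
  also have "\<dots> \<le> card ({..<n} \<times> {..<n})" by (rule card_image_le) simp
  finally show ?thesis by (simp add: power2_eq_square)
qed

text \<open>With \<open>x = n + 2\<close> the sum of the parameters is at most
  \<open>8 * x ^ (2 * p1 + 2 * p2 + 4)\<close>, the 8 is at most \<open>x ^ 3\<close>, and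
  \<open>big\<close> asks for the sixth power. The summand \<open>M\<close> makes the constant
  \<open>M\<close> fit into a word.\<close>

definition small_const :: "nat \<Rightarrow> nat \<Rightarrow> nat \<Rightarrow> nat" where
  "small_const p1 p2 M = 6 * (2 * p1 + 2 * p2 + 7) + M"

lemma prog_ctx_intro:
  assumes g: "simple_graph n es" and z: "40 \<le> z" and B: "((n + 2) ^ small_const p1 p2 M) ^ (2 ^ z) \<le> B"
    and D: "1 \<le> \<Delta>" "\<Delta> \<le> 2 * length es + 1 \<or> \<Delta> \<le> length es ^ p1" and lb: "lb \<le> length es ^ p2"
    and P: "P \<le> length es" "length es \<le> P ^ 2"
  shows "prog_ctx B ((n + 2) ^ small_const p1 p2 M) z n es \<Delta> lb P" "M < (n + 2) ^ small_const p1 p2 M"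
proof -
  let ?x = "n + 2" and ?e = "2 * p1 + 2 * p2 + 4" and ?V = "(n + 2) ^ small_const p1 p2 M"
  have m: "length es \<le> n ^ 2" by (rule simple_graph_edges_le[OF g])
  have pw: "?x ^ i \<le> ?x ^ j" if "i \<le> j" for i j using that by (intro power_increasing) auto
  have m2: "length es \<le> ?x ^ 2" by (rule order_trans[OF m power_mono]) simp_all
  have mp: "length es ^ p \<le> ?x ^ (2 * p)" for p
    using power_mono[OF m2, of p] by (simp add: power_mult)
  have x3: "2 * length es + 1 \<le> ?x ^ 3"
  proof -
    have "2 * length es + 1 \<le> 2 * ?x ^ 2" using m by (simp add: power2_eq_square algebra_simps)
    also have "\<dots> \<le> ?x * ?x ^ 2" by (intro mult_le_mono1) simp
    also have "\<dots> = ?x ^ 3" by (simp only: power3_eq_cube power2_eq_square mult.assoc)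
    finally show ?thesis .
  qed
  have b1: "n \<le> ?x ^ ?e" using pw[of 1 ?e] by simp
  have b2: "length es \<le> ?x ^ ?e" using m2 pw[of 2 ?e] by linarith
  have b3: "\<Delta> \<le> ?x ^ ?e" using D(2) x3 mp[of p1] pw[of 3 ?e] pw[of "2 * p1" ?e] by linarith
  have b4: "lb \<le> ?x ^ ?e" using lb mp[of p2] pw[of "2 * p2" ?e] by linarith
  have "2 ^ 4 \<le> ?x ^ ?e" by (rule order_trans[OF power_mono pw]) simp_all
  then have b5: "10 \<le> ?x ^ ?e" by (rule order_trans[rotated]) simp
  have "2 ^ 3 \<le> ?x ^ 3" by (rule power_mono) simp_all
  then have "8 * ?x ^ ?e \<le> ?x ^ 3 * ?x ^ ?e" by (intro mult_le_mono1) simp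
  also have "\<dots> = ?x ^ (2 * p1 + 2 * p2 + 7)" unfolding power_add[symmetric] by (rule arg_cong[where f = "power ?x"]) simp
  finally have "n + length es + \<Delta> + lb + P + 10 \<le> ?x ^ (2 * p1 + 2 * p2 + 7)"
    using b1 b2 b3 b4 b5 P by linarith
  then have "(n + length es + \<Delta> + lb + P + 10) ^ 6 \<le> (?x ^ (2 * p1 + 2 * p2 + 7)) ^ 6" by (rule power_mono) simp
  also have "\<dots> = ?x ^ (6 * (2 * p1 + 2 * p2 + 7))" by (simp only: power_mult[symmetric] mult.commute)
  also have "\<dots> \<le> ?V" by (rule pw) (simp add: small_const_def)
  finally have big: "(n + length es + \<Delta> + lb + P + 10) ^ 6 \<le> ?V" .
  have two: "2 ^ small_const p1 p2 M \<le> ?V" by (rule power_mono) simp_all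
  have "(2 :: nat) ^ 10 \<le> 2 ^ small_const p1 p2 M" by (rule power_increasing) (simp_all add: small_const_def)
  then have V: "1000 < ?V" using two by simp
  show "prog_ctx B ?V z n es \<Delta> lb P"
    by unfold_locales (use V B z g big D P in \<open>simp_all only:\<close>)
  have "M < 2 ^ M" by (rule less_exp)
  also have "\<dots> \<le> (2 :: nat) ^ small_const p1 p2 M" by (rule power_increasing) (simp_all add: small_const_def)
  also have "\<dots> \<le> ?V" by (rule two)
  finally show "M < ?V" .
qed

text \<open>\<open>U + 2\<close> is at most the square of \<open>x ^ k\<close>, and the remaining
  factor 4 is at most \<open>x ^ 2\<close>.\<close>

lemma word_bound_le:
  assumes "U < x ^ k" "2 \<le> x" "1 \<le> k"
  shows "2 * word_bound D U + 2 \<le> x ^ (2 * k * word_const D + 2)"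
proof -
  have "2 \<le> x ^ k" using assms(2,3) self_le_power[of x k] by linarith
  then have "U + 2 \<le> x ^ k * x ^ k" using assms(1) mult_le_mono1[of 2 "x ^ k" "x ^ k"] by linarith
  also have "\<dots> = x ^ (2 * k)" by (simp add: power_add[symmetric] mult_2)
  finally have "word_bound D U \<le> x ^ (2 * k * word_const D)"
    unfolding word_bound_def power_mult by (rule power_mono) simp
  moreover have "1 \<le> x ^ (2 * k * word_const D)" using assms(2) by (intro one_le_power) simp
  ultimately have "2 * word_bound D U + 2 \<le> 4 * x ^ (2 * k * word_const D)" by linarith
  also have "\<dots> \<le> x ^ 2 * x ^ (2 * k * word_const D)"
    using power_mono[OF assms(2), of 2] by (intro mult_le_mono1) simp
  finally show ?thesis by (simp only: power_add mult.commute)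
qed

text \<open>The neighbour lists of distinct vertices have total length at most \<open>2 * m\<close>.
  \<open>Quad\<close> scans all \<open>N\<close> high vertices in every phase, and there
  \<open>N * N\<close> is at most \<open>n ^ 2\<close>.\<close>

lemma (in prog_ctx) cand_sum_le:
  assumes "d = Quad \<Longrightarrow> n ^ 2 \<le> k * m" "2 \<le> k"
  shows "(\<Sum>v<N. cand_num d v) \<le> k * m"
proof (cases "d = Quad")
  case True
  have "(\<Sum>v<N. cand_num d v) = N * N" using True by (simp add: cand_num_def)
  also have "\<dots> \<le> n * n" by (rule mult_le_mono[OF N_bounds(2) N_bounds(2)])
  finally show ?thesis using assms(1)[OF True] by (simp add: power2_eq_square)
next
  case False
  have "(\<Sum>v<N. cand_num d v) = (\<Sum>v<N. deg (hs ! v))" using False by (simp add: cand_num_def)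
  also have "\<dots> = (\<Sum>x\<in>set hs. deg x)"
    using bij_betw_nth[OF distinct_high refl refl, of \<Delta> "2 * m"]
    by (intro sum.reindex_bij_betw) (simp add: N_def)
  also have "\<dots> \<le> 2 * m" by (rule sum_deg) simp
  finally show ?thesis using assms(2) mult_le_mono1[of 2 k m] by linarith
qed

lemma (in red_ctx) time_le:
  assumes "lb \<le> m" "P \<le> m" "(\<Sum>v<N. cand_num d v) \<le> k * m"
  shows "front_time p1 q1 + solve_time p2 q2 + 9 \<le> (6000 + 3 * p1 + 3 * q1 + 3 * p2 + 3 * q2 + 726 * k) * ((m + 1) * (\<Delta> + 1))"
proof -
  let ?S = "\<Sum>v<N. cand_num d v" and ?X = "(m + 1) * (\<Delta> + 1)"
  have X: "m + 1 \<le> ?X" "\<Delta> + 1 \<le> ?X" "1 \<le> ?X" by simp_all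
  have "(\<Delta> + 1) * (20 + 3 * p1 + 3 * q1) \<le> ?X * (20 + 3 * p1 + 3 * q1)" using X by (intro mult_le_mono1)
  moreover have "(20 + y) + (200 * u + 200 * X) \<le> w + 420 * X" if "y \<le> w" "u \<le> X" "1 \<le> X" for y w u X :: nat
    using that by linarith
  ultimately have f: "front_time p1 q1 \<le> ?X * (20 + 3 * p1 + 3 * q1) + 420 * ?X"
    using X unfolding front_time_def mult.assoc[of 200] by blast
  have s1: "(\<Sum>v<N. 400 * cand_num d v + 700) = 400 * ?S + 700 * N"
    by (simp add: sum.distrib sum_distrib_left)
  have s2: "(\<Sum>v<N. 2 * cand_num d v + 2) = 2 * ?S + 2 * N"
    unfolding sum.distrib sum_distrib_left[symmetric] by simp
  have "(lb + 1) * (20 + 3 * p2 + 3 * q2) \<le> ?X * (20 + 3 * p2 + 3 * q2)" using X assms(1) by (intro mult_le_mono1) linarith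
  moreover have "L d \<le> m" using assms(1) by (simp add: L_def)
  \<comment> \<open>Products are abstracted to variables to keep the arithmetic linear. 726 is 400
    per candidate plus 163 for each of two items per candidate; 1538 collects the coefficients of
    \<open>N'\<close>.\<close>
  moreover have "y + ((P' + 1) * 29 + (200 * (m' + 1) + (100 + (500 * (m' + N' + L' + 1) + (400 * S' + 700 * N' + (N' + 1) * 12))))) +
      (163 * l + 12) \<le> w + 5500 * X + 726 * S'"
    if "y \<le> w" "L' \<le> m'" "l \<le> 2 * S' + 2 * N'" "m' + 1 \<le> X" "P' \<le> m'" "N' \<le> 2 * m'" for y w P' m' N' L' S' l X :: nat
    using that(1) mult_le_mono2[OF that(2), of 500] mult_le_mono2[OF that(3), of 163] mult_le_mono2[OF that(4), of 5500]
      mult_le_mono2[OF that(5), of 29] mult_le_mono2[OF that(6), of 1538] by (simp only: distrib_left distrib_right)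
  ultimately have "solve_time p2 q2 \<le> ?X * (20 + 3 * p2 + 3 * q2) + 5500 * ?X + 726 * ?S"
    using length_script[of d tri, unfolded s2] X(1) assms(2) N_bounds(1) unfolding solve_time_def prep_time_def s1 by blast
  moreover have "?S \<le> k * ?X" using assms(3) X mult_le_mono2[of m ?X k] by linarith
  moreover have "ft + st + 9 \<le> y + w + 5920 * X + 9 * X + 726 * u"
    if "ft \<le> y + 420 * X" "st \<le> w + 5500 * X + 726 * S'" "S' \<le> u" "1 \<le> X" for ft st y w X S' u :: nat
    using that by linarith
  ultimately have "front_time p1 q1 + solve_time p2 q2 + 9 \<le>
      ?X * (20 + 3 * p1 + 3 * q1) + ?X * (20 + 3 * p2 + 3 * q2) + 5920 * ?X + 9 * ?X + 726 * (k * ?X)"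
    using f X(3) by blast
  also have "\<dots> \<le> (6000 + 3 * p1 + 3 * q1 + 3 * p2 + 3 * q2 + 726 * k) * ?X" by (simp add: algebra_simps)
  finally show ?thesis .
qed

lemma eventually_powr_ge:
  assumes "0 < e"
  shows "\<forall>\<^sub>F m in sequentially. K \<le> real m powr e"
proof (rule eventually_sequentiallyI)
  fix m assume m: "nat \<lceil>max K 1 powr (1 / e)\<rceil> \<le> m"
  have "max K 1 powr (1 / e) \<le> real m" using m by linarith
  then have "(max K 1 powr (1 / e)) powr e \<le> real m powr e" using assms by (intro powr_mono2) auto
  then show "K \<le> real m powr e" using assms by (simp add: powr_powr)
qed

text \<open>The exponent may be negative, so \<open>real k powr b\<close> can move either way on the
  window; within a factor of 10 it changes by a factor of at most
  \<open>10 powr \<bar>b\<bar>\<close>.\<close>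

lemma bigo_window:
  fixes f :: "nat \<Rightarrow> real"
  assumes "f \<in> O(\<lambda>m. real m powr a)" "a \<le> b"
  shows "\<exists>C>0. \<forall>\<^sub>F m in sequentially. \<forall>k. m \<le> k \<and> k \<le> 10 * m \<longrightarrow> f k \<le> C * real m powr b"
proof -
  obtain C where C: "0 < C" "\<forall>\<^sub>F k in sequentially. norm (f k) \<le> C * norm (real k powr a)"
    using assms(1) by (rule landau_o.bigE)
  then obtain N0 where N0: "\<And>k. N0 \<le> k \<Longrightarrow> norm (f k) \<le> C * norm (real k powr a)"
    by (auto simp: eventually_sequentially)
  have "f k \<le> (C * 10 powr \<bar>b\<bar>) * real m powr b" if m: "max N0 1 \<le> m" and k: "m \<le> k" "k \<le> 10 * m" for m k
  proof -
    have "f k \<le> C * real k powr a" using N0[of k] m k by simp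
    also have "\<dots> \<le> C * real k powr b" using C(1) m k assms(2) by (intro mult_left_mono powr_mono) auto
    also have "real k powr b \<le> 10 powr \<bar>b\<bar> * real m powr b"
    proof (cases "0 \<le> b")
      case True
      have "real k powr b \<le> (10 * real m) powr b" using True k by (intro powr_mono2) auto
      then show ?thesis using True by (simp add: powr_mult)
    next
      case False
      have "real k powr b \<le> real m powr b" using False k m by (intro powr_mono2') auto
      also have "\<dots> \<le> 10 powr \<bar>b\<bar> * real m powr b"
        using mult_right_mono[of 1 "10 powr \<bar>b\<bar>" "real m powr b"] ge_one_powr_ge_zero[of 10 "\<bar>b\<bar>"] by simp
      finally show ?thesis .
    qed
    finally show ?thesis using C(1) by (simp add: mult.assoc mult_left_mono)
  qed
  then show ?thesis using C(1)
    by (intro exI[of _ "C * 10 powr \<bar>b\<bar>"] conjI eventually_sequentiallyI[of "max N0 1"]) auto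
qed

lemma root_power: "1 \<le> q \<Longrightarrow> (real d ^ q) powr (1 / real q) = real d"
  by (cases "d = 0") (simp_all add: powr_realpow[symmetric] powr_powr power_0_left)

lemma ceil_root_real:
  assumes "1 \<le> q" "1 \<le> m"
  shows "real m powr (real p / real q) \<le> real (ceil_root p q m)"
    "real (ceil_root p q m) \<le> real m powr (real p / real q) + 1" "1 \<le> ceil_root p q m"
proof -
  let ?d = "ceil_root p q m"
  have e: "real m powr (real p / real q) = (real m ^ p) powr (1 / real q)"
    using assms by (simp add: powr_realpow[symmetric] powr_powr)
  have "real m ^ p \<le> real ?d ^ q" using ceil_root(1)[OF assms(1), of m p] by (metis of_nat_le_iff of_nat_power)
  then have "(real m ^ p) powr (1 / real q) \<le> (real ?d ^ q) powr (1 / real q)" by (intro powr_mono2) auto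
  then show 1: "real m powr (real p / real q) \<le> real ?d" using e root_power[OF assms(1)] by simp
  show p: "1 \<le> ?d"
  proof (rule ccontr)
    assume "\<not> 1 \<le> ?d"
    moreover have "0 < real m powr (real p / real q)" using assms(2) by simp
    ultimately show False using 1 by linarith
  qed
  have "(?d - 1) ^ q < m ^ p" using p by (intro ceil_root(2)[OF assms(1)]) simp
  then have "real (?d - 1) ^ q \<le> real m ^ p" by (metis less_imp_le of_nat_le_iff of_nat_power)
  then have "(real (?d - 1) ^ q) powr (1 / real q) \<le> (real m ^ p) powr (1 / real q)" by (intro powr_mono2) auto
  then have "real (?d - 1) \<le> real m powr (real p / real q)" unfolding root_power[OF assms(1)] e .
  then show "real ?d \<le> real m powr (real p / real q) + 1" using p by linarith
qed

lemma ceil_root_le_self: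
  assumes "p \<le> q" "1 \<le> q" "1 \<le> m"
  shows "ceil_root p q m \<le> m"
proof -
  have "m ^ p \<le> m ^ q" using assms by (intro power_increasing) auto
  then show ?thesis unfolding ceil_root_def by (rule Least_le)
qed

lemma sqrt_ceil: "m \<le> ceil_root 1 2 m ^ 2" "ceil_root 1 2 m \<le> m"
  using ceil_root(1)[of 2 m 1] ceil_root(3)[of 2 1 m] by simp_all

section \<open>From the work bound to the failure of the conjecture\<close>

lemma refute_conjecture:
  assumes det: "detects_triangles Q K c" and \<eta>: "0 < \<eta>"
    and work: "\<forall>\<^sub>F m in sequentially. triangle_work Q K c m \<le> ennreal (R * real m powr (1 + \<delta> - \<eta>))"
  shows "\<not> triangle_conjecture Q \<delta>"
proof
  assume "triangle_conjecture Q \<delta>"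
  then obtain g C where C: "0 < C" and g: "g \<longlonglongrightarrow> 0"
    and low: "\<forall>\<^sub>F m in sequentially. ennreal (C * real m powr (1 + \<delta> - g m)) \<le> triangle_work Q K c m"
    unfolding triangle_conjecture_def using det by meson
  have "\<forall>\<^sub>F m in sequentially. g m < \<eta> / 2" using g \<eta> by (intro order_tendstoD(2)) auto
  \<comment> \<open>Eventually \<open>g m < \<eta> / 2\<close>, so the two bounds on the work differ
    by a factor of order \<open>real m powr (\<eta> / 2)\<close>, which is unbounded. The summand 1
    makes the final inequality strict, and \<open>max R 0\<close> admits any sign of
    \<open>R\<close>.\<close>
  moreover have "\<forall>\<^sub>F m in sequentially. max R 0 / C + 1 \<le> real m powr (\<eta> / 2)"
    using \<eta> by (intro eventually_powr_ge) simp
  moreover have "\<forall>\<^sub>F m in sequentially. 1 \<le> (m :: nat)" by (rule eventually_ge_at_top)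
  ultimately have "\<forall>\<^sub>F m :: nat in sequentially. False"
    using low work
  proof eventually_elim
    case (elim m)
    let ?y = "real m powr (1 + \<delta> - \<eta>)"
    have y: "0 < ?y" using elim(3) by simp
    have "ennreal (C * real m powr (1 + \<delta> - g m)) \<le> ennreal (max R 0 * ?y)"
      by (rule order_trans[OF order_trans[OF elim(4) elim(5)]]) (intro ennreal_leI mult_right_mono, auto)
    then have "C * real m powr (1 + \<delta> - g m) \<le> max R 0 * ?y" by (subst (asm) ennreal_le_iff) auto
    moreover have "?y * real m powr (\<eta> / 2) \<le> real m powr (1 + \<delta> - g m)"
      unfolding powr_add[symmetric] using elim by (intro powr_mono) auto
    ultimately have "C * (?y * real m powr (\<eta> / 2)) \<le> max R 0 * ?y"
      using C by (meson mult_left_mono less_imp_le order_trans)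
    then have "(C * real m powr (\<eta> / 2)) * ?y \<le> max R 0 * ?y" by (simp add: algebra_simps)
    then have "C * real m powr (\<eta> / 2) \<le> max R 0" using y by simp
    moreover have "C * (max R 0 / C + 1) \<le> C * real m powr (\<eta> / 2)" using elim(2) C by (intro mult_left_mono) auto
    moreover have "C * (max R 0 / C + 1) = max R 0 + C" using C by (simp add: field_simps)
    ultimately show False using C by linarith
  qed
  then show False by simp
qed

lemma (in prog_ctx) init_mem:
  defines "s \<equiv> put ([n, m] @ concat (map (\<lambda>(u, v). [u, v]) es)) empty_mem"
  shows "bnd s" "has_input s" "\<And>a. a \<noteq> 0 \<Longrightarrow> s a = (\<lambda>_. 0)"
proof -
  let ?xs = "concat (map (\<lambda>(u, v). [u, v]) es)"
  have len: "length ?xs = 2 * m" by (induction es) auto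
  have ln: "x < n" if "x \<in> set ?xs" for x
    using that simple by (auto simp: simple_graph_def)
  have lt: "x < V" if "x \<in> set ([n, m] @ ?xs)" for x
    using that less_V(1,2) ln[of x] by (auto simp del: set_concat set_map)
  have "s a i < V" for a i
  proof (cases "a = 0 \<and> i < length ([n, m] @ ?xs)")
    case True
    then have "s a i = ([n, m] @ ?xs) ! i" by (simp add: s_def put_def)
    then show ?thesis using lt nth_mem[of i "[n, m] @ ?xs"] True by metis
  next
    case False
    then have "s a i = 0" by (auto simp: s_def put_def empty_mem_def)
    then show ?thesis using V by linarith
  qed
  then show "bnd s" by (simp add: bnd_def)
  show "has_input s" using len by (simp add: has_input_def s_def put_def tail_def)
  show "s a = (\<lambda>_. 0)" if "a \<noteq> 0" for a using that by (simp add: s_def put_def empty_mem_def)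
qed

lemma (in red_ctx) dyn_work_ennreal:
  assumes "TP = ennreal t" "TU = ennreal u" "TQ = ennreal w" "0 \<le> t" "0 \<le> u" "0 \<le> w"
  shows "dyn_work = ennreal (t + (2 * real (\<Sum>v<N. cand_num d v) * u + real N * w))"
proof -
  have "of_nat (2 * cand_num d v) * TU + TQ = ennreal (2 * real (cand_num d v) * u + w)" for v
    using assms by (simp add: ennreal_of_nat_eq_real_of_nat ennreal_mult'[symmetric] ennreal_plus[symmetric] del: of_nat_mult ennreal_plus)
  then have "(\<Sum>v<N. of_nat (2 * cand_num d v) * TU + TQ) = ennreal (\<Sum>v<N. 2 * real (cand_num d v) * u + w)"
    using assms by (simp only:) (rule sum_ennreal, simp)
  also have "(\<Sum>v<N. 2 * real (cand_num d v) * u + w) = 2 * real (\<Sum>v<N. cand_num d v) * u + real N * w"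
    by (simp add: sum.distrib sum_distrib_left sum_distrib_right)
  finally have e: "(\<Sum>v<N. of_nat (2 * cand_num d v) * TU + TQ) = ennreal (2 * real (\<Sum>v<N. cand_num d v) * u + real N * w)" .
  have "0 \<le> 2 * real (\<Sum>v<N. cand_num d v) * u + real N * w"
    using assms by (intro add_nonneg_nonneg mult_nonneg_nonneg) (auto simp del: of_nat_sum)
  from ennreal_plus[OF assms(4) this] show ?thesis unfolding dyn_work_def e using assms(1) by simp
qed

text \<open>\<eta> is the smaller of the slack of brute force, \<open>\<delta> - r\<close>, and that
  of the queries, \<open>r - \<delta> + \<epsilon>\<close>. Preprocessing and updates have slack
  \<epsilon>, the sum of the two.\<close>

lemma total_bound:
  fixes x r \<delta> \<epsilon> :: real
  assumes x: "1 \<le> x" and \<Delta>: "x powr r \<le> \<Delta>" "\<Delta> \<le> x powr r + 1" and N: "0 \<le> N" "N * \<Delta> \<le> 2 * x"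
    and S: "S \<le> k * x" and r: "0 \<le> r" "r \<le> \<delta>" and \<eta>: "\<eta> = min (\<delta> - r) (r - \<delta> + \<epsilon>)"
    and C: "0 \<le> C0" "0 \<le> c3" "0 \<le> C" "0 \<le> k" and A: "A \<le> c3 * ((x + 1) * (\<Delta> + 1))"
  shows "A + C * (C0 * x powr (1 + \<delta> - \<epsilon>) + (2 * S * (C0 * x powr (\<delta> - \<epsilon>)) + N * (C0 * x powr (2 * \<delta> - \<epsilon>)))) \<le>
    (6 * c3 + C * (C0 * (2 * k + 3))) * x powr (1 + \<delta> - \<eta>)"
proof -
  let ?y = "x powr (1 + \<delta> - \<eta>)"
  have mono: "x powr a \<le> ?y" if "a \<le> 1 + \<delta> - \<eta>" for a using that x by (rule powr_mono)
  have x1: "x * x powr a = x powr (1 + a)" for a using x by (simp add: powr_add)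
  have xr: "1 \<le> x powr r" by (rule ge_one_powr_ge_zero[OF x r(1)])
  have "(x + 1) * (\<Delta> + 1) \<le> (2 * x) * (3 * x powr r)" using x xr \<Delta> by (intro mult_mono) auto
  also have "\<dots> = 6 * x powr (1 + r)" by (simp add: x1[symmetric])
  also have "\<dots> \<le> 6 * ?y" using \<eta> by (intro mult_left_mono mono) auto
  finally have "c3 * ((x + 1) * (\<Delta> + 1)) \<le> c3 * (6 * ?y)" using C by (intro mult_left_mono)
  then have 1: "A \<le> 6 * c3 * ?y" using A by simp
  have 2: "x powr (1 + \<delta> - \<epsilon>) \<le> ?y" using \<eta> r by (intro mono) auto
  have "S * x powr (\<delta> - \<epsilon>) \<le> k * x * x powr (\<delta> - \<epsilon>)" by (rule mult_right_mono[OF S]) simp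
  also have "\<dots> = k * x powr (1 + \<delta> - \<epsilon>)" using x1[of "\<delta> - \<epsilon>"] by (simp add: mult.assoc add_diff_eq)
  also have "\<dots> \<le> k * ?y" using C 2 by (intro mult_left_mono)
  finally have 3: "S * x powr (\<delta> - \<epsilon>) \<le> k * ?y" .
  have "N * x powr r \<le> N * \<Delta>" by (rule mult_left_mono[OF \<Delta>(1) N(1)])
  then have Nr: "N * x powr r \<le> 2 * x" using N(2) by linarith
  have "N * x powr (2 * \<delta> - \<epsilon>) = (N * x powr r) * x powr (2 * \<delta> - \<epsilon> - r)"
    by (simp add: mult.assoc powr_add[symmetric])
  also have "\<dots> \<le> 2 * x * x powr (2 * \<delta> - \<epsilon> - r)" by (rule mult_right_mono[OF Nr]) simp
  also have "\<dots> = 2 * x powr (1 + (2 * \<delta> - \<epsilon> - r))" using x1 by (simp add: mult.assoc)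
  also have "\<dots> \<le> 2 * ?y" using \<eta> by (intro mult_left_mono mono) auto
  finally have 4: "N * x powr (2 * \<delta> - \<epsilon>) \<le> 2 * ?y" .
  have "C0 * x powr (1 + \<delta> - \<epsilon>) + (2 * S * (C0 * x powr (\<delta> - \<epsilon>)) + N * (C0 * x powr (2 * \<delta> - \<epsilon>))) =
      C0 * (x powr (1 + \<delta> - \<epsilon>) + (2 * (S * x powr (\<delta> - \<epsilon>)) + N * x powr (2 * \<delta> - \<epsilon>)))"
    by (simp add: algebra_simps)
  also have "\<dots> \<le> C0 * (?y + (2 * (k * ?y) + 2 * ?y))" using 2 3 4 C by (intro mult_left_mono add_mono) auto
  also have "\<dots> = C0 * (2 * k + 3) * ?y" by (simp add: algebra_simps)
  finally have "C * (C0 * x powr (1 + \<delta> - \<epsilon>) + (2 * S * (C0 * x powr (\<delta> - \<epsilon>)) + N * (C0 * x powr (2 * \<delta> - \<epsilon>)))) \<le>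
      C * (C0 * (2 * k + 3) * ?y)" using C by (intro mult_left_mono)
  then show ?thesis using 1 by (simp add: algebra_simps)
qed

text \<open>\<open>c'\<close> is above \<open>c\<close>, so that m^c' absorbs the constant of the
  approximation factor and its ceiling can serve as \<open>lb\<close>. It is below 1, so that
  \<open>lb\<close> is at most \<open>m\<close> and the leaves of the hub do not blow up the
  instance.\<close>

lemma reduction:
  fixes \<delta> \<epsilon> c a b e r c' :: real and p1 q1 p2 q2 k :: nat and Q Qc :: gclass
  assumes rc: "r = real p1 / real q1" "c' = real p2 / real q2" and q: "1 \<le> q1" "1 \<le> q2"
    and r: "0 < r" "\<delta> - \<epsilon> < r" "r < \<delta>" and c: "c < c'" "c' < 1"
    and lam: "lam \<in> O(\<lambda>m. real m powr c)" "\<And>m. 1 \<le> lam m"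
    and tp: "tp \<in> O(\<lambda>m. real m powr a)" "a \<le> 1 + \<delta> - \<epsilon>"
    and tu: "tu \<in> O(\<lambda>m. real m powr b)" "b \<le> \<delta> - \<epsilon>"
    and tq: "tq \<in> O(\<lambda>m. real m powr e)" "e \<le> 2 * \<delta> - \<epsilon>"
    and solves: "solves_count_hac (kind d) Qc lam D"
    and bounds: "if d = Full then amortized_bounds (kind d) Qc tp tu tq D else worst_case_bounds (kind d) Qc tp tu tq D"
    and Qc: "\<forall>\<^sub>F m in sequentially. \<forall>n N j. Q n m \<longrightarrow> N \<le> n \<longrightarrow> N * ceil_root p1 q1 m \<le> 2 * m \<longrightarrow> m \<le> j \<longrightarrow>
        Qc (2 * N + 1 + (if d = Sup then ceil_root p2 q2 m else 0) + 2 * ceil_root 1 2 m) j"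
    and quad: "\<And>n m. d = Quad \<Longrightarrow> Q n m \<Longrightarrow> n ^ 2 \<le> k * m" and k: "2 \<le> k"
  shows "\<not> triangle_conjecture Q \<delta>"
proof -
  obtain Cl where Cl: "0 < Cl" "\<forall>\<^sub>F m in sequentially. \<forall>j. m \<le> j \<and> j \<le> 10 * m \<longrightarrow> lam j \<le> Cl * real m powr c"
    using bigo_window[OF lam(1) order_refl] by blast
  obtain Cp where Cp: "0 < Cp" "\<forall>\<^sub>F m in sequentially. \<forall>j. m \<le> j \<and> j \<le> 10 * m \<longrightarrow> tp j \<le> Cp * real m powr (1 + \<delta> - \<epsilon>)"
    using bigo_window[OF tp] by blast
  obtain Cu where Cu: "0 < Cu" "\<forall>\<^sub>F m in sequentially. \<forall>j. m \<le> j \<and> j \<le> 10 * m \<longrightarrow> tu j \<le> Cu * real m powr (\<delta> - \<epsilon>)"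
    using bigo_window[OF tu] by blast
  obtain Cq where Cq: "0 < Cq" "\<forall>\<^sub>F m in sequentially. \<forall>j. m \<le> j \<and> j \<le> 10 * m \<longrightarrow> tq j \<le> Cq * real m powr (2 * \<delta> - \<epsilon>)"
    using bigo_window[OF tq] by blast
  define C0 where "C0 = Cp + Cu + Cq"
  have C0: "Cp \<le> C0" "Cu \<le> C0" "Cq \<le> C0" "0 \<le> C0" using Cp(1) Cu(1) Cq(1) by (simp_all add: C0_def)
  let ?good = "\<lambda>m. 1 \<le> m \<and> (\<forall>j. m \<le> j \<and> j \<le> 10 * m \<longrightarrow> lam j \<le> real m powr c' \<and> tp j \<le> C0 * real m powr (1 + \<delta> - \<epsilon>) \<and>
      tu j \<le> C0 * real m powr (\<delta> - \<epsilon>) \<and> tq j \<le> C0 * real m powr (2 * \<delta> - \<epsilon>)) \<and>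
      (\<forall>n N j. Q n m \<longrightarrow> N \<le> n \<longrightarrow> N * ceil_root p1 q1 m \<le> 2 * m \<longrightarrow> m \<le> j \<longrightarrow>
        Qc (2 * N + 1 + (if d = Sup then ceil_root p2 q2 m else 0) + 2 * ceil_root 1 2 m) j)"
  have cpos: "0 < c' - c" using c by simp
  have "\<forall>\<^sub>F m in sequentially. ?good m"
    using Cl(2) Cp(2) Cu(2) Cq(2) Qc eventually_powr_ge[OF cpos, of Cl] eventually_ge_at_top[of "1 :: nat"]
  proof eventually_elim
    case (elim m)
    have up: "X * real m powr y \<le> C0 * real m powr y" if "X \<le> C0" for X y using that by (intro mult_right_mono) auto
    have "Cl * real m powr c \<le> real m powr (c' - c) * real m powr c" by (rule mult_right_mono[OF elim(6)]) simp
    also have "\<dots> = real m powr c'" by (simp add: powr_add[symmetric])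
    finally have l: "Cl * real m powr c \<le> real m powr c'" .
    show ?case
      using elim(1-4) up[OF C0(1), of "1 + \<delta> - \<epsilon>"] up[OF C0(2), of "\<delta> - \<epsilon>"] up[OF C0(3), of "2 * \<delta> - \<epsilon>"] l
      by (intro conjI elim(5,7)) (meson order_trans)
  qed
  \<comment> \<open>From \<open>M\<close> on all asymptotic hypotheses hold as plain inequalities;
    this number becomes a constant of the program.\<close>
  then obtain M where M: "\<And>m. M \<le> m \<Longrightarrow> ?good m" unfolding eventually_sequentially by blast
  \<comment> \<open>Room for the depth of all expressions: 40 for the fixed ones, the rest for the
    powers in \<open>root_com\<close>.\<close>
  define z where "z = 40 + p1 + q1 + p2 + q2"
  define K0 where "K0 = small_const p1 p2 M"
  \<comment> \<open>The first summand keeps the reduction free of overflow, the second leaves the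
    simulated algorithm its word length.\<close>
  define K where "K = K0 * 2 ^ z + (2 * K0 * word_const D + 2)"
  define C where "C = tr_cost (preprocess D) + tr_cost (insertion D) + tr_cost (deletion D) + tr_cost (query D) + 1"
  define prog where "prog = detect_com C D d M p1 q1 p2 q2"
  define c3 where "c3 = 6000 + 3 * p1 + 3 * q1 + 3 * p2 + 3 * q2 + 726 * k"
  define \<eta> where "\<eta> = min (\<delta> - r) (r - \<delta> + \<epsilon>)"
  define R where "R = 6 * real c3 + real C * (C0 * (2 * real k + 3))"
  have zz: "40 \<le> z" "q1 < z" "p1 < z" "q2 < z" "p2 < z" by (simp_all add: z_def)
  have KB: "((n + 2) ^ K0) ^ (2 ^ z) \<le> (n + 2) ^ K" "(n + 2) ^ (2 * K0 * word_const D + 2) \<le> (n + 2) ^ K" for n :: nat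
    unfolding power_mult[symmetric] by (rule power_increasing; simp add: K_def)+
  have trC: "tr_cost (preprocess D) \<le> C" "tr_cost (insertion D) \<le> C" "tr_cost (deletion D) \<le> C" "tr_cost (query D) \<le> C" "0 < C"
    by (simp_all add: C_def)
  have small: "lossless_spmf (triangle_run K prog n es)" "\<sigma> \<in> set_spmf (triangle_run K prog n es) \<Longrightarrow>
      result \<sigma> = of_bool (has_triangle (edges_of es))"
    if g: "simple_graph n es" and lt: "length es < M" for n es \<sigma>
  proof -
    have P: "length es \<le> length es ^ 2" by (cases "length es") (simp_all add: power2_eq_square)
    have pc: "prog_ctx ((n + 2) ^ K) ((n + 2) ^ K0) z n es (2 * length es + 1) 0 (length es)" "M < (n + 2) ^ K0"
      using prog_ctx_intro[OF g zz(1) KB(1)[unfolded K0_def], of "2 * length es + 1" 0 "length es"] P by (simp_all add: K0_def)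
    interpret prog_ctx "(n + 2) ^ K" "(n + 2) ^ K0" z n es "2 * length es + 1" 0 "length es" by (rule pc(1))
    have "ert ((n + 2) ^ K) prog (\<lambda>s. if s 0 0 = of_bool (has_triangle (edges_of es)) then 0 else \<infinity>)
        (put ([n, length es] @ concat (map (\<lambda>(u, v). [u, v]) es)) empty_mem) \<le> of_nat (front_time p1 q1) + (of_nat 10 + 0)"
      unfolding prog_def by (rule ert_detect_few[OF init_mem pc(2) lt q(1) zz(2,3) refl]) simp_all
    note rfe = run_from_ert[OF this]
    have fin: "of_nat (front_time p1 q1) + (of_nat 10 + 0) < (\<infinity> :: ennreal)"
      unfolding add_0_right of_nat_add[symmetric] by (simp only: infinity_ennreal_def of_nat_less_top)
    show "lossless_spmf (triangle_run K prog n es)" unfolding triangle_run_def by (rule rfe(1)[OF fin])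
    show "\<sigma> \<in> set_spmf (triangle_run K prog n es) \<Longrightarrow> result \<sigma> = of_bool (has_triangle (edges_of es))"
      unfolding triangle_run_def by (rule rfe(2)[OF fin])
  qed
  have large: "lossless_spmf (triangle_run K prog n es)" "\<sigma> \<in> set_spmf (triangle_run K prog n es) \<Longrightarrow>
      result \<sigma> = of_bool (has_triangle (edges_of es))"
    "expected_work (triangle_run K prog n es) \<le> ennreal (R * real (length es) powr (1 + \<delta> - \<eta>))"
    if g: "simple_graph n es" and Qn: "Q n (length es)" and ge: "M \<le> length es" for n es \<sigma>
  proof -
    let ?m = "length es"
    let ?\<Delta> = "ceil_root p1 q1 ?m" and ?lb = "ceil_root p2 q2 ?m" and ?P = "ceil_root 1 2 ?m"
    have good: "?good ?m" by (rule M[OF ge])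
    then have m1: "1 \<le> ?m" by blast
    note win = good[THEN conjunct2, THEN conjunct1, rule_format]
    note D = ceil_root_real[OF q(1) m1, of p1, folded rc(1)]
    note l = ceil_root_real[OF q(2) m1, of p2, folded rc(2)]
    have "p2 \<le> q2" using c(2) rc(2) q(2) by (simp add: divide_less_eq split: if_splits)
    then have lbm: "?lb \<le> ?m" by (rule ceil_root_le_self[OF _ q(2) m1])
    have w10: "j \<le> 10 * ?m" if "j \<le> 8 * ?m + ?lb + 1" for j using that lbm m1 by linarith
    have pc: "prog_ctx ((n + 2) ^ K) ((n + 2) ^ K0) z n es ?\<Delta> ?lb ?P" "M < (n + 2) ^ K0"
      using prog_ctx_intro[OF g zz(1) KB(1)[unfolded K0_def], of ?\<Delta> ?lb ?P] D(3) sqrt_ceil[of ?m]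
        ceil_root(3)[OF q(1), of p1 ?m] ceil_root(3)[OF q(2), of p2 ?m] by (simp_all add: K0_def)
    interpret pc: prog_ctx "(n + 2) ^ K" "(n + 2) ^ K0" z n es ?\<Delta> ?lb ?P by (rule pc(1))
    let ?t = "C0 * real ?m powr (1 + \<delta> - \<epsilon>)" and ?u = "C0 * real ?m powr (\<delta> - \<epsilon>)" and ?w = "C0 * real ?m powr (2 * \<delta> - \<epsilon>)"
    have nn: "0 \<le> ?t" "0 \<le> ?u" "0 \<le> ?w" using C0 by simp_all
    have n': "pc.n' d = 2 * pc.N + 1 + (if d = Sup then ?lb else 0) + 2 * ?P"
      unfolding pc.n'_def pc.x0_def pc.L_def by (rule refl)
    interpret red_ctx "(n + 2) ^ K" "(n + 2) ^ K0" z n es ?\<Delta> ?lb ?P D d lam tp tu tq Qc "ennreal ?t" "ennreal ?u" "ennreal ?w"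
    proof (unfold_locales)
      show "solves_count_hac (kind d) Qc lam D" by (rule solves)
      show "if d = Full then amortized_bounds (kind d) Qc tp tu tq D else worst_case_bounds (kind d) Qc tp tu tq D" by (rule bounds)
      fix j assume j: "?m \<le> j"
      show "Qc (pc.n' d) j" unfolding n'
        using good[THEN conjunct2, THEN conjunct2] Qn pc.N_bounds(2,3) j by blast
      assume j': "j \<le> 8 * ?m + ?lb + 1"
      note w = win[OF conjI[OF j w10[OF j']]]
      show "1 \<le> lam j \<and> lam j \<le> real ?lb" using w lam(2)[of j] l(1) by linarith
      show "ennreal (tp j) \<le> ennreal ?t" "ennreal (tu j) \<le> ennreal ?u" "ennreal (tq j) \<le> ennreal ?w"
        using w by (simp_all add: ennreal_leI)
    qed
    have S: "(\<Sum>v<pc.N. pc.cand_num d v) \<le> k * ?m" by (rule pc.cand_sum_le[OF quad[OF _ Qn] k])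
    have lt: "\<not> ?m < M" using ge by simp
    have U: "U < (n + 2) ^ K0" by (rule pc.design_less_V)
    have K01: "1 \<le> K0" by (simp add: K0_def small_const_def)
    have Bd: "2 * word_bound D U + 2 \<le> (n + 2) ^ K"
      by (rule order_trans[OF word_bound_le[OF U _ K01] KB(2)]) simp
    let ?A = "pc.front_time p1 q1 + solve_time p2 q2 + 9"
    let ?dw = "?t + (2 * real (\<Sum>v<pc.N. pc.cand_num d v) * ?u + real pc.N * ?w)"
    have dw: "dyn_work = ennreal ?dw" by (rule dyn_work_ennreal[OF refl refl refl nn])
    have dw0: "0 \<le> ?dw" using nn by (intro add_nonneg_nonneg mult_nonneg_nonneg C0(4)) (auto simp del: of_nat_sum)
    have "ert ((n + 2) ^ K) prog (\<lambda>s. if s 0 0 = of_bool (has_triangle (edges_of es)) then 0 else \<infinity>)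
        (put ([n, length es] @ concat (map (\<lambda>(u, v). [u, v]) es)) empty_mem) \<le>
        of_nat (pc.front_time p1 q1) + (of_nat 5 + (of_nat (solve_time p2 q2) + (of_nat C * dyn_work + (of_nat 4 + 0))))"
      unfolding prog_def
      by (rule ert_detect_many[OF pc.init_mem pc(2) lt q(1) zz(2,3) q(2) zz(4,5) refl refl refl Bd trC]) simp_all
    also have "\<dots> = of_nat ?A + of_nat C * dyn_work" by (simp add: add_ac)
    also have "\<dots> = ennreal (real ?A + real C * ?dw)"
      unfolding dw using dw0
      by (simp only: ennreal_of_nat_eq_real_of_nat ennreal_mult'[symmetric] of_nat_0_le_iff ennreal_plus[symmetric] mult_nonneg_nonneg)
    also have "\<dots> \<le> ennreal (R * real ?m powr (1 + \<delta> - \<eta>))"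
    proof (rule ennreal_leI)
      have "?A \<le> c3 * ((?m + 1) * (?\<Delta> + 1))"
        unfolding c3_def by (rule time_le[OF lbm sqrt_ceil(2) S])
      then have "real ?A \<le> real (c3 * ((?m + 1) * (?\<Delta> + 1)))" by (simp only: of_nat_le_iff)
      then have A: "real ?A \<le> real c3 * ((real ?m + 1) * (real ?\<Delta> + 1))" by (simp only: of_nat_mult of_nat_add of_nat_1)
      have N\<Delta>: "real pc.N * real ?\<Delta> \<le> 2 * real ?m" using pc.N_bounds(3) by (metis of_nat_le_iff of_nat_mult of_nat_numeral)
      have S': "real (\<Sum>v<pc.N. pc.cand_num d v) \<le> real k * real ?m" using S by (metis of_nat_le_iff of_nat_mult)
      show "real ?A + real C * ?dw \<le> R * real ?m powr (1 + \<delta> - \<eta>)"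
        unfolding R_def by (rule total_bound[OF _ D(1,2) _ N\<Delta> S' _ _ \<eta>_def C0(4) _ _ _ A]) (use m1 r in simp_all)
    qed
    finally have e: "ert ((n + 2) ^ K) prog (\<lambda>s. if s 0 0 = of_bool (has_triangle (edges_of es)) then 0 else \<infinity>)
        (put ([n, length es] @ concat (map (\<lambda>(u, v). [u, v]) es)) empty_mem) \<le> ennreal (R * real ?m powr (1 + \<delta> - \<eta>))" .
    note rfe = run_from_ert[OF e]
    have fin: "ennreal (R * real ?m powr (1 + \<delta> - \<eta>)) < \<infinity>" by simp
    show "lossless_spmf (triangle_run K prog n es)" unfolding triangle_run_def by (rule rfe(1)[OF fin])
    show "\<sigma> \<in> set_spmf (triangle_run K prog n es) \<Longrightarrow> result \<sigma> = of_bool (has_triangle (edges_of es))"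
      unfolding triangle_run_def by (rule rfe(2)[OF fin])
    show "expected_work (triangle_run K prog n es) \<le> ennreal (R * real ?m powr (1 + \<delta> - \<eta>))"
      unfolding triangle_run_def by (rule rfe(3)[OF fin])
  qed
  show ?thesis
  proof (rule refute_conjecture)
    have run: "lossless_spmf (triangle_run K prog n es) \<and>
        (\<forall>\<sigma>\<in>set_spmf (triangle_run K prog n es). result \<sigma> = of_bool (has_triangle (edges_of es)))"
      if "simple_graph n es" "Q n (length es)" for n es
    proof (cases "length es < M")
      case True
      then show ?thesis using small[OF that(1) True] by blast
    next
      case False
      then have "M \<le> length es" by simp
      then show ?thesis using large(1,2)[OF that] by blast
    qed
    show "detects_triangles Q K prog"
      unfolding detects_triangles_def triangle_instances_def
    proof (intro ballI)
      fix x assume "x \<in> {(n, es). simple_graph n es \<and> Q n (length es)}"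
      then obtain n es where "x = (n, es)" "simple_graph n es" "Q n (length es)" by blast
      then show "case x of (n, es) \<Rightarrow> lossless_spmf (triangle_run K prog n es) \<and>
          (\<forall>\<sigma>\<in>set_spmf (triangle_run K prog n es). result \<sigma> = of_bool (has_triangle (edges_of es)))"
        using run[of n es] by simp
    qed
    show "0 < \<eta>" using r by (simp add: \<eta>_def)
    show "\<forall>\<^sub>F m in sequentially. triangle_work Q K prog m \<le> ennreal (R * real m powr (1 + \<delta> - \<eta>))"
    proof (rule eventually_sequentiallyI)
      fix m assume "M \<le> m"
      then show "triangle_work Q K prog m \<le> ennreal (R * real m powr (1 + \<delta> - \<eta>))"
        unfolding triangle_work_def triangle_instances_def using large(3) by (intro SUP_least) auto
    qed
  qed
qed

text \<open>\<mu> is the largest exponent among those of \<open>N\<close>, \<open>lb\<close> and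
  \<open>P\<close>, so the instance has O(m^\<mu>) vertices with \<mu> < 1, and \<gamma> is chosen
  such that \<mu> (1 + \<gamma>) = (1 + \<mu>) / 2. The instance is dense however sparse the input
  graph is.\<close>

lemma superlinear_size:
  assumes "1 \<le> q1" "1 \<le> q2" "0 < real p1 / real q1" "real p2 / real q2 < 1"
  shows "\<exists>\<gamma>>0. \<forall>\<^sub>F m in sequentially. \<forall>N j. N * ceil_root p1 q1 m \<le> 2 * m \<longrightarrow> m \<le> j \<longrightarrow>
    superlinear \<gamma> (2 * N + 1 + ceil_root p2 q2 m + 2 * ceil_root 1 2 m) j"
proof -
  define r where "r = real p1 / real q1"
  define \<mu> where "\<mu> = max (1 - r) (max (real p2 / real q2) (1 / 2))"
  define \<gamma> where "\<gamma> = (1 - \<mu>) / (2 * \<mu>)"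
  have \<mu>: "1 - r \<le> \<mu>" "real p2 / real q2 \<le> \<mu>" "1 / 2 \<le> \<mu>" "\<mu> < 1" "0 < \<mu>"
  proof -
    show "1 - r \<le> \<mu>" unfolding \<mu>_def by (rule max.cobounded1)
    show "real p2 / real q2 \<le> \<mu>" unfolding \<mu>_def by (rule max.coboundedI2[OF max.cobounded1])
    show "1 / 2 \<le> \<mu>" unfolding \<mu>_def by (rule max.coboundedI2[OF max.cobounded2])
    then show "0 < \<mu>" by linarith
    show "\<mu> < 1" unfolding \<mu>_def r_def max_less_iff_conj using assms(3,4) by simp
  qed
  have \<gamma>: "0 < \<gamma>" "\<mu> * (1 + \<gamma>) = 1 - (1 - \<mu>) / 2" using \<mu> by (simp_all add: \<gamma>_def field_simps)
  have pos: "0 < (1 - \<mu>) / 2" using \<mu> by simp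
  have "\<forall>\<^sub>F m in sequentially. \<forall>N j. N * ceil_root p1 q1 m \<le> 2 * m \<longrightarrow> m \<le> j \<longrightarrow>
    superlinear \<gamma> (2 * N + 1 + ceil_root p2 q2 m + 2 * ceil_root 1 2 m) j"
    using eventually_powr_ge[OF pos, of "11 powr (1 + \<gamma>)"] eventually_ge_at_top[of "1 :: nat"]
  proof eventually_elim
    case (elim m)
    have m1: "1 \<le> m" by (rule elim(2))
    let ?x = "real m" and ?y = "real m powr \<mu>"
    have mono: "?x powr a \<le> ?y" if "a \<le> \<mu>" for a using that m1 by (intro powr_mono) auto
    have y1: "1 \<le> ?y" using m1 \<mu> by (intro ge_one_powr_ge_zero) auto
    have lb: "real (ceil_root p2 q2 m) \<le> ?y + 1" using ceil_root_real(2)[OF assms(2) m1, of p2] mono[OF \<mu>(2)] by linarith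
    have P: "real (ceil_root 1 2 m) \<le> ?y + 1" using ceil_root_real(2)[of 2 m 1] m1 mono[OF \<mu>(3)] by simp
    show ?case
    proof (intro allI impI)
      fix N j assume N: "N * ceil_root p1 q1 m \<le> 2 * m" and j: "m \<le> j"
      have "real N * ?x powr r \<le> real N * real (ceil_root p1 q1 m)"
        using ceil_root_real(1)[OF assms(1) m1, of p1] by (intro mult_left_mono) (simp_all add: r_def)
      also have "\<dots> \<le> 2 * ?x" using N by (metis of_nat_le_iff of_nat_mult of_nat_numeral)
      finally have "real N * ?x powr r * ?x powr (- r) \<le> 2 * ?x * ?x powr (- r)" by (rule mult_right_mono) simp
      then have "real N \<le> 2 * ?x powr (1 - r)" using m1 by (simp add: mult.assoc powr_add[symmetric] powr_mult_base)
      also have "\<dots> \<le> 2 * ?y" using mono[OF \<mu>(1)] by simp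
      \<comment> \<open>The 11 consists of 4 from \<open>2 * N\<close>, 1, 2 from \<open>lb\<close>
        and 4 from twice the root, as \<open>?y\<close> is at least 1.\<close>
      finally have "real (2 * N + 1 + ceil_root p2 q2 m + 2 * ceil_root 1 2 m) \<le> 11 * ?y"
        using lb P y1 by simp
      then have "real (2 * N + 1 + ceil_root p2 q2 m + 2 * ceil_root 1 2 m) powr (1 + \<gamma>) \<le> (11 * ?y) powr (1 + \<gamma>)"
        using \<gamma>(1) by (intro powr_mono2) auto
      also have "\<dots> = 11 powr (1 + \<gamma>) * ?x powr (1 - (1 - \<mu>) / 2)"
        by (simp add: powr_mult powr_powr \<gamma>(2))
      also have "\<dots> \<le> ?x powr ((1 - \<mu>) / 2) * ?x powr (1 - (1 - \<mu>) / 2)" by (rule mult_right_mono[OF elim(1)]) simp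
      also have "\<dots> = ?x" using m1 by (simp add: powr_add[symmetric])
      also have "\<dots> \<le> real j" using j by simp
      finally show "superlinear \<gamma> (2 * N + 1 + ceil_root p2 q2 m + 2 * ceil_root 1 2 m) j" by (simp add: superlinear_def)
    qed
  qed
  then show ?thesis using \<gamma>(1) by blast
qed

text \<open>With \<open>t\<close> one below the square root rounded up, the size is at most
  \<open>2 * n + 3 + 2 * t\<close>. Its square is at most three times the sum of the squares, and
  \<open>n ^ 2 \<le> k * m\<close>, \<open>t ^ 2 \<le> m\<close> and \<open>1 \<le> m\<close> give
  12 k + 12 + 27.\<close>

lemma quadratic_size:
  assumes m: "1 \<le> m" and n: "n ^ 2 \<le> k * m" "N \<le> n" and j: "m \<le> j"
  shows "quadratic (1 / (12 * real k + 39)) (2 * N + 1 + 0 + 2 * ceil_root 1 2 m) j"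
proof -
  define t where "t = ceil_root 1 2 m - 1"
  have P: "ceil_root 1 2 m = t + 1" using ceil_root_real(3)[of 2 m 1] m by (simp add: t_def)
  have "t ^ 2 < m ^ 1" using P by (intro ceil_root(2)) simp_all
  then have t: "real t ^ 2 \<le> real m" by (metis less_imp_le of_nat_le_iff of_nat_power power_one_right)
  have n': "real n ^ 2 \<le> real k * real m" using n(1) by (metis of_nat_le_iff of_nat_power of_nat_mult)
  have "real (2 * N + 1 + 0 + 2 * ceil_root 1 2 m) \<le> 2 * real n + 3 + 2 * real t" unfolding P using n(2) by simp
  then have "real (2 * N + 1 + 0 + 2 * ceil_root 1 2 m) ^ 2 \<le> (2 * real n + 3 + 2 * real t) ^ 2" by (rule power_mono) simp
  also have "\<dots> \<le> 12 * real n ^ 2 + 27 + 12 * real t ^ 2"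
  proof -
    \<comment> \<open>Three times the sum of the squares minus the square of the sum is the sum of
      the squared differences.\<close>
    have "0 \<le> (2 * real n - 3) ^ 2 + (2 * real n - 2 * real t) ^ 2 + (3 - 2 * real t) ^ 2" by simp
    then show ?thesis by (simp add: power2_eq_square algebra_simps)
  qed
  also have "\<dots> \<le> 12 * (real k * real m) + 27 * real m + 12 * real m"
  proof -
    have "1 \<le> real m" using m by simp
    then show ?thesis using n' t by linarith
  qed
  also have "\<dots> = (12 * real k + 39) * real m" by (simp add: algebra_simps)
  also have "\<dots> \<le> (12 * real k + 39) * real j" using j by (intro mult_left_mono) auto
  finally show ?thesis unfolding quadratic_def by (simp add: field_simps)
qed

lemma rational_between:
  fixes x y :: real
  assumes "0 \<le> x" "x < y"
  obtains p q :: nat where "1 \<le> q" "x < real p / real q" "real p / real q < y"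
proof -
  obtain u where u: "u \<in> \<rat>" "x < u" "u < y" using Rats_dense_in_real[OF assms(2)] by blast
  obtain p q :: nat where "q \<noteq> 0" "\<bar>u\<bar> = real p / real q" using Rats_abs_nat_div_natE[OF u(1)] by metis
  then show ?thesis using u assms that[of q p] by auto
qed

theorem theoremF5:
  fixes \<delta> \<epsilon> c :: real
  assumes "\<delta> > 0" and "\<epsilon> > 0" and "0 \<le> c" and "c < 1"
  shows
    "(amortized_count_hac fully_dynamic all_graphs c
        ((1 + \<delta>) * (1 - c) - \<epsilon>) (\<delta> * (1 - c) - \<epsilon>) (2 * \<delta> * (1 - c) - \<epsilon>) \<or>
      (\<forall>\<gamma>>0. worst_case_count_hac incremental (superlinear \<gamma>) c
        ((1 + \<delta>) * (1 - c) - \<epsilon>) (\<delta> * (1 - c) - \<epsilon>) (2 * \<delta> * (1 - c) - \<epsilon>)) \<or>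
      worst_case_count_hac decremental all_graphs c
        ((1 + \<delta>) * (1 - c) - \<epsilon>) (\<delta> * (1 - c) - \<epsilon>) (2 * \<delta> * (1 - c) - \<epsilon>)
      \<longrightarrow> \<not> triangle_conjecture all_graphs \<delta>)
     \<and>
     ((\<forall>\<kappa>>0. worst_case_count_hac incremental (quadratic \<kappa>) c
        ((1 + \<delta>) * (1 - c) - \<epsilon>) (\<delta> * (1 - c) - \<epsilon>) (2 * \<delta> * (1 - c) - \<epsilon>))
      \<longrightarrow> (\<forall>\<kappa>>0. \<not> triangle_conjecture (quadratic \<kappa>) \<delta>))"
proof -
  \<comment> \<open>The maximum with 0 is taken because \<delta> - \<epsilon> may be negative,
    whereas a positive r is needed for the instance to have few vertices.\<close>
  obtain p1 q1 :: nat where r: "1 \<le> q1" "max 0 (\<delta> - \<epsilon>) < real p1 / real q1" "real p1 / real q1 < \<delta>"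
  proof -
    have "0 \<le> max 0 (\<delta> - \<epsilon>)" "max 0 (\<delta> - \<epsilon>) < \<delta>" using assms by auto
    then show ?thesis by (rule rational_between) (rule that)
  qed
  obtain p2 q2 :: nat where c': "1 \<le> q2" "c < real p2 / real q2" "real p2 / real q2 < 1"
    by (rule rational_between[OF assms(3,4)])
  have r': "0 < real p1 / real q1" "\<delta> - \<epsilon> < real p1 / real q1" using r(2) by auto
  let ?a = "(1 + \<delta>) * (1 - c) - \<epsilon>" and ?b = "\<delta> * (1 - c) - \<epsilon>" and ?e = "2 * \<delta> * (1 - c) - \<epsilon>"
  \<comment> \<open>The factors 1 - c only lower the exponents, so the bounds hold with the values
    for c = 0.\<close>
  have "0 \<le> \<delta> * c" using assms by simp
  then have ex: "?a \<le> 1 + \<delta> - \<epsilon>" "?b \<le> \<delta> - \<epsilon>" "?e \<le> 2 * \<delta> - \<epsilon>" using assms(3) by (simp_all add: algebra_simps)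
  let ?size = "\<lambda>d N m. 2 * N + 1 + (if d = Sup then ceil_root p2 q2 m else 0) + 2 * ceil_root 1 2 m"
  have main: "\<not> triangle_conjecture Q \<delta>"
    if sol: "count_hac_solvable (bd (kind d) Qc) (kind d) Qc c ?a ?b ?e"
      and bd: "bd = (if d = Full then amortized_bounds else worst_case_bounds)"
      and Qc: "\<forall>\<^sub>F m in sequentially. \<forall>n N j. Q n m \<longrightarrow> N \<le> n \<longrightarrow> N * ceil_root p1 q1 m \<le> 2 * m \<longrightarrow> m \<le> j \<longrightarrow> Qc (?size d N m) j"
      and quad: "\<And>n m. d = Quad \<Longrightarrow> Q n m \<Longrightarrow> n ^ 2 \<le> k * m" and k: "2 \<le> k" for bd d Q Qc k
  proof -
    obtain D lam tp tu tq where h: "lam \<in> O(\<lambda>m. real m powr c)" "\<forall>m. lam m \<ge> 1" "tp \<in> O(\<lambda>m. real m powr ?a)"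
      "tu \<in> O(\<lambda>m. real m powr ?b)" "tq \<in> O(\<lambda>m. real m powr ?e)" "solves_count_hac (kind d) Qc lam D" "bd (kind d) Qc tp tu tq D"
      using sol unfolding count_hac_solvable_def by blast
    have b: "if d = Full then amortized_bounds (kind d) Qc tp tu tq D else worst_case_bounds (kind d) Qc tp tu tq D"
      using h(7) unfolding bd by (cases "d = Full") simp_all
    show ?thesis
      by (rule reduction[OF refl refl r(1) c'(1) r' r(3) c'(2,3) h(1) h(2)[rule_format] h(3) ex(1) h(4) ex(2) h(5) ex(3) h(6) b Qc quad k])
  qed
  have 1: "\<not> triangle_conjecture all_graphs \<delta>" if "amortized_count_hac fully_dynamic all_graphs c ?a ?b ?e"
    by (rule main[where d = Full and k = 2 and Qc = all_graphs and bd = amortized_bounds])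
      (use that in \<open>simp_all add: amortized_count_hac_def kind_def all_graphs_def\<close>)
  have 2: "\<not> triangle_conjecture all_graphs \<delta>" if "worst_case_count_hac decremental all_graphs c ?a ?b ?e"
    by (rule main[where d = Dec and k = 2 and Qc = all_graphs and bd = worst_case_bounds])
      (use that in \<open>simp_all add: worst_case_count_hac_def kind_def all_graphs_def\<close>)
  have 3: "\<not> triangle_conjecture all_graphs \<delta>" if h: "\<forall>\<gamma>>0. worst_case_count_hac incremental (superlinear \<gamma>) c ?a ?b ?e"
  proof -
    \<comment> \<open>The instances are dense whatever the input is, so an algorithm for one
      suitable \<gamma> handles all graphs.\<close>
    obtain \<gamma> where \<gamma>: "0 < \<gamma>" and ev: "\<forall>\<^sub>F m in sequentially. \<forall>N j. N * ceil_root p1 q1 m \<le> 2 * m \<longrightarrow> m \<le> j \<longrightarrow>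
        superlinear \<gamma> (2 * N + 1 + ceil_root p2 q2 m + 2 * ceil_root 1 2 m) j"
      using superlinear_size[OF r(1) c'(1) r'(1) c'(3)] by blast
    show ?thesis
    proof (rule main[where d = Sup and k = 2 and Qc = "superlinear \<gamma>" and bd = worst_case_bounds])
      show "count_hac_solvable (worst_case_bounds (kind Sup) (superlinear \<gamma>)) (kind Sup) (superlinear \<gamma>) c ?a ?b ?e"
        using h \<gamma> by (simp add: worst_case_count_hac_def kind_def)
      show "\<forall>\<^sub>F m in sequentially. \<forall>n N j. all_graphs n m \<longrightarrow> N \<le> n \<longrightarrow> N * ceil_root p1 q1 m \<le> 2 * m \<longrightarrow> m \<le> j \<longrightarrow>
          superlinear \<gamma> (?size Sup N m) j"
        using ev by eventually_elim simp
    qed simp_all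
  qed
  have 4: "\<not> triangle_conjecture (quadratic \<kappa>) \<delta>"
    if h: "\<forall>\<kappa>>0. worst_case_count_hac incremental (quadratic \<kappa>) c ?a ?b ?e" and \<kappa>: "0 < \<kappa>" for \<kappa>
  proof -
    define k where "k = max 2 (nat \<lceil>1 / \<kappa>\<rceil>)"
    have k1: "1 / \<kappa> \<le> real k" unfolding k_def by linarith
    have nk: "n ^ 2 \<le> k * m" if "quadratic \<kappa> n m" for n m
    proof -
      have "real n ^ 2 \<le> 1 / \<kappa> * real m" using that \<kappa> by (simp add: quadratic_def field_simps)
      also have "\<dots> \<le> real k * real m" by (rule mult_right_mono[OF k1]) simp
      finally show ?thesis by (metis of_nat_le_iff of_nat_power of_nat_mult)
    qed
    \<comment> \<open>The density guaranteed for the instance is smaller than \<kappa>, so the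
      assumption is applied at a density other than that of the input.\<close>
    let ?\<kappa> = "1 / (12 * real k + 39)"
    have "0 < ?\<kappa>" by (simp add: add_nonneg_pos)
    then have sol: "worst_case_count_hac incremental (quadratic ?\<kappa>) c ?a ?b ?e" using h by blast
    show ?thesis
    proof (rule main[where d = Quad and k = k and Qc = "quadratic ?\<kappa>" and bd = worst_case_bounds])
      show "count_hac_solvable (worst_case_bounds (kind Quad) (quadratic ?\<kappa>)) (kind Quad) (quadratic ?\<kappa>) c ?a ?b ?e"
        using sol by (simp add: worst_case_count_hac_def kind_def)
      show "\<forall>\<^sub>F m in sequentially. \<forall>n N j. quadratic \<kappa> n m \<longrightarrow> N \<le> n \<longrightarrow> N * ceil_root p1 q1 m \<le> 2 * m \<longrightarrow> m \<le> j \<longrightarrow>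
          quadratic ?\<kappa> (?size Quad N m) j"
        using eventually_ge_at_top[of "1 :: nat"]
      proof eventually_elim
        case (elim m)
        then show ?case using quadratic_size[OF elim nk] by simp
      qed
    qed (simp, erule nk, simp add: k_def)
  qed
  show ?thesis using 1 2 3 4 by blast
qed

end
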